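(* Let $d\ge1$ and let $\mu$ be a compactly supported finite Borel measure on $\mathbb R^d$. Suppose that for some $a>\frac12$, some $0<b\le d$, and some constant $C_0$, $$|\widehat\mu(\xi)|\le C_0|\xi|^{-a}\quad(\xi\in\mathbb R^d\setminus\{0\}),\qquad \mu(B(x,r))\le C_0 r^b\quad (x\in\mathbb R^d,\ r>0).$$ Let $p_a=\frac{2a+1}{2a}$, $p_{(a,b)}=\frac{2(d-b)+2a-1}{d-b+2a-1}$, $p_\circ=\min\{p_a,p_{(a,b)}\}$, and let $\Delta\subset[0,1]^2$ be the closed triangle with vertices $$O=(0,0),\quad P=(1/p_\circ,1/p_\circ),\quad Q=(1/p_{(a,b)},\,1/p_{(a,b)}').$$ Let $M_\mu^{loc}f(x)=\sup_{t\in[1,2]}|f\ast\mu_t(x)|$. Then: (1) If $b\ge d-1$, then for every $(1/p,1/q)\in\Delta\setminus[P,Q]$ there is a constant $C$ such that $\|M_\mu^{loc}f\|_{L^q(\mathbb R^d)}\le C\|f\|_{L^p(\mathbb R^d)}$ for all $f\in L^p(\mathbb R^d)$. (2) If $b<d-1$, then for every $(1/p,1/q)\in\Delta\setminus\{P,Q\}$ there is a constant $C$ such that $\|M_\mu^{loc}f\|_{L^q(\mathbb R^d)}\le C\|f\|_{L^p(\mathbb R^d)}$ for all $f\in L^p(\mathbb R^d)$. Moreover, for $(1/p,1/q)=P$ and for $(1/p,1/q)=Q$ there is a constant $C$ such that $\|M_\mu^{loc}f\|_{L^{q,\infty}(\mathbb R^d)}\le C\|f\|_{L^{p,1}(\mathbb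 R^d)}$ for all $f\in L^{p,1}(\mathbb R^d)$.
   Context: $B(x,r)$ is the ball of radius $r$ centered at $x$. For $t>0$, $\mu_t$ is the dilated measure defined by $(\mu_t,\phi)=\int\phi(ty)\,d\mu(y)$ for $\phi\in C_c(\mathbb R^d)$, so $f\ast\mu_t(x)=\int f(x-ty)\,d\mu(y)$. The Fourier transform is $\widehat\mu(\xi)=\int e^{-2\pi i x\cdot\xi}\,d\mu(x)$. $p'$ is the Hölder conjugate exponent of $p$, and $[P,Q]$ is the closed line segment joining $P$ and $Q$. $L^{p,r}(\mathbb R^d)$ denotes the Lorentz space with respect to Lebesgue measure, with $L^{\infty,\infty}=L^\infty$. *)

theory Defs
  imports "HOL-Probability.Essential_Supremum"
begin

section \<open>Lebesgue and Lorentz norms\<close>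

text \<open>
  The quantities below are defined for functions with values in \<open>[0, \<infinity>]\<close>; for a complex-valued
  \<open>f\<close> they are applied to \<open>|f|\<close>. Exponents live in \<open>[1, \<infinity>]\<close>, encoded in \<^typ>\<open>ennreal\<close>;
  there \<open>1 / \<infinity> = 0\<close> and \<open>1 / 0 = \<infinity>\<close>, so \<open>1\<close> and \<open>\<infinity>\<close> are conjugate to each other.
  Since \<open>nn_integral\<close> is a lower integral on non-measurable functions, Lebesgue measurability is
  always required separately wherever these norms are used.
\<close>

definition ennpowr :: "ennreal \<Rightarrow> real \<Rightarrow> ennreal"
  where "ennpowr x s =
    (if s = 0 then 1 else if x = \<infinity> then \<infinity> else ennreal (enn2real x powr s))"

definition recip :: "ennreal \<Rightarrow> real"
  where "recip p = enn2real (1 / p)"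

definition conj_exponent :: "ennreal \<Rightarrow> ennreal"
  where "conj_exponent p = 1 / (1 - 1 / p)"

definition Lp_norm :: "ennreal \<Rightarrow> ('a::euclidean_space \<Rightarrow> ennreal) \<Rightarrow> ennreal"
  where "Lp_norm p g =
    (if p = \<infinity> then esssup lebesgue g
     else ennpowr (\<integral>\<^sup>+ x. ennpowr (g x) (enn2real p) \<partial>lebesgue) (recip p))"

definition distribution_fun :: "('a::euclidean_space \<Rightarrow> ennreal) \<Rightarrow> ennreal \<Rightarrow> ennreal"
  where "distribution_fun g s = emeasure lebesgue {x. s < g x}"

definition decreasing_rearrangement :: "('a::euclidean_space \<Rightarrow> ennreal) \<Rightarrow> real \<Rightarrow> ennreal"
  where "decreasing_rearrangement g t = Inf {s. distribution_fun g s \<le> ennreal t}"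

text \<open>
  With \<open>g\<^sup>*\<close> the decreasing rearrangement, the \<open>L\<^sup>p\<^sup>,\<^sup>r\<close> quasinorm is
  \<open>(\<integral>\<^sub>0\<^sup>\<infinity> (t powr (1/p) * g\<^sup>* t) powr r dt/t) powr (1/r)\<close> for \<open>r < \<infinity>\<close> and
  \<open>sup\<^sub>t\<^sub>>\<^sub>0 t powr (1/p) * g\<^sup>* t\<close> for \<open>r = \<infinity>\<close>.
\<close>

definition Lorentz_norm :: "ennreal \<Rightarrow> ennreal \<Rightarrow> ('a::euclidean_space \<Rightarrow> ennreal) \<Rightarrow> ennreal"
  where "Lorentz_norm p r g =
    (if r = \<infinity>
     then SUP t\<in>{0<..}. ennreal (t powr recip p) * decreasing_rearrangement g t
     else ennpowr
       (\<integral>\<^sup>+ t\<in>{0<..}.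
          ennpowr (ennreal (t powr recip p) * decreasing_rearrangement g t) (enn2real r)
            * ennreal (1 / t) \<partial>lborel)
       (recip r))"

lemma Lorentz_norm_infinity:
  fixes g :: "'a::euclidean_space \<Rightarrow> ennreal"
  assumes [measurable]: "g \<in> borel_measurable lebesgue"
  shows "Lorentz_norm \<infinity> \<infinity> g = Lp_norm \<infinity> g"
proof -
  have r: "recip top = 0"
    by (simp add: recip_def)
  have e: "esssup lebesgue g = Inf {s. distribution_fun g s = 0}"
    by (subst esssup_eq) (auto simp: distribution_fun_def)
  have "(SUP t\<in>{0<..}. decreasing_rearrangement g t) = Inf {s. distribution_fun g s = 0}"
  proof (rule antisym)
    show "(SUP t\<in>{0<..}. decreasing_rearrangement g t) \<le> Inf {s. distribution_fun g s = 0}"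
      unfolding decreasing_rearrangement_def
      by (intro SUP_least Inf_superset_mono) auto
    show "Inf {s. distribution_fun g s = 0} \<le> (SUP t\<in>{0<..}. decreasing_rearrangement g t)"
    proof (rule dense_ge)
      fix z assume z: "(SUP t\<in>{0<..}. decreasing_rearrangement g t) < z"
      have "distribution_fun g z \<le> ennreal t" if "0 < t" for t
      proof -
        have "decreasing_rearrangement g t < z"
          using z that by (meson SUP_lessD greaterThan_iff)
        then obtain s where s: "s < z" "distribution_fun g s \<le> ennreal t"
          unfolding decreasing_rearrangement_def Inf_less_iff by auto
        have "distribution_fun g z \<le> distribution_fun g s"
        proof -
          have "{x \<in> space lebesgue. s < g x} \<in> sets lebesgue"
            by measurable
          moreover have "{x. z < g x} \<subseteq> {x \<in> space lebesgue. s < g x}"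
            using less_trans[OF s(1)] by (simp add: Collect_mono)
          ultimately have
            "emeasure lebesgue {x. z < g x} \<le> emeasure lebesgue {x \<in> space lebesgue. s < g x}"
            by (rule emeasure_mono[rotated])
          then show ?thesis
            by (simp add: distribution_fun_def)
        qed
        then show ?thesis using s(2) by (rule order_trans)
      qed
      then have "distribution_fun g z \<le> 0"
        by - (rule ennreal_le_epsilon, simp)
      then show "Inf {s. distribution_fun g s = 0} \<le> z"
        by (intro Inf_lower) simp
    qed
  qed
  then show ?thesis
    by (simp add: Lorentz_norm_def Lp_norm_def r e)
qed

definition Lp_space :: "ennreal \<Rightarrow> ('a::euclidean_space \<Rightarrow> complex) set"
  where "Lp_space p =
    {f \<in> borel_measurable lebesgue. Lp_norm p (\<lambda>x. ennreal (norm (f x))) < \<infinity>}"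

definition Lorentz_space :: "ennreal \<Rightarrow> ennreal \<Rightarrow> ('a::euclidean_space \<Rightarrow> complex) set"
  where "Lorentz_space p r =
    {f \<in> borel_measurable lebesgue. Lorentz_norm p r (\<lambda>x. ennreal (norm (f x))) < \<infinity>}"

section \<open>Fourier transform and the local maximal function\<close>

definition fourier_transform :: "'a::euclidean_space measure \<Rightarrow> 'a \<Rightarrow> complex"
  where "fourier_transform \<mu> \<xi> =
    (\<integral>x. exp (- 2 * of_real pi * \<i> * of_real (x \<bullet> \<xi>)) \<partial>\<mu>)"

text \<open>
  \<open>|f \<ast> \<mu>\<^sub>t (x)|\<close>, where \<open>f \<ast> \<mu>\<^sub>t (x) = \<integral> f (x - t y) d\<mu>(y)\<close>. The completion of \<open>\<mu>\<close> makes sense of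
  this for Lebesgue measurable \<open>f\<close>, i.e. for every representative of an \<open>L\<^sup>p\<close> class. Where the integral
  does not converge absolutely the value is \<open>\<infinity>\<close> (and not the default \<open>0\<close> of the Bochner integral),
  so that finiteness of the maximal function includes that the averages are well defined.
\<close>

definition abs_average ::
    "'a::euclidean_space measure \<Rightarrow> real \<Rightarrow> ('a \<Rightarrow> complex) \<Rightarrow> 'a \<Rightarrow> ennreal"
  where "abs_average \<mu> t f x =
    (if integrable (completion \<mu>) (\<lambda>y. f (x - t *\<^sub>R y))
     then ennreal (norm (\<integral>y. f (x - t *\<^sub>R y) \<partial>completion \<mu>))
     else \<infinity>)"

definition local_maximal ::
    "'a::euclidean_space measure \<Rightarrow> ('a \<Rightarrow> complex) \<Rightarrow> 'a \<Rightarrow> ennreal"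
  where "local_maximal \<mu> f x = (SUP t\<in>{1..2}. abs_average \<mu> t f x)"

section \<open>Exponents and the triangle\<close>

definition p_dec :: "real \<Rightarrow> real"
  where "p_dec a = (2 * a + 1) / (2 * a)"

definition p_dim :: "nat \<Rightarrow> real \<Rightarrow> real \<Rightarrow> real"
  where "p_dim d a b = (2 * (real d - b) + 2 * a - 1) / (real d - b + 2 * a - 1)"

definition p_circ :: "nat \<Rightarrow> real \<Rightarrow> real \<Rightarrow> real"
  where "p_circ d a b = min (p_dec a) (p_dim d a b)"

definition vertex_P :: "nat \<Rightarrow> real \<Rightarrow> real \<Rightarrow> real \<times> real"
  where "vertex_P d a b = (1 / p_circ d a b, 1 / p_circ d a b)"

definition vertex_Q :: "nat \<Rightarrow> real \<Rightarrow> real \<Rightarrow> real \<times> real"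
  where "vertex_Q d a b =
    (1 / p_dim d a b, recip (conj_exponent (ennreal (p_dim d a b))))"

definition exponent_triangle :: "nat \<Rightarrow> real \<Rightarrow> real \<Rightarrow> (real \<times> real) set"
  where "exponent_triangle d a b = convex hull {(0, 0), vertex_P d a b, vertex_Q d a b}"

end

theory Submission
  imports Defs "HOL-Complex_Analysis.Complex_Analysis" "HOL-Probability.Probability"
    "HOL-Real_Asymp.Real_Asymp"
begin

text \<open>
  Both vertices come from one estimate for the maximal averages of \<open>f = 1\<^sub>U\<close> with \<open>U\<close> open. Let \<open>P\<^sub>s\<close>
  be convolution with the Gaussian of width \<open>\<surd>s\<close>. Expanding \<open>(1 - exp (- \<pi> \<epsilon>\<^sup>2 |\<xi>|\<^sup>2))\<close> to the \<open>N\<close>-th power on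
  the Fourier side, with \<open>N \<ge> a\<close>, splits \<open>P\<^sub>\<delta> f\<close> into a high frequency part and a combination of
  \<open>P\<^sub>s f\<close> with \<open>s = \<delta> + i \<epsilon>\<^sup>2\<close>, \<open>1 \<le> i \<le> N\<close>.

  High frequencies: the decay of the Fourier transform of \<open>\<mu>\<close> passes to its radial derivative, with one power
  lost, so Plancherel and a Sobolev inequality in \<open>t\<close> on every dyadic shell give an \<open>L\<^sup>2\<close> bound with
  constant \<open>\<epsilon> powr (a - 1/2)\<close>. Low frequencies: the kernel \<open>sup\<^sub>t G\<^sub>s * \<mu>\<^sub>t\<close> is at most
  \<open>C s powr (- (d - b) / 2)\<close> pointwise, by the ball condition, and its integral is at most
  \<open>C s powr (- min 1 (d - b) / 2)\<close>. Optimising over \<open>\<epsilon>\<close> gives restricted weak type estimates at \<open>P\<close> and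
  \<open>Q\<close>, and with the trivial one at \<open>O\<close> and convexity, on the whole triangle.

  A general \<open>f\<close> is dominated by dyadic multiples of indicators of open sets that contain its level sets. Summing over
  the levels gives the Lorentz estimates at the vertices, and Marcinkiewicz interpolation between two points with
  distinct coordinates gives the Lebesgue estimates. The excluded edge \<open>[P, Q]\<close> is vertical exactly
  when \<open>b \<ge> d - 1\<close>, so that interpolation along it is available only for \<open>b < d - 1\<close>.
\<close>

section \<open>Gaussians and Plancherel's inequality\<close>

text \<open>The exponents reflect two choices of \<epsilon> at height l. With \<gamma> = min 1 (d -
  b), the high part costs \<epsilon>^(2a-1) |U| / l^2 and the low part \<epsilon>^(-\<gamma>) |U| /
  l; equating them gives P and the minimum in \<open>p_circ\<close>. Taking \<epsilon>^(d-b)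
  comparable to |U| / l instead keeps the low part below l/2 everywhere, so that only the high part
  is left; this gives Q. Openness of U matters because then the indicator is at most the lower limit
  of its Gaussian means at every point: bounds uniform in \<delta> survive \<delta> -> 0, and
  superlevel sets of the maximal function are open although the supremum over t is uncountable.
  Since \<mu> may be singular, averages of a function given only almost everywhere need a meaning,
  for all t at once. The level set bound for open sets of small measure supplies it: for almost
  every x no average charges a given null set. The derivative costs one power of |\<xi>| because
  compact support makes the Fourier transform entire along each ray. Its decay persists in a strip
  around the real axis, where Cauchy's estimate applies.\<close>

abbreviation vol :: "'a::euclidean_space set \<Rightarrow> ennreal"
  where "vol \<equiv> emeasure lborel"

definition ee :: "real \<Rightarrow> complex"
  where "ee t = cis (2 * pi * t)"

text \<open>Normalised to integral 1, with Fourier transform exp (- \<pi> s |\<xi>|^2). Thus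
  \<open>s\<close> is a squared width, and multiplying two such symbols adds their parameters, which
  is the origin of the sums \<delta> + i \<epsilon>^2.\<close>

definition gauss :: "real \<Rightarrow> 'a::euclidean_space \<Rightarrow> real"
  where "gauss s x = s powr (- (DIM('a) / 2)) * exp (- (pi * (norm x)\<^sup>2 / s))"

lemma norm_ee [simp]: "norm (ee t) = 1"
  by (simp add: ee_def)

lemma ee_0 [simp]: "ee 0 = 1"
  by (simp add: ee_def)

lemma ee_add: "ee (s + t) = ee s * ee t"
  by (simp add: ee_def cis_mult distrib_left)

lemma ee_diff: "ee (s - t) = ee s * cnj (ee t)"
  by (simp add: ee_def cis_mult cis_cnj right_diff_distrib)

lemma ee_minus: "ee (- t) = cnj (ee t)"
  by (simp add: ee_def cis_cnj)

lemma ee_sum: "finite A \<Longrightarrow> ee (sum f A) = (\<Prod>i\<in>A. ee (f i))"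
  by (induction rule: finite_induct) (auto simp: ee_add)

lemma continuous_on_ee [continuous_intros]:
  "continuous_on S f \<Longrightarrow> continuous_on S (\<lambda>x. ee (f x))"
  unfolding ee_def cis_conv_exp by (intro continuous_intros)

lemma borel_measurable_ee [measurable (raw)]:
  "f \<in> borel_measurable M \<Longrightarrow> (\<lambda>x. ee (f x)) \<in> borel_measurable M"
  by (rule measurable_compose[OF _ borel_measurable_continuous_onI[OF continuous_on_ee[OF continuous_on_id]]])
    simp

lemma has_vector_derivative_ee:
  "((\<lambda>t. ee (t * u)) has_vector_derivative (2 * pi * \<i> * u) * ee (t * u)) (at t within S)"
proof -
  have "((\<lambda>z. exp (2 * pi * \<i> * u * z)) has_field_derivative (2 * pi * \<i> * u) * exp (2 * pi * \<i> * u * of_real t))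
     (at (of_real t))"
    by (auto intro!: derivative_eq_intros)
  from field_vector_diff_chain_within[OF has_vector_derivative_of_real[OF DERIV_ident] has_field_derivative_at_within[OF this], of S]
  show ?thesis
    by (simp add: ee_def cis_conv_exp o_def mult_ac)
qed

lemma borel_measurable_gauss [measurable]:
  "gauss s \<in> borel_measurable borel"
  unfolding gauss_def[abs_def] by measurable

lemma gauss_nonneg [simp]: "0 \<le> gauss s x"
  by (simp add: gauss_def)

lemma gauss_minus [simp]: "gauss s (- x) = gauss s x"
  by (simp add: gauss_def)

lemma gauss_fourier_real:
  fixes s y :: real
  assumes s: "0 < s"
  shows "integrable lborel (\<lambda>x. ee (x * y) * exp (- (pi * s * x\<^sup>2)))"
    and "(\<integral>x. ee (x * y) * exp (- (pi * s * x\<^sup>2)) \<partial>lborel) = s powr (- 1 / 2) * exp (- (pi * y\<^sup>2 / s))"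
proof -
  \<comment> \<open>The formula is the characteristic function of the standard normal law, rescaled:
    with c^2 = 2 \<pi> s the density at c x is (2 \<pi>)^(-1/2) exp (- \<pi> s x^2).\<close>
  define c where "c = sqrt (2 * pi * s)"
  have c: "0 < c" "c\<^sup>2 = 2 * pi * s"
    using s by (auto simp: c_def)
  define f where "f x = std_normal_density x *\<^sub>R cis ((2 * pi * y / c) * x)" for x :: real
  have int: "integrable lborel f"
  proof (rule Bochner_Integration.integrable_bound)
    show "integrable lborel std_normal_density"
      by (rule integrable_normal_density) simp
    show "f \<in> borel_measurable lborel"
      unfolding f_def cis_conv_exp by measurable
  qed (auto simp: f_def)
  have val: "(\<integral>x. f x \<partial>lborel) = exp (- ((2 * pi * y / c)\<^sup>2) / 2)"
  proof -
    have "char std_normal_distribution (2 * pi * y / c) = (\<integral>x. f x \<partial>lborel)"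
      unfolding char_def f_def
      by (subst integral_density) (auto simp: cis_conv_exp)
    then show ?thesis
      by (simp add: char_std_normal_distribution)
  qed
  have fc: "f (0 + c * x) = (1 / sqrt (2 * pi)) * (ee (x * y) * exp (- (pi * s * x\<^sup>2)))" for x
  proof -
    have "(c * x)\<^sup>2 / 2 = pi * s * x\<^sup>2"
      using c by (simp add: power_mult_distrib)
    then show ?thesis
      using c(1) by (simp add: f_def ee_def normal_density_def mult_ac scaleR_conv_of_real)
  qed
  have int2: "integrable lborel (\<lambda>x. f (0 + c * x))"
    using lborel_integrable_real_affine[OF int, of c 0] c by simp
  then show "integrable lborel (\<lambda>x. ee (x * y) * exp (- (pi * s * x\<^sup>2)))"
  proof -
    have "integrable lborel (\<lambda>x. complex_of_real (sqrt (2 * pi)) * f (0 + c * x))"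
      using int2 by (intro integrable_mult_right) auto
    moreover have "complex_of_real (sqrt (2 * pi)) * f (0 + c * x) = ee (x * y) * exp (- (pi * s * x\<^sup>2))" for x
      unfolding fc by (simp flip: of_real_mult mult.assoc)
    ultimately show ?thesis by simp
  qed
  have "(\<integral>x. f x \<partial>lborel) = c *\<^sub>R (\<integral>x. f (0 + c * x) \<partial>lborel)"
    using lborel_integral_real_affine[of c f 0] c by simp
  also have "\<dots> = c / sqrt (2 * pi) * (\<integral>x. ee (x * y) * exp (- (pi * s * x\<^sup>2)) \<partial>lborel)"
    unfolding fc by (simp add: scaleR_conv_of_real)
  also have "c / sqrt (2 * pi) = sqrt s"
    by (simp add: c_def real_sqrt_mult)
  finally have "sqrt s * (\<integral>x. ee (x * y) * exp (- (pi * s * x\<^sup>2)) \<partial>lborel) = exp (- ((2 * pi * y / c)\<^sup>2) / 2)"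
    using val by simp
  moreover have "(2 * pi * y / c)\<^sup>2 / 2 = pi * y\<^sup>2 / s"
    using s by (simp add: power_divide c(2) power_mult_distrib) (simp add: field_simps power2_eq_square)
  ultimately have "sqrt s * (\<integral>x. ee (x * y) * exp (- (pi * s * x\<^sup>2)) \<partial>lborel) = exp (- (pi * y\<^sup>2 / s))"
    by simp
  moreover have "complex_of_real (s powr (- 1 / 2)) * complex_of_real (sqrt s) = 1"
    using s by (simp add: powr_half_sqrt[symmetric] flip: of_real_mult powr_add)
  ultimately show "(\<integral>x. ee (x * y) * exp (- (pi * s * x\<^sup>2)) \<partial>lborel) = s powr (- 1 / 2) * exp (- (pi * y\<^sup>2 / s))"
    by (metis (no_types, lifting) mult.assoc mult_1 of_real_mult)
qed

lemma lborel_integral_prod: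
  fixes f :: "'a::euclidean_space \<Rightarrow> real \<Rightarrow> complex"
  assumes int: "\<And>b. b \<in> Basis \<Longrightarrow> integrable lborel (f b)"
  shows "integrable lborel (\<lambda>x::'a. \<Prod>b\<in>Basis. f b (x \<bullet> b))"
    and "(\<integral>x. (\<Prod>b\<in>Basis. f b ((x::'a) \<bullet> b)) \<partial>lborel) = (\<Prod>b\<in>Basis. \<integral>x. f b x \<partial>lborel)"
proof -
  interpret product_sigma_finite "\<lambda>_::'a. lborel :: real measure"
    by standard
  have [measurable]: "f b \<in> borel_measurable borel" if "b \<in> Basis" for b
    using borel_measurable_integrable[OF int[OF that]] by simp
  have i: "integrable (Pi\<^sub>M (Basis :: 'a set) (\<lambda>_. lborel)) (\<lambda>x. \<Prod>b\<in>Basis. f b (x b))"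
    by (rule product_integrable_prod) (auto intro: int)
  have j: "(\<integral>x. (\<Prod>b\<in>Basis. f b (x b)) \<partial>(Pi\<^sub>M (Basis :: 'a set) (\<lambda>_. lborel))) = (\<Prod>b\<in>Basis. \<integral>x. f b x \<partial>lborel)"
    by (rule product_integral_prod) (auto intro: int)
  have e: "(\<Prod>b\<in>Basis. f b ((\<Sum>b\<in>Basis. x b *\<^sub>R b) \<bullet> b)) = (\<Prod>b\<in>Basis. f b (x b))" for x :: "'a \<Rightarrow> real"
    by (intro prod.cong) auto
  show "integrable lborel (\<lambda>x::'a. \<Prod>b\<in>Basis. f b (x \<bullet> b))"
    by (subst lborel_eq, subst integrable_distr_eq) (auto simp: e i)
  show "(\<integral>x. (\<Prod>b\<in>Basis. f b ((x::'a) \<bullet> b)) \<partial>lborel) = (\<Prod>b\<in>Basis. \<integral>x. f b x \<partial>lborel)"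
    by (subst (1) lborel_eq, subst integral_distr) (auto simp: e j)
qed

text \<open>Both the Gaussian and the character are products over the coordinates, so the integral
  factors into one-dimensional ones.\<close>

lemma gauss_fourier:
  fixes y :: "'a::euclidean_space"
  assumes s: "0 < s"
  shows "integrable lborel (\<lambda>x. ee (x \<bullet> y) * exp (- (pi * s * (norm x)\<^sup>2)))" (is ?A)
    and "(\<integral>x. ee (x \<bullet> y) * exp (- (pi * s * (norm x)\<^sup>2)) \<partial>lborel) = gauss s y" (is ?B)
proof -
  have n: "(norm x)\<^sup>2 = (\<Sum>b\<in>Basis. (x \<bullet> b)\<^sup>2)" for x :: 'a
    using power2_norm_eq_inner[of x] euclidean_inner[of x x] by (simp add: power2_eq_square)
  have e: "ee (x \<bullet> y) * exp (- (pi * s * (norm x)\<^sup>2))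
      = (\<Prod>b\<in>Basis. ee ((x \<bullet> b) * (y \<bullet> b)) * exp (- (pi * s * (x \<bullet> b)\<^sup>2)))" for x
    unfolding n by (subst euclidean_inner) (simp add: ee_sum prod.distrib sum_distrib_left
        exp_sum[symmetric] sum_negf flip: of_real_prod)
  show ?A
    unfolding e
    by (rule lborel_integral_prod(1)[of "\<lambda>b x. ee (x * (y \<bullet> b)) * exp (- (pi * s * x\<^sup>2))"])
      (rule gauss_fourier_real(1)[OF s])
  have "(\<integral>x. ee (x \<bullet> y) * exp (- (pi * s * (norm x)\<^sup>2)) \<partial>lborel)
     = (\<Prod>b\<in>Basis. \<integral>x. ee (x * (y \<bullet> b)) * exp (- (pi * s * x\<^sup>2)) \<partial>lborel)"
    unfolding e
    by (rule lborel_integral_prod(2)[of "\<lambda>b x. ee (x * (y \<bullet> b)) * exp (- (pi * s * x\<^sup>2))"])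
      (rule gauss_fourier_real(1)[OF s])
  also have "\<dots> = (\<Prod>b\<in>Basis. of_real (s powr (- 1 / 2) * exp (- (pi * (y \<bullet> b)\<^sup>2 / s))))"
    by (intro prod.cong refl gauss_fourier_real(2)[OF s])
  also have "\<dots> = of_real (\<Prod>b\<in>(Basis::'a set). s powr (- 1 / 2) * exp (- (pi * (y \<bullet> b)\<^sup>2 / s)))"
    by simp
  also have "(\<Prod>b\<in>(Basis::'a set). s powr (- 1 / 2) * exp (- (pi * (y \<bullet> b)\<^sup>2 / s))) = gauss s y"
    unfolding gauss_def n using s
    by (simp add: prod.distrib powr_power exp_sum[symmetric] sum_negf sum_divide_distrib[symmetric] sum_distrib_left[symmetric])
  finally show ?B .
qed

lemma integrable_exp_norm_square:
  assumes "0 < s"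
  shows "integrable lborel (\<lambda>x::'a::euclidean_space. exp (- (pi * s * (norm x)\<^sup>2)))"
  using integrable_norm[OF gauss_fourier(1)[OF assms, of "0::'a"]] by simp

lemma gauss_integral:
  assumes "0 < s"
  shows "integrable lborel (gauss s :: 'a::euclidean_space \<Rightarrow> real)"
    and "(\<integral>x. gauss s (x::'a) \<partial>lborel) = 1"
proof -
  have e: "gauss s = (\<lambda>x::'a. s powr (- (DIM('a) / 2)) * exp (- (pi * (1 / s) * (norm x)\<^sup>2)))"
    by (simp add: gauss_def fun_eq_iff)
  show "integrable lborel (gauss s :: 'a::euclidean_space \<Rightarrow> real)"
    unfolding e using integrable_exp_norm_square[of "1 / s"] assms by simp
  have "complex_of_real (\<integral>x. exp (- (pi * (1 / s) * (norm (x::'a))\<^sup>2)) \<partial>lborel) = gauss (1 / s) (0::'a)"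
    using gauss_fourier(2)[of "1 / s" "0::'a"] assms
    by (simp add: flip: integral_complex_of_real)
  then have "(\<integral>x. exp (- (pi * (1 / s) * (norm (x::'a))\<^sup>2)) \<partial>lborel) = (1 / s) powr (- (DIM('a) / 2))"
    by (simp add: gauss_def of_real_eq_iff)
  then show "(\<integral>x. gauss s (x::'a) \<partial>lborel) = 1"
    unfolding e using assms by (simp add: powr_divide powr_minus)
qed

lemma nn_integral_gauss:
  assumes "0 < s"
  shows "(\<integral>\<^sup>+x. gauss s (y - (x::'a::euclidean_space)) \<partial>lborel) = 1"
    and "(\<integral>\<^sup>+x. gauss s ((x::'a::euclidean_space) - y) \<partial>lborel) = 1"
proof -
  have 1: "(\<integral>\<^sup>+x. gauss s (x::'a) \<partial>lborel) = 1"
    using gauss_integral[OF assms, where 'a='a] by (simp add: nn_integral_eq_integral)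
  have "(\<integral>\<^sup>+x. gauss s (x::'a) \<partial>lborel) = (\<integral>\<^sup>+x. gauss s (x - y) \<partial>lborel)"
    using nn_integral_distr[of "(+) (- y)" lborel borel "\<lambda>x. ennreal (gauss s x)"]
      lborel_distr_plus[of "- y"]
    by (simp add: add.commute[of "- y"] diff_conv_add_uminus[symmetric] del: diff_conv_add_uminus)
  then show "(\<integral>\<^sup>+x. gauss s ((x::'a::euclidean_space) - y) \<partial>lborel) = 1"
    using 1 by simp
  moreover have "gauss s (x - y) = gauss s (y - x)" for x
    by (metis gauss_minus minus_diff_eq)
  ultimately show "(\<integral>\<^sup>+x. gauss s (y - (x::'a::euclidean_space)) \<partial>lborel) = 1"
    by simp
qed

section \<open>Exchange of integrals against a bounded kernel\<close>

lemma integrable_product_bounded_kernel: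
  fixes f :: "'a \<Rightarrow> complex" and g :: "'b \<Rightarrow> complex" and K :: "'a \<Rightarrow> 'b \<Rightarrow> complex"
  assumes "sigma_finite_measure M" "sigma_finite_measure N"
    and f: "integrable M f" and g: "integrable N g"
    and K [measurable]: "case_prod K \<in> borel_measurable (M \<Otimes>\<^sub>M N)"
    and B: "\<And>x y. norm (K x y) \<le> B"
  shows "integrable (M \<Otimes>\<^sub>M N) (\<lambda>(x, y). f x * g y * K x y)"
proof -
  interpret pair_sigma_finite M N
    using assms by (simp add: pair_sigma_finite_def)
  have [measurable]: "f \<in> borel_measurable M" "g \<in> borel_measurable N"
    using f g by auto
  have i: "integrable (M \<Otimes>\<^sub>M N) (\<lambda>(x, y). f x * g y)"
  proof (rule Fubini_integrable)
    have "(\<integral>y. norm (f x * g y) \<partial>N) = norm (f x) * (\<integral>y. norm (g y) \<partial>N)" for x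
      by (simp add: norm_mult)
    then show "integrable M (\<lambda>x. \<integral>y. norm (case (x, y) of (x, y) \<Rightarrow> f x * g y) \<partial>N)"
      using f by simp
  qed (use g in auto)
  show ?thesis
  proof (rule Bochner_Integration.integrable_bound)
    show "integrable (M \<Otimes>\<^sub>M N) (\<lambda>p. B *\<^sub>R (case p of (x, y) \<Rightarrow> f x * g y))"
      using i by simp
    have "norm (f x) * norm (g y) * norm (K x y) \<le> \<bar>B\<bar> * (norm (f x) * norm (g y))" for x y
      using mult_right_mono[OF order_trans[OF B[of x y] abs_ge_self], of "norm (f x) * norm (g y)"]
      by (simp add: mult_ac)
    then show "AE p in M \<Otimes>\<^sub>M N. norm (case p of (x, y) \<Rightarrow> f x * g y * K x y)
        \<le> norm (B *\<^sub>R (case p of (x, y) \<Rightarrow> f x * g y))"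
      by (intro always_eventually) (auto simp: norm_mult)
  qed measurable
qed

text \<open>The common form of the exchanges made on the Fourier side: each variable has its own
  integrable factor, and the two are coupled only by a bounded kernel such as a character.\<close>

lemma Fubini_bounded_kernel:
  fixes f :: "'a \<Rightarrow> complex" and g :: "'b \<Rightarrow> complex" and K :: "'a \<Rightarrow> 'b \<Rightarrow> complex"
  assumes "sigma_finite_measure M" "sigma_finite_measure N"
    and f: "integrable M f" and g: "integrable N g"
    and K [measurable]: "case_prod K \<in> borel_measurable (M \<Otimes>\<^sub>M N)"
    and B: "\<And>x y. norm (K x y) \<le> B"
  shows "(\<integral>x. f x * (\<integral>y. g y * K x y \<partial>N) \<partial>M) = (\<integral>y. g y * (\<integral>x. f x * K x y \<partial>M) \<partial>N)"
proof -
  interpret pair_sigma_finite M N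
    using assms by (simp add: pair_sigma_finite_def)
  have "(\<integral>y. \<integral>x. f x * g y * K x y \<partial>M \<partial>N) = (\<integral>x. \<integral>y. f x * g y * K x y \<partial>N \<partial>M)"
    by (rule Fubini_integral) (rule integrable_product_bounded_kernel[OF assms])
  moreover have "(\<integral>x. f x * g y * K x y \<partial>M) = g y * (\<integral>x. f x * K x y \<partial>M)" for y
    by (subst integral_mult_right_zero[symmetric]) (simp add: mult_ac)
  moreover have "(\<integral>y. f x * g y * K x y \<partial>N) = f x * (\<integral>y. g y * K x y \<partial>N)" for x
    by (subst integral_mult_right_zero[symmetric]) (simp add: mult_ac)
  ultimately show ?thesis
    by simp
qed

lemma integral_norm_bound_ennreal_le:
  fixes f :: "'a \<Rightarrow> 'b::{banach, second_countable_topology}"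
  shows "ennreal (norm (integral\<^sup>L M f)) \<le> (\<integral>\<^sup>+x. ennreal (norm (f x)) \<partial>M)"
  by (cases "integrable M f") (auto simp: integral_norm_bound_ennreal not_integrable_integral_eq)

lemma nn_integral_le_of_tendsto:
  fixes g :: "nat \<Rightarrow> 'a \<Rightarrow> ennreal"
  assumes [measurable]: "\<And>n. g n \<in> borel_measurable M"
    and lim: "\<And>x. x \<in> space M \<Longrightarrow> (\<lambda>n. g n x) \<longlonglongrightarrow> h x"
    and bound: "\<And>n. (\<integral>\<^sup>+x. g n x \<partial>M) \<le> C"
  shows "(\<integral>\<^sup>+x. h x \<partial>M) \<le> C"
proof -
  have "(\<integral>\<^sup>+x. h x \<partial>M) = (\<integral>\<^sup>+x. liminf (\<lambda>n. g n x) \<partial>M)"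
    by (intro nn_integral_cong) (metis lim lim_imp_Liminf sequentially_bot)
  also have "\<dots> \<le> liminf (\<lambda>n. \<integral>\<^sup>+x. g n x \<partial>M)"
    by (rule nn_integral_liminf) simp
  also have "\<dots> \<le> C"
    by (rule Liminf_le) (simp_all add: bound)
  finally show ?thesis .
qed

section \<open>Fourier transform and Plancherel's inequality\<close>

definition ft :: "('a::euclidean_space \<Rightarrow> complex) \<Rightarrow> 'a \<Rightarrow> complex"
  where "ft f \<xi> = (\<integral>y. f y * ee (- (y \<bullet> \<xi>)) \<partial>lborel)"

lemma borel_measurable_ft [measurable]:
  assumes [measurable]: "f \<in> borel_measurable borel"
  shows "ft f \<in> borel_measurable borel"
  unfolding ft_def[abs_def] by measurable

lemma norm_ft_le: "norm (ft f \<xi>) \<le> (\<integral>y. norm (f y) \<partial>lborel)"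
  unfolding ft_def by (rule integral_norm_bound[THEN order_trans]) (simp add: norm_mult)

lemma integrable_ft_gauss:
  fixes f :: "'a::euclidean_space \<Rightarrow> complex"
  assumes f: "integrable lborel f" and s: "0 < s"
  shows "integrable lborel (\<lambda>\<xi>. ft f \<xi> * exp (- (pi * s * (norm \<xi>)\<^sup>2)))"
proof (rule Bochner_Integration.integrable_bound)
  have [measurable]: "f \<in> borel_measurable borel"
    using f by (simp add: borel_measurable_integrable)
  show "integrable lborel (\<lambda>\<xi>::'a. (\<integral>y. norm (f y) \<partial>lborel) * exp (- (pi * s * (norm \<xi>)\<^sup>2)))"
    by (rule integrable_mult_right) (rule integrable_exp_norm_square[OF s])
  show "(\<lambda>\<xi>. ft f \<xi> * complex_of_real (exp (- (pi * s * (norm \<xi>)\<^sup>2)))) \<in> borel_measurable lborel"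
    by measurable
qed (auto simp: norm_mult intro!: mult_right_mono order_trans[OF norm_ft_le])

text \<open>After exchanging the integrals the inner one is the Fourier transform of a Gaussian.
  Damping \<open>ft f\<close> by a Gaussian therefore amounts to convolving \<open>f\<close> with
  \<open>gauss s\<close>, which serves as the inversion formula throughout.\<close>

lemma ft_gauss_inversion:
  fixes f :: "'a::euclidean_space \<Rightarrow> complex"
  assumes f: "integrable lborel f" and s: "0 < s"
  shows "(\<integral>\<xi>. ft f \<xi> * exp (- (pi * s * (norm \<xi>)\<^sup>2)) * ee (x \<bullet> \<xi>) \<partial>lborel)
    = (\<integral>y. f y * gauss s (x - y) \<partial>lborel)"
proof -
  have [measurable]: "f \<in> borel_measurable borel"
    using f by (simp add: borel_measurable_integrable)
  define E where "E \<xi> = complex_of_real (exp (- (pi * s * (norm \<xi>)\<^sup>2)))" for \<xi> :: 'a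
  have E: "integrable lborel (\<lambda>\<xi>. E \<xi> * ee (x \<bullet> \<xi>))"
    using gauss_fourier(1)[OF s, of x] by (simp add: E_def inner_commute mult.commute)
  have "(\<integral>\<xi>. ft f \<xi> * E \<xi> * ee (x \<bullet> \<xi>) \<partial>lborel)
      = (\<integral>\<xi>. (E \<xi> * ee (x \<bullet> \<xi>)) * (\<integral>y. f y * ee (- (y \<bullet> \<xi>)) \<partial>lborel) \<partial>lborel)"
    by (simp add: ft_def mult_ac)
  also have "\<dots> = (\<integral>y. f y * (\<integral>\<xi>. (E \<xi> * ee (x \<bullet> \<xi>)) * ee (- (y \<bullet> \<xi>)) \<partial>lborel) \<partial>lborel)"
    by (rule Fubini_bounded_kernel[OF _ _ E f, where B = 1])
      (auto simp: lborel.sigma_finite_measure_axioms)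
  also have "\<dots> = (\<integral>y. f y * gauss s (x - y) \<partial>lborel)"
  proof (intro Bochner_Integration.integral_cong refl)
    fix y
    have "E \<xi> * ee (x \<bullet> \<xi>) * ee (- (y \<bullet> \<xi>)) = ee (\<xi> \<bullet> (x - y)) * exp (- (pi * s * (norm \<xi>)\<^sup>2))" for \<xi>
      by (simp add: E_def inner_diff_right ee_diff ee_minus inner_commute)
    then show "f y * (\<integral>\<xi>. (E \<xi> * ee (x \<bullet> \<xi>)) * ee (- (y \<bullet> \<xi>)) \<partial>lborel) = f y * gauss s (x - y)"
      using gauss_fourier(2)[OF s, of "x - y"] by simp
  qed
  finally show ?thesis
    by (simp add: E_def)
qed

text \<open>Damped by a Gaussian, the integral of |ft f|^2 becomes the pairing of \<open>f\<close>
  with its Gaussian mean. As the Gaussian has integral 1, this is at most the integral of |f|^2, and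
  Fatou's lemma removes the damping.\<close>

lemma Plancherel_le:
  fixes f :: "'a::euclidean_space \<Rightarrow> complex"
  assumes f: "integrable lborel f"
  shows "(\<integral>\<^sup>+\<xi>. ennreal ((norm (ft f \<xi>))\<^sup>2) \<partial>lborel) \<le> (\<integral>\<^sup>+y. ennreal ((norm (f y))\<^sup>2) \<partial>lborel)"
proof -
  have [measurable]: "f \<in> borel_measurable borel"
    using f by (simp add: borel_measurable_integrable)
  define E where "E s \<xi> = exp (- (pi * s * (norm \<xi>)\<^sup>2))" for s and \<xi> :: 'a
  have [measurable]: "E s \<in> borel_measurable borel" for s
    unfolding E_def by measurable
  have *: "(\<integral>\<^sup>+\<xi>. ennreal ((norm (ft f \<xi>))\<^sup>2 * E s \<xi>) \<partial>lborel) \<le> (\<integral>\<^sup>+y. ennreal ((norm (f y))\<^sup>2) \<partial>lborel)"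
    if s: "0 < s" for s
  proof -
    have i1: "integrable lborel (\<lambda>\<xi>. ft f \<xi> * E s \<xi>)"
      using integrable_ft_gauss[OF f s] by (simp add: E_def)
    have i2: "integrable lborel (\<lambda>y. cnj (f y))"
      using f by simp
    have c: "cnj (ft f \<xi>) = (\<integral>y. cnj (f y) * ee (y \<bullet> \<xi>) \<partial>lborel)" for \<xi>
    proof -
      have "(\<integral>y. cnj (f y) * ee (y \<bullet> \<xi>) \<partial>lborel) = (\<integral>y. cnj (f y * ee (- (y \<bullet> \<xi>))) \<partial>lborel)"
        by (intro Bochner_Integration.integral_cong) (auto simp: ee_minus)
      then show ?thesis
        unfolding ft_def by (simp only: Bochner_Integration.integral_cnj)
    qed
    have n: "(norm (ft f \<xi>))\<^sup>2 * E s \<xi> = (ft f \<xi> * E s \<xi>) * cnj (ft f \<xi>)" for \<xi>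
      using complex_norm_square[of "ft f \<xi>"] by (simp add: mult_ac)
    have i3: "integrable lborel (\<lambda>\<xi>. (norm (ft f \<xi>))\<^sup>2 * E s \<xi>)"
    proof (rule Bochner_Integration.integrable_bound)
      show "integrable lborel (\<lambda>\<xi>. (\<integral>y. norm (f y) \<partial>lborel) *\<^sub>R (ft f \<xi> * E s \<xi>))"
        using i1 by simp
      have "(norm (ft f \<xi>))\<^sup>2 * E s \<xi> \<le> (\<integral>y. norm (f y) \<partial>lborel) * (norm (ft f \<xi>) * E s \<xi>)" for \<xi>
        using mult_right_mono[OF norm_ft_le[of f \<xi>], of "norm (ft f \<xi>) * E s \<xi>"]
        by (simp add: power2_eq_square E_def mult_ac)
      then show "AE \<xi> in lborel. norm ((norm (ft f \<xi>))\<^sup>2 * E s \<xi>) \<le> norm ((\<integral>y. norm (f y) \<partial>lborel) *\<^sub>R (ft f \<xi> * E s \<xi>))"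
        by (intro always_eventually allI) (simp add: norm_mult E_def abs_mult)
    qed measurable
    \<comment> \<open>One factor of |ft f|^2 is written out as an integral over y; exchanging the
      order leaves an inverse transform of the damped \<open>ft f\<close>.\<close>
    have "complex_of_real (\<integral>\<xi>. (norm (ft f \<xi>))\<^sup>2 * E s \<xi> \<partial>lborel)
        = (\<integral>\<xi>. (ft f \<xi> * E s \<xi>) * (\<integral>y. cnj (f y) * ee (y \<bullet> \<xi>) \<partial>lborel) \<partial>lborel)"
      unfolding integral_complex_of_real[symmetric] n c ..
    also have "\<dots> = (\<integral>y. cnj (f y) * (\<integral>\<xi>. (ft f \<xi> * E s \<xi>) * ee (y \<bullet> \<xi>) \<partial>lborel) \<partial>lborel)"
      by (rule Fubini_bounded_kernel[OF _ _ i1 i2, where B = 1])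
        (auto simp: lborel.sigma_finite_measure_axioms)
    also have "\<dots> = (\<integral>z. cnj (f z) * (\<integral>y. f y * gauss s (z - y) \<partial>lborel) \<partial>lborel)"
      using ft_gauss_inversion[OF f s] by (simp add: E_def)
    finally have eq: "complex_of_real (\<integral>\<xi>. (norm (ft f \<xi>))\<^sup>2 * E s \<xi> \<partial>lborel) = \<dots>" .
    have "(\<integral>\<^sup>+\<xi>. ennreal ((norm (ft f \<xi>))\<^sup>2 * E s \<xi>) \<partial>lborel) = ennreal (\<integral>\<xi>. (norm (ft f \<xi>))\<^sup>2 * E s \<xi> \<partial>lborel)"
      by (rule nn_integral_eq_integral[OF i3]) (simp add: E_def)
    also have "\<dots> \<le> ennreal (norm (complex_of_real (\<integral>\<xi>. (norm (ft f \<xi>))\<^sup>2 * E s \<xi> \<partial>lborel)))"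
      by (intro ennreal_leI) simp
    also have "\<dots> = ennreal (norm (\<integral>z. cnj (f z) * (\<integral>y. f y * gauss s (z - y) \<partial>lborel) \<partial>lborel))"
      unfolding eq ..
    also have "\<dots> \<le> (\<integral>\<^sup>+z. ennreal (norm (cnj (f z) * (\<integral>y. f y * gauss s (z - y) \<partial>lborel))) \<partial>lborel)"
      by (rule integral_norm_bound_ennreal_le)
    also have "\<dots> \<le> (\<integral>\<^sup>+z. ennreal (norm (f z)) * (\<integral>\<^sup>+y. ennreal (norm (f y)) * ennreal (gauss s (z - y)) \<partial>lborel) \<partial>lborel)"
    proof (intro nn_integral_mono)
      fix z
      have "ennreal (norm (\<integral>y. f y * gauss s (z - y) \<partial>lborel)) \<le> (\<integral>\<^sup>+y. ennreal (norm (f y)) * ennreal (gauss s (z - y)) \<partial>lborel)"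
        by (rule integral_norm_bound_ennreal_le[THEN order_trans]) (simp add: norm_mult ennreal_mult)
      then show "ennreal (norm (cnj (f z) * (\<integral>y. f y * gauss s (z - y) \<partial>lborel)))
          \<le> ennreal (norm (f z)) * (\<integral>\<^sup>+y. ennreal (norm (f y)) * ennreal (gauss s (z - y)) \<partial>lborel)"
        by (auto simp: norm_mult ennreal_mult intro!: mult_left_mono)
    qed
    also have "\<dots> = (\<integral>\<^sup>+z. \<integral>\<^sup>+y. ennreal (norm (f z) * norm (f y) * gauss s (z - y)) \<partial>lborel \<partial>lborel)"
      by (simp add: nn_integral_cmult[symmetric] ennreal_mult mult.assoc)
    \<comment> \<open>The arithmetic-geometric mean inequality separates the two factors. The kernel
      is symmetric with integral 1 in either variable, so each half contributes half of the square
      integral.\<close>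
    also have "\<dots> \<le> (\<integral>\<^sup>+z. \<integral>\<^sup>+y. ennreal ((norm (f z))\<^sup>2 / 2) * ennreal (gauss s (z - y)) +
        ennreal ((norm (f y))\<^sup>2 / 2) * ennreal (gauss s (z - y)) \<partial>lborel \<partial>lborel)"
    proof (intro nn_integral_mono)
      fix z y
      have "norm (f z) * norm (f y) \<le> (norm (f z))\<^sup>2 / 2 + (norm (f y))\<^sup>2 / 2"
        using sum_squares_bound[of "norm (f z)" "norm (f y)"] by simp
      from mult_right_mono[OF this gauss_nonneg[of s "z - y"]]
      show "ennreal (norm (f z) * norm (f y) * gauss s (z - y)) \<le> ennreal ((norm (f z))\<^sup>2 / 2) * ennreal (gauss s (z - y)) +
        ennreal ((norm (f y))\<^sup>2 / 2) * ennreal (gauss s (z - y))"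
        by (simp add: distrib_right flip: ennreal_mult ennreal_plus)
    qed
    also have "\<dots> = (\<integral>\<^sup>+z. ennreal ((norm (f z))\<^sup>2 / 2) * (\<integral>\<^sup>+y. ennreal (gauss s (z - y)) \<partial>lborel) \<partial>lborel) +
        (\<integral>\<^sup>+z. \<integral>\<^sup>+y. ennreal ((norm (f y))\<^sup>2 / 2) * ennreal (gauss s (z - y)) \<partial>lborel \<partial>lborel)"
      by (simp add: nn_integral_add nn_integral_cmult)
    also have "(\<integral>\<^sup>+z. \<integral>\<^sup>+y. ennreal ((norm (f y))\<^sup>2 / 2) * ennreal (gauss s (z - y)) \<partial>lborel \<partial>lborel)
        = (\<integral>\<^sup>+y. \<integral>\<^sup>+z. ennreal ((norm (f y))\<^sup>2 / 2) * ennreal (gauss s (z - y)) \<partial>lborel \<partial>lborel)"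
      by (rule lborel_pair.Fubini') measurable
    also have "\<dots> = (\<integral>\<^sup>+y. ennreal ((norm (f y))\<^sup>2 / 2) * (\<integral>\<^sup>+z. ennreal (gauss s (z - y)) \<partial>lborel) \<partial>lborel)"
      by (simp add: nn_integral_cmult)
    also have "(\<integral>\<^sup>+z. ennreal ((norm (f z))\<^sup>2 / 2) * (\<integral>\<^sup>+y. ennreal (gauss s (z - y)) \<partial>lborel) \<partial>lborel) + \<dots>
        = (\<integral>\<^sup>+y. ennreal ((norm (f y))\<^sup>2 / 2) + ennreal ((norm (f y))\<^sup>2 / 2) \<partial>lborel)"
      by (simp add: nn_integral_gauss[OF s] nn_integral_add)
    also have "\<dots> = (\<integral>\<^sup>+y. ennreal ((norm (f y))\<^sup>2) \<partial>lborel)"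
      by (simp flip: ennreal_plus)
    finally show ?thesis .
  qed
  show ?thesis
  proof (rule nn_integral_le_of_tendsto)
    show "(\<integral>\<^sup>+\<xi>. ennreal ((norm (ft f \<xi>))\<^sup>2 * E (1 / Suc n) \<xi>) \<partial>lborel) \<le> (\<integral>\<^sup>+y. ennreal ((norm (f y))\<^sup>2) \<partial>lborel)" for n
      by (rule *) simp
    show "(\<lambda>n. ennreal ((norm (ft f \<xi>))\<^sup>2 * E (1 / Suc n) \<xi>)) \<longlonglongrightarrow> ennreal ((norm (ft f \<xi>))\<^sup>2)" for \<xi>
    proof -
      have "(\<lambda>n. (norm (ft f \<xi>))\<^sup>2 * exp (- (pi * (1 / real (Suc n)) * (norm \<xi>)\<^sup>2))) \<longlonglongrightarrow> (norm (ft f \<xi>))\<^sup>2 * exp (- (pi * 0 * (norm \<xi>)\<^sup>2))"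
        using LIMSEQ_inverse_real_of_nat by (intro tendsto_intros) (simp add: inverse_eq_divide)
      then show ?thesis
        unfolding E_def by (intro tendsto_ennrealI) simp
    qed
  qed measurable
qed

text \<open>Conjugation turns the inverse transform into the transform of the conjugate
  function.\<close>

lemma Plancherel_inverse_le:
  fixes f :: "'a::euclidean_space \<Rightarrow> complex"
  assumes f: "integrable lborel f"
  shows "(\<integral>\<^sup>+x. ennreal ((norm (\<integral>\<xi>. f \<xi> * ee (x \<bullet> \<xi>) \<partial>lborel))\<^sup>2) \<partial>lborel)
    \<le> (\<integral>\<^sup>+\<xi>. ennreal ((norm (f \<xi>))\<^sup>2) \<partial>lborel)"
proof -
  have "norm (\<integral>\<xi>. f \<xi> * ee (x \<bullet> \<xi>) \<partial>lborel) = norm (ft (\<lambda>\<xi>. cnj (f \<xi>)) x)" for x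
  proof -
    have "(\<integral>\<xi>. f \<xi> * ee (x \<bullet> \<xi>) \<partial>lborel) = cnj (ft (\<lambda>\<xi>. cnj (f \<xi>)) x)"
    proof -
      have "(\<integral>\<xi>. f \<xi> * ee (x \<bullet> \<xi>) \<partial>lborel) = (\<integral>y. cnj (cnj (f y) * ee (- (y \<bullet> x))) \<partial>lborel)"
        by (intro Bochner_Integration.integral_cong) (auto simp: ee_minus inner_commute)
      then show ?thesis
        unfolding ft_def by (simp only: Bochner_Integration.integral_cnj)
    qed
    then show ?thesis by simp
  qed
  then show ?thesis
    using Plancherel_le[of "\<lambda>\<xi>. cnj (f \<xi>)"] f by simp
qed

section \<open>Decay of the derivative of the Fourier transform\<close>

lemma integrable_exp_bounded:
  fixes v :: "'a \<Rightarrow> complex"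
  assumes "finite_measure M" and [measurable]: "v \<in> borel_measurable M" and v: "AE y in M. norm (v y) \<le> B"
  shows "integrable M (\<lambda>y. exp (z * v y))"
proof (rule finite_measure.integrable_const_bound[OF assms(1)])
  show "AE y in M. norm (exp (z * v y)) \<le> exp (norm z * B)"
    using v
  proof eventually_elim
    case (elim y)
    have "norm (exp (z * v y)) \<le> exp (norm (z * v y))"
      by (rule norm_exp)
    also have "\<dots> \<le> exp (norm z * B)"
      using elim by (simp add: norm_mult mult_left_mono)
    finally show ?case .
  qed
qed measurable

text \<open>Dominated convergence along an arbitrary sequence of increments: the essential bound on
  \<open>v\<close> dominates the difference quotients uniformly. It follows that the integral is an
  entire function of \<open>z\<close>.\<close>

lemma has_field_derivative_integral_exp:
  fixes v :: "'a \<Rightarrow> complex"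
  assumes fin: "finite_measure M" and [measurable]: "v \<in> borel_measurable M" and v: "AE y in M. norm (v y) \<le> B"
  shows "((\<lambda>z. \<integral>y. exp (z * v y) \<partial>M) has_field_derivative (\<integral>y. v y * exp (z * v y) \<partial>M)) (at z)"
  unfolding DERIV_def tendsto_at_iff_sequentially
proof (intro allI impI)
  fix h :: "nat \<Rightarrow> complex"
  assume h: "\<forall>i. h i \<in> UNIV - {0}" and lim: "h \<longlonglongrightarrow> 0"
  obtain H where H: "\<And>i. norm (h i) \<le> H"
    using convergent_imp_Bseq[OF convergentI[OF lim]] by (metis BseqE)
  have "(\<lambda>i. \<integral>y. (exp ((z + h i) * v y) - exp (z * v y)) / h i \<partial>M) \<longlonglongrightarrow> (\<integral>y. v y * exp (z * v y) \<partial>M)"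
  proof (rule integral_dominated_convergence)
    show "integrable M (\<lambda>y. B * exp (norm z * B) * exp (H * B))"
      by (simp add: finite_measure.integrable_const[OF fin])
    show "AE y in M. (\<lambda>i. (exp ((z + h i) * v y) - exp (z * v y)) / h i) \<longlonglongrightarrow> v y * exp (z * v y)"
    proof (intro always_eventually allI)
      fix y
      have "((\<lambda>z. exp (z * v y)) has_field_derivative v y * exp (z * v y)) (at z)"
        by (auto intro!: derivative_eq_intros)
      then have "((\<lambda>h. (exp ((z + h) * v y) - exp (z * v y)) / h) \<longlongrightarrow> v y * exp (z * v y)) (at 0)"
        by (simp add: DERIV_def)
      then show "(\<lambda>i. (exp ((z + h i) * v y) - exp (z * v y)) / h i) \<longlonglongrightarrow> v y * exp (z * v y)"
        unfolding tendsto_at_iff_sequentially o_def using h lim by blast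
    qed
    show "AE y in M. norm ((exp ((z + h i) * v y) - exp (z * v y)) / h i) \<le> B * exp (norm z * B) * exp (H * B)" for i
      using v
    proof eventually_elim
      case (elim y)
      have hB: "norm (h i * v y) \<le> H * B"
        using elim H[of i] by (simp add: norm_mult mult_mono')
      \<comment> \<open>The bound |exp w - 1| \<le> |w| exp |w| provides the factor |h| that cancels
        the denominator.\<close>
      have "norm (exp (h i * v y) - 1) \<le> norm (h i * v y) * exp (norm (h i * v y))"
        using Taylor_exp[of "h i * v y" 0] abs_Re_le_cmod[of "h i * v y"]
        by (simp add: mult.commute) (meson exp_le_cancel_iff mult_left_mono norm_ge_zero order_trans)
      also have "\<dots> \<le> (norm (h i) * B) * exp (H * B)"
        using elim hB order_trans[OF norm_ge_zero elim] by (intro mult_mono) (auto simp: norm_mult mult_left_mono)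
      finally have 1: "norm (exp (h i * v y) - 1) \<le> (norm (h i) * B) * exp (H * B)" .
      have 2: "norm (exp (z * v y)) \<le> exp (norm z * B)"
        by (rule order_trans[OF norm_exp]) (use elim in \<open>simp add: norm_mult mult_left_mono\<close>)
      have "exp ((z + h i) * v y) - exp (z * v y) = exp (z * v y) * (exp (h i * v y) - 1)"
        by (simp add: distrib_right exp_add algebra_simps)
      then have "norm ((exp ((z + h i) * v y) - exp (z * v y)) / h i) =
          norm (exp (z * v y)) * norm (exp (h i * v y) - 1) / norm (h i)"
        by (simp add: norm_mult norm_divide)
      also have "\<dots> \<le> exp (norm z * B) * ((norm (h i) * B) * exp (H * B)) / norm (h i)"
        by (intro divide_right_mono mult_mono 1 2) auto
      also have "\<dots> = B * exp (norm z * B) * exp (H * B)"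
        using h by simp
      finally show ?case .
    qed
  qed measurable
  moreover have "(\<integral>y. (exp ((z + h i) * v y) - exp (z * v y)) / h i \<partial>M) =
      ((\<integral>y. exp ((z + h i) * v y) \<partial>M) - (\<integral>y. exp (z * v y) \<partial>M)) / h i" for i
    unfolding integral_divide_zero
    by (subst Bochner_Integration.integral_diff) (auto intro!: integrable_exp_bounded[OF fin _ v])
  ultimately show "((\<lambda>h. ((\<integral>y. exp ((z + h) * v y) \<partial>M) - (\<integral>y. exp (z * v y) \<partial>M)) / h) \<circ> h)
      \<longlonglongrightarrow> (\<integral>y. v y * exp (z * v y) \<partial>M)"
    by (simp only: o_def)
qed

text \<open>A Phragmen--Lindelof argument: \<open>g z * exp (\<i> * B * z) * (z + \<i>) powr a\<close> grows at most
  polynomially in the upper half plane, and it is bounded on the real axis.\<close>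

lemma integral_exp_upper_half_plane:
  fixes u :: "'a \<Rightarrow> real"
  assumes fin: "finite_measure M" and [measurable]: "u \<in> borel_measurable M" and u: "AE y in M. \<bar>u y\<bar> \<le> B"
    and a: "0 < a" and C: "0 \<le> C"
    and decay: "\<And>s. s \<noteq> 0 \<Longrightarrow> norm (\<integral>y. exp (of_real s * (- \<i> * u y)) \<partial>M) \<le> C * \<bar>s\<bar> powr (- a)"
    and z: "0 \<le> Im z"
  shows "norm (\<integral>y. exp (z * (- \<i> * u y)) \<partial>M) \<le> (2 powr a * (measure M (space M) + C) + 1) * exp (B * Im z) * norm (z + \<i>) powr (- a)"
proof -
  interpret finite_measure M by fact
  define m where "m = measure M (space M)"
  \<comment> \<open>On the real axis |z + \<i>| \<le> 2 max 1 |x|, and |g| (max 1 |x|)^a \<le> m +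
    C, trivially for |x| \<le> 1 and by the decay beyond. The additional 1 makes \<open>D\<close>
    positive, so that a quantity tending to 0 falls below it.\<close>
  define D where "D = 2 powr a * (m + C) + 1"
  define g where "g z = (\<integral>y. exp (z * (- \<i> * u y)) \<partial>M)" for z
  have v: "AE y in M. norm (- \<i> * u y) \<le> B"
    using u by (simp add: norm_mult)
  have m: "0 \<le> m"
    by (simp add: m_def)
  have hol: "g holomorphic_on UNIV"
    unfolding g_def holomorphic_on_def field_differentiable_def
    using has_field_derivative_integral_exp[OF fin _ v] by (auto intro: has_field_derivative_at_within)
  have bound: "norm (g z) \<le> m * exp (B * Im z)" if "0 \<le> Im z" for z
  proof -
    have "norm (g z) \<le> (\<integral>y. exp (B * Im z) \<partial>M)"
      unfolding g_def
    proof (rule integral_norm_bound[THEN order_trans], rule integral_mono_AE)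
      show "integrable M (\<lambda>y. norm (exp (z * (- \<i> * complex_of_real (u y)))))"
        by (intro integrable_norm integrable_exp_bounded[OF fin _ v]) measurable
      show "AE y in M. norm (exp (z * (- \<i> * u y))) \<le> exp (B * Im z)"
        using u
      proof eventually_elim
        case (elim y)
        then have "Im z * u y \<le> Im z * B"
          using that by (intro mult_left_mono) auto
        then show ?case
          by (simp add: mult.commute)
      qed
    qed simp
    then show ?thesis
      by (simp add: m_def mult.commute)
  qed
  \<comment> \<open>The exponential factor cancels the growth exp (B Im z) of \<open>g\<close>, and
    the power is to be beaten by the decay. The shift by \<i> keeps the closed half plane off the
    branch cut.\<close>
  define G where "G z = g z * exp (\<i> * B * z) * (z + \<i>) powr (of_real a)" for z
  have normG: "norm (G z) = norm (g z) * exp (- (B * Im z)) * norm (z + \<i>) powr a" for z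
    by (simp add: G_def norm_mult norm_powr_real_powr')
  have half: "z + \<i> \<notin> \<real>\<^sub>\<le>\<^sub>0" if "0 \<le> Im z" for z
    using that by (auto simp: complex_nonpos_Reals_iff)
  have holG: "G holomorphic_on {z. 0 \<le> Im z}"
    unfolding G_def using half
    by (intro holomorphic_intros holomorphic_on_subset[OF hol]) auto
  have G_real: "norm (G z) \<le> D" if "Im z = 0" for z
  proof -
    define x where "x = Re z"
    have zx: "z = of_real x"
      using that by (simp add: x_def complex_eq_iff)
    have n: "norm (z + \<i>) \<le> 2 * max 1 \<bar>x\<bar>"
      using norm_triangle_ineq[of z \<i>] by (simp add: zx)
    have "norm (z + \<i>) powr a \<le> (2 * max 1 \<bar>x\<bar>) powr a"
      using a n by (intro powr_mono2) auto
    also have "\<dots> = 2 powr a * max 1 \<bar>x\<bar> powr a"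
      by (simp add: powr_mult)
    finally have 1: "norm (z + \<i>) powr a \<le> 2 powr a * max 1 \<bar>x\<bar> powr a" .
    have 2: "norm (g z) * max 1 \<bar>x\<bar> powr a \<le> m + C"
    proof (cases "\<bar>x\<bar> \<le> 1")
      case True
      then show ?thesis
        using bound[of z] that C by (simp add: max_def)
    next
      case False
      then have "norm (g z) * \<bar>x\<bar> powr a \<le> (C * \<bar>x\<bar> powr (- a)) * \<bar>x\<bar> powr a"
        unfolding g_def zx by (intro mult_right_mono decay) auto
      also have "\<dots> = C"
        using False by (simp add: mult.assoc flip: powr_add)
      finally show ?thesis
        using False m by (simp add: max_def)
    qed
    have "norm (G z) = norm (g z) * norm (z + \<i>) powr a"
      using that by (simp add: normG)
    also have "\<dots> \<le> norm (g z) * (2 powr a * max 1 \<bar>x\<bar> powr a)"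
      by (rule mult_left_mono[OF 1]) simp
    also have "\<dots> = 2 powr a * (norm (g z) * max 1 \<bar>x\<bar> powr a)"
      by simp
    also have "\<dots> \<le> D"
      unfolding D_def using mult_left_mono[OF 2, of "2 powr a"] powr_ge_zero[of 2 a] by linarith
    finally show ?thesis .
  qed
  have G_growth: "norm (G z) \<le> m * (1 + norm z) powr a" if "0 \<le> Im z" for z
  proof -
    have "norm (G z) \<le> (m * exp (B * Im z)) * exp (- (B * Im z)) * (1 + norm z) powr a"
      unfolding normG using bound[OF that] a norm_triangle_ineq[of z \<i>]
      by (intro mult_mono powr_mono2) (auto simp: m add.commute)
    then show ?thesis
      by (simp add: mult.assoc flip: exp_add)
  qed
  \<comment> \<open>Dividing by the \<open>n\<close>-th power of 1 - \<i> \<delta> z, whose modulus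
    is at least 1 and at least \<delta> |z|, forces decay at infinity without spoiling the bound on
    the real axis.\<close>
  obtain n :: nat where n: "a < real n"
    using reals_Archimedean2 by blast
  have den: "1 \<le> norm (1 - \<i> * \<delta> * z)" "\<delta> * norm z \<le> norm (1 - \<i> * \<delta> * z)"
    if "0 < \<delta>" "0 \<le> Im z" for \<delta> :: real and z
  proof -
    have "1 \<le> Re (1 - \<i> * \<delta> * z)"
      using that by simp
    then show "1 \<le> norm (1 - \<i> * \<delta> * z)"
      using complex_Re_le_cmod order_trans by blast
    have "(\<delta> * norm z)\<^sup>2 \<le> (norm (1 - \<i> * \<delta> * z))\<^sup>2"
      using that unfolding power_mult_distrib cmod_power2
      by (simp add: algebra_simps power2_eq_square)
    then show "\<delta> * norm z \<le> norm (1 - \<i> * \<delta> * z)"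
      by (rule power2_le_imp_le) simp
  qed
  have G_damped: "norm (G z / (1 - \<i> * \<delta> * z) ^ n) \<le> D" if \<delta>: "0 < \<delta>" and z: "0 \<le> Im z" for \<delta> :: real and z
  proof -
    have "((\<lambda>r. m * (1 + r) powr a / (\<delta> * r) ^ n) \<longlongrightarrow> 0) at_top"
      using n \<delta> a by real_asymp
    moreover have "0 < D"
      using m C by (simp add: D_def add_nonneg_pos)
    ultimately have "eventually (\<lambda>r. m * (1 + r) powr a / (\<delta> * r) ^ n < D) at_top"
      by (rule order_tendstoD(2))
    then have "eventually (\<lambda>r. m * (1 + r) powr a / (\<delta> * r) ^ n < D \<and> r > 0 \<and> r \<ge> norm z) at_top"
      by (intro eventually_conj eventually_gt_at_top eventually_ge_at_top)
    then obtain r where r: "m * (1 + r) powr a / (\<delta> * r) ^ n < D" "r > 0" "r \<ge> norm z"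
      by (auto dest: eventually_happens)
    \<comment> \<open>A half disc: on its diameter the bound on the real axis applies, and on its
      arc the radius \<open>r\<close> is so large that the damped growth bound is below
      \<open>D\<close>.\<close>
    define S where "S = {z. 0 \<le> Im z} \<inter> cball 0 r"
    have nz: "1 - \<i> * \<delta> * w \<noteq> 0" if "0 \<le> Im w" for w
      using den(1)[OF \<delta> that] by force
    have hG: "(\<lambda>z. G z / (1 - \<i> * \<delta> * z) ^ n) holomorphic_on {z. 0 \<le> Im z}"
      using nz by (intro holomorphic_intros holG) auto
    have cl: "closed S"
      unfolding S_def by (intro closed_Int closed_halfspace_Im_ge closed_cball)
    show ?thesis
    proof (rule maximum_modulus_frontier[where S = S and f = "\<lambda>z. G z / (1 - \<i> * \<delta> * z) ^ n"])
      show "(\<lambda>z. G z / (1 - \<i> * \<delta> * z) ^ n) holomorphic_on interior S"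
        using interior_subset[of S] by (intro holomorphic_on_subset[OF hG]) (auto simp: S_def)
      show "continuous_on (closure S) (\<lambda>z. G z / (1 - \<i> * \<delta> * z) ^ n)"
        using closure_closed[OF cl] by (intro holomorphic_on_imp_continuous_on holomorphic_on_subset[OF hG]) (auto simp: S_def)
      show "bounded S"
        by (simp add: S_def bounded_Int)
      show "z \<in> S"
        using z r by (simp add: S_def)
      fix w assume w: "w \<in> frontier S"
      then have wS: "0 \<le> Im w" "norm w \<le> r"
        using frontier_subset_closed[OF cl] by (auto simp: S_def)
      have "{z. 0 < Im z} \<inter> ball 0 r \<subseteq> interior S"
        by (rule interior_maximal) (auto simp: S_def open_halfspace_Im_gt intro!: open_Int)
      moreover have "w \<notin> interior S"
        using w by (simp add: frontier_def)
      ultimately have "\<not> (0 < Im w \<and> norm w < r)"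
        by auto
      then have "Im w = 0 \<or> norm w = r"
        using wS by linarith
      then show "norm (G w / (1 - \<i> * \<delta> * w) ^ n) \<le> D"
      proof
        assume "Im w = 0"
        have "norm (G w / (1 - \<i> * \<delta> * w) ^ n) \<le> D / 1"
          unfolding norm_divide norm_power
          using G_real[OF \<open>Im w = 0\<close>] den(1)[OF \<delta> wS(1)]
          by (intro frac_le) (auto intro: one_le_power order_trans[OF norm_ge_zero])
        then show ?thesis by simp
      next
        assume "norm w = r"
        have "norm (G w / (1 - \<i> * \<delta> * w) ^ n) \<le> m * (1 + r) powr a / (\<delta> * r) ^ n"
          unfolding norm_divide norm_power
          using G_growth[OF wS(1)] den(2)[OF \<delta> wS(1)] \<delta> r m \<open>norm w = r\<close>
          by (intro frac_le power_mono) auto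
        then show ?thesis
          using r by simp
      qed
    qed
  qed
  \<comment> \<open>The bound does not depend on \<delta>, so the damping is removed by letting
    \<delta> tend to 0.\<close>
  have "norm (G z) \<le> D"
  proof (rule tendsto_upperbound)
    have "((\<lambda>\<delta>. norm (G z / (1 - \<i> * of_real \<delta> * z) ^ n)) \<longlongrightarrow> norm (G z / (1 - \<i> * of_real 0 * z) ^ n)) (at_right 0)"
      by (intro tendsto_intros) auto
    then show "((\<lambda>\<delta>. norm (G z / (1 - \<i> * of_real \<delta> * z) ^ n)) \<longlongrightarrow> norm (G z)) (at_right 0)"
      by simp
    show "\<forall>\<^sub>F \<delta> in at_right 0. norm (G z / (1 - \<i> * of_real \<delta> * z) ^ n) \<le> D"
      using G_damped[OF _ z] eventually_at_right_less by (rule eventually_mono[rotated])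
  qed simp
  then have "norm (g z) * exp (- (B * Im z)) * norm (z + \<i>) powr a * (exp (B * Im z) * norm (z + \<i>) powr (- a))
      \<le> D * (exp (B * Im z) * norm (z + \<i>) powr (- a))"
    unfolding normG by (intro mult_right_mono) auto
  moreover have "z + \<i> \<noteq> 0"
    using half[OF z] by auto
  then have "norm (g z) * exp (- (B * Im z)) * norm (z + \<i>) powr a * (exp (B * Im z) * norm (z + \<i>) powr (- a)) = norm (g z)"
    by (simp add: exp_minus powr_minus field_simps)
  ultimately have "norm (g z) \<le> D * (exp (B * Im z) * norm (z + \<i>) powr (- a))"
    by (simp only:)
  then show ?thesis
    by (simp only: D_def g_def m_def mult.assoc)
qed

text \<open>Cauchy's estimate on the circle of radius 1/2 around the real point \<open>s\<close>.
  There the imaginary part is bounded, so the exponential growth costs only a constant, and |w| is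
  comparable to \<open>s\<close>, so the decay is that of \<open>s\<close>.\<close>

lemma integral_exp_derivative_decay:
  fixes u :: "'a \<Rightarrow> real"
  assumes fin: "finite_measure M" and [measurable]: "u \<in> borel_measurable M" and u: "AE y in M. \<bar>u y\<bar> \<le> B"
    and a: "0 < a" and C: "0 \<le> C" and B: "0 \<le> B"
    and decay: "\<And>s. s \<noteq> 0 \<Longrightarrow> norm (\<integral>y. exp (of_real s * (- \<i> * u y)) \<partial>M) \<le> C * \<bar>s\<bar> powr (- a)"
    and s: "1 \<le> s"
  shows "norm (\<integral>y. - \<i> * u y * exp (of_real s * (- \<i> * u y)) \<partial>M)
    \<le> 2 * (2 powr a * (measure M (space M) + C) + 1) * exp B * 2 powr a * s powr (- a)"
proof -
  define g where "g z = (\<integral>y. exp (z * (- \<i> * u y)) \<partial>M)" for z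
  define D where "D = 2 powr a * (measure M (space M) + C) + 1"
  have D: "0 \<le> D"
    using C by (simp add: D_def)
  have v: "AE y in M. norm (- \<i> * u y) \<le> B"
    using u by (simp add: norm_mult)
  have der: "(g has_field_derivative (\<integral>y. - \<i> * u y * exp (z * (- \<i> * u y)) \<partial>M)) (at z)" for z
    unfolding g_def by (rule has_field_derivative_integral_exp[OF fin _ v]) measurable
  have hol: "g holomorphic_on UNIV"
    unfolding holomorphic_on_def field_differentiable_def
    using der by (auto intro: has_field_derivative_at_within)
  have *: "norm (g w) \<le> D * exp B * (2 powr a * s powr (- a))" if w: "norm (of_real s - w) = 1 / 2" for w
  proof -
    have nw: "s / 2 \<le> norm w"
      using norm_triangle_ineq2[of "of_real s" "of_real s - w"] w s by simp
    have imw: "\<bar>Im w\<bar> \<le> 1"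
      using abs_Im_le_cmod[of "of_real s - w"] w by simp
    \<comment> \<open>In the upper half plane adding \<i> increases the modulus, and |w| \<ge> s -
      1/2 \<ge> s/2.\<close>
    have e: "norm (z + \<i>) powr (- a) \<le> 2 powr a * s powr (- a)" if "norm z = norm w" "0 \<le> Im z" for z
    proof -
      have "(norm z)\<^sup>2 \<le> (norm (z + \<i>))\<^sup>2"
        unfolding cmod_power2 using that by (simp add: power2_eq_square algebra_simps)
      then have "norm z \<le> norm (z + \<i>)"
        by (rule power2_le_imp_le) simp
      then have "norm (z + \<i>) powr (- a) \<le> (s / 2) powr (- a)"
        using nw s a that by (intro powr_mono2') auto
      then show ?thesis
        using s by (simp add: powr_divide powr_minus field_simps)
    qed
    have "norm (g w) \<le> D * exp (B * \<bar>Im w\<bar>) * (2 powr a * s powr (- a))"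
    proof (cases "0 \<le> Im w")
      case True
      have "norm (g w) \<le> D * exp (B * Im w) * norm (w + \<i>) powr (- a)"
        unfolding g_def D_def by (rule integral_exp_upper_half_plane[OF fin _ u a C decay True]) measurable
      also have "\<dots> \<le> D * exp (B * Im w) * (2 powr a * s powr (- a))"
        using e[of w] True D by (intro mult_left_mono) auto
      finally show ?thesis
        using True by simp
    next
      case False
      \<comment> \<open>Replacing \<open>u\<close> and \<open>w\<close> by their negatives leaves
        the integral unchanged and moves the point to the upper half plane.\<close>
      have "norm (\<integral>y. exp ((- w) * (- \<i> * of_real (- u y))) \<partial>M) \<le> D * exp (B * Im (- w)) * norm (- w + \<i>) powr (- a)"
        unfolding D_def
      proof (rule integral_exp_upper_half_plane[OF fin _ _ a C])
        show "AE y in M. \<bar>- u y\<bar> \<le> B"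
          using u by simp
        show "norm (\<integral>y. exp (of_real s * (- \<i> * of_real (- u y))) \<partial>M) \<le> C * \<bar>s\<bar> powr (- a)" if "s \<noteq> 0" for s
          using decay[of "- s"] that by simp
        show "0 \<le> Im (- w)"
          using False by simp
      qed measurable
      also have "(\<integral>y. exp ((- w) * (- \<i> * of_real (- u y))) \<partial>M) = g w"
        by (simp add: g_def)
      also have "D * exp (B * Im (- w)) * norm (- w + \<i>) powr (- a) \<le> D * exp (B * Im (- w)) * (2 powr a * s powr (- a))"
        using e[of "- w"] False D by (intro mult_left_mono) auto
      finally show ?thesis
        using False by simp
    qed
    also have "\<dots> \<le> D * exp (B * 1) * (2 powr a * s powr (- a))"
      using imw B D by (intro mult_right_mono mult_left_mono) (auto intro: mult_left_le)
    finally show ?thesis by simp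
  qed
  have "norm ((deriv ^^ 1) g (of_real s)) \<le> fact 1 * (D * exp B * (2 powr a * s powr (- a))) / (1 / 2) ^ 1"
    by (rule Cauchy_inequality[OF holomorphic_on_subset[OF hol] _ _ *])
      (auto intro!: holomorphic_on_imp_continuous_on holomorphic_on_subset[OF hol])
  then show ?thesis
    by (simp add: DERIV_imp_deriv[OF der] D_def mult_ac del: distrib_left_numeral)
qed

section \<open>High frequencies\<close>

text \<open>A one-dimensional Sobolev inequality at scale 1/L: the value at \<open>t\<close> is
  compared with an average over an interval of length 1/L, and Cauchy-Schwarz bounds the oscillation
  there by the derivative. It is balanced when a derivative costs a factor \<open>L\<close>. The
  fundamental theorem of calculus is a hypothesis because for multipliers it results from Fubini's
  theorem.\<close>

lemma sup_square_le_integral: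
  fixes \<phi> \<phi>' :: "real \<Rightarrow> complex"
  assumes [measurable]: "\<phi> \<in> borel_measurable borel" "\<phi>' \<in> borel_measurable borel"
    and ftc: "\<And>s t. \<lbrakk>1 \<le> s; s \<le> t; t \<le> 2\<rbrakk> \<Longrightarrow> \<phi> t - \<phi> s = (\<integral>\<tau>. indicator {s..t} \<tau> *\<^sub>R \<phi>' \<tau> \<partial>lborel)"
    and L: "1 \<le> L" and t: "1 \<le> t" "t \<le> 2"
  shows "ennreal ((norm (\<phi> t))\<^sup>2) \<le>
    ennreal (2 * L) * (\<integral>\<^sup>+\<tau>\<in>{1..2}. ennreal ((norm (\<phi> \<tau>))\<^sup>2) \<partial>lborel) +
    ennreal (2 / L) * (\<integral>\<^sup>+\<tau>\<in>{1..2}. ennreal ((norm (\<phi>' \<tau>))\<^sup>2) \<partial>lborel)"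
proof -
  \<comment> \<open>The interval of length 1/L ends at \<open>t\<close>, unless it would leave
    [1, 2] on the left; then it starts at 1 and still contains \<open>t\<close>.\<close>
  define c where "c = max 1 (t - 1 / L)"
  define I where "I = {c..c + 1 / L}"
  have L': "0 < 1 / L" "1 / L \<le> 1"
    using L by auto
  have c: "1 \<le> c" "c \<le> t" "t \<le> c + 1 / L" "c + 1 / L \<le> 2"
    using L' t by (auto simp: c_def max_def)
  have I12: "I \<subseteq> {1..2}"
    using c by (auto simp: I_def)
  have [measurable]: "I \<in> sets borel"
    by (simp add: I_def)
  have emI: "vol I = ennreal (1 / L)"
    using L' by (simp add: I_def)
  define D where "D = (\<integral>\<^sup>+\<tau>\<in>I. ennreal (norm (\<phi>' \<tau>)) \<partial>lborel)"
  have D2: "D\<^sup>2 \<le> ennreal (1 / L) * (\<integral>\<^sup>+\<tau>\<in>I. ennreal ((norm (\<phi>' \<tau>))\<^sup>2) \<partial>lborel)"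
  proof -
    have "D = (\<integral>\<^sup>+\<tau>. indicator I \<tau> * (ennreal (norm (\<phi>' \<tau>)) * indicator I \<tau>) \<partial>lborel)"
      unfolding D_def by (intro nn_integral_cong) (auto split: split_indicator)
    also have "\<dots>\<^sup>2 \<le> (\<integral>\<^sup>+\<tau>. (indicator I \<tau>)\<^sup>2 \<partial>lborel) * (\<integral>\<^sup>+\<tau>. (ennreal (norm (\<phi>' \<tau>)) * indicator I \<tau>)\<^sup>2 \<partial>lborel)"
      by (rule Cauchy_Schwarz_nn_integral) measurable
    also have "(\<integral>\<^sup>+\<tau>. (indicator I \<tau>)\<^sup>2 \<partial>lborel) = (\<integral>\<^sup>+\<tau>. indicator I \<tau> \<partial>lborel)"
      by (intro nn_integral_cong) (auto split: split_indicator)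
    also have "(\<integral>\<^sup>+\<tau>. (ennreal (norm (\<phi>' \<tau>)) * indicator I \<tau>)\<^sup>2 \<partial>lborel) = (\<integral>\<^sup>+\<tau>\<in>I. ennreal ((norm (\<phi>' \<tau>))\<^sup>2) \<partial>lborel)"
      by (intro nn_integral_cong) (auto split: split_indicator simp: ennreal_power)
    finally show ?thesis
      by (simp add: emI)
  qed
  have diff: "ennreal (norm (\<phi> v - \<phi> u)) \<le> D" if "u \<in> I" "v \<in> I" "u \<le> v" for u v
  proof -
    have uv: "1 \<le> u" "v \<le> 2" "{u..v} \<subseteq> I"
      using that c by (auto simp: I_def)
    have "ennreal (norm (\<phi> v - \<phi> u)) \<le> (\<integral>\<^sup>+\<tau>. ennreal (norm (indicator {u..v} \<tau> *\<^sub>R \<phi>' \<tau>)) \<partial>lborel)"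
      unfolding ftc[OF uv(1) that(3) uv(2)] by (rule integral_norm_bound_ennreal_le)
    also have "\<dots> \<le> D"
      unfolding D_def using uv(3) by (intro nn_integral_mono) (auto split: split_indicator)
    finally show ?thesis .
  qed
  have tI: "t \<in> I"
    using c by (simp add: I_def)
  have pt: "ennreal ((norm (\<phi> t))\<^sup>2) \<le> 2 * ennreal ((norm (\<phi> s))\<^sup>2) + 2 * D\<^sup>2" if s: "s \<in> I" for s
  proof -
    have "ennreal (norm (\<phi> t - \<phi> s)) \<le> D"
      using diff[OF s tI] diff[OF tI s] by (cases "s \<le> t") (auto simp: norm_minus_commute)
    then have "ennreal (norm (\<phi> s)) + ennreal (norm (\<phi> t - \<phi> s)) \<le> ennreal (norm (\<phi> s)) + D"
      by (rule add_left_mono)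
    moreover have "ennreal (norm (\<phi> t)) \<le> ennreal (norm (\<phi> s)) + ennreal (norm (\<phi> t - \<phi> s))"
      using ennreal_leI[OF norm_triangle_sub[of "\<phi> t" "\<phi> s"]] by (simp add: ennreal_plus)
    ultimately have "ennreal (norm (\<phi> t)) \<le> ennreal (norm (\<phi> s)) + D"
      by (rule order_trans[rotated])
    then have "ennreal (norm (\<phi> t)) ^ 2 \<le> (ennreal (norm (\<phi> s)) + D) ^ 2"
      by (intro power_mono) auto
    also have "\<dots> \<le> 2 * (ennreal (norm (\<phi> s)))\<^sup>2 + 2 * D\<^sup>2"
    proof (cases D)
      case (real d)
      have "(norm (\<phi> s) + d)\<^sup>2 \<le> 2 * (norm (\<phi> s))\<^sup>2 + 2 * d\<^sup>2"
        using sum_squares_bound[of "norm (\<phi> s)" d] by (simp add: power2_sum)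
      then have "ennreal ((norm (\<phi> s) + d)\<^sup>2) \<le> ennreal (2 * (norm (\<phi> s))\<^sup>2 + 2 * d\<^sup>2)"
        by (rule ennreal_leI)
      moreover have "(ennreal (norm (\<phi> s)) + D)\<^sup>2 = ennreal ((norm (\<phi> s) + d)\<^sup>2)"
        using real by (simp add: ennreal_power[symmetric])
      moreover have "2 * (ennreal (norm (\<phi> s)))\<^sup>2 + 2 * D\<^sup>2 = ennreal (2 * (norm (\<phi> s))\<^sup>2 + 2 * d\<^sup>2)"
        using real by (simp add: ennreal_power ennreal_mult)
      ultimately show ?thesis by (simp only:)
    qed (simp add: top_power_ennreal ennreal_mult_top)
    finally show ?thesis
      by (simp add: ennreal_power)
  qed
  have "ennreal ((norm (\<phi> t))\<^sup>2) * ennreal (1 / L) = (\<integral>\<^sup>+s\<in>I. ennreal ((norm (\<phi> t))\<^sup>2) \<partial>lborel)"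
    by (simp add: nn_integral_cmult_indicator emI)
  also have "\<dots> \<le> (\<integral>\<^sup>+s\<in>I. (2 * ennreal ((norm (\<phi> s))\<^sup>2) + 2 * D\<^sup>2) \<partial>lborel)"
    using pt by (intro nn_integral_mono) (auto split: split_indicator)
  also have "\<dots> = (\<integral>\<^sup>+s. 2 * (ennreal ((norm (\<phi> s))\<^sup>2) * indicator I s) + 2 * D\<^sup>2 * indicator I s \<partial>lborel)"
    by (intro nn_integral_cong) (auto split: split_indicator)
  also have "\<dots> = 2 * (\<integral>\<^sup>+s\<in>I. ennreal ((norm (\<phi> s))\<^sup>2) \<partial>lborel) + 2 * D\<^sup>2 * ennreal (1 / L)"
    by (simp add: nn_integral_add nn_integral_cmult nn_integral_cmult_indicator emI)
  finally have main: "ennreal L * (ennreal ((norm (\<phi> t))\<^sup>2) * ennreal (1 / L)) \<le>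
      ennreal L * (2 * (\<integral>\<^sup>+s\<in>I. ennreal ((norm (\<phi> s))\<^sup>2) \<partial>lborel) + 2 * D\<^sup>2 * ennreal (1 / L))"
    by (rule mult_left_mono) simp
  have LL: "ennreal L * ennreal (1 / L) = 1"
    using L by (simp flip: ennreal_mult)
  have "ennreal ((norm (\<phi> t))\<^sup>2) = ennreal L * (ennreal ((norm (\<phi> t))\<^sup>2) * ennreal (1 / L))"
    by (metis LL mult.commute mult.assoc mult_1)
  also note main
  also have "ennreal L * (2 * (\<integral>\<^sup>+s\<in>I. ennreal ((norm (\<phi> s))\<^sup>2) \<partial>lborel) + 2 * D\<^sup>2 * ennreal (1 / L)) =
      2 * ennreal L * (\<integral>\<^sup>+s\<in>I. ennreal ((norm (\<phi> s))\<^sup>2) \<partial>lborel) + 2 * D\<^sup>2 * (ennreal L * ennreal (1 / L))"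
    by (simp only: distrib_left mult_ac)
  also have "\<dots> \<le> 2 * ennreal L * (\<integral>\<^sup>+s\<in>{1..2}. ennreal ((norm (\<phi> s))\<^sup>2) \<partial>lborel) +
      2 * (ennreal (1 / L) * (\<integral>\<^sup>+\<tau>\<in>{1..2}. ennreal ((norm (\<phi>' \<tau>))\<^sup>2) \<partial>lborel))"
  proof (intro add_mono mult_left_mono)
    show "(\<integral>\<^sup>+s\<in>I. ennreal ((norm (\<phi> s))\<^sup>2) \<partial>lborel) \<le> (\<integral>\<^sup>+s\<in>{1..2}. ennreal ((norm (\<phi> s))\<^sup>2) \<partial>lborel)"
      using I12 by (intro nn_integral_mono) (auto split: split_indicator)
    have "(\<integral>\<^sup>+\<tau>\<in>I. ennreal ((norm (\<phi>' \<tau>))\<^sup>2) \<partial>lborel) \<le> (\<integral>\<^sup>+\<tau>\<in>{1..2}. ennreal ((norm (\<phi>' \<tau>))\<^sup>2) \<partial>lborel)"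
      using I12 by (intro nn_integral_mono) (auto split: split_indicator)
    then have "D\<^sup>2 \<le> ennreal (1 / L) * (\<integral>\<^sup>+\<tau>\<in>{1..2}. ennreal ((norm (\<phi>' \<tau>))\<^sup>2) \<partial>lborel)"
      by (intro order_trans[OF D2] mult_left_mono) auto
    then show "2 * D\<^sup>2 * (ennreal L * ennreal (1 / L)) \<le> 2 * (ennreal (1 / L) * (\<integral>\<^sup>+\<tau>\<in>{1..2}. ennreal ((norm (\<phi>' \<tau>))\<^sup>2) \<partial>lborel))"
      unfolding LL by (simp add: mult_left_mono)
  qed auto
  also have "2 * ennreal L = ennreal (2 * L)"
    using L by (simp add: ennreal_mult)
  also have "2 * (ennreal (1 / L) * (\<integral>\<^sup>+\<tau>\<in>{1..2}. ennreal ((norm (\<phi>' \<tau>))\<^sup>2) \<partial>lborel))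
      = ennreal (2 * (1 / L)) * (\<integral>\<^sup>+\<tau>\<in>{1..2}. ennreal ((norm (\<phi>' \<tau>))\<^sup>2) \<partial>lborel)"
    using L by (subst ennreal_mult) (auto simp: mult.assoc)
  finally show ?thesis
    by simp
qed

section \<open>The measure, its Fourier transform and the derivative along rays\<close>

locale decaying_measure =
  fixes \<mu> :: "'a::euclidean_space measure" and a b C R :: real
  assumes sets_mu [measurable_cong]: "sets \<mu> = sets borel"
    and fin: "finite_measure \<mu>"
    and R: "0 < R" "AE y in \<mu>. norm y \<le> R"
    and a: "1 / 2 < a"
    and b: "0 < b" "b \<le> DIM('a)"
    and C: "0 \<le> C"
    and decay: "\<And>\<xi>. \<xi> \<noteq> 0 \<Longrightarrow> norm (fourier_transform \<mu> \<xi>) \<le> C * norm \<xi> powr (- a)"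
    and ball_bound: "\<And>x r. 0 < r \<Longrightarrow> measure \<mu> (ball x r) \<le> C * r powr b"

sublocale decaying_measure \<subseteq> finite_measure \<mu>
  by (rule fin)

context decaying_measure
begin

definition mass :: real
  where "mass = measure \<mu> UNIV"

lemma space_mu [simp]: "space \<mu> = UNIV"
  using sets_eq_imp_space_eq[OF sets_mu] by simp

lemma mass_nonneg [simp]: "0 \<le> mass"
  by (simp add: mass_def)

lemma emeasure_mu_UNIV: "emeasure \<mu> UNIV = ennreal mass"
  by (simp add: mass_def emeasure_eq_measure)

definition muhat :: "'a \<Rightarrow> complex"
  where "muhat \<xi> = (\<integral>y. ee (- (y \<bullet> \<xi>)) \<partial>\<mu>)"

text \<open>The derivative of \<open>muhat (t *\<^sub>R \<xi>)\<close> in \<open>t\<close>, in the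
  integrated sense of \<open>muhat_diff\<close>.\<close>

definition dmuhat :: "real \<Rightarrow> 'a \<Rightarrow> complex"
  where "dmuhat t \<xi> = (\<integral>y. - 2 * pi * \<i> * (y \<bullet> \<xi>) * ee (- (t * (y \<bullet> \<xi>))) \<partial>\<mu>)"

lemma muhat_eq: "muhat \<xi> = fourier_transform \<mu> \<xi>"
  by (simp add: muhat_def fourier_transform_def ee_def cis_conv_exp mult_ac)

lemma borel_measurable_muhat [measurable]: "muhat \<in> borel_measurable borel"
  unfolding muhat_def[abs_def] by measurable

lemma borel_measurable_dmuhat [measurable]: "case_prod dmuhat \<in> borel_measurable (borel \<Otimes>\<^sub>M borel)"
  unfolding dmuhat_def[abs_def] by measurable

lemma norm_muhat_le: "norm (muhat \<xi>) \<le> mass"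
  unfolding muhat_def mass_def by (rule integral_norm_bound[THEN order_trans]) simp

lemma abs_inner_le: "norm y \<le> R \<Longrightarrow> \<bar>y \<bullet> \<xi>\<bar> \<le> R * norm \<xi>"
  by (rule order_trans[OF Cauchy_Schwarz_ineq2 mult_right_mono]) auto

lemma integrable_inner: "integrable \<mu> (\<lambda>y. y \<bullet> \<xi>)"
proof (rule integrable_const_bound)
  show "AE y in \<mu>. norm (y \<bullet> \<xi>) \<le> R * norm \<xi>"
    using R(2) by eventually_elim (simp add: abs_inner_le)
qed measurable

lemma norm_dmuhat_le: "norm (dmuhat t \<xi>) \<le> 2 * pi * R * mass * norm \<xi>"
proof -
  have "norm (dmuhat t \<xi>) \<le> (\<integral>y. norm (- 2 * pi * \<i> * (y \<bullet> \<xi>) * ee (- (t * (y \<bullet> \<xi>)))) \<partial>\<mu>)"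
    unfolding dmuhat_def by (rule integral_norm_bound)
  also have "\<dots> \<le> (\<integral>y. 2 * pi * (R * norm \<xi>) \<partial>\<mu>)"
  proof (rule integral_mono_AE)
    show "integrable \<mu> (\<lambda>y. norm (- 2 * pi * \<i> * (y \<bullet> \<xi>) * ee (- (t * (y \<bullet> \<xi>)))))"
      using integrable_inner[of \<xi>] by (simp add: norm_mult)
    show "AE y in \<mu>. norm (- 2 * pi * \<i> * (y \<bullet> \<xi>) * ee (- (t * (y \<bullet> \<xi>)))) \<le> 2 * pi * (R * norm \<xi>)"
      using R(2) by eventually_elim (simp add: norm_mult abs_inner_le)
  qed simp
  finally show ?thesis
    by (simp add: mass_def mult_ac)
qed

text \<open>On the ray through \<xi> the Fourier transform is a one-variable exponential integral
  with phase 2 \<pi> (y \<bullet> \<omega>), bounded because \<mu> has bounded support. Its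
  derivative decays like the function itself; the lost power is the chain rule factor
  |\<xi>|.\<close>

lemma dmuhat_decay:
  obtains K where "0 \<le> K"
    "\<And>t \<xi>. \<lbrakk>1 \<le> t; 1 \<le> norm \<xi>\<rbrakk> \<Longrightarrow> norm (dmuhat t \<xi>) \<le> K * norm \<xi> powr (1 - a)"
proof
  define B where "B = 2 * pi * R"
  define K where "K = 2 * (2 powr a * (mass + C) + 1) * exp B * 2 powr a"
  show "0 \<le> K"
    using C by (simp add: K_def)
  fix t :: real and \<xi> assume t: "1 \<le> t" and \<xi>: "1 \<le> norm (\<xi> :: 'a)"
  define r where "r = norm \<xi>"
  define \<omega> where "\<omega> = (1 / r) *\<^sub>R \<xi>"
  have r: "1 \<le> r" "0 < r"
    using \<xi> by (auto simp: r_def)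
  have \<omega>: "\<xi> = r *\<^sub>R \<omega>" "norm \<omega> = 1"
    using r by (auto simp: \<omega>_def r_def)
  define u where "u y = 2 * pi * (y \<bullet> \<omega>)" for y :: 'a
  have [measurable]: "u \<in> borel_measurable \<mu>"
    unfolding u_def by measurable
  have e: "exp (of_real s * (- \<i> * u y)) = ee (- (y \<bullet> (s *\<^sub>R \<omega>)))" for s y
    by (simp add: ee_def cis_conv_exp u_def mult_ac)
  have "norm (\<integral>y. - \<i> * u y * exp (of_real (t * r) * (- \<i> * u y)) \<partial>\<mu>)
      \<le> 2 * (2 powr a * (measure \<mu> (space \<mu>) + C) + 1) * exp B * 2 powr a * (t * r) powr (- a)"
  proof (rule integral_exp_derivative_decay[OF fin])
    show "AE y in \<mu>. \<bar>u y\<bar> \<le> B"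
      using R(2)
    proof eventually_elim
      case (elim y)
      then have "\<bar>y \<bullet> \<omega>\<bar> \<le> R"
        using Cauchy_Schwarz_ineq2[of y \<omega>] \<omega> by simp
      then show ?case
        by (simp add: u_def B_def abs_mult)
    qed
    show "0 < a" "0 \<le> C" "0 \<le> B"
      using a C R by (auto simp: B_def)
    show "norm (\<integral>y. exp (of_real s * (- \<i> * u y)) \<partial>\<mu>) \<le> C * \<bar>s\<bar> powr (- a)" if "s \<noteq> 0" for s
    proof -
      have "(\<integral>y. exp (of_real s * (- \<i> * u y)) \<partial>\<mu>) = muhat (s *\<^sub>R \<omega>)"
        unfolding e muhat_def ..
      moreover have "s *\<^sub>R \<omega> \<noteq> 0"
        using that \<omega> by auto
      ultimately show ?thesis
        using decay[of "s *\<^sub>R \<omega>"] \<omega> by (simp add: muhat_eq)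
    qed
    show "1 \<le> t * r"
      using t r mult_mono[of 1 t 1 r] by simp
  qed measurable
  also have "\<dots> \<le> K * r powr (- a)"
  proof -
    have "r \<le> t * r"
      using t r by simp
    then have "(t * r) powr (- a) \<le> r powr (- a)"
      using r a by (intro powr_mono2') auto
    then show ?thesis
      using C unfolding K_def mass_def by (intro mult_mono) auto
  qed
  finally have 1: "norm (\<integral>y. - \<i> * u y * exp (of_real (t * r) * (- \<i> * u y)) \<partial>\<mu>) \<le> K * r powr (- a)" .
  have "dmuhat t \<xi> = (\<integral>y. r * (- \<i> * u y * exp (of_real (t * r) * (- \<i> * u y))) \<partial>\<mu>)"
    unfolding dmuhat_def e by (intro Bochner_Integration.integral_cong) (auto simp: u_def \<omega>(1) mult_ac)
  also have "\<dots> = r * (\<integral>y. - \<i> * u y * exp (of_real (t * r) * (- \<i> * u y)) \<partial>\<mu>)"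
    by (rule integral_mult_right_zero)
  finally have "norm (dmuhat t \<xi>) = r * norm (\<integral>y. - \<i> * u y * exp (of_real (t * r) * (- \<i> * u y)) \<partial>\<mu>)"
    using r by (simp only: norm_mult norm_of_real abs_of_pos)
  also have "\<dots> \<le> r * (K * r powr (- a))"
    using r by (intro mult_left_mono 1) auto
  also have "\<dots> = K * r powr (1 - a)"
    using r by (simp add: powr_diff powr_minus field_simps)
  finally show "norm (dmuhat t \<xi>) \<le> K * norm \<xi> powr (1 - a)"
    by (simp add: r_def)
qed

text \<open>The fundamental theorem of calculus holds for every character; integrating over
  \<open>y\<close> and exchanging the integrals transfers it to the transform.\<close>

lemma muhat_diff:
  assumes "s \<le> t"
  shows "muhat (t *\<^sub>R \<xi>) - muhat (s *\<^sub>R \<xi>) = (\<integral>\<tau>. indicator {s..t} \<tau> *\<^sub>R dmuhat \<tau> \<xi> \<partial>lborel)"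
proof -
  have ie: "integrable \<mu> (\<lambda>y. ee (- (y \<bullet> (r *\<^sub>R \<xi>))))" for r
    by (rule integrable_const_bound[where B = 1]) auto
  have i1: "integrable \<mu> (\<lambda>y. - 2 * pi * \<i> * complex_of_real (y \<bullet> \<xi>))"
    using integrable_inner[of \<xi>] by (intro integrable_mult_right integrable_of_real)
  have i2: "integrable lborel (\<lambda>\<tau>. complex_of_real (indicator {s..t} \<tau>))"
    by (intro integrable_of_real integrable_real_indicator) (auto simp: emeasure_lborel_Icc_eq)
  have ftc: "ee (- (y \<bullet> (t *\<^sub>R \<xi>))) - ee (- (y \<bullet> (s *\<^sub>R \<xi>))) =
     (- 2 * pi * \<i> * (y \<bullet> \<xi>)) * (\<integral>\<tau>. of_real (indicator {s..t} \<tau>) * ee (- (\<tau> * (y \<bullet> \<xi>))) \<partial>lborel)" for y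
  proof -
    have "(\<integral>\<tau>. indicator {s..t} \<tau> *\<^sub>R ((2 * pi * \<i> * (- (y \<bullet> \<xi>))) * ee (\<tau> * - (y \<bullet> \<xi>))) \<partial>lborel)
        = ee (t * - (y \<bullet> \<xi>)) - ee (s * - (y \<bullet> \<xi>))"
      using has_vector_derivative_ee[of "- (y \<bullet> \<xi>)"]
      by (intro integral_FTC_atLeastAtMost assms) (auto intro!: continuous_intros)
    then show ?thesis
      by (subst integral_mult_right_zero[symmetric]) (simp add: scaleR_conv_of_real mult_ac)
  qed
  have "muhat (t *\<^sub>R \<xi>) - muhat (s *\<^sub>R \<xi>) = (\<integral>y. ee (- (y \<bullet> (t *\<^sub>R \<xi>))) - ee (- (y \<bullet> (s *\<^sub>R \<xi>))) \<partial>\<mu>)"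
    unfolding muhat_def by (rule Bochner_Integration.integral_diff[symmetric]) (rule ie)+
  also have "\<dots> = (\<integral>y. (- 2 * pi * \<i> * (y \<bullet> \<xi>)) * (\<integral>\<tau>. of_real (indicator {s..t} \<tau>) * ee (- (\<tau> * (y \<bullet> \<xi>))) \<partial>lborel) \<partial>\<mu>)"
    unfolding ftc ..
  also have "\<dots> = (\<integral>\<tau>. of_real (indicator {s..t} \<tau>) * (\<integral>y. (- 2 * pi * \<i> * (y \<bullet> \<xi>)) * ee (- (\<tau> * (y \<bullet> \<xi>))) \<partial>\<mu>) \<partial>lborel)"
    by (rule Fubini_bounded_kernel[OF _ _ i1 i2, where B = 1])
      (auto simp: lborel.sigma_finite_measure_axioms sigma_finite_measure_axioms)
  finally show ?thesis
    by (simp add: dmuhat_def scaleR_conv_of_real)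
qed

end

section \<open>Dyadic shells in frequency\<close>

definition shell :: "nat \<Rightarrow> 'a::real_normed_vector set"
  where "shell j = (if j = 0 then {\<xi>. norm \<xi> < 1} else {\<xi>. 2 ^ (j - 1) \<le> norm \<xi> \<and> norm \<xi> < 2 ^ j})"

lemma shell_measurable [measurable]: "shell j \<in> sets (borel :: 'a::euclidean_space measure)"
  by (simp add: shell_def)

lemma shell_norm_less: "\<xi> \<in> shell j \<Longrightarrow> norm \<xi> < 2 ^ j"
  by (auto simp: shell_def split: if_splits)

lemma sum_indicator_shell: "(\<Sum>j\<le>n. indicator (shell j) \<xi>) = (indicator {\<xi>. norm \<xi> < 2 ^ n} \<xi> :: real)"
proof (induction n)
  case (Suc n)
  have "norm \<xi> < 2 ^ Suc n" if "norm \<xi> < 2 ^ n"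
    using that by (rule less_le_trans) simp
  then have "indicator {\<xi>. norm \<xi> < 2 ^ n} \<xi> + indicator (shell (Suc n)) \<xi> = (indicator {\<xi>. norm \<xi> < 2 ^ Suc n} \<xi> :: real)"
    by (auto simp: shell_def indicator_def)
  then show ?case
    using Suc by simp
qed (simp add: shell_def)

context decaying_measure
begin

text \<open>On a shell with j \<ge> 1 the frequency is comparable to 2^j and the decay estimates
  apply. Shell 0 is the whole unit ball, where the trivial bounds by the mass suffice.\<close>

lemma multiplier_bounds:
  obtains K where "0 \<le> K"
    "\<And>j t \<xi>. \<lbrakk>\<xi> \<in> shell j; 1 \<le> t\<rbrakk> \<Longrightarrow> norm (muhat (t *\<^sub>R \<xi>)) \<le> K * (2 ^ j) powr (- a)"
    "\<And>j t \<xi>. \<lbrakk>\<xi> \<in> shell j; 1 \<le> t\<rbrakk> \<Longrightarrow> norm (dmuhat t \<xi>) \<le> K * (2 ^ j) powr (1 - a)"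
proof -
  obtain K1 where K1: "0 \<le> K1"
    "\<And>t \<xi>. \<lbrakk>1 \<le> t; 1 \<le> norm \<xi>\<rbrakk> \<Longrightarrow> norm (dmuhat t \<xi>) \<le> K1 * norm \<xi> powr (1 - a)"
    using dmuhat_decay by blast
  define K where "K = mass + 2 * pi * R * mass + C * 2 powr a + K1 * 2 powr a"
  have Kge: "0 \<le> K" "mass \<le> K" "2 * pi * R * mass \<le> K" "C * 2 powr a \<le> K" "K1 * 2 powr a \<le> K"
    using K1 C R by (auto simp: K_def)
  show ?thesis
  proof
    show "0 \<le> K" by (rule Kge)
    fix j and t :: real and \<xi> :: 'a
    assume \<xi>: "\<xi> \<in> shell j" and t: "1 \<le> t"
    show "norm (muhat (t *\<^sub>R \<xi>)) \<le> K * (2 ^ j) powr (- a)"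
    proof (cases "j = 0")
      case True
      then show ?thesis
        using norm_muhat_le[of "t *\<^sub>R \<xi>"] Kge by simp
    next
      case False
      then have r: "2 ^ (j - 1) \<le> norm \<xi>"
        using \<xi> by (simp add: shell_def)
      have half: "(2::real) ^ (j - 1) = 2 ^ j / 2"
        using False by (cases j) auto
      have pos: "0 < norm \<xi>"
        using r by (rule less_le_trans[rotated]) simp
      have "2 ^ j / 2 \<le> t * norm \<xi>"
        using r half mult_mono[of 1 t "2 ^ j / 2" "norm \<xi>"] t by simp
      then have "(t * norm \<xi>) powr (- a) \<le> (2 ^ j / 2) powr (- a)"
        using a by (intro powr_mono2') auto
      also have "\<dots> = 2 powr a * (2 ^ j) powr (- a)"
        by (simp add: powr_divide powr_minus field_simps)
      finally have "C * (t * norm \<xi>) powr (- a) \<le> (C * 2 powr a) * (2 ^ j) powr (- a)"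
        using C by (simp add: mult_left_mono mult.assoc)
      also have "\<dots> \<le> K * (2 ^ j) powr (- a)"
        using Kge by (intro mult_right_mono) auto
      finally show ?thesis
        using decay[of "t *\<^sub>R \<xi>"] pos t by (simp add: muhat_eq)
    qed
    show "norm (dmuhat t \<xi>) \<le> K * (2 ^ j) powr (1 - a)"
    proof (cases "j = 0")
      case True
      then have "2 * pi * R * mass * norm \<xi> \<le> 2 * pi * R * mass * 1"
        using \<xi> R by (intro mult_left_mono) (auto simp: shell_def)
      then have "norm (dmuhat t \<xi>) \<le> K"
        using norm_dmuhat_le[of t \<xi>] Kge by linarith
      then show ?thesis
        using True by simp
    next
      case False
      then have r: "2 ^ (j - 1) \<le> norm \<xi>" "norm \<xi> < 2 ^ j"
        using \<xi> by (auto simp: shell_def)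
      have half: "(2::real) ^ (j - 1) = 2 ^ j / 2"
        using False by (cases j) auto
      have one: "1 \<le> norm \<xi>"
        using r(1) one_le_power[of "2::real" "j - 1"] by linarith
      \<comment> \<open>The sign of 1 - a decides whether the power is largest at the outer or at
        the inner radius of the shell.\<close>
      have "norm \<xi> powr (1 - a) \<le> 2 powr a * (2 ^ j) powr (1 - a)"
      proof (cases "a \<le> 1")
        case True
        then have "norm \<xi> powr (1 - a) \<le> (2 ^ j) powr (1 - a)"
          using r by (intro powr_mono2) auto
        also have "\<dots> \<le> 2 powr a * (2 ^ j) powr (1 - a)"
          using a by (intro mult_le_cancel_right1[THEN iffD2]) (auto simp: ge_one_powr_ge_zero)
        finally show ?thesis .
      next
        case False
        then have "norm \<xi> powr (1 - a) \<le> (2 ^ j / 2) powr (1 - a)"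
          using r half by (intro powr_mono2') auto
        also have "\<dots> = 2 powr (a - 1) * (2 ^ j) powr (1 - a)"
          by (simp add: powr_divide powr_diff field_simps)
        also have "\<dots> \<le> 2 powr a * (2 ^ j) powr (1 - a)"
          by (intro mult_right_mono powr_mono) auto
        finally show ?thesis .
      qed
      then have "K1 * norm \<xi> powr (1 - a) \<le> (K1 * 2 powr a) * (2 ^ j) powr (1 - a)"
        using K1 by (simp add: mult_left_mono mult.assoc)
      also have "\<dots> \<le> K * (2 ^ j) powr (1 - a)"
        using Kge by (intro mult_right_mono) auto
      finally show ?thesis
        using K1(2)[OF t one] by linarith
    qed
  qed
qed

text \<open>When \<open>h\<close> is the Fourier transform of a function, this is formally the
  average of that function over x - t y, written on the Fourier side.\<close>

definition multiplier_avg :: "('a \<Rightarrow> complex) \<Rightarrow> real \<Rightarrow> 'a \<Rightarrow> complex"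
  where "multiplier_avg h t x = (\<integral>\<xi>. h \<xi> * muhat (t *\<^sub>R \<xi>) * ee (x \<bullet> \<xi>) \<partial>lborel)"

definition dmultiplier_avg :: "('a \<Rightarrow> complex) \<Rightarrow> real \<Rightarrow> 'a \<Rightarrow> complex"
  where "dmultiplier_avg h t x = (\<integral>\<xi>. h \<xi> * dmuhat t \<xi> * ee (x \<bullet> \<xi>) \<partial>lborel)"

lemma borel_measurable_multiplier_avg [measurable (raw)]:
  assumes [measurable]: "h \<in> borel_measurable borel" "f \<in> borel_measurable M" "g \<in> borel_measurable M"
  shows "(\<lambda>z. multiplier_avg h (f z) (g z)) \<in> borel_measurable M"
    and "(\<lambda>z. dmultiplier_avg h (f z) (g z)) \<in> borel_measurable M"
  unfolding multiplier_avg_def dmultiplier_avg_def by measurable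

text \<open>For fixed \<open>t\<close> Plancherel bounds the averages and their
  \<open>t\<close>-derivatives by the sizes L^(-a) and L^(1-a) of their multipliers, where L = 2^j.
  In the Sobolev inequality at scale 1/L the two terms become L L^(-2a) and L^(-1) L^(2-2a), which
  agree. The supremum enters only through the measurable majorant \<open>S\<close>.\<close>

lemma dyadic_piece_bound:
  obtains K where "0 \<le> K"
    "\<And>j h. \<lbrakk>integrable lborel h; \<And>\<xi>. \<xi> \<notin> shell j \<Longrightarrow> h \<xi> = 0\<rbrakk> \<Longrightarrow>
      \<exists>S\<in>borel_measurable borel. (\<forall>x. \<forall>t\<in>{1..2}. ennreal ((norm (multiplier_avg h t x))\<^sup>2) \<le> S x) \<and>
        (\<integral>\<^sup>+x. S x \<partial>lborel) \<le> ennreal (K * (2 ^ j) powr (1 - 2 * a)) * (\<integral>\<^sup>+\<xi>. ennreal ((norm (h \<xi>))\<^sup>2) \<partial>lborel)"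
proof -
  obtain K where K: "0 \<le> K"
    "\<And>j t \<xi>. \<lbrakk>\<xi> \<in> shell j; 1 \<le> t\<rbrakk> \<Longrightarrow> norm (muhat (t *\<^sub>R \<xi>)) \<le> K * (2 ^ j) powr (- a)"
    "\<And>j t \<xi>. \<lbrakk>\<xi> \<in> shell j; 1 \<le> t\<rbrakk> \<Longrightarrow> norm (dmuhat t \<xi>) \<le> K * (2 ^ j) powr (1 - a)"
    using multiplier_bounds by blast
  show ?thesis
  proof
    show "0 \<le> 4 * K\<^sup>2" by simp
    fix j and h :: "'a \<Rightarrow> complex"
    assume h: "integrable lborel h" and supp: "\<And>\<xi>. \<xi> \<notin> shell j \<Longrightarrow> h \<xi> = 0"
    have [measurable]: "h \<in> borel_measurable borel"
      using h by (simp add: borel_measurable_integrable)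
    define H where "H = (\<integral>\<^sup>+\<xi>. ennreal ((norm (h \<xi>))\<^sup>2) \<partial>lborel)"
    define L where "L = (2::real) ^ j"
    have L: "1 \<le> L" by (simp add: L_def)
    define F where "F t x = multiplier_avg h t x" for t x
    define F' where "F' t x = dmultiplier_avg h t x" for t x
    note F_defs = F_def F'_def
    have F_meas [measurable]: "(\<lambda>p. F (fst p) (snd p)) \<in> borel_measurable (borel \<Otimes>\<^sub>M borel)"
        "(\<lambda>p. F' (fst p) (snd p)) \<in> borel_measurable (borel \<Otimes>\<^sub>M borel)"
        "(\<lambda>t. F t x) \<in> borel_measurable borel" "(\<lambda>t. F' t x) \<in> borel_measurable borel" for x
      unfolding F_defs by measurable
    define S where "S x = ennreal (2 * L) * (\<integral>\<^sup>+\<tau>\<in>{1..2}. ennreal ((norm (F \<tau> x))\<^sup>2) \<partial>lborel) +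
      ennreal (2 / L) * (\<integral>\<^sup>+\<tau>\<in>{1..2}. ennreal ((norm (F' \<tau> x))\<^sup>2) \<partial>lborel)" for x
    have S_meas: "S \<in> borel_measurable borel"
      unfolding S_def[abs_def] F_defs by measurable
    have ih: "integrable lborel (\<lambda>\<xi>. h \<xi> * muhat (t *\<^sub>R \<xi>) * ee (x \<bullet> \<xi>))" for t x
    proof (rule Bochner_Integration.integrable_bound)
      show "integrable lborel (\<lambda>\<xi>. mass *\<^sub>R h \<xi>)" using h by simp
      have "norm (h \<xi>) * norm (muhat (t *\<^sub>R \<xi>)) \<le> mass * norm (h \<xi>)" for \<xi>
        using mult_left_mono[OF norm_muhat_le[of "t *\<^sub>R \<xi>"], of "norm (h \<xi>)"] by (simp add: mult.commute)
      then show "AE \<xi> in lborel. norm (h \<xi> * muhat (t *\<^sub>R \<xi>) * ee (x \<bullet> \<xi>)) \<le> norm (mass *\<^sub>R h \<xi>)"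
        by (simp add: norm_mult)
    qed measurable
    have ftc: "F t x - F s x = (\<integral>\<tau>. indicator {s..t} \<tau> *\<^sub>R F' \<tau> x \<partial>lborel)" if "s \<le> t" for s t x
    proof -
      \<comment> \<open>The derivative of the transform is unbounded in \<xi>; cutting it off to the
        shell, outside which \<open>h\<close> vanishes, yields the bounded kernel needed for the
        exchange.\<close>
      define k where "k \<xi> \<tau> = dmuhat \<tau> \<xi> * of_real (indicator (shell j) \<xi>)" for \<xi> :: 'a and \<tau>
      have i1: "integrable lborel (\<lambda>\<xi>. h \<xi> * ee (x \<bullet> \<xi>))"
        by (rule Bochner_Integration.integrable_bound[OF h]) (auto simp: norm_mult)
      have i2: "integrable lborel (\<lambda>\<tau>. complex_of_real (indicator {s..t} \<tau>))"
        by (intro integrable_of_real integrable_real_indicator) (auto simp: emeasure_lborel_Icc_eq)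
      have "F t x - F s x = (\<integral>\<xi>. h \<xi> * muhat (t *\<^sub>R \<xi>) * ee (x \<bullet> \<xi>) - h \<xi> * muhat (s *\<^sub>R \<xi>) * ee (x \<bullet> \<xi>) \<partial>lborel)"
        unfolding F_def multiplier_avg_def by (rule Bochner_Integration.integral_diff[symmetric]) (rule ih)+
      also have "\<dots> = (\<integral>\<xi>. h \<xi> * ee (x \<bullet> \<xi>) * (\<integral>\<tau>. of_real (indicator {s..t} \<tau>) * k \<xi> \<tau> \<partial>lborel) \<partial>lborel)"
      proof (intro Bochner_Integration.integral_cong refl)
        fix \<xi> :: 'a
        show "h \<xi> * muhat (t *\<^sub>R \<xi>) * ee (x \<bullet> \<xi>) - h \<xi> * muhat (s *\<^sub>R \<xi>) * ee (x \<bullet> \<xi>) =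
          h \<xi> * ee (x \<bullet> \<xi>) * (\<integral>\<tau>. of_real (indicator {s..t} \<tau>) * k \<xi> \<tau> \<partial>lborel)"
        proof (cases "\<xi> \<in> shell j")
          case True
          then show ?thesis
            using muhat_diff[OF that, of \<xi>] by (simp add: k_def scaleR_conv_of_real algebra_simps)
        qed (simp add: supp)
      qed
      also have "\<dots> = (\<integral>\<tau>. of_real (indicator {s..t} \<tau>) * (\<integral>\<xi>. h \<xi> * ee (x \<bullet> \<xi>) * k \<xi> \<tau> \<partial>lborel) \<partial>lborel)"
      proof (rule Fubini_bounded_kernel[OF _ _ i1 i2])
        show "norm (k \<xi> \<tau>) \<le> 2 * pi * R * mass * 2 ^ j" for \<xi> \<tau>
        proof (cases "\<xi> \<in> shell j")
          case True
          have "2 * pi * R * mass * norm \<xi> \<le> 2 * pi * R * mass * 2 ^ j"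
            using shell_norm_less[OF True] R by (intro mult_left_mono) auto
          then show ?thesis
            using order_trans[OF norm_dmuhat_le[of \<tau> \<xi>]] True by (simp add: k_def)
        qed (use R in \<open>simp add: k_def\<close>)
        show "case_prod k \<in> borel_measurable (lborel \<Otimes>\<^sub>M lborel)"
          unfolding k_def by measurable
      qed (auto simp: lborel.sigma_finite_measure_axioms)
      also have "\<dots> = (\<integral>\<tau>. indicator {s..t} \<tau> *\<^sub>R F' \<tau> x \<partial>lborel)"
      proof (intro Bochner_Integration.integral_cong refl)
        fix \<tau> :: real
        have "(\<integral>\<xi>. h \<xi> * ee (x \<bullet> \<xi>) * k \<xi> \<tau> \<partial>lborel) = F' \<tau> x"
          unfolding F'_def dmultiplier_avg_def k_def using supp
          by (intro Bochner_Integration.integral_cong) (auto simp: indicator_def)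
        then show "of_real (indicator {s..t} \<tau>) * (\<integral>\<xi>. h \<xi> * ee (x \<bullet> \<xi>) * k \<xi> \<tau> \<partial>lborel) = indicator {s..t} \<tau> *\<^sub>R F' \<tau> x"
          by (simp add: scaleR_conv_of_real)
      qed
      finally show ?thesis .
    qed
    have le_S: "ennreal ((norm (F t x))\<^sup>2) \<le> S x" if "t \<in> {1..2}" for t x
      unfolding S_def using that by (intro sup_square_le_integral L ftc) auto
    have FL2: "(\<integral>\<^sup>+x. ennreal ((norm (\<integral>\<xi>. h \<xi> * m \<xi> * ee (x \<bullet> \<xi>) \<partial>lborel))\<^sup>2) \<partial>lborel) \<le> ennreal (D\<^sup>2) * H"
      if [measurable]: "m \<in> borel_measurable borel" and m: "\<And>\<xi>. \<xi> \<in> shell j \<Longrightarrow> norm (m \<xi>) \<le> D" and D: "0 \<le> D" for m D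
    proof -
      have le: "norm (h \<xi> * m \<xi>) \<le> D * norm (h \<xi>)" for \<xi>
      proof (cases "\<xi> \<in> shell j")
        case True
        then show ?thesis
          using mult_left_mono[OF m[OF True], of "norm (h \<xi>)"] by (simp add: norm_mult mult.commute)
      qed (simp add: supp)
      have "integrable lborel (\<lambda>\<xi>. h \<xi> * m \<xi>)"
      proof (rule Bochner_Integration.integrable_bound)
        show "integrable lborel (\<lambda>\<xi>. D *\<^sub>R h \<xi>)" using h by simp
      qed (use le D in auto)
      then have "(\<integral>\<^sup>+x. ennreal ((norm (\<integral>\<xi>. h \<xi> * m \<xi> * ee (x \<bullet> \<xi>) \<partial>lborel))\<^sup>2) \<partial>lborel)
          \<le> (\<integral>\<^sup>+\<xi>. ennreal ((norm (h \<xi> * m \<xi>))\<^sup>2) \<partial>lborel)"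
        by (rule Plancherel_inverse_le)
      also have "\<dots> \<le> (\<integral>\<^sup>+\<xi>. ennreal (D\<^sup>2) * ennreal ((norm (h \<xi>))\<^sup>2) \<partial>lborel)"
        using le by (intro nn_integral_mono)
          (auto simp flip: ennreal_mult power_mult_distrib intro!: ennreal_leI power_mono)
      finally show ?thesis
        by (simp add: nn_integral_cmult H_def)
    qed
    have swap: "(\<integral>\<^sup>+x. (\<integral>\<^sup>+\<tau>\<in>{1..2}. ennreal ((norm (G \<tau> x))\<^sup>2) \<partial>lborel) \<partial>lborel) \<le> ennreal (D\<^sup>2) * H"
      if [measurable]: "(\<lambda>p. G (fst p) (snd p)) \<in> borel_measurable (borel \<Otimes>\<^sub>M borel)"
        and G: "\<And>\<tau>. \<tau> \<in> {1..2} \<Longrightarrow> (\<integral>\<^sup>+x. ennreal ((norm (G \<tau> x))\<^sup>2) \<partial>lborel) \<le> ennreal (D\<^sup>2) * H"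
      for G :: "real \<Rightarrow> 'a \<Rightarrow> complex" and D
    proof -
      have "(\<integral>\<^sup>+x. (\<integral>\<^sup>+\<tau>\<in>{1..2}. ennreal ((norm (G \<tau> x))\<^sup>2) \<partial>lborel) \<partial>lborel) =
          (\<integral>\<^sup>+\<tau>. \<integral>\<^sup>+x. ennreal ((norm (G \<tau> x))\<^sup>2) * indicator {1..2} \<tau> \<partial>lborel \<partial>lborel)"
        by (rule lborel_pair.Fubini'[where f = "\<lambda>\<tau> x. ennreal ((norm (G \<tau> x))\<^sup>2) * indicator {1..2} \<tau>"])
          (auto simp: split_beta')
      also have "\<dots> \<le> (\<integral>\<^sup>+\<tau>. (ennreal (D\<^sup>2) * H) * indicator {1..2::real} \<tau> \<partial>lborel)"
        using G by (intro nn_integral_mono) (auto split: split_indicator)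
      also have "\<dots> = ennreal (D\<^sup>2) * H"
        by (subst nn_integral_cmult_indicator) auto
      finally show ?thesis .
    qed
    \<comment> \<open>The sup norms of the two multipliers on the shell.\<close>
    define D1 where "D1 = K * L powr (- a)"
    define D2 where "D2 = K * L powr (1 - a)"
    have "(\<integral>\<^sup>+x. S x \<partial>lborel) = ennreal (2 * L) * (\<integral>\<^sup>+x. (\<integral>\<^sup>+\<tau>\<in>{1..2}. ennreal ((norm (F \<tau> x))\<^sup>2) \<partial>lborel) \<partial>lborel) +
      ennreal (2 / L) * (\<integral>\<^sup>+x. (\<integral>\<^sup>+\<tau>\<in>{1..2}. ennreal ((norm (F' \<tau> x))\<^sup>2) \<partial>lborel) \<partial>lborel)"
      unfolding S_def by (subst nn_integral_add; (subst nn_integral_cmult)?; (subst nn_integral_cmult)?; unfold F_defs; measurable)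
    also have "\<dots> \<le> ennreal (2 * L) * (ennreal (D1\<^sup>2) * H) + ennreal (2 / L) * (ennreal (D2\<^sup>2) * H)"
    proof (intro add_mono mult_left_mono swap)
      show "(\<integral>\<^sup>+x. ennreal ((norm (F \<tau> x))\<^sup>2) \<partial>lborel) \<le> ennreal (D1\<^sup>2) * H" if "\<tau> \<in> {1..2}" for \<tau>
        unfolding F_def multiplier_avg_def using that K
        by (intro FL2) (auto simp: D1_def L_def)
      show "(\<integral>\<^sup>+x. ennreal ((norm (F' \<tau> x))\<^sup>2) \<partial>lborel) \<le> ennreal (D2\<^sup>2) * H" if "\<tau> \<in> {1..2}" for \<tau>
        unfolding F'_def dmultiplier_avg_def using that K
        by (intro FL2) (auto simp: D2_def L_def)
    qed auto
    also have "\<dots> = ennreal (2 * L * D1\<^sup>2 + 2 / L * D2\<^sup>2) * H"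
    proof -
      have "ennreal (2 * L * D1\<^sup>2 + 2 / L * D2\<^sup>2) = ennreal (2 * L * D1\<^sup>2) + ennreal (2 / L * D2\<^sup>2)"
        by (rule ennreal_plus) (use L in auto)
      also have "ennreal (2 * L * D1\<^sup>2) = ennreal (2 * L) * ennreal (D1\<^sup>2)"
        by (rule ennreal_mult) (use L in auto)
      also have "ennreal (2 / L * D2\<^sup>2) = ennreal (2 / L) * ennreal (D2\<^sup>2)"
        by (rule ennreal_mult) (use L in auto)
      finally show ?thesis
        by (simp only: distrib_right mult.assoc)
    qed
    also have "2 * L * D1\<^sup>2 + 2 / L * D2\<^sup>2 = 4 * K\<^sup>2 * L powr (1 - 2 * a)"
    proof -
      have "L * D1\<^sup>2 = K\<^sup>2 * L powr (1 - 2 * a)"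
        using L by (simp add: D1_def power_mult_distrib power2_eq_square powr_diff powr_minus field_simps flip: powr_add)
      moreover have "D2\<^sup>2 / L = K\<^sup>2 * L powr (1 - 2 * a)"
        using L by (simp add: D2_def power_mult_distrib power2_eq_square powr_diff powr_minus field_simps flip: powr_add)
      ultimately show ?thesis by simp
    qed
    finally have "(\<integral>\<^sup>+x. S x \<partial>lborel) \<le> ennreal (4 * K\<^sup>2 * (2 ^ j) powr (1 - 2 * a)) * H"
      by (simp add: L_def)
    then show "\<exists>S\<in>borel_measurable borel. (\<forall>x. \<forall>t\<in>{1..2}. ennreal ((norm (multiplier_avg h t x))\<^sup>2) \<le> S x) \<and>
        (\<integral>\<^sup>+x. S x \<partial>lborel) \<le> ennreal (4 * K\<^sup>2 * (2 ^ j) powr (1 - 2 * a)) * (\<integral>\<^sup>+\<xi>. ennreal ((norm (h \<xi>))\<^sup>2) \<partial>lborel)"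
      using S_meas le_S unfolding H_def F_def by blast
  qed
qed

end

section \<open>Summation over the shells\<close>

lemma Cauchy_Schwarz_suminf:
  fixes r :: "nat \<Rightarrow> ennreal" and w :: "nat \<Rightarrow> real"
  assumes w: "\<And>j. 0 < w j"
  shows "(\<Sum>j. r j)\<^sup>2 \<le> (\<Sum>j. ennreal (w j)) * (\<Sum>j. ennreal (1 / w j) * (r j)\<^sup>2)"
proof -
  have e: "ennreal (sqrt (w j)) * (ennreal (1 / sqrt (w j)) * r j) = r j" for j
    using w[of j] by (simp add: mult.assoc[symmetric] flip: ennreal_mult)
  have e1: "(ennreal (sqrt (w j)))\<^sup>2 = ennreal (w j)" for j
    using w[of j] by (simp add: ennreal_power)
  have e2: "(ennreal (1 / sqrt (w j)) * r j)\<^sup>2 = ennreal (1 / w j) * (r j)\<^sup>2" for j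
    using w[of j] by (simp add: power_mult_distrib ennreal_power power_divide)
  have "(\<integral>\<^sup>+j. ennreal (sqrt (w j)) * (ennreal (1 / sqrt (w j)) * r j) \<partial>count_space UNIV)\<^sup>2
    \<le> (\<integral>\<^sup>+j. (ennreal (sqrt (w j)))\<^sup>2 \<partial>count_space UNIV) * (\<integral>\<^sup>+j. (ennreal (1 / sqrt (w j)) * r j)\<^sup>2 \<partial>count_space UNIV)"
    by (rule Cauchy_Schwarz_nn_integral) auto
  then show ?thesis
    unfolding e e1 e2 by (simp add: nn_integral_count_space_nat)
qed

text \<open>The terms decay geometrically in both directions from the first index \<open>j0\<close>
  with \<epsilon> 2^j0 \<ge> 1, so the sum does not depend on \<epsilon> up to a constant.\<close>

lemma dyadic_two_sided_sum:
  assumes "0 < \<alpha>"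
  obtains K where "0 \<le> K"
    "\<And>\<epsilon>. \<lbrakk>0 < \<epsilon>; \<epsilon> \<le> 1\<rbrakk> \<Longrightarrow> (\<Sum>j. ennreal (min ((\<epsilon> * 2 ^ j) powr \<alpha>) ((\<epsilon> * 2 ^ j) powr (- \<alpha>)))) \<le> ennreal K"
proof -
  define q where "q = (2::real) powr (- \<alpha>)"
  have q: "0 < q" "q < 1"
    using assms by (auto simp: q_def powr_less_one)
  show ?thesis
  proof
    show "0 \<le> 1 / (1 - q) + 1 / (1 - q)"
      using q by simp
    fix \<epsilon> :: real assume \<epsilon>: "0 < \<epsilon>" "\<epsilon> \<le> 1"
    have "\<exists>j. 1 \<le> \<epsilon> * 2 ^ j"
    proof -
      obtain j where "1 / \<epsilon> < 2 ^ j"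
        using real_arch_pow[of 2 "1 / \<epsilon>"] by auto
      then show ?thesis
        using \<epsilon> by (auto simp: field_simps intro!: exI[of _ j])
    qed
    then obtain j0 where j0: "1 \<le> \<epsilon> * 2 ^ j0" "\<And>j. j < j0 \<Longrightarrow> \<epsilon> * 2 ^ j < 1"
      using exists_least_iff[of "\<lambda>j. 1 \<le> \<epsilon> * 2 ^ j"] by (auto simp: not_le)
    define g where "g j = (if j < j0 then q ^ (j0 - 1 - j) else q ^ (j - j0))" for j
    have le: "min ((\<epsilon> * 2 ^ j) powr \<alpha>) ((\<epsilon> * 2 ^ j) powr (- \<alpha>)) \<le> g j" for j
    proof (cases "j < j0")
      case True
      define i where "i = j0 - 1 - j"
      have "\<epsilon> * 2 ^ (j0 - 1) < 1"
        using True by (intro j0) auto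
      also have "(2::real) ^ (j0 - 1) = 2 ^ j * 2 ^ i"
        using True by (simp add: i_def flip: power_add)
      finally have "\<epsilon> * 2 ^ j \<le> 1 / 2 ^ i"
        by (simp add: field_simps)
      then have "(\<epsilon> * 2 ^ j) powr \<alpha> \<le> (1 / 2 ^ i) powr \<alpha>"
        using \<epsilon> assms by (intro powr_mono2) auto
      also have "\<dots> = q ^ i"
        by (simp add: q_def powr_divide powr_minus powr_realpow[symmetric] powr_powr powr_power field_simps)
      finally show ?thesis
        using True by (simp add: g_def i_def min_def)
    next
      case False
      define i where "i = j - j0"
      have "(2::real) ^ j = 2 ^ j0 * 2 ^ i"
        using False by (simp add: i_def flip: power_add)
      then have "2 ^ i \<le> \<epsilon> * 2 ^ j"
        using mult_right_mono[OF j0(1), of "2 ^ i"] by (simp add: mult.assoc)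
      then have "(\<epsilon> * 2 ^ j) powr (- \<alpha>) \<le> (2 ^ i) powr (- \<alpha>)"
        using assms by (intro powr_mono2') auto
      also have "\<dots> = q ^ i"
        by (simp add: q_def powr_realpow[symmetric] powr_powr powr_power mult.commute)
      finally show ?thesis
        using False by (simp add: g_def i_def min_def)
    qed
    have "(\<lambda>i. q ^ i) sums (1 / (1 - q))"
      using q by (intro geometric_sums) auto
    then have "(\<lambda>i. g (i + j0)) sums (1 / (1 - q))"
      by (simp add: g_def)
    then have g: "g sums (1 / (1 - q) + (\<Sum>j<j0. g j))"
      by (simp add: sums_iff_shift)
    have "(\<Sum>j<j0. g j) = (\<Sum>j<j0. q ^ (j0 - Suc j))"
      by (intro sum.cong) (auto simp: g_def)
    also have "\<dots> = (\<Sum>j<j0. q ^ j)"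
      by (rule sum.nat_diff_reindex)
    also have "\<dots> \<le> (\<Sum>j. q ^ j)"
      using q by (intro sum_le_suminf summable_geometric) auto
    also have "\<dots> = 1 / (1 - q)"
      using q by (intro suminf_geometric) auto
    finally have gle: "suminf g \<le> 1 / (1 - q) + 1 / (1 - q)"
      using sums_unique[OF g] by simp
    have g0: "0 \<le> g j" for j
      using q by (simp add: g_def)
    have "(\<Sum>j. ennreal (min ((\<epsilon> * 2 ^ j) powr \<alpha>) ((\<epsilon> * 2 ^ j) powr (- \<alpha>)))) \<le> (\<Sum>j. ennreal (g j))"
      using le by (intro suminf_le ennreal_leI) auto
    also have "\<dots> = ennreal (suminf g)"
      using g0 sums_summable[OF g] by (intro suminf_ennreal2) auto
    also have "\<dots> \<le> ennreal (1 / (1 - q) + 1 / (1 - q))"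
      by (rule ennreal_leI) (rule gle)
    finally show "(\<Sum>j. ennreal (min ((\<epsilon> * 2 ^ j) powr \<alpha>) ((\<epsilon> * 2 ^ j) powr (- \<alpha>)))) \<le> ennreal (1 / (1 - q) + 1 / (1 - q))" .
  qed
qed

context decaying_measure
begin

definition ord :: nat
  where "ord = nat \<lceil>a\<rceil>"

text \<open>The order of vanishing \<open>2 ord\<close> at \<open>\<xi> = 0\<close> exceeds \<open>a - 1/2\<close>, which makes the dyadic sum converge for
  \<open>|\<xi>| < 1 / \<epsilon>\<close>. The factor with \<open>\<delta>\<close> only secures integrability.\<close>

definition high_symbol :: "real \<Rightarrow> real \<Rightarrow> ('a \<Rightarrow> complex) \<Rightarrow> 'a \<Rightarrow> complex"
  where "high_symbol \<delta> \<epsilon> f \<xi> = ft f \<xi> *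
    of_real (exp (- (pi * \<delta> * (norm \<xi>)\<^sup>2)) * (1 - exp (- (pi * \<epsilon>\<^sup>2 * (norm \<xi>)\<^sup>2))) ^ ord)"

text \<open>The square root of the dyadic constant 2^(j(1-2a)) times the size of the high frequency
  factor on the shell: the natural bound for the norm of the \<open>j\<close>-th piece, used as
  weight in Cauchy-Schwarz.\<close>

definition weight :: "real \<Rightarrow> nat \<Rightarrow> real"
  where "weight \<epsilon> j = (2 ^ j) powr (1 / 2 - a) * min 1 ((pi * (\<epsilon> * 2 ^ j)\<^sup>2) ^ ord)"

lemma weight_pos: "0 < \<epsilon> \<Longrightarrow> 0 < weight \<epsilon> j"
  by (simp add: weight_def)

text \<open>With \<alpha> = a - 1/2 and x = \<epsilon> 2^j, the factor \<epsilon>^\<alpha> can be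
  taken out of each weight. What remains is bounded by the smaller of x^\<alpha> and x^(-\<alpha>),
  up to a power of \<pi>.\<close>

lemma weight_sum:
  obtains K where "0 \<le> K"
    "\<And>\<epsilon>. \<lbrakk>0 < \<epsilon>; \<epsilon> \<le> 1\<rbrakk> \<Longrightarrow> (\<Sum>j. ennreal (weight \<epsilon> j)) \<le> ennreal (K * \<epsilon> powr (a - 1 / 2))"
proof -
  define \<alpha> where "\<alpha> = a - 1 / 2"
  have \<alpha>: "0 < \<alpha>" using a by (simp add: \<alpha>_def)
  obtain K where K: "0 \<le> K"
    "\<And>\<epsilon>. \<lbrakk>0 < \<epsilon>; \<epsilon> \<le> 1\<rbrakk> \<Longrightarrow> (\<Sum>j. ennreal (min ((\<epsilon> * 2 ^ j) powr \<alpha>) ((\<epsilon> * 2 ^ j) powr (- \<alpha>)))) \<le> ennreal K"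
    using dyadic_two_sided_sum[OF \<alpha>] by blast
  show ?thesis
  proof
    show "0 \<le> pi ^ ord * K"
      using K by simp
    fix \<epsilon> :: real assume \<epsilon>: "0 < \<epsilon>" "\<epsilon> \<le> 1"
    have le: "weight \<epsilon> j \<le> (pi ^ ord * \<epsilon> powr \<alpha>) * min ((\<epsilon> * 2 ^ j) powr \<alpha>) ((\<epsilon> * 2 ^ j) powr (- \<alpha>))" for j
    proof -
      define x where "x = \<epsilon> * 2 ^ j"
      have x: "0 < x" using \<epsilon> by (simp add: x_def)
      have pi1: "1 \<le> pi ^ ord"
        using pi_ge_two by (intro one_le_power) linarith
      have "min 1 ((pi * x\<^sup>2) ^ ord) \<le> pi ^ ord * min 1 (x powr (2 * \<alpha>))"
      proof (cases "x \<le> 1")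
        case True
        \<comment> \<open>The order of vanishing at the origin enters here: for x \<le> 1 the power
          x^(2 ord) may be replaced by the larger x^(2 \<alpha>).\<close>
        have "2 * \<alpha> \<le> real (2 * ord)"
          using a by (simp add: \<alpha>_def ord_def) linarith
        then have "x powr real (2 * ord) \<le> x powr (2 * \<alpha>)"
          using x True by (intro powr_mono') auto
        moreover have "(x\<^sup>2) ^ ord = x powr real (2 * ord)"
          using powr_realpow[OF x, of "2 * ord"] by (simp add: power_mult)
        ultimately have "(pi * x\<^sup>2) ^ ord \<le> pi ^ ord * x powr (2 * \<alpha>)"
          by (simp add: power_mult_distrib)
        then show ?thesis
          using pi1 by (auto simp: min_def mult_left_mono)
      next
        case False
        then have "1 \<le> x powr (2 * \<alpha>)"
          using \<alpha> by (intro ge_one_powr_ge_zero) auto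
        then show ?thesis
          using pi1 by (simp add: min_def)
      qed
      then have "x powr (- \<alpha>) * min 1 ((pi * x\<^sup>2) ^ ord) \<le> x powr (- \<alpha>) * (pi ^ ord * min 1 (x powr (2 * \<alpha>)))"
        by (rule mult_left_mono) simp
      also have "\<dots> = pi ^ ord * (x powr (- \<alpha>) * min 1 (x powr (2 * \<alpha>)))"
        by simp
      also have "x powr (- \<alpha>) * min 1 (x powr (2 * \<alpha>)) = min (x powr \<alpha>) (x powr (- \<alpha>))"
      proof -
        have "x powr (- \<alpha>) * x powr (2 * \<alpha>) = x powr \<alpha>"
          using x by (simp flip: powr_add)
        then show ?thesis
          by (simp add: min_mult_distrib_left min.commute)
      qed
      finally have "\<epsilon> powr \<alpha> * (x powr (- \<alpha>) * min 1 ((pi * x\<^sup>2) ^ ord)) \<le> \<epsilon> powr \<alpha> * (pi ^ ord * min (x powr \<alpha>) (x powr (- \<alpha>)))"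
        by (rule mult_left_mono) simp
      moreover have "\<epsilon> powr \<alpha> * x powr (- \<alpha>) = (2 ^ j) powr (1 / 2 - a)"
      proof -
        have "x powr (- \<alpha>) = \<epsilon> powr (- \<alpha>) * (2 ^ j) powr (- \<alpha>)"
          using \<epsilon> by (simp add: x_def powr_mult)
        moreover have "\<epsilon> powr \<alpha> * \<epsilon> powr (- \<alpha>) = 1"
          using \<epsilon> by (simp flip: powr_add)
        moreover have "- \<alpha> = 1 / 2 - a"
          by (simp add: \<alpha>_def)
        ultimately show ?thesis
          by (metis mult.assoc mult_1)
      qed
      ultimately have "(2 ^ j) powr (1 / 2 - a) * min 1 ((pi * x\<^sup>2) ^ ord) \<le> \<epsilon> powr \<alpha> * (pi ^ ord * min (x powr \<alpha>) (x powr (- \<alpha>)))"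
        by (metis mult.assoc)
      then show ?thesis
        by (simp only: weight_def x_def mult_ac)
    qed
    have "(\<Sum>j. ennreal (weight \<epsilon> j)) \<le>
        (\<Sum>j. ennreal (pi ^ ord * \<epsilon> powr \<alpha>) * ennreal (min ((\<epsilon> * 2 ^ j) powr \<alpha>) ((\<epsilon> * 2 ^ j) powr (- \<alpha>))))"
      using le by (intro suminf_le) (auto simp flip: ennreal_mult intro!: ennreal_leI)
    also have "\<dots> = ennreal (pi ^ ord * \<epsilon> powr \<alpha>) * (\<Sum>j. ennreal (min ((\<epsilon> * 2 ^ j) powr \<alpha>) ((\<epsilon> * 2 ^ j) powr (- \<alpha>))))"
      by simp
    also have "\<dots> \<le> ennreal (pi ^ ord * \<epsilon> powr \<alpha>) * ennreal K"
      by (intro mult_left_mono K \<epsilon>) auto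
    also have "\<dots> = ennreal (pi ^ ord * K * \<epsilon> powr (a - 1 / 2))"
      using K by (simp add: \<alpha>_def mult_ac flip: ennreal_mult)
    finally show "(\<Sum>j. ennreal (weight \<epsilon> j)) \<le> ennreal (pi ^ ord * K * \<epsilon> powr (a - 1 / 2))" .
  qed
qed

text \<open>The elementary bound 1 - exp (- x) \<le> min 1 x, raised to the power
  \<open>ord\<close>.\<close>

lemma high_symbol_bound:
  assumes "0 < \<delta>" "\<xi> \<in> shell j"
  shows "norm (high_symbol \<delta> \<epsilon> f \<xi>) \<le> min 1 ((pi * (\<epsilon> * 2 ^ j)\<^sup>2) ^ ord) * norm (ft f \<xi>)"
proof -
  define x where "x = pi * \<epsilon>\<^sup>2 * (norm \<xi>)\<^sup>2"
  have x: "0 \<le> x" by (simp add: x_def)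
  have "(norm \<xi>)\<^sup>2 \<le> (2 ^ j)\<^sup>2"
    using shell_norm_less[OF assms(2)] by (intro power_mono) auto
  then have "x \<le> pi * (\<epsilon> * 2 ^ j)\<^sup>2"
    unfolding x_def power_mult_distrib by (simp add: mult_left_mono)
  moreover have "1 - exp (- x) \<le> x"
    using exp_ge_add_one_self[of "- x"] by simp
  ultimately have "(1 - exp (- x)) ^ ord \<le> (pi * (\<epsilon> * 2 ^ j)\<^sup>2) ^ ord"
    using x by (intro power_mono) auto
  moreover have "(1 - exp (- x)) ^ ord \<le> 1"
    using x by (intro power_le_one) auto
  ultimately have m: "(1 - exp (- x)) ^ ord \<le> min 1 ((pi * (\<epsilon> * 2 ^ j)\<^sup>2) ^ ord)"
    by simp
  have "exp (- (pi * \<delta> * (norm \<xi>)\<^sup>2)) * (1 - exp (- x)) ^ ord \<le> 1 * min 1 ((pi * (\<epsilon> * 2 ^ j)\<^sup>2) ^ ord)"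
    using assms x by (intro mult_mono m) auto
  moreover have "0 \<le> exp (- (pi * \<delta> * (norm \<xi>)\<^sup>2)) * (1 - exp (- x)) ^ ord"
    using x by simp
  ultimately have "norm (complex_of_real (exp (- (pi * \<delta> * (norm \<xi>)\<^sup>2)) * (1 - exp (- x)) ^ ord)) \<le> min 1 ((pi * (\<epsilon> * 2 ^ j)\<^sup>2) ^ ord)"
    unfolding norm_of_real by simp
  then show ?thesis
    unfolding high_symbol_def norm_mult x_def[symmetric]
    by (subst mult.commute) (intro mult_right_mono, auto)
qed

lemma borel_measurable_high_symbol [measurable]:
  assumes [measurable]: "f \<in> borel_measurable borel"
  shows "high_symbol \<delta> \<epsilon> f \<in> borel_measurable borel"
  unfolding high_symbol_def[abs_def] by measurable

lemma integrable_high_symbol: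
  assumes f: "integrable lborel f" and "0 < \<delta>"
  shows "integrable lborel (high_symbol \<delta> \<epsilon> f)"
proof (rule Bochner_Integration.integrable_bound)
  have [measurable]: "f \<in> borel_measurable borel"
    using f by (simp add: borel_measurable_integrable)
  show "integrable lborel (\<lambda>\<xi>. ft f \<xi> * exp (- (pi * \<delta> * (norm \<xi>)\<^sup>2)))"
    by (rule integrable_ft_gauss) fact+
  show "high_symbol \<delta> \<epsilon> f \<in> borel_measurable lborel"
    by measurable
  have "\<bar>(1 - exp (- (pi * \<epsilon>\<^sup>2 * (norm \<xi>)\<^sup>2))) ^ ord\<bar> \<le> 1" for \<xi> :: 'a
    unfolding power_abs by (intro power_le_one) auto
  then have "norm (ft f \<xi>) * exp (- (pi * \<delta> * (norm \<xi>)\<^sup>2)) * \<bar>(1 - exp (- (pi * \<epsilon>\<^sup>2 * (norm \<xi>)\<^sup>2))) ^ ord\<bar> \<le>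
      norm (ft f \<xi>) * exp (- (pi * \<delta> * (norm \<xi>)\<^sup>2)) * 1" for \<xi>
    by (intro mult_left_mono) auto
  then show "AE \<xi> in lborel. norm (high_symbol \<delta> \<epsilon> f \<xi>) \<le> norm (ft f \<xi> * exp (- (pi * \<delta> * (norm \<xi>)\<^sup>2)))"
    by (intro always_eventually allI) (simp only: high_symbol_def norm_mult norm_of_real abs_mult abs_exp_cancel mult.assoc mult_1_right)
qed

text \<open>The first shells fill balls of radius 2^n, on which dominated convergence recovers the
  full integral. The decomposition is thus subadditive at each point, for each
  \<open>t\<close>.\<close>

lemma multiplier_avg_le_pieces:
  assumes h: "integrable lborel h"
  shows "ennreal (norm (multiplier_avg h t x)) \<le> (\<Sum>j. ennreal (norm (multiplier_avg (\<lambda>\<xi>. indicator (shell j) \<xi> *\<^sub>R h \<xi>) t x)))"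
proof -
  have [measurable]: "h \<in> borel_measurable borel"
    using h by (simp add: borel_measurable_integrable)
  define g where "g \<xi> = h \<xi> * muhat (t *\<^sub>R \<xi>) * ee (x \<bullet> \<xi>)" for \<xi>
  have g: "integrable lborel g"
  proof (rule Bochner_Integration.integrable_bound)
    show "integrable lborel (\<lambda>\<xi>. mass *\<^sub>R h \<xi>)" using h by simp
    have "norm (h \<xi>) * norm (muhat (t *\<^sub>R \<xi>)) \<le> mass * norm (h \<xi>)" for \<xi>
      using mult_left_mono[OF norm_muhat_le[of "t *\<^sub>R \<xi>"], of "norm (h \<xi>)"] by (simp add: mult.commute)
    then show "AE \<xi> in lborel. norm (g \<xi>) \<le> norm (mass *\<^sub>R h \<xi>)"
      by (simp add: g_def norm_mult)
  qed (simp add: g_def[abs_def])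
  have [measurable]: "g \<in> borel_measurable borel"
    using g by (simp add: borel_measurable_integrable)
  define F where "F j = multiplier_avg (\<lambda>\<xi>. indicator (shell j) \<xi> *\<^sub>R h \<xi>) t x" for j
  have Fj: "F j = (\<integral>\<xi>. indicator (shell j) \<xi> *\<^sub>R g \<xi> \<partial>lborel)" for j
    unfolding F_def multiplier_avg_def g_def by (simp add: scaleR_conv_of_real mult.assoc)
  have ij: "integrable lborel (\<lambda>\<xi>. indicator (shell j) \<xi> *\<^sub>R g \<xi>)" for j
    by (rule Bochner_Integration.integrable_bound[OF g]) (auto simp: indicator_def)
  have part: "(\<Sum>j\<le>n. F j) = (\<integral>\<xi>. indicator {\<xi>. norm \<xi> < 2 ^ n} \<xi> *\<^sub>R g \<xi> \<partial>lborel)" for n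
    unfolding Fj by (subst Bochner_Integration.integral_sum[symmetric]) (auto simp: ij sum_indicator_shell simp flip: scaleR_left.sum)
  have "(\<lambda>n. \<integral>\<xi>. indicator {\<xi>. norm \<xi> < 2 ^ n} \<xi> *\<^sub>R g \<xi> \<partial>lborel) \<longlonglongrightarrow> (\<integral>\<xi>. g \<xi> \<partial>lborel)"
  proof (rule integral_dominated_convergence[where w = "\<lambda>\<xi>. norm (g \<xi>)"])
    show "AE \<xi> in lborel. (\<lambda>n. indicator {\<xi>. norm \<xi> < 2 ^ n} \<xi> *\<^sub>R g \<xi>) \<longlonglongrightarrow> g \<xi>"
    proof (intro AE_I2 tendsto_eventually)
      fix \<xi> :: 'a
      obtain n0 where n0: "norm \<xi> < 2 ^ n0"
        using real_arch_pow[of 2 "norm \<xi>"] by auto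
      have "norm \<xi> < 2 ^ n" if "n0 \<le> n" for n
        using power_increasing[OF that, of "2::real"] by (intro less_le_trans[OF n0]) simp
      then show "\<forall>\<^sub>F n in sequentially. indicator {\<xi>. norm \<xi> < 2 ^ n} \<xi> *\<^sub>R g \<xi> = g \<xi>"
        unfolding eventually_sequentially by (auto simp: indicator_def)
    qed
  qed (use g in \<open>auto simp: indicator_def\<close>)
  then have "(\<lambda>n. \<Sum>j\<le>n. F j) \<longlonglongrightarrow> multiplier_avg h t x"
    unfolding part by (simp add: multiplier_avg_def g_def)
  then have "(\<lambda>n. ennreal (norm (\<Sum>j\<le>n. F j))) \<longlonglongrightarrow> ennreal (norm (multiplier_avg h t x))"
    by (intro tendsto_ennrealI tendsto_norm)
  moreover have "ennreal (norm (\<Sum>j\<le>n. F j)) \<le> (\<Sum>j. ennreal (norm (F j)))" for n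
  proof -
    have "ennreal (norm (\<Sum>j\<le>n. F j)) \<le> ennreal (\<Sum>j\<le>n. norm (F j))"
      by (intro ennreal_leI norm_sum)
    also have "\<dots> = (\<Sum>j\<le>n. ennreal (norm (F j)))"
      by simp
    also have "\<dots> \<le> (\<Sum>j. ennreal (norm (F j)))"
      by (rule sum_le_suminf) auto
    finally show ?thesis .
  qed
  ultimately have "ennreal (norm (multiplier_avg h t x)) \<le> (\<Sum>j. ennreal (norm (F j)))"
    by (intro LIMSEQ_le_const2) blast+
  then show ?thesis
    by (simp only: F_def)
qed

text \<open>Weighted Cauchy-Schwarz over the shells. The square of the weight is the dyadic constant
  times the squared symbol bound, so each shell contributes at most a constant times its weight
  times the energy of \<open>ft f\<close> there. Bounding this weight by the total W leaves W^2
  times the full energy, and W is of size \<epsilon>^(a - 1/2).\<close>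

lemma high_part:
  obtains K where "0 \<le> K"
    "\<And>\<delta> \<epsilon> f. \<lbrakk>0 < \<delta>; 0 < \<epsilon>; \<epsilon> \<le> 1; integrable lborel f\<rbrakk> \<Longrightarrow>
      \<exists>S\<in>borel_measurable borel. (\<forall>x. \<forall>t\<in>{1..2}. ennreal ((norm (multiplier_avg (high_symbol \<delta> \<epsilon> f) t x))\<^sup>2) \<le> S x) \<and>
        (\<integral>\<^sup>+x. S x \<partial>lborel) \<le> ennreal (K * \<epsilon> powr (2 * a - 1)) * (\<integral>\<^sup>+x. ennreal ((norm (f x))\<^sup>2) \<partial>lborel)"
proof -
  obtain K where K: "0 \<le> K"
    "\<And>j h. \<lbrakk>integrable lborel h; \<And>\<xi>. \<xi> \<notin> shell j \<Longrightarrow> h \<xi> = 0\<rbrakk> \<Longrightarrow>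
      \<exists>S\<in>borel_measurable borel. (\<forall>x. \<forall>t\<in>{1..2}. ennreal ((norm (multiplier_avg h t x))\<^sup>2) \<le> S x) \<and>
        (\<integral>\<^sup>+x. S x \<partial>lborel) \<le> ennreal (K * (2 ^ j) powr (1 - 2 * a)) * (\<integral>\<^sup>+\<xi>. ennreal ((norm (h \<xi>))\<^sup>2) \<partial>lborel)"
    using dyadic_piece_bound by blast
  obtain Kw where Kw: "0 \<le> Kw"
    "\<And>\<epsilon>. \<lbrakk>0 < \<epsilon>; \<epsilon> \<le> 1\<rbrakk> \<Longrightarrow> (\<Sum>j. ennreal (weight \<epsilon> j)) \<le> ennreal (Kw * \<epsilon> powr (a - 1 / 2))"
    using weight_sum by blast
  show ?thesis
  proof
    show "0 \<le> K * Kw\<^sup>2"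
      using K by simp
    fix \<delta> \<epsilon> :: real and f :: "'a \<Rightarrow> complex"
    assume \<delta>: "0 < \<delta>" and \<epsilon>: "0 < \<epsilon>" "\<epsilon> \<le> 1" and f: "integrable lborel f"
    have [measurable]: "f \<in> borel_measurable borel"
      using f by (simp add: borel_measurable_integrable)
    define h where "h = high_symbol \<delta> \<epsilon> f"
    have h: "integrable lborel h"
      unfolding h_def by (rule integrable_high_symbol[OF f \<delta>])
    have [measurable]: "h \<in> borel_measurable borel"
      using h by (simp add: borel_measurable_integrable)
    define hj where "hj j \<xi> = indicator (shell j) \<xi> *\<^sub>R h \<xi>" for j \<xi>
    have hj: "integrable lborel (hj j)" for j
      unfolding hj_def by (rule Bochner_Integration.integrable_bound[OF h]) (auto simp: indicator_def)
    define \<rho> where "\<rho> j = min 1 ((pi * (\<epsilon> * 2 ^ j)\<^sup>2) ^ ord)" for j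
    have \<rho>: "0 < \<rho> j" for j
      using \<epsilon> by (simp add: \<rho>_def)
    have "\<forall>j. \<exists>S. S \<in> borel_measurable borel \<and> (\<forall>x. \<forall>t\<in>{1..2}. ennreal ((norm (multiplier_avg (hj j) t x))\<^sup>2) \<le> S x) \<and>
        (\<integral>\<^sup>+x. S x \<partial>lborel) \<le> ennreal (K * (2 ^ j) powr (1 - 2 * a)) * (\<integral>\<^sup>+\<xi>. ennreal ((norm (hj j \<xi>))\<^sup>2) \<partial>lborel)"
    proof
      fix j
      have "hj j \<xi> = 0" if "\<xi> \<notin> shell j" for \<xi>
        using that by (simp add: hj_def)
      from K(2)[OF hj this] show "\<exists>S. S \<in> borel_measurable borel \<and> (\<forall>x. \<forall>t\<in>{1..2}. ennreal ((norm (multiplier_avg (hj j) t x))\<^sup>2) \<le> S x) \<and>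
        (\<integral>\<^sup>+x. S x \<partial>lborel) \<le> ennreal (K * (2 ^ j) powr (1 - 2 * a)) * (\<integral>\<^sup>+\<xi>. ennreal ((norm (hj j \<xi>))\<^sup>2) \<partial>lborel)"
        by blast
    qed
    then obtain S where [measurable]: "\<And>j. S j \<in> borel_measurable borel"
      and S: "\<And>j x t. t \<in> {1..2} \<Longrightarrow> ennreal ((norm (multiplier_avg (hj j) t x))\<^sup>2) \<le> S j x"
      and S_int: "\<And>j. (\<integral>\<^sup>+x. S j x \<partial>lborel) \<le> ennreal (K * (2 ^ j) powr (1 - 2 * a)) * (\<integral>\<^sup>+\<xi>. ennreal ((norm (hj j \<xi>))\<^sup>2) \<partial>lborel)"
      unfolding choice_iff by blast
    define w where "w = weight \<epsilon>"
    define W where "W = (\<Sum>j. ennreal (w j))"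
    define T where "T x = W * (\<Sum>j. ennreal (1 / w j) * S j x)" for x
    have w: "0 < w j" for j
      using weight_pos[OF \<epsilon>(1)] by (simp add: w_def)
    have wW: "ennreal (w j) \<le> W" for j
      unfolding W_def using sum_le_suminf[of "\<lambda>j. ennreal (w j)" "{j}"] by simp
    have w2: "(w j)\<^sup>2 = (2 ^ j) powr (1 - 2 * a) * (\<rho> j)\<^sup>2" for j
      unfolding w_def weight_def \<rho>_def power_mult_distrib
      by (simp add: power2_eq_square flip: powr_add)
    have T_meas: "T \<in> borel_measurable borel"
      unfolding T_def[abs_def] by measurable
    have bound: "ennreal ((norm (multiplier_avg h t x))\<^sup>2) \<le> T x" if "t \<in> {1..2}" for t x
    proof -
      have "ennreal ((norm (multiplier_avg h t x))\<^sup>2) = (ennreal (norm (multiplier_avg h t x)))\<^sup>2"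
        by (simp add: ennreal_power)
      also have "\<dots> \<le> (\<Sum>j. ennreal (norm (multiplier_avg (hj j) t x)))\<^sup>2"
        unfolding hj_def by (intro power_mono multiplier_avg_le_pieces[OF h]) auto
      also have "\<dots> \<le> W * (\<Sum>j. ennreal (1 / w j) * (ennreal (norm (multiplier_avg (hj j) t x)))\<^sup>2)"
        unfolding W_def by (rule Cauchy_Schwarz_suminf[OF w])
      also have "\<dots> \<le> T x"
        unfolding T_def using S[OF that]
        by (intro mult_left_mono suminf_le) (auto simp: ennreal_power)
      finally show ?thesis .
    qed
    \<comment> \<open>The energy of the transform on one shell; the shells being disjoint,
      Plancherel bounds the sum of these energies.\<close>
    define A where "A j = (\<integral>\<^sup>+\<xi>. ennreal ((norm (ft f \<xi>))\<^sup>2) * indicator (shell j) \<xi> \<partial>lborel)" for j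
    have A_sum: "(\<Sum>j. A j) \<le> (\<integral>\<^sup>+x. ennreal ((norm (f x))\<^sup>2) \<partial>lborel)"
    proof -
      have ind: "(\<Sum>j. ennreal (indicator (shell j) \<xi>)) \<le> 1" for \<xi> :: 'a
      proof (rule suminf_le_const)
        show "(\<Sum>j<n. ennreal (indicator (shell j) \<xi>)) \<le> 1" for n
        proof -
          have "(\<Sum>j<n. ennreal (indicator (shell j) \<xi>)) \<le> (\<Sum>j\<le>n. ennreal (indicator (shell j) \<xi>))"
            by (intro sum_mono2) auto
          also have "\<dots> = ennreal (\<Sum>j\<le>n. indicator (shell j) \<xi>)"
            by (simp add: sum_ennreal)
          also have "\<dots> \<le> 1"
            unfolding sum_indicator_shell by (simp add: indicator_def)
          finally show ?thesis .
        qed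
      qed auto
      have "(\<Sum>j. A j) = (\<integral>\<^sup>+\<xi>. (\<Sum>j. ennreal ((norm (ft f \<xi>))\<^sup>2) * indicator (shell j) \<xi>) \<partial>lborel)"
        unfolding A_def by (rule nn_integral_suminf[symmetric]) measurable
      also have "\<dots> \<le> (\<integral>\<^sup>+\<xi>. ennreal ((norm (ft f \<xi>))\<^sup>2) \<partial>lborel)"
        using ind by (intro nn_integral_mono) (simp add: ennreal_indicator mult_left_le)
      also have "\<dots> \<le> (\<integral>\<^sup>+x. ennreal ((norm (f x))\<^sup>2) \<partial>lborel)"
        by (rule Plancherel_le[OF f])
      finally show ?thesis .
    qed
    have Sj: "ennreal (1 / w j) * (\<integral>\<^sup>+x. S j x \<partial>lborel) \<le> ennreal K * W * A j" for j
    proof -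
      have "(\<integral>\<^sup>+\<xi>. ennreal ((norm (hj j \<xi>))\<^sup>2) \<partial>lborel) \<le> (\<integral>\<^sup>+\<xi>. ennreal ((\<rho> j)\<^sup>2) * (ennreal ((norm (ft f \<xi>))\<^sup>2) * indicator (shell j) \<xi>) \<partial>lborel)"
      proof (intro nn_integral_mono)
        fix \<xi> :: 'a
        show "ennreal ((norm (hj j \<xi>))\<^sup>2) \<le> ennreal ((\<rho> j)\<^sup>2) * (ennreal ((norm (ft f \<xi>))\<^sup>2) * indicator (shell j) \<xi>)"
        proof (cases "\<xi> \<in> shell j")
          case True
          have "(norm (h \<xi>))\<^sup>2 \<le> (\<rho> j * norm (ft f \<xi>))\<^sup>2"
            unfolding h_def \<rho>_def by (intro power_mono high_symbol_bound \<delta> True) auto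
          then show ?thesis
            using True by (simp add: hj_def power_mult_distrib flip: ennreal_mult)
        qed (simp add: hj_def)
      qed
      also have "\<dots> = ennreal ((\<rho> j)\<^sup>2) * A j"
        unfolding A_def by (rule nn_integral_cmult) measurable
      finally have "ennreal (1 / w j) * (\<integral>\<^sup>+x. S j x \<partial>lborel) \<le> ennreal (1 / w j) * (ennreal (K * (2 ^ j) powr (1 - 2 * a)) * (ennreal ((\<rho> j)\<^sup>2) * A j))"
        by (intro mult_left_mono order_trans[OF S_int]) auto
      also have "\<dots> = ennreal (1 / w j * (K * (2 ^ j) powr (1 - 2 * a) * (\<rho> j)\<^sup>2)) * A j"
      proof -
        have "ennreal (1 / w j * (K * (2 ^ j) powr (1 - 2 * a) * (\<rho> j)\<^sup>2)) =
            ennreal (1 / w j) * ennreal (K * (2 ^ j) powr (1 - 2 * a) * (\<rho> j)\<^sup>2)"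
          using K(1) w[of j] by (intro ennreal_mult) auto
        also have "ennreal (K * (2 ^ j) powr (1 - 2 * a) * (\<rho> j)\<^sup>2) = ennreal (K * (2 ^ j) powr (1 - 2 * a)) * ennreal ((\<rho> j)\<^sup>2)"
          using K(1) by (intro ennreal_mult) auto
        finally show ?thesis
          by (simp only: mult.assoc)
      qed
      also have "1 / w j * (K * (2 ^ j) powr (1 - 2 * a) * (\<rho> j)\<^sup>2) = K * w j"
      proof -
        have "1 / w j * (K * (2 ^ j) powr (1 - 2 * a) * (\<rho> j)\<^sup>2) = K * (w j)\<^sup>2 / w j"
          unfolding w2 by simp
        then show ?thesis
          using w[of j] by (simp add: power2_eq_square)
      qed
      also have "ennreal (K * w j) * A j = ennreal K * ennreal (w j) * A j"
        using ennreal_mult[of K "w j"] K(1) w[of j] by simp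
      also have "\<dots> \<le> ennreal K * W * A j"
        using wW by (intro mult_right_mono mult_left_mono) auto
      finally show ?thesis .
    qed
    have "(\<integral>\<^sup>+x. T x \<partial>lborel) = W * (\<Sum>j. ennreal (1 / w j) * (\<integral>\<^sup>+x. S j x \<partial>lborel))"
      unfolding T_def by (simp add: nn_integral_cmult nn_integral_suminf)
    also have "\<dots> \<le> W * (\<Sum>j. ennreal K * W * A j)"
      using Sj by (intro mult_left_mono suminf_le) auto
    also have "\<dots> = W * (ennreal K * W * (\<Sum>j. A j))"
      by simp
    also have "\<dots> = ennreal K * W\<^sup>2 * (\<Sum>j. A j)"
      by (simp only: power2_eq_square mult_ac)
    also have "\<dots> \<le> ennreal K * (ennreal (Kw * \<epsilon> powr (a - 1 / 2)))\<^sup>2 * (\<integral>\<^sup>+x. ennreal ((norm (f x))\<^sup>2) \<partial>lborel)"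
      unfolding W_def w_def by (intro mult_mono power_mono Kw \<epsilon> A_sum) auto
    also have "ennreal K * (ennreal (Kw * \<epsilon> powr (a - 1 / 2)))\<^sup>2 = ennreal (K * Kw\<^sup>2 * \<epsilon> powr (2 * a - 1))"
    proof -
      have "(Kw * \<epsilon> powr (a - 1 / 2))\<^sup>2 = Kw\<^sup>2 * \<epsilon> powr (2 * a - 1)"
        by (simp add: power_mult_distrib) (simp add: power2_eq_square flip: powr_add)
      then show ?thesis
        using K(1) Kw(1) ennreal_power[of "Kw * \<epsilon> powr (a - 1 / 2)" 2] ennreal_mult[of K "Kw\<^sup>2 * \<epsilon> powr (2 * a - 1)"]
        by (simp only: mult.assoc) simp
    qed
    finally show "\<exists>S\<in>borel_measurable borel. (\<forall>x. \<forall>t\<in>{1..2}. ennreal ((norm (multiplier_avg (high_symbol \<delta> \<epsilon> f) t x))\<^sup>2) \<le> S x) \<and>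
        (\<integral>\<^sup>+x. S x \<partial>lborel) \<le> ennreal (K * Kw\<^sup>2 * \<epsilon> powr (2 * a - 1)) * (\<integral>\<^sup>+x. ennreal ((norm (f x))\<^sup>2) \<partial>lborel)"
      using T_meas bound unfolding h_def by blast
  qed
qed

end

section \<open>Low frequencies\<close>

lemma summable_gauss_shells: "summable (\<lambda>k. exp (- (pi * (real k)\<^sup>2)) * (real k + 1) powr b)"
proof (rule summable_comparison_test_bigo)
  show "summable (\<lambda>k. norm (1 / (real k)\<^sup>2))"
    using inverse_power_summable[of 2, where 'a=real] by (simp add: inverse_eq_divide)
  show "(\<lambda>k. exp (- (pi * (real k)\<^sup>2)) * (real k + 1) powr b) \<in> O(\<lambda>k. 1 / (real k)\<^sup>2)"
    by real_asymp
qed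

lemma nth_le_suminf: "f k \<le> (\<Sum>j. f j)" for f :: "nat \<Rightarrow> ennreal"
  using sum_le_suminf[of f "{k}"] by simp

text \<open>The Gaussian is at most its value at the inner radius of the annulus of width sqrt s
  containing \<open>z\<close>. The annuli are enlarged to balls, to which the ball condition on
  \<mu> applies.\<close>

lemma gauss_le_shells:
  fixes z :: "'a::euclidean_space"
  assumes s: "0 < s"
  shows "ennreal (gauss s z) \<le> ennreal (s powr (- (DIM('a) / 2))) *
    (\<Sum>k. ennreal (exp (- (pi * (real k)\<^sup>2))) * indicator {z. norm z < (real k + 1) * sqrt s} z)"
proof -
  define k where "k = nat \<lfloor>norm z / sqrt s\<rfloor>"
  have s': "0 < sqrt s" using s by simp
  have k: "real k \<le> norm z / sqrt s" "norm z / sqrt s < real k + 1"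
    using s' by (auto simp: k_def)
  have "(real k)\<^sup>2 \<le> (norm z / sqrt s)\<^sup>2"
    using k(1) by (intro power_mono) auto
  then have "(real k)\<^sup>2 \<le> (norm z)\<^sup>2 / s"
    using s by (simp add: power_divide)
  then have "pi * (real k)\<^sup>2 \<le> pi * (norm z)\<^sup>2 / s"
    using mult_left_mono[of "(real k)\<^sup>2" "(norm z)\<^sup>2 / s" pi] by simp
  then have "gauss s z \<le> s powr (- (DIM('a) / 2)) * exp (- (pi * (real k)\<^sup>2))"
    unfolding gauss_def by (intro mult_left_mono) auto
  then have "ennreal (gauss s z) \<le> ennreal (s powr (- (DIM('a) / 2))) * ennreal (exp (- (pi * (real k)\<^sup>2)))"
    by (simp flip: ennreal_mult add: ennreal_leI)
  also have "\<dots> = ennreal (s powr (- (DIM('a) / 2))) * (ennreal (exp (- (pi * (real k)\<^sup>2))) * indicator {z. norm z < (real k + 1) * sqrt s} z)"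
    using k(2) s' by (simp add: field_simps)
  also have "\<dots> \<le> ennreal (s powr (- (DIM('a) / 2))) *
    (\<Sum>k. ennreal (exp (- (pi * (real k)\<^sup>2))) * indicator {z. norm z < (real k + 1) * sqrt s} z)"
    by (intro mult_left_mono nth_le_suminf[of "\<lambda>k. ennreal (exp (- (pi * (real k)\<^sup>2))) * indicator {z. norm z < (real k + 1) * sqrt s} z"]) auto
  finally show ?thesis .
qed

text \<open>Halving the distance is compensated by quadrupling \<open>s\<close>, at the cost 2^d of
  the changed normalisation.\<close>

lemma gauss_le_gauss_far:
  fixes z x :: "'a::euclidean_space"
  assumes s: "0 < s" and n: "norm x / 2 \<le> norm z"
  shows "gauss s z \<le> 2 ^ DIM('a) * gauss (4 * s) x"
proof -
  have "(norm x / 2)\<^sup>2 \<le> (norm z)\<^sup>2"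
    using n by (intro power_mono) auto
  then have "(norm x)\<^sup>2 / (4 * s) \<le> (norm z)\<^sup>2 / s"
    using s by (simp add: power_divide field_simps)
  then have "pi * (norm x)\<^sup>2 / (4 * s) \<le> pi * (norm z)\<^sup>2 / s"
    using mult_left_mono[of "(norm x)\<^sup>2 / (4 * s)" "(norm z)\<^sup>2 / s" pi] by simp
  then have "gauss s z \<le> s powr (- (DIM('a) / 2)) * exp (- (pi * (norm x)\<^sup>2 / (4 * s)))"
    unfolding gauss_def by (intro mult_left_mono) auto
  also have "s powr (- (DIM('a) / 2)) = 2 ^ DIM('a) * (4 * s) powr (- (DIM('a) / 2))"
  proof -
    have "(4::real) powr (- (DIM('a) / 2)) = (2 powr 2) powr (- (DIM('a) / 2))"
      by simp
    also have "\<dots> = 2 powr (- real DIM('a))"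
      unfolding powr_powr by simp
    also have "\<dots> = 1 / 2 ^ DIM('a)"
      by (simp add: powr_minus powr_realpow divide_inverse)
    finally show ?thesis
      using s by (simp add: powr_mult)
  qed
  finally show ?thesis
    by (simp add: gauss_def)
qed

text \<open>By (A + B)^2 \<le> 2 A^2 + 2 B^2, doubling \<open>s\<close> absorbs a displacement of
  size \<rho> sqrt s into a constant factor.\<close>

lemma gauss_le_gauss_near:
  fixes z x :: "'a::euclidean_space"
  assumes s: "0 < s" and n: "norm x \<le> norm z + sqrt s * \<rho>" and \<rho>: "0 \<le> \<rho>"
  shows "gauss s z \<le> (2 powr (DIM('a) / 2) * exp (pi * \<rho>\<^sup>2)) * gauss (2 * s) x"
proof -
  have "(norm x)\<^sup>2 \<le> (norm z + sqrt s * \<rho>)\<^sup>2"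
    using n by (intro power_mono) auto
  also have "\<dots> \<le> 2 * (norm z)\<^sup>2 + 2 * (sqrt s * \<rho>)\<^sup>2"
    using sum_squares_bound[of "norm z" "sqrt s * \<rho>"] by (simp add: power2_sum)
  also have "(sqrt s * \<rho>)\<^sup>2 = s * \<rho>\<^sup>2"
    using s by (simp add: power_mult_distrib)
  finally have "(norm x)\<^sup>2 / (2 * s) \<le> (norm z)\<^sup>2 / s + \<rho>\<^sup>2"
    using s by (simp add: field_simps)
  then have "pi * (norm x)\<^sup>2 / (2 * s) \<le> pi * (norm z)\<^sup>2 / s + pi * \<rho>\<^sup>2"
    using mult_left_mono[of "(norm x)\<^sup>2 / (2 * s)" "(norm z)\<^sup>2 / s + \<rho>\<^sup>2" pi] by (simp add: distrib_left)
  then have "exp (- (pi * (norm z)\<^sup>2 / s)) \<le> exp (pi * \<rho>\<^sup>2 + - (pi * (norm x)\<^sup>2 / (2 * s)))"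
    by simp
  then have "gauss s z \<le> s powr (- (DIM('a) / 2)) * (exp (pi * \<rho>\<^sup>2) * exp (- (pi * (norm x)\<^sup>2 / (2 * s))))"
    unfolding gauss_def exp_add by (intro mult_left_mono) auto
  also have "s powr (- (DIM('a) / 2)) = 2 powr (DIM('a) / 2) * (2 * s) powr (- (DIM('a) / 2))"
    using s by (simp add: powr_mult powr_minus)
  finally show ?thesis
    by (simp add: gauss_def mult_ac)
qed

section \<open>Pointwise and maximal bounds for the smoothed kernel\<close>

context decaying_measure
begin

text \<open>The convolution of \<open>gauss s\<close> with the dilate of \<mu> by \<open>t\<close>:
  averages of a Gaussian mean of \<open>f\<close> are convolutions of \<open>f\<close> with
  it.\<close>

definition kernel :: "real \<Rightarrow> real \<Rightarrow> 'a \<Rightarrow> ennreal"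
  where "kernel s t x = (\<integral>\<^sup>+y. ennreal (gauss s (x - t *\<^sub>R y)) \<partial>\<mu>)"

text \<open>The ball condition gives the \<open>k\<close>-th ball, of radius (k + 1) sqrt s, measure
  of order ((k + 1) sqrt s)^b. The Gaussian weights make the sum over \<open>k\<close> converge, and
  the powers of \<open>s\<close> combine to -d/2 + b/2.\<close>

lemma kernel_le:
  obtains K where "0 \<le> K"
    "\<And>s t x. \<lbrakk>0 < s; 1 \<le> t\<rbrakk> \<Longrightarrow> kernel s t x \<le> ennreal (K * s powr (- ((DIM('a) - b) / 2)))"
proof -
  define g where "g k = exp (- (pi * (real k)\<^sup>2)) * (real k + 1) powr b" for k
  have g: "summable g" "\<And>k. 0 \<le> g k"
    using summable_gauss_shells[of b] by (auto simp: g_def[abs_def])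
  show ?thesis
  proof
    show "0 \<le> C * suminf g"
      using C g by (intro mult_nonneg_nonneg suminf_nonneg) auto
    fix s t :: real and x :: 'a assume s: "0 < s" and t: "1 \<le> t"
    have shell: "emeasure \<mu> {y. norm (x - t *\<^sub>R y) < (real k + 1) * sqrt s} \<le> ennreal (C * s powr (b / 2) * (real k + 1) powr b)" for k
    proof -
      \<comment> \<open>For t \<ge> 1 division by \<open>t\<close> is a contraction, so the radius
        needs no adjustment.\<close>
      have "{y. norm (x - t *\<^sub>R y) < (real k + 1) * sqrt s} \<subseteq> ball ((1 / t) *\<^sub>R x) ((real k + 1) * sqrt s)"
      proof
        fix y assume "y \<in> {y. norm (x - t *\<^sub>R y) < (real k + 1) * sqrt s}"
        then have y: "norm (x - t *\<^sub>R y) < (real k + 1) * sqrt s" by simp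
        have "(1 / t) *\<^sub>R x - y = (1 / t) *\<^sub>R (x - t *\<^sub>R y)"
          using t by (simp add: scaleR_diff_right)
        then have "norm ((1 / t) *\<^sub>R x - y) = (1 / t) * norm (x - t *\<^sub>R y)"
          using t by simp
        also have "\<dots> \<le> 1 * norm (x - t *\<^sub>R y)"
          using t by (intro mult_right_mono) auto
        finally show "y \<in> ball ((1 / t) *\<^sub>R x) ((real k + 1) * sqrt s)"
          using y by (simp add: dist_norm)
      qed
      then have "emeasure \<mu> {y. norm (x - t *\<^sub>R y) < (real k + 1) * sqrt s} \<le> emeasure \<mu> (ball ((1 / t) *\<^sub>R x) ((real k + 1) * sqrt s))"
        by (intro emeasure_mono) (auto simp: sets_mu)
      also have "\<dots> \<le> ennreal (C * ((real k + 1) * sqrt s) powr b)"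
        unfolding emeasure_eq_measure using s by (intro ennreal_leI ball_bound) auto
      also have "((real k + 1) * sqrt s) powr b = s powr (b / 2) * (real k + 1) powr b"
        using s by (simp add: powr_mult powr_half_sqrt[symmetric] powr_powr)
      finally show ?thesis
        by (simp add: mult.assoc)
    qed
    have "(\<Sum>k. ennreal (exp (- (pi * (real k)\<^sup>2))) * ennreal (C * s powr (b / 2) * (real k + 1) powr b)) =
        (\<Sum>k. ennreal (C * s powr (b / 2)) * ennreal (g k))"
      using C by (simp add: g_def mult_ac flip: ennreal_mult)
    also have "\<dots> = ennreal (C * s powr (b / 2)) * ennreal (suminf g)"
      using g by (simp add: suminf_ennreal2)
    finally have shells_eq: "(\<Sum>k. ennreal (exp (- (pi * (real k)\<^sup>2))) * ennreal (C * s powr (b / 2) * (real k + 1) powr b)) =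
        ennreal (C * s powr (b / 2)) * ennreal (suminf g)" .
    have ind_eq: "(\<integral>\<^sup>+y. indicator {z. norm z < (real k + 1) * sqrt s} (x - t *\<^sub>R y) \<partial>\<mu>) =
        emeasure \<mu> {y. norm (x - t *\<^sub>R y) < (real k + 1) * sqrt s}" for k
    proof -
      have "(\<lambda>y. indicator {z. norm z < (real k + 1) * sqrt s} (x - t *\<^sub>R y)) = (indicator {y. norm (x - t *\<^sub>R y) < (real k + 1) * sqrt s} :: 'a \<Rightarrow> ennreal)"
        by (simp add: indicator_def fun_eq_iff)
      then show ?thesis
        by (simp add: sets_mu)
    qed
    have "kernel s t x \<le> (\<integral>\<^sup>+y. ennreal (s powr (- (DIM('a) / 2))) *
        (\<Sum>k. ennreal (exp (- (pi * (real k)\<^sup>2))) * indicator {z. norm z < (real k + 1) * sqrt s} (x - t *\<^sub>R y)) \<partial>\<mu>)"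
      unfolding kernel_def by (intro nn_integral_mono gauss_le_shells s)
    also have "\<dots> = ennreal (s powr (- (DIM('a) / 2))) *
        (\<Sum>k. ennreal (exp (- (pi * (real k)\<^sup>2))) * (\<integral>\<^sup>+y. indicator {z. norm z < (real k + 1) * sqrt s} (x - t *\<^sub>R y) \<partial>\<mu>))"
      by (simp add: nn_integral_cmult nn_integral_suminf)
    also have "\<dots> = ennreal (s powr (- (DIM('a) / 2))) *
        (\<Sum>k. ennreal (exp (- (pi * (real k)\<^sup>2))) * emeasure \<mu> {y. norm (x - t *\<^sub>R y) < (real k + 1) * sqrt s})"
      by (simp only: ind_eq)
    also have "\<dots> \<le>
        ennreal (s powr (- (DIM('a) / 2))) *
        (\<Sum>k. ennreal (exp (- (pi * (real k)\<^sup>2))) * ennreal (C * s powr (b / 2) * (real k + 1) powr b))"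
      by (intro mult_left_mono suminf_le shell) auto
    also have "ennreal (s powr (- (DIM('a) / 2))) *
        (\<Sum>k. ennreal (exp (- (pi * (real k)\<^sup>2))) * ennreal (C * s powr (b / 2) * (real k + 1) powr b)) =
        ennreal (C * suminf g * s powr (- ((DIM('a) - b) / 2)))"
    proof -
      have "s powr (- (DIM('a) / 2)) * (C * s powr (b / 2) * suminf g) = C * suminf g * (s powr (- (DIM('a) / 2)) * s powr (b / 2))"
        by simp
      also have "s powr (- (DIM('a) / 2)) * s powr (b / 2) = s powr (- ((DIM('a) - b) / 2))"
        by (simp add: diff_divide_distrib flip: powr_add)
      finally show ?thesis
        unfolding shells_eq using C g by (simp add: suminf_nonneg flip: ennreal_mult)
    qed
    finally show "kernel s t x \<le> ennreal (C * suminf g * s powr (- ((DIM('a) - b) / 2)))" .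
  qed
qed

text \<open>The pointwise bound is used on the ball of radius 4 R. Outside it |t y| \<le> 2 R \<le>
  |x| / 2, so the kernel is dominated by a wider Gaussian in \<open>x\<close> alone, with bounded
  integral.\<close>

lemma kernel_maximal_dim:
  assumes S: "0 < S"
  obtains K where "0 \<le> K"
    "\<And>s. \<lbrakk>0 < s; s \<le> S\<rbrakk> \<Longrightarrow> \<exists>\<kappa>\<in>borel_measurable borel. (\<forall>x. \<forall>t\<in>{1..2}. kernel s t x \<le> \<kappa> x) \<and>
      (\<integral>\<^sup>+x. \<kappa> x \<partial>lborel) \<le> ennreal (K * s powr (- ((DIM('a) - b) / 2)))"
proof -
  obtain K where K: "0 \<le> K"
    "\<And>s t x. \<lbrakk>0 < s; 1 \<le> t\<rbrakk> \<Longrightarrow> kernel s t x \<le> ennreal (K * s powr (- ((DIM('a) - b) / 2)))"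
    using kernel_le by blast
  define V where "V = measure lborel (cball (0::'a) (4 * R))"
  have V0: "0 \<le> V"
    unfolding V_def by (rule measure_nonneg)
  have fin_ball: "vol (cball (0::'a) (4 * R)) < \<infinity>"
    by (rule emeasure_bounded_finite) (rule bounded_cball)
  have V: "vol (cball (0::'a) (4 * R)) = ennreal V"
    unfolding V_def by (rule emeasure_eq_ennreal_measure) (rule less_imp_neq[OF fin_ball[unfolded infinity_ennreal_def]])
  define e where "e = (DIM('a) - b) / 2"
  have e: "0 \<le> e" using b by (simp add: e_def)
  define K' where "K' = K * V + mass * 2 ^ DIM('a) * S powr e"
  show ?thesis
  proof
    show "0 \<le> K'"
      using K by (simp add: K'_def V0)
    fix s :: real assume s: "0 < s" "s \<le> S"
    define A where "A = ennreal (K * s powr (- e))"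
    define B where "B = ennreal (mass * 2 ^ DIM('a))"
    define Q where "Q = cball (0::'a) (4 * R)"
    have [measurable]: "Q \<in> sets borel"
      by (simp add: Q_def)
    define \<kappa> where "\<kappa> x = A * indicator Q x + B * ennreal (gauss (4 * s) x)" for x :: 'a
    have "kernel s t x \<le> \<kappa> x" if t: "t \<in> {1..2}" for t x
    proof (cases "x \<in> Q")
      case True
      then show ?thesis
        using K(2)[of s t x] s t by (simp add: \<kappa>_def A_def e_def add_increasing2)
    next
      case False
      then have x: "4 * R < norm x" by (simp add: Q_def)
      have "kernel s t x \<le> (\<integral>\<^sup>+y. ennreal (2 ^ DIM('a) * gauss (4 * s) x) \<partial>\<mu>)"
        unfolding kernel_def
      proof (rule nn_integral_mono_AE)
        show "AE y in \<mu>. ennreal (gauss s (x - t *\<^sub>R y)) \<le> ennreal (2 ^ DIM('a) * gauss (4 * s) x)"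
          using R(2)
        proof eventually_elim
          case (elim y)
          have "t * norm y \<le> 2 * R"
            using t elim R by (intro mult_mono) auto
          then have "norm x / 2 \<le> norm (x - t *\<^sub>R y)"
            using norm_triangle_ineq2[of x "t *\<^sub>R y"] x t by simp
          then show ?case
            by (intro ennreal_leI gauss_le_gauss_far s)
        qed
      qed
      also have "\<dots> = ennreal (2 ^ DIM('a) * gauss (4 * s) x) * ennreal mass"
        by (simp add: emeasure_mu_UNIV)
      also have "\<dots> = B * ennreal (gauss (4 * s) x)"
      proof -
        have "ennreal (2 ^ DIM('a) * gauss (4 * s) x) = ennreal (2 ^ DIM('a)) * ennreal (gauss (4 * s) x)"
          by (intro ennreal_mult) auto
        moreover have "B = ennreal mass * ennreal (2 ^ DIM('a))"
          unfolding B_def by (intro ennreal_mult) auto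
        ultimately show ?thesis
          by (simp only: mult_ac)
      qed
      also have "\<dots> \<le> \<kappa> x"
        by (simp add: \<kappa>_def)
      finally show ?thesis .
    qed
    moreover have "\<kappa> \<in> borel_measurable borel"
      unfolding \<kappa>_def[abs_def] by measurable
    moreover have "(\<integral>\<^sup>+x. \<kappa> x \<partial>lborel) \<le> ennreal (K' * s powr (- e))"
    proof -
      have "(\<integral>\<^sup>+x. \<kappa> x \<partial>lborel) = (\<integral>\<^sup>+x. A * indicator Q x \<partial>lborel) + (\<integral>\<^sup>+x. B * ennreal (gauss (4 * s) (x :: 'a)) \<partial>lborel)"
        unfolding \<kappa>_def by (rule nn_integral_add) measurable
      also have "(\<integral>\<^sup>+x. A * indicator Q x \<partial>lborel) = A * ennreal V"
        by (subst nn_integral_cmult_indicator) (auto simp: V Q_def)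
      also have "A * ennreal V = ennreal (K * s powr (- e) * V)"
        unfolding A_def using K V0 by (intro ennreal_mult[symmetric]) auto
      also have "(\<integral>\<^sup>+x. B * ennreal (gauss (4 * s) (x :: 'a)) \<partial>lborel) = B"
        using nn_integral_gauss(2)[of "4 * s" "0 :: 'a"] s by (subst nn_integral_cmult) auto
      also have "ennreal (K * s powr (- e) * V) + B = ennreal (K * s powr (- e) * V + mass * 2 ^ DIM('a))"
        unfolding B_def using K V0 by (intro ennreal_plus[symmetric]) auto
      also have "\<dots> \<le> ennreal (K' * s powr (- e))"
      proof (rule ennreal_leI)
        \<comment> \<open>The Gaussian tail has an integral independent of \<open>s\<close>; since
          \<open>s\<close> stays below \<open>S\<close> it is absorbed by the negative power of
          \<open>s\<close>.\<close>
        have "1 = S powr e * S powr (- e)"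
          using S by (simp flip: powr_add)
        also have "\<dots> \<le> S powr e * s powr (- e)"
          using s e by (intro mult_left_mono powr_mono2') auto
        finally have "mass * 2 ^ DIM('a) * 1 \<le> mass * 2 ^ DIM('a) * (S powr e * s powr (- e))"
          by (intro mult_left_mono) auto
        then show "K * s powr (- e) * V + mass * 2 ^ DIM('a) \<le> K' * s powr (- e)"
          by (simp add: K'_def algebra_simps)
      qed
      finally show ?thesis .
    qed
    ultimately show "\<exists>\<kappa>\<in>borel_measurable borel. (\<forall>x. \<forall>t\<in>{1..2}. kernel s t x \<le> \<kappa> x) \<and>
      (\<integral>\<^sup>+x. \<kappa> x \<partial>lborel) \<le> ennreal (K' * s powr (- ((DIM('a) - b) / 2)))"
      unfolding e_def[symmetric] by (intro bexI[of _ \<kappa>] conjI allI ballI)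
  qed
qed

text \<open>Cover \<open>[1, 2]\<close> by intervals of length \<open>\<surd>s\<close>: within one of them the dilation moves the support of \<open>\<mu>\<close>
  by at most \<open>R \<surd>s\<close>, which doubling \<open>s\<close> absorbs.\<close>

lemma kernel_maximal_net:
  assumes S: "0 < S"
  obtains K where "0 \<le> K"
    "\<And>s. \<lbrakk>0 < s; s \<le> S\<rbrakk> \<Longrightarrow> \<exists>\<kappa>\<in>borel_measurable borel. (\<forall>x. \<forall>t\<in>{1..2}. kernel s t x \<le> \<kappa> x) \<and>
      (\<integral>\<^sup>+x. \<kappa> x \<partial>lborel) \<le> ennreal (K * s powr (- (1 / 2)))"
proof -
  define c where "c = 2 powr (DIM('a) / 2) * exp (pi * R\<^sup>2)"
  have c: "0 \<le> c" by (simp add: c_def)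
  show ?thesis
  proof
    show "0 \<le> (1 + sqrt S) * (c * mass)"
      using c S by simp
    fix s :: real assume s: "0 < s" "s \<le> S"
    define \<sigma> where "\<sigma> = sqrt s"
    have \<sigma>: "0 < \<sigma>" "\<sigma> \<le> sqrt S" using s by (auto simp: \<sigma>_def)
    \<comment> \<open>The nodes are 1 + i \<sigma> for 0 \<le> i \<le> n. Each \<open>t\<close> in
      [1, 2] lies within \<sigma> to the right of a node, and the number of nodes gives the power
      -1/2 of \<open>s\<close>.\<close>
    define n where "n = nat \<lfloor>1 / \<sigma>\<rfloor>"
    define cc where "cc = ennreal c"
    define \<kappa> where "\<kappa> x = (\<Sum>i\<le>n. \<integral>\<^sup>+y. cc * ennreal (gauss (2 * s) (x - (1 + i * \<sigma>) *\<^sub>R y)) \<partial>\<mu>)" for x :: 'a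
    have "kernel s t x \<le> \<kappa> x" if t: "t \<in> {1..2}" for t x
    proof -
      define i where "i = nat \<lfloor>(t - 1) / \<sigma>\<rfloor>"
      have i: "real i \<le> (t - 1) / \<sigma>" "(t - 1) / \<sigma> < real i + 1"
        using \<sigma> t by (auto simp: i_def)
      have "(t - 1) / \<sigma> \<le> 1 / \<sigma>"
        using t \<sigma> by (intro divide_right_mono) auto
      then have in': "i \<le> n"
        unfolding i_def n_def by (intro nat_mono floor_mono)
      have d: "0 \<le> t - (1 + i * \<sigma>)" "t - (1 + i * \<sigma>) \<le> \<sigma>"
        using i \<sigma> by (auto simp: field_simps)
      have "kernel s t x \<le> (\<integral>\<^sup>+y. cc * ennreal (gauss (2 * s) (x - (1 + i * \<sigma>) *\<^sub>R y)) \<partial>\<mu>)"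
        unfolding kernel_def
      proof (rule nn_integral_mono_AE)
        show "AE y in \<mu>. ennreal (gauss s (x - t *\<^sub>R y)) \<le> cc * ennreal (gauss (2 * s) (x - (1 + i * \<sigma>) *\<^sub>R y))"
          using R(2)
        proof eventually_elim
          case (elim y)
          have "x - (1 + i * \<sigma>) *\<^sub>R y = (x - t *\<^sub>R y) + (t - (1 + i * \<sigma>)) *\<^sub>R y"
            by (simp add: algebra_simps)
          then have "norm (x - (1 + i * \<sigma>) *\<^sub>R y) = norm ((x - t *\<^sub>R y) + (t - (1 + i * \<sigma>)) *\<^sub>R y)"
            by (rule arg_cong)
          also have "\<dots> \<le> norm (x - t *\<^sub>R y) + (t - (1 + i * \<sigma>)) * norm y"
            using norm_triangle_ineq[of "x - t *\<^sub>R y" "(t - (1 + i * \<sigma>)) *\<^sub>R y"] d by simp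
          also have "(t - (1 + i * \<sigma>)) * norm y \<le> sqrt s * R"
            using d elim \<sigma> by (intro mult_mono) (auto simp: \<sigma>_def)
          finally have "gauss s (x - t *\<^sub>R y) \<le> c * gauss (2 * s) (x - (1 + i * \<sigma>) *\<^sub>R y)"
            unfolding c_def using s R by (intro gauss_le_gauss_near) auto
          then show ?case
            unfolding cc_def using c by (subst ennreal_mult[symmetric]) (auto intro: ennreal_leI)
        qed
      qed
      also have "\<dots> \<le> \<kappa> x"
        unfolding \<kappa>_def using in'
        by (intro member_le_sum[where f = "\<lambda>i. \<integral>\<^sup>+y. cc * ennreal (gauss (2 * s) (x - (1 + real i * \<sigma>) *\<^sub>R y)) \<partial>\<mu>"]) auto
      finally show ?thesis .
    qed
    moreover have "\<kappa> \<in> borel_measurable borel"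
      unfolding \<kappa>_def[abs_def] by measurable
    moreover have "(\<integral>\<^sup>+x. \<kappa> x \<partial>lborel) \<le> ennreal ((1 + sqrt S) * (c * mass) * s powr (- (1 / 2)))"
    proof -
      interpret P: pair_sigma_finite \<mu> "lborel :: 'a measure"
        by (simp add: pair_sigma_finite_def sigma_finite_measure_axioms lborel.sigma_finite_measure_axioms)
      have one: "(\<integral>\<^sup>+x. \<integral>\<^sup>+y. cc * ennreal (gauss (2 * s) (x - r *\<^sub>R y)) \<partial>\<mu> \<partial>lborel) = ennreal (c * mass)" for r
      proof -
        have "(\<integral>\<^sup>+x. \<integral>\<^sup>+y. cc * ennreal (gauss (2 * s) (x - r *\<^sub>R y)) \<partial>\<mu> \<partial>lborel) =
          (\<integral>\<^sup>+y. \<integral>\<^sup>+x. cc * ennreal (gauss (2 * s) (x - r *\<^sub>R y)) \<partial>lborel \<partial>\<mu>)"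
          by (rule P.Fubini'[where f = "\<lambda>y x. cc * ennreal (gauss (2 * s) (x - r *\<^sub>R y))"]) measurable
        also have "\<dots> = ennreal (c * mass)"
          unfolding cc_def using s c by (simp add: nn_integral_cmult nn_integral_gauss(2) emeasure_mu_UNIV ennreal_mult)
        finally show ?thesis .
      qed
      have "(\<integral>\<^sup>+x. \<kappa> x \<partial>lborel) = (\<Sum>i\<le>n. ennreal (c * mass))"
        unfolding \<kappa>_def by (subst nn_integral_sum) (auto simp: one)
      also have "\<dots> = ennreal ((n + 1) * (c * mass))"
        using c by (subst sum_ennreal) auto
      also have "\<dots> \<le> ennreal ((1 + sqrt S) * (c * mass) * s powr (- (1 / 2)))"
      proof (rule ennreal_leI)
        have "real n \<le> 1 / \<sigma>"
          using \<sigma> by (simp add: n_def)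
        moreover have "1 \<le> sqrt S / \<sigma>"
          using \<sigma> by simp
        ultimately have "real n + 1 \<le> (1 + sqrt S) / \<sigma>"
          by (simp add: add_divide_distrib)
        also have "\<dots> = (1 + sqrt S) * s powr (- (1 / 2))"
          using s by (simp add: \<sigma>_def powr_minus_divide powr_half_sqrt)
        finally have "(real n + 1) * (c * mass) \<le> (1 + sqrt S) * s powr (- (1 / 2)) * (c * mass)"
          using c by (intro mult_right_mono) auto
        then show "real (n + 1) * (c * mass) \<le> (1 + sqrt S) * (c * mass) * s powr (- (1 / 2))"
          by (simp add: mult_ac add.commute)
      qed
      finally show ?thesis .
    qed
    ultimately show "\<exists>\<kappa>\<in>borel_measurable borel. (\<forall>x. \<forall>t\<in>{1..2}. kernel s t x \<le> \<kappa> x) \<and>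
      (\<integral>\<^sup>+x. \<kappa> x \<partial>lborel) \<le> ennreal ((1 + sqrt S) * (c * mass) * s powr (- (1 / 2)))"
      by (intro bexI[of _ \<kappa>] conjI allI ballI)
  qed
qed

text \<open>The exponent of the better of the two integral bounds for the maximal kernel,
  \<open>s\<close> being bounded above. It is the source of the minimum in
  \<open>p_circ\<close>.\<close>

definition gam :: real
  where "gam = min 1 (DIM('a) - b)"

lemma kernel_maximal:
  assumes S: "0 < S"
  obtains K where "0 \<le> K"
    "\<And>s. \<lbrakk>0 < s; s \<le> S\<rbrakk> \<Longrightarrow> \<exists>\<kappa>\<in>borel_measurable borel. (\<forall>x. \<forall>t\<in>{1..2}. kernel s t x \<le> \<kappa> x) \<and>
      (\<integral>\<^sup>+x. \<kappa> x \<partial>lborel) \<le> ennreal (K * s powr (- (gam / 2)))"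
proof (cases "DIM('a) - b \<le> 1")
  case True
  then have g: "gam = DIM('a) - b" by (simp add: gam_def)
  show ?thesis
    by (rule kernel_maximal_dim[OF S]) (rule that[unfolded g])
next
  case False
  then have g: "gam = 1" by (simp add: gam_def)
  show ?thesis
    by (rule kernel_maximal_net[OF S]) (rule that[unfolded g])
qed

end

section \<open>Gaussian means of open sets\<close>

lemma emeasure_eventually_le:
  assumes [measurable]: "\<And>n. B n \<in> sets M"
    and bound: "\<And>n. emeasure M (B n) \<le> c"
    and A: "\<And>x. x \<in> A \<Longrightarrow> eventually (\<lambda>n. x \<in> B n) sequentially"
  shows "emeasure M A \<le> c"
proof -
  \<comment> \<open>The sets \<open>I n\<close> increase and cover \<open>A\<close>: Fatou's lemma
    for sets, in a form that asks of \<open>A\<close> only to lie in the lower limit.\<close>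
  define I where "I n = (\<Inter>m\<in>{n..}. B m)" for n
  have [measurable]: "I n \<in> sets M" for n
    unfolding I_def by measurable
  have "A \<subseteq> (\<Union>n. I n)"
    using A by (fastforce simp: I_def eventually_sequentially)
  then have "emeasure M A \<le> emeasure M (\<Union>n. I n)"
    by (intro emeasure_mono) auto
  also have "\<dots> = (SUP n. emeasure M (I n))"
    by (intro SUP_emeasure_incseq[symmetric]) (auto simp: I_def incseq_def)
  also have "\<dots> \<le> c"
  proof (rule SUP_least)
    fix n
    have "emeasure M (I n) \<le> emeasure M (B n)"
      by (intro emeasure_mono) (auto simp: I_def)
    then show "emeasure M (I n) \<le> c"
      using bound[of n] by (rule order_trans)
  qed
  finally show ?thesis .
qed

text \<open>Half of the exponent is spent on the small factor, and the other half is a Gaussian with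
  parameter 2 s, which still integrates to a constant.\<close>

lemma gauss_outside_ball:
  fixes x :: "'a::euclidean_space"
  assumes s: "0 < s" and r: "0 < r"
  shows "(\<integral>\<^sup>+z. indicator (- ball x r) z * ennreal (gauss s (x - z)) \<partial>lborel) \<le> ennreal (2 powr (DIM('a) / 2) * exp (- (pi * r\<^sup>2 / (2 * s))))"
proof -
  define c where "c = ennreal (2 powr (DIM('a) / 2) * exp (- (pi * r\<^sup>2 / (2 * s))))"
  have le: "gauss s (x - z) \<le> 2 powr (DIM('a) / 2) * exp (- (pi * r\<^sup>2 / (2 * s))) * gauss (2 * s) (x - z)" if "r \<le> norm (x - z)" for z
  proof -
    have "r\<^sup>2 \<le> (norm (x - z))\<^sup>2"
      using r that by (intro power_mono) auto
    then have "pi * r\<^sup>2 \<le> pi * (norm (x - z))\<^sup>2"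
      by simp
    then have "pi * r\<^sup>2 / (2 * s) + pi * (norm (x - z))\<^sup>2 / (2 * s) \<le> pi * (norm (x - z))\<^sup>2 / s"
      using s by (simp add: field_simps)
    then have "exp (- (pi * (norm (x - z))\<^sup>2 / s)) \<le> exp (- (pi * r\<^sup>2 / (2 * s)) + - (pi * (norm (x - z))\<^sup>2 / (2 * s)))"
      by simp
    then have "gauss s (x - z) \<le> s powr (- (DIM('a) / 2)) * (exp (- (pi * r\<^sup>2 / (2 * s))) * exp (- (pi * (norm (x - z))\<^sup>2 / (2 * s))))"
      unfolding gauss_def exp_add by (intro mult_left_mono) auto
    also have "s powr (- (DIM('a) / 2)) = 2 powr (DIM('a) / 2) * (2 * s) powr (- (DIM('a) / 2))"
      using s by (simp add: powr_mult powr_minus)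
    finally show ?thesis
      by (simp add: gauss_def mult_ac)
  qed
  have "(\<integral>\<^sup>+z. indicator (- ball x r) z * ennreal (gauss s (x - z)) \<partial>lborel) \<le> (\<integral>\<^sup>+z. c * ennreal (gauss (2 * s) (x - z)) \<partial>lborel)"
  proof (intro nn_integral_mono)
    fix z
    show "indicator (- ball x r) z * ennreal (gauss s (x - z)) \<le> c * ennreal (gauss (2 * s) (x - z))"
    proof (cases "z \<in> ball x r")
      case False
      then have "r \<le> norm (x - z)"
        by (simp add: dist_norm)
      then show ?thesis
        using ennreal_leI[OF le] False unfolding c_def by (subst ennreal_mult[symmetric]) auto
    qed simp
  qed
  also have "\<dots> = c"
    using nn_integral_gauss(1)[of "2 * s" x] s by (subst nn_integral_cmult) auto
  finally show ?thesis
    by (simp add: c_def)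
qed

definition smoothed :: "real \<Rightarrow> 'a::euclidean_space set \<Rightarrow> 'a \<Rightarrow> ennreal"
  where "smoothed s U x = (\<integral>\<^sup>+z. indicator U z * ennreal (gauss s (x - z)) \<partial>lborel)"

lemma borel_measurable_smoothed [measurable]:
  assumes [measurable]: "U \<in> sets borel"
  shows "smoothed s U \<in> borel_measurable borel"
  unfolding smoothed_def[abs_def] by measurable

lemma smoothed_le_1:
  assumes "0 < s"
  shows "smoothed s U x \<le> 1"
proof -
  have "smoothed s U x \<le> (\<integral>\<^sup>+z. ennreal (gauss s (x - z)) \<partial>lborel)"
    unfolding smoothed_def by (intro nn_integral_mono) (auto simp: indicator_def)
  then show ?thesis
    using nn_integral_gauss(1)[OF assms, of x] by simp
qed

text \<open>At a point of \<open>U\<close> a whole ball lies in \<open>U\<close>, and the Gaussian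
  loses only an exponentially small mass outside this ball. Off \<open>U\<close> there is nothing to
  show.\<close>

lemma indicator_le_liminf_smoothed:
  fixes U :: "'a::euclidean_space set"
  assumes U: "open U" and \<delta>: "\<And>n. 0 < \<delta> n" "\<delta> \<longlonglongrightarrow> 0"
  shows "indicator U x \<le> liminf (\<lambda>n. smoothed (\<delta> n) U x)"
proof (cases "x \<in> U")
  case True
  obtain r where r: "0 < r" "ball x r \<subseteq> U"
    using U True openE by blast
  have [measurable]: "U \<in> sets borel"
    using U by simp
  define h where "h n = 2 powr (DIM('a) / 2) * exp (- (pi * r\<^sup>2 / (2 * \<delta> n)))" for n
  have h0: "0 \<le> h n" for n
    by (simp add: h_def)
  have ge: "ennreal (1 - h n) \<le> smoothed (\<delta> n) U x" for n
  proof -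
    have "1 = (\<integral>\<^sup>+z. ennreal (gauss (\<delta> n) (x - z)) \<partial>lborel)"
      using nn_integral_gauss(1)[OF \<delta>(1), of n x] by simp
    also have "\<dots> \<le> (\<integral>\<^sup>+z. indicator U z * ennreal (gauss (\<delta> n) (x - z)) + indicator (- ball x r) z * ennreal (gauss (\<delta> n) (x - z)) \<partial>lborel)"
      using r by (intro nn_integral_mono) (auto simp: indicator_def)
    also have "\<dots> = smoothed (\<delta> n) U x + (\<integral>\<^sup>+z. indicator (- ball x r) z * ennreal (gauss (\<delta> n) (x - z)) \<partial>lborel)"
      unfolding smoothed_def by (rule nn_integral_add) measurable
    also have "\<dots> \<le> smoothed (\<delta> n) U x + ennreal (h n)"
      unfolding h_def using gauss_outside_ball[OF \<delta>(1) r(1)] by (intro add_left_mono)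
    finally have "1 \<le> smoothed (\<delta> n) U x + ennreal (h n)" .
    then have "1 - ennreal (h n) \<le> smoothed (\<delta> n) U x"
      by (simp add: ennreal_minus_le_iff add.commute)
    then show ?thesis
      using h0[of n] by (simp add: ennreal_minus flip: ennreal_1)
  qed
  have "filterlim \<delta> (at_right 0) sequentially"
    using \<delta> by (intro filterlim_atI[THEN filterlim_mono[OF _ order_refl order_refl]] tendsto_imp_filterlim_at_right) auto
  then have "h \<longlonglongrightarrow> 0"
  proof -
    have "((\<lambda>s. 2 powr (DIM('a) / 2) * exp (- (pi * r\<^sup>2 / (2 * s)))) \<longlongrightarrow> 0) (at_right 0)"
      using r by real_asymp
    from filterlim_compose[OF this \<open>filterlim \<delta> (at_right 0) sequentially\<close>] show ?thesis
      unfolding h_def[abs_def] by simp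
  qed
  then have "(\<lambda>n. ennreal (1 - h n)) \<longlonglongrightarrow> ennreal (1 - 0)"
    by (intro tendsto_intros)
  then have "liminf (\<lambda>n. ennreal (1 - h n)) = 1"
    by (simp add: lim_imp_Liminf)
  moreover have "liminf (\<lambda>n. ennreal (1 - h n)) \<le> liminf (\<lambda>n. smoothed (\<delta> n) U x)"
    using ge by (intro Liminf_mono) auto
  ultimately show ?thesis
    using True by simp
qed simp

context decaying_measure
begin

definition pos_max :: "('a \<Rightarrow> ennreal) \<Rightarrow> 'a \<Rightarrow> ennreal"
  where "pos_max g x = (SUP t\<in>{1..2}. \<integral>\<^sup>+y. g (x - t *\<^sub>R y) \<partial>\<mu>)"

abbreviation omax :: "'a set \<Rightarrow> 'a \<Rightarrow> ennreal"
  where "omax U \<equiv> pos_max (indicator U)"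

text \<open>The average of a Gaussian mean of the indicator. With s = \<delta> it stands in for the
  full average, with s \<ge> \<epsilon>^2 for its low frequencies.\<close>

definition low :: "real \<Rightarrow> 'a set \<Rightarrow> real \<Rightarrow> 'a \<Rightarrow> ennreal"
  where "low s U t x = (\<integral>\<^sup>+y. smoothed s U (x - t *\<^sub>R y) \<partial>\<mu>)"

lemma average_le_liminf_low:
  assumes U: "open U" and \<delta>: "\<And>n. 0 < \<delta> n" "\<delta> \<longlonglongrightarrow> 0"
  shows "(\<integral>\<^sup>+y. indicator U (x - t *\<^sub>R y) \<partial>\<mu>) \<le> liminf (\<lambda>n. low (\<delta> n) U t x)"
proof -
  have [measurable]: "U \<in> sets borel"
    using U by simp
  have "(\<integral>\<^sup>+y. indicator U (x - t *\<^sub>R y) \<partial>\<mu>) \<le> (\<integral>\<^sup>+y. liminf (\<lambda>n. smoothed (\<delta> n) U (x - t *\<^sub>R y)) \<partial>\<mu>)"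
    by (intro nn_integral_mono indicator_le_liminf_smoothed U \<delta>)
  also have "\<dots> \<le> liminf (\<lambda>n. low (\<delta> n) U t x)"
    unfolding low_def by (rule nn_integral_liminf) measurable
  finally show ?thesis .
qed

lemma low_eq_kernel:
  assumes [measurable]: "U \<in> sets borel"
  shows "low s U t x = (\<integral>\<^sup>+z. indicator U z * kernel s t (x - z) \<partial>lborel)"
proof -
  interpret P: pair_sigma_finite \<mu> "lborel :: 'a measure"
    by (simp add: pair_sigma_finite_def sigma_finite_measure_axioms lborel.sigma_finite_measure_axioms)
  have "low s U t x = (\<integral>\<^sup>+z. \<integral>\<^sup>+y. indicator U z * ennreal (gauss s (x - t *\<^sub>R y - z)) \<partial>\<mu> \<partial>lborel)"
    unfolding low_def smoothed_def
    by (rule P.Fubini'[where f = "\<lambda>y z. indicator U z * ennreal (gauss s (x - t *\<^sub>R y - z))", symmetric]) measurable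
  also have "\<dots> = (\<integral>\<^sup>+z. indicator U z * kernel s t (x - z) \<partial>lborel)"
  proof (intro nn_integral_cong)
    fix z
    have "(\<integral>\<^sup>+y. indicator U z * ennreal (gauss s (x - t *\<^sub>R y - z)) \<partial>\<mu>) = indicator U z * (\<integral>\<^sup>+y. ennreal (gauss s (x - t *\<^sub>R y - z)) \<partial>\<mu>)"
      by (rule nn_integral_cmult) measurable
    moreover have e: "(x - z) - t *\<^sub>R y = x - t *\<^sub>R y - z" for y
      by simp
    ultimately show "(\<integral>\<^sup>+y. indicator U z * ennreal (gauss s (x - t *\<^sub>R y - z)) \<partial>\<mu>) = indicator U z * kernel s t (x - z)"
      unfolding kernel_def e by simp
  qed
  finally show ?thesis .
qed

text \<open>The bound from L^1 to L^\<infinity>, by the supremum of the convolution kernel.\<close>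

lemma low_bounded:
  assumes [measurable]: "U \<in> sets borel" and K: "\<And>x. kernel s t x \<le> K"
  shows "low s U t x \<le> K * vol U"
proof -
  have "low s U t x \<le> (\<integral>\<^sup>+z. K * indicator U z \<partial>lborel)"
    unfolding low_eq_kernel[OF assms(1)] using K by (intro nn_integral_mono) (auto simp: indicator_def)
  also have "\<dots> = K * vol U"
    by (rule nn_integral_cmult_indicator) simp
  finally show ?thesis .
qed

text \<open>The bound from L^1 to L^1, by Tonelli's theorem. Convolving \<open>U\<close> with the
  majorant \<kappa> of all kernels treats every \<open>t\<close> at once and gives a measurable
  majorant.\<close>

lemma low_maximal:
  assumes [measurable]: "U \<in> sets borel" "\<kappa> \<in> borel_measurable borel"
    and \<kappa>: "\<And>x t. t \<in> {1..2} \<Longrightarrow> kernel s t x \<le> \<kappa> x" and int: "(\<integral>\<^sup>+x. \<kappa> x \<partial>lborel) \<le> K"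
  shows "\<exists>\<Lambda>\<in>borel_measurable borel. (\<forall>x. \<forall>t\<in>{1..2}. low s U t x \<le> \<Lambda> x) \<and> (\<integral>\<^sup>+x. \<Lambda> x \<partial>lborel) \<le> K * vol U"
proof (intro bexI conjI allI ballI)
  define \<Lambda> where "\<Lambda> x = (\<integral>\<^sup>+z. indicator U z * \<kappa> (x - z) \<partial>lborel)" for x
  show "\<Lambda> \<in> borel_measurable borel"
    unfolding \<Lambda>_def[abs_def] by measurable
  show "low s U t x \<le> \<Lambda> x" if "t \<in> {1..2}" for t x
    unfolding low_eq_kernel[OF assms(1)] \<Lambda>_def using \<kappa>[OF that] by (intro nn_integral_mono mult_left_mono) auto
  have shift: "(\<integral>\<^sup>+x. \<kappa> (x - z) \<partial>lborel) = (\<integral>\<^sup>+x. \<kappa> x \<partial>lborel)" for z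
    using nn_integral_distr[of "(+) (- z)" lborel borel \<kappa>] lborel_distr_plus[of "- z"]
    by (simp add: add.commute[of "- z"] diff_conv_add_uminus[symmetric] del: diff_conv_add_uminus)
  have "(\<integral>\<^sup>+x. \<Lambda> x \<partial>lborel) = (\<integral>\<^sup>+z. \<integral>\<^sup>+x. indicator U z * \<kappa> (x - z) \<partial>lborel \<partial>lborel)"
    unfolding \<Lambda>_def by (rule lborel_pair.Fubini'[where f = "\<lambda>z x. indicator U z * \<kappa> (x - z)"]) measurable
  also have "\<dots> = (\<integral>\<^sup>+z. indicator U z * (\<integral>\<^sup>+x. \<kappa> (x - z) \<partial>lborel) \<partial>lborel)"
    by (intro nn_integral_cong nn_integral_cmult) measurable
  also have "\<dots> = (\<integral>\<^sup>+z. (\<integral>\<^sup>+x. \<kappa> x \<partial>lborel) * indicator U z \<partial>lborel)"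
    unfolding shift by (simp only: mult.commute)
  also have "\<dots> = (\<integral>\<^sup>+x. \<kappa> x \<partial>lborel) * vol U"
    by (rule nn_integral_cmult_indicator) simp
  also have "\<dots> \<le> K * vol U"
    by (rule mult_right_mono[OF int]) simp
  finally show "(\<integral>\<^sup>+x. \<Lambda> x \<partial>lborel) \<le> K * vol U" .
qed

text \<open>The binomial expansion of the high frequency factor has the Gaussian mean with parameter
  \<delta> as its term i = 0. Solving for this term and applying the triangle inequality gives the
  splitting.\<close>

lemma low_le_high_plus_low:
  assumes [measurable]: "U \<in> sets borel" and U: "vol U < \<infinity>" and \<delta>: "0 < \<delta>" and \<epsilon>: "0 < \<epsilon>"
  shows "low \<delta> U t x \<le> ennreal (norm (multiplier_avg (high_symbol \<delta> \<epsilon> (\<lambda>z. of_real (indicator U z))) t x))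
    + (\<Sum>i\<in>{1..ord}. of_nat (ord choose i) * low (\<delta> + real i * \<epsilon>\<^sup>2) U t x)"
proof -
  define f where "f z = complex_of_real (indicator U z)" for z
  have f: "integrable lborel f"
    unfolding f_def using U by (intro integrable_of_real integrable_real_indicator) auto
  define s where "s i = \<delta> + real i * \<epsilon>\<^sup>2" for i
  have s: "0 < s i" for i
    using \<delta> \<epsilon> by (auto simp: s_def intro: add_pos_nonneg)
  define c where "c i = (of_nat (ord choose i) * (- 1) ^ i :: complex)" for i
  \<comment> \<open>The expansion has signs, so the extended nonnegative quantities
    \<open>smoothed\<close> and \<open>low\<close> are replaced by their real counterparts
    \<open>g\<close> and \<open>A\<close>.\<close>
  define g where "g r w = (\<integral>z. indicator U z * gauss r (w - z) \<partial>lborel)" for r w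
  have g_int: "integrable lborel (\<lambda>z. indicator U z * gauss r (w - z))" if r: "0 < r" for r w
  proof (rule integrableI_bounded)
    have "(\<integral>\<^sup>+z. ennreal (norm (indicator U z * gauss r (w - z))) \<partial>lborel) = smoothed r U w"
      unfolding smoothed_def by (intro nn_integral_cong) (auto simp: indicator_def)
    then show "(\<integral>\<^sup>+z. ennreal (norm (indicator U z * gauss r (w - z))) \<partial>lborel) < \<infinity>"
      using smoothed_le_1[OF r, of U w] by (simp add: order_le_less_trans)
  qed measurable
  have g_smoothed: "ennreal (g r w) = smoothed r U w" if r: "0 < r" for r w
    unfolding g_def smoothed_def
    by (subst nn_integral_eq_integral[symmetric, OF g_int[OF r]])
      (auto simp: indicator_def intro!: nn_integral_cong)
  have g0: "0 \<le> g r w" for r w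
    unfolding g_def by (intro integral_nonneg_AE) auto
  have g1: "g r w \<le> 1" if "0 < r" for r w
    using smoothed_le_1[OF that, of U w] g_smoothed[OF that, of w] by (simp add: ennreal_le_1[symmetric] del: ennreal_le_1)
  have [measurable]: "g r \<in> borel_measurable borel" for r
    unfolding g_def[abs_def] by measurable
  define A where "A r = (\<integral>y. g r (x - t *\<^sub>R y) \<partial>\<mu>)" for r
  have Ai: "integrable \<mu> (\<lambda>y. g r (x - t *\<^sub>R y))" if "0 < r" for r
    by (rule integrable_const_bound[where B = 1]) (use g0 g1[OF that] in auto)
  have A0: "0 \<le> A r" for r
    unfolding A_def by (intro integral_nonneg_AE) (simp add: g0)
  have A_low: "ennreal (A r) = low r U t x" if "0 < r" for r
    unfolding A_def low_def
    by (subst nn_integral_eq_integral[symmetric, OF Ai[OF that]]) (auto simp: g0 g_smoothed[OF that])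
  define h where "h = high_symbol \<delta> \<epsilon> f"
  have h: "integrable lborel h"
    unfolding h_def by (rule integrable_high_symbol[OF f \<delta>])
  have h_exp: "h \<xi> = (\<Sum>i\<le>ord. c i * (ft f \<xi> * exp (- (pi * s i * (norm \<xi>)\<^sup>2))))" for \<xi>
  proof -
    define q where "q = complex_of_real (exp (- (pi * \<epsilon>\<^sup>2 * (norm \<xi>)\<^sup>2)))"
    have "(1 - q) ^ ord = (\<Sum>i\<le>ord. c i * q ^ i)"
    proof -
      have "(1 - q) ^ ord = (- q + 1) ^ ord" by simp
      also have "\<dots> = (\<Sum>i\<le>ord. of_nat (ord choose i) * (- q) ^ i * 1 ^ (ord - i))"
        by (rule binomial_ring)
      also have "\<dots> = (\<Sum>i\<le>ord. c i * q ^ i)"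
        by (intro sum.cong) (auto simp: c_def power_minus[of q])
      finally show ?thesis .
    qed
    moreover have "exp (- (pi * \<delta> * (norm \<xi>)\<^sup>2)) * q ^ i = exp (- (pi * s i * (norm \<xi>)\<^sup>2))" for i
    proof -
      have "exp (- (pi * \<delta> * (norm \<xi>)\<^sup>2)) * exp (- (pi * \<epsilon>\<^sup>2 * (norm \<xi>)\<^sup>2)) ^ i = exp (- (pi * s i * (norm \<xi>)\<^sup>2))"
        by (simp add: s_def exp_of_nat_mult[symmetric] algebra_simps flip: exp_add)
      then show ?thesis
        unfolding q_def by (metis of_real_mult of_real_power)
    qed
    ultimately show ?thesis
      unfolding h_def high_symbol_def of_real_mult of_real_power of_real_diff of_real_1 q_def[symmetric]
      by (simp add: sum_distrib_left) (intro sum.cong refl, simp add: mult_ac)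
  qed
  have inv: "(\<integral>\<xi>. h \<xi> * ee (w \<bullet> \<xi>) \<partial>lborel) = (\<Sum>i\<le>ord. c i * g (s i) w)" for w
  proof -
    have ii: "integrable lborel (\<lambda>\<xi>. ft f \<xi> * exp (- (pi * s i * (norm \<xi>)\<^sup>2)) * ee (w \<bullet> \<xi>))" for i
      by (rule Bochner_Integration.integrable_bound[OF integrable_ft_gauss[OF f s[of i]]])
        (use f in \<open>auto simp: norm_mult borel_measurable_integrable\<close>)
    have "(\<integral>\<xi>. h \<xi> * ee (w \<bullet> \<xi>) \<partial>lborel) = (\<integral>\<xi>. (\<Sum>i\<le>ord. c i * (ft f \<xi> * exp (- (pi * s i * (norm \<xi>)\<^sup>2)) * ee (w \<bullet> \<xi>))) \<partial>lborel)"
      unfolding h_exp sum_distrib_right by (simp only: mult.assoc)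
    also have "\<dots> = (\<Sum>i\<le>ord. c i * (\<integral>\<xi>. ft f \<xi> * exp (- (pi * s i * (norm \<xi>)\<^sup>2)) * ee (w \<bullet> \<xi>) \<partial>lborel))"
      using ii by (subst Bochner_Integration.integral_sum) auto
    also have "\<dots> = (\<Sum>i\<le>ord. c i * g (s i) w)"
    proof (intro sum.cong refl arg_cong2[where f = "(*)"])
      fix i
      have "(\<integral>\<xi>. ft f \<xi> * exp (- (pi * s i * (norm \<xi>)\<^sup>2)) * ee (w \<bullet> \<xi>) \<partial>lborel) = (\<integral>z. complex_of_real (indicator U z * gauss (s i) (w - z)) \<partial>lborel)"
        unfolding ft_gauss_inversion[OF f s] by (simp add: f_def)
      then show "(\<integral>\<xi>. ft f \<xi> * exp (- (pi * s i * (norm \<xi>)\<^sup>2)) * ee (w \<bullet> \<xi>) \<partial>lborel) = g (s i) w"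
        unfolding g_def by (simp only: integral_complex_of_real)
    qed
    finally show ?thesis .
  qed
  \<comment> \<open>Writing the multiplier as an integral over \<mu> and exchanging integrals turns
    the Fourier side into averages of Gaussian means.\<close>
  have "multiplier_avg h t x = (\<integral>\<xi>. h \<xi> * (\<integral>y. 1 * (ee (x \<bullet> \<xi>) * ee (- (y \<bullet> (t *\<^sub>R \<xi>)))) \<partial>\<mu>) \<partial>lborel)"
    unfolding multiplier_avg_def muhat_def by (simp add: mult_ac)
  also have "\<dots> = (\<integral>y. 1 * (\<integral>\<xi>. h \<xi> * (ee (x \<bullet> \<xi>) * ee (- (y \<bullet> (t *\<^sub>R \<xi>)))) \<partial>lborel) \<partial>\<mu>)"
    by (rule Fubini_bounded_kernel[where B = 1])
      (auto simp: lborel.sigma_finite_measure_axioms sigma_finite_measure_axioms h norm_mult)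
  also have "\<dots> = (\<integral>y. (\<Sum>i\<le>ord. c i * g (s i) (x - t *\<^sub>R y)) \<partial>\<mu>)"
  proof (intro Bochner_Integration.integral_cong refl)
    fix y
    have "ee (x \<bullet> \<xi>) * ee (- (y \<bullet> (t *\<^sub>R \<xi>))) = ee ((x - t *\<^sub>R y) \<bullet> \<xi>)" for \<xi>
      by (simp add: inner_diff_left flip: ee_add)
    then show "1 * (\<integral>\<xi>. h \<xi> * (ee (x \<bullet> \<xi>) * ee (- (y \<bullet> (t *\<^sub>R \<xi>)))) \<partial>lborel) = (\<Sum>i\<le>ord. c i * g (s i) (x - t *\<^sub>R y))"
      unfolding inv[symmetric] by simp
  qed
  also have "\<dots> = (\<Sum>i\<le>ord. c i * A (s i))"
  proof -
    show ?thesis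
      unfolding A_def using Ai[OF s] by (subst Bochner_Integration.integral_sum) auto
  qed
  \<comment> \<open>Here s 0 = \<delta>; every other parameter is at least \<epsilon>^2.\<close>
  also have "\<dots> = A \<delta> + (\<Sum>i\<in>{1..ord}. c i * A (s i))"
  proof -
    have "{..ord} = insert 0 {1..ord}" by auto
    then show ?thesis
      by (simp add: c_def s_def)
  qed
  finally have "complex_of_real (A \<delta>) = multiplier_avg h t x - (\<Sum>i\<in>{1..ord}. c i * A (s i))"
    by simp
  then have "A \<delta> = norm (multiplier_avg h t x - (\<Sum>i\<in>{1..ord}. c i * A (s i)))"
    using A0[of \<delta>] by (metis abs_of_nonneg norm_of_real)
  also have "\<dots> \<le> norm (multiplier_avg h t x) + norm (\<Sum>i\<in>{1..ord}. c i * A (s i))"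
    by (rule norm_triangle_ineq4)
  also have "norm (\<Sum>i\<in>{1..ord}. c i * A (s i)) \<le> (\<Sum>i\<in>{1..ord}. real (ord choose i) * A (s i))"
    using A0 by (intro sum_norm_le) (simp add: c_def norm_mult norm_power)
  finally have "ennreal (A \<delta>) \<le> ennreal (norm (multiplier_avg h t x) + (\<Sum>i\<in>{1..ord}. real (ord choose i) * A (s i)))"
    by (intro ennreal_leI) simp
  also have "\<dots> = ennreal (norm (multiplier_avg h t x)) + (\<Sum>i\<in>{1..ord}. ennreal (real (ord choose i) * A (s i)))"
    using A0 by (subst ennreal_plus) (auto intro: sum_nonneg simp: sum_ennreal)
  also have "(\<Sum>i\<in>{1..ord}. ennreal (real (ord choose i) * A (s i))) = (\<Sum>i\<in>{1..ord}. of_nat (ord choose i) * low (s i) U t x)"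
    using A_low[OF s] A0 by (intro sum.cong) (auto simp: ennreal_mult ennreal_of_nat_eq_real_of_nat)
  finally show ?thesis
    using A_low[OF \<delta>] by (simp add: h_def f_def[abs_def] s_def)
qed

end

section \<open>Restricted weak type estimates\<close>

lemma Markov_lborel:
  fixes u :: "'a::euclidean_space \<Rightarrow> ennreal"
  assumes [measurable]: "u \<in> borel_measurable borel" and l: "0 < l"
  shows "vol {x. ennreal l \<le> u x} \<le> ennreal (1 / l) * (\<integral>\<^sup>+x. u x \<partial>lborel)"
proof -
  have "ennreal (1 / l) * ennreal l = 1"
    using l by (simp flip: ennreal_mult)
  then have le: "indicator {x. ennreal l \<le> u x} x \<le> ennreal (1 / l) * u x" for x
    using mult_left_mono[of "ennreal l" "u x" "ennreal (1 / l)"] by (auto simp: indicator_def)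
  have "vol {x. ennreal l \<le> u x} = (\<integral>\<^sup>+x. indicator {x. ennreal l \<le> u x} x \<partial>lborel)"
    by (subst nn_integral_indicator) auto
  also have "\<dots> \<le> (\<integral>\<^sup>+x. ennreal (1 / l) * u x \<partial>lborel)"
    by (intro nn_integral_mono le)
  also have "\<dots> = ennreal (1 / l) * (\<integral>\<^sup>+x. u x \<partial>lborel)"
    by (rule nn_integral_cmult) simp
  finally show ?thesis .
qed

context decaying_measure
begin

lemma gam_nonneg: "0 \<le> gam"
  using b by (simp add: gam_def)

text \<open>If the sum exceeds \<open>l\<close>, one part exceeds l/2. The high part is controlled
  by Chebyshev's inequality in L^2. For the low part the first estimate uses Chebyshev in L^1, while
  in the second its supremum stays below l/2, so that it contributes nothing. No constant depends on
  \<delta>.\<close>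

lemma level_set_core:
  obtains K where "0 < K"
    "\<And>U \<epsilon> \<delta> l. \<lbrakk>open U; vol U < \<infinity>; 0 < \<epsilon>; \<epsilon> \<le> 1; 0 < \<delta>; \<delta> \<le> \<epsilon>\<^sup>2; 0 < l\<rbrakk> \<Longrightarrow>
      \<exists>B\<in>sets borel. (\<forall>x. (\<exists>t\<in>{1..2}. ennreal l < low \<delta> U t x) \<longrightarrow> x \<in> B) \<and>
        vol B \<le> ennreal (K * (\<epsilon> powr (- gam) / l + \<epsilon> powr (2 * a - 1) / l\<^sup>2)) * vol U"
    "\<And>U \<epsilon> \<delta> l. \<lbrakk>open U; vol U < \<infinity>; 0 < \<epsilon>; \<epsilon> \<le> 1; 0 < \<delta>; \<delta> \<le> \<epsilon>\<^sup>2; 0 < l;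
        K * \<epsilon> powr (- (DIM('a) - b)) * measure lborel U \<le> l\<rbrakk> \<Longrightarrow>
      \<exists>B\<in>sets borel. (\<forall>x. (\<exists>t\<in>{1..2}. ennreal l < low \<delta> U t x) \<longrightarrow> x \<in> B) \<and>
        vol B \<le> ennreal (K * (\<epsilon> powr (2 * a - 1) / l\<^sup>2)) * vol U"
proof -
  obtain Kh where Kh: "0 \<le> Kh"
    "\<And>\<delta> \<epsilon> f. \<lbrakk>0 < \<delta>; 0 < \<epsilon>; \<epsilon> \<le> 1; integrable lborel f\<rbrakk> \<Longrightarrow>
      \<exists>S\<in>borel_measurable borel. (\<forall>x. \<forall>t\<in>{1..2}. ennreal ((norm (multiplier_avg (high_symbol \<delta> \<epsilon> f) t x))\<^sup>2) \<le> S x) \<and>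
        (\<integral>\<^sup>+x. S x \<partial>lborel) \<le> ennreal (Kh * \<epsilon> powr (2 * a - 1)) * (\<integral>\<^sup>+x. ennreal ((norm (f x))\<^sup>2) \<partial>lborel)"
    using high_part by blast
  have ordS: "0 < real ord + 1" by simp
  obtain Kk where Kk: "0 \<le> Kk"
    "\<And>s. \<lbrakk>0 < s; s \<le> real ord + 1\<rbrakk> \<Longrightarrow> \<exists>\<kappa>\<in>borel_measurable borel. (\<forall>x. \<forall>t\<in>{1..2}. kernel s t x \<le> \<kappa> x) \<and>
      (\<integral>\<^sup>+x. \<kappa> x \<partial>lborel) \<le> ennreal (Kk * s powr (- (gam / 2)))"
    using kernel_maximal[OF ordS] by blast
  obtain K1 where K1: "0 \<le> K1"
    "\<And>s t x. \<lbrakk>0 < s; 1 \<le> t\<rbrakk> \<Longrightarrow> kernel s t x \<le> ennreal (K1 * s powr (- ((DIM('a) - b) / 2)))"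
    using kernel_le by blast
  define M where "M = real (\<Sum>i\<in>{1..ord}. ord choose i)"
  have M: "0 \<le> M" by (simp add: M_def sum_nonneg)
  have M_eq: "(\<Sum>i\<in>{1..ord}. of_nat (ord choose i) :: ennreal) = ennreal M"
    unfolding M_def ennreal_of_nat_eq_real_of_nat by (subst sum_ennreal) auto
  define K where "K = 4 * Kh + 2 * (M * Kk) + 2 * (M * K1) + 1"
  have KMk: "0 \<le> M * Kk" "0 \<le> M * K1"
    using M Kk(1) K1(1) by auto
  have K: "0 < K" "4 * Kh \<le> K" "2 * (M * Kk) \<le> K" "2 * (M * K1) \<le> K"
    using KMk Kh(1) by (auto simp: K_def)
  \<comment> \<open>The level set of the high part, common to both estimates; the squared L^2 norm
    of the indicator is the measure of \<open>U\<close>.\<close>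
  have S_ex: "\<exists>S\<in>borel_measurable borel. (\<forall>x. \<forall>t\<in>{1..2}. ennreal ((norm (multiplier_avg (high_symbol \<delta> \<epsilon> (\<lambda>z. of_real (indicator U z))) t x))\<^sup>2) \<le> S x) \<and>
        vol {x. ennreal ((l / 2)\<^sup>2) \<le> S x} \<le> ennreal (K * (\<epsilon> powr (2 * a - 1) / l\<^sup>2)) * vol U"
    if U: "open U" "vol U < \<infinity>" and \<epsilon>: "0 < \<epsilon>" "\<epsilon> \<le> 1" and \<delta>: "0 < \<delta>" and l: "0 < l" for U \<epsilon> \<delta> l
  proof -
    have [measurable]: "U \<in> sets borel" using U by simp
    define f where "f z = complex_of_real (indicator U z)" for z
    have f: "integrable lborel f"
      unfolding f_def using U by (intro integrable_of_real integrable_real_indicator) auto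
    have "(\<integral>\<^sup>+x. ennreal ((norm (f x))\<^sup>2) \<partial>lborel) = (\<integral>\<^sup>+x. indicator U x \<partial>lborel)"
      by (intro nn_integral_cong) (auto simp: f_def indicator_def)
    then have fU: "(\<integral>\<^sup>+x. ennreal ((norm (f x))\<^sup>2) \<partial>lborel) = vol U"
      by simp
    obtain S where S: "S \<in> borel_measurable borel"
      "\<And>x t. t \<in> {1..2} \<Longrightarrow> ennreal ((norm (multiplier_avg (high_symbol \<delta> \<epsilon> f) t x))\<^sup>2) \<le> S x"
      "(\<integral>\<^sup>+x. S x \<partial>lborel) \<le> ennreal (Kh * \<epsilon> powr (2 * a - 1)) * vol U"
      using Kh(2)[OF \<delta> \<epsilon> f] unfolding fU by blast
    have "vol {x. ennreal ((l / 2)\<^sup>2) \<le> S x} \<le> ennreal (1 / (l / 2)\<^sup>2) * (\<integral>\<^sup>+x. S x \<partial>lborel)"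
      using l by (intro Markov_lborel S) auto
    also have "\<dots> \<le> ennreal (1 / (l / 2)\<^sup>2) * (ennreal (Kh * \<epsilon> powr (2 * a - 1)) * vol U)"
      by (intro mult_left_mono S) auto
    also have "\<dots> = ennreal (1 / (l / 2)\<^sup>2 * (Kh * \<epsilon> powr (2 * a - 1))) * vol U"
      using Kh(1) by (subst ennreal_mult) (auto simp: mult.assoc)
    also have "\<dots> \<le> ennreal (K * (\<epsilon> powr (2 * a - 1) / l\<^sup>2)) * vol U"
    proof (intro mult_right_mono ennreal_leI)
      have "1 / (l / 2)\<^sup>2 * (Kh * \<epsilon> powr (2 * a - 1)) = (4 * Kh) * (\<epsilon> powr (2 * a - 1) / l\<^sup>2)"
        using l by (simp add: power_divide)
      also have "\<dots> \<le> K * (\<epsilon> powr (2 * a - 1) / l\<^sup>2)"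
        by (intro mult_right_mono K) auto
      finally show "1 / (l / 2)\<^sup>2 * (Kh * \<epsilon> powr (2 * a - 1)) \<le> K * (\<epsilon> powr (2 * a - 1) / l\<^sup>2)" .
    qed simp
    finally show ?thesis
      using S(1,2) unfolding f_def[abs_def] by blast
  qed
  have split: "ennreal ((l / 2)\<^sup>2) \<le> S"
    if "ennreal l < ennreal n + \<Lambda>" "\<Lambda> \<le> ennreal (l / 2)" "ennreal (n\<^sup>2) \<le> S" "0 < l" "0 \<le> n" for l n \<Lambda> S
  proof -
    have "ennreal l < ennreal n + ennreal (l / 2)"
      using that(1,2) by (metis add_left_mono order_less_le_trans)
    also have "\<dots> = ennreal (n + l / 2)"
      using that by (intro ennreal_plus[symmetric]) auto
    finally have "l < n + l / 2"
      using that by (subst (asm) ennreal_less_iff) auto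
    then have "l / 2 < n"
      by simp
    then have "(l / 2)\<^sup>2 \<le> n\<^sup>2"
      using that by (intro power_mono) auto
    then show ?thesis
      using that(3) by (meson ennreal_leI order_trans)
  qed
  \<comment> \<open>For i \<ge> 1 all parameters lie between \<epsilon>^2 and ord + 1: the lower
    bound yields powers of \<epsilon>, the upper one the uniform range required for the maximal
    kernel.\<close>
  have sb: "0 < \<delta> + real i * \<epsilon>\<^sup>2" "\<delta> + real i * \<epsilon>\<^sup>2 \<le> real ord + 1"
      "0 \<le> e \<Longrightarrow> (\<delta> + real i * \<epsilon>\<^sup>2) powr (- (e / 2)) \<le> \<epsilon> powr (- e)"
    if \<epsilon>: "0 < \<epsilon>" "\<epsilon> \<le> 1" and \<delta>: "0 < \<delta>" "\<delta> \<le> \<epsilon>\<^sup>2" and i: "i \<in> {1..ord}" for \<epsilon> \<delta> :: real and i and e :: real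
  proof -
    have e2: "0 < \<epsilon>\<^sup>2" "\<epsilon>\<^sup>2 \<le> 1"
      using \<epsilon> by (auto intro: power_le_one)
    have "1 * \<epsilon>\<^sup>2 \<le> real i * \<epsilon>\<^sup>2"
      using i by (intro mult_right_mono) auto
    then have ge: "\<epsilon>\<^sup>2 \<le> \<delta> + real i * \<epsilon>\<^sup>2"
      using \<delta> by simp
    then show "0 < \<delta> + real i * \<epsilon>\<^sup>2"
      using e2 by linarith
    have "real i * \<epsilon>\<^sup>2 \<le> real ord * 1"
      using i e2 by (intro mult_mono) auto
    then show "\<delta> + real i * \<epsilon>\<^sup>2 \<le> real ord + 1"
      using \<delta> e2 by simp
    show "(\<delta> + real i * \<epsilon>\<^sup>2) powr (- (e / 2)) \<le> \<epsilon> powr (- e)" if "0 \<le> e"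
    proof -
      have "(\<delta> + real i * \<epsilon>\<^sup>2) powr (- (e / 2)) \<le> (\<epsilon>\<^sup>2) powr (- (e / 2))"
        using ge e2 that by (intro powr_mono2') auto
      also have "(\<epsilon>\<^sup>2) powr (- (e / 2)) = (\<epsilon> powr 2) powr (- (e / 2))"
        using \<epsilon> by simp
      also have "\<dots> = \<epsilon> powr (- e)"
        unfolding powr_powr by simp
      finally show ?thesis .
    qed
  qed
  show ?thesis
  proof
    show "0 < K" by (rule K)
  next
    fix U :: "'a set" and \<epsilon> \<delta> l :: real
    assume U: "open U" "vol U < \<infinity>" and \<epsilon>: "0 < \<epsilon>" "\<epsilon> \<le> 1" and \<delta>: "0 < \<delta>" "\<delta> \<le> \<epsilon>\<^sup>2" and l: "0 < l"
    have Ub [measurable]: "U \<in> sets borel" using U by simp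
    obtain S where [measurable]: "S \<in> borel_measurable borel" and
      S: "\<And>x t. t \<in> {1..2} \<Longrightarrow> ennreal ((norm (multiplier_avg (high_symbol \<delta> \<epsilon> (\<lambda>z. of_real (indicator U z))) t x))\<^sup>2) \<le> S x"
        "vol {x. ennreal ((l / 2)\<^sup>2) \<le> S x} \<le> ennreal (K * (\<epsilon> powr (2 * a - 1) / l\<^sup>2)) * vol U"
      using S_ex[OF U \<epsilon> \<delta>(1) l] by blast
    define s where "s i = \<delta> + real i * \<epsilon>\<^sup>2" for i
    define Y where "Y = ennreal (Kk * \<epsilon> powr (- gam)) * vol U"
    have "\<forall>i\<in>{1..ord}. \<exists>\<Lambda>. \<Lambda> \<in> borel_measurable borel \<and> (\<forall>x. \<forall>t\<in>{1..2}. low (s i) U t x \<le> \<Lambda> x) \<and> (\<integral>\<^sup>+x. \<Lambda> x \<partial>lborel) \<le> Y"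
    proof
      fix i assume i: "i \<in> {1..ord}"
      note sb' = sb[OF \<epsilon> \<delta> i, folded s_def]
      obtain \<kappa> where \<kappa>: "\<kappa> \<in> borel_measurable borel" "\<And>x t. t \<in> {1..2} \<Longrightarrow> kernel (s i) t x \<le> \<kappa> x"
          "(\<integral>\<^sup>+x. \<kappa> x \<partial>lborel) \<le> ennreal (Kk * (s i) powr (- (gam / 2)))"
        using Kk(2)[OF sb'(1,2)] by blast
      have "Kk * (s i) powr (- (gam / 2)) \<le> Kk * \<epsilon> powr (- gam)"
        using sb'(3)[OF gam_nonneg] Kk(1) by (rule mult_left_mono)
      then have "(\<integral>\<^sup>+x. \<kappa> x \<partial>lborel) \<le> ennreal (Kk * \<epsilon> powr (- gam))"
        using \<kappa>(3) by (meson ennreal_leI order_trans)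
      from low_maximal[OF Ub \<kappa>(1,2) this]
      show "\<exists>\<Lambda>. \<Lambda> \<in> borel_measurable borel \<and> (\<forall>x. \<forall>t\<in>{1..2}. low (s i) U t x \<le> \<Lambda> x) \<and> (\<integral>\<^sup>+x. \<Lambda> x \<partial>lborel) \<le> Y"
        unfolding Y_def by blast
    qed
    from bchoice[OF this] obtain \<Lambda> where \<Lambda>: "\<And>i. i \<in> {1..ord} \<Longrightarrow> \<Lambda> i \<in> borel_measurable borel"
      "\<And>i x t. i \<in> {1..ord} \<Longrightarrow> t \<in> {1..2} \<Longrightarrow> low (s i) U t x \<le> \<Lambda> i x"
      "\<And>i. i \<in> {1..ord} \<Longrightarrow> (\<integral>\<^sup>+x. \<Lambda> i x \<partial>lborel) \<le> Y"
      by blast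
    define L where "L x = (\<Sum>i\<in>{1..ord}. of_nat (ord choose i) * \<Lambda> i x)" for x
    have [measurable]: "L \<in> borel_measurable borel"
      unfolding L_def[abs_def] using \<Lambda>(1) by (intro borel_measurable_sum borel_measurable_times_ennreal borel_measurable_const) auto
    have "(\<integral>\<^sup>+x. L x \<partial>lborel) = (\<Sum>i\<in>{1..ord}. \<integral>\<^sup>+x. of_nat (ord choose i) * \<Lambda> i x \<partial>lborel)"
      unfolding L_def using \<Lambda>(1) by (intro nn_integral_sum) auto
    also have "\<dots> = (\<Sum>i\<in>{1..ord}. of_nat (ord choose i) * (\<integral>\<^sup>+x. \<Lambda> i x \<partial>lborel))"
      using \<Lambda>(1) by (intro sum.cong refl nn_integral_cmult) auto
    also have "\<dots> \<le> (\<Sum>i\<in>{1..ord}. of_nat (ord choose i) * Y)"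
      using \<Lambda>(3) by (intro sum_mono mult_left_mono) auto
    also have "\<dots> = ennreal M * Y"
      unfolding sum_distrib_right[symmetric] M_eq ..
    finally have L_int: "(\<integral>\<^sup>+x. L x \<partial>lborel) \<le> ennreal M * Y" .
    have "vol {x. ennreal (l / 2) \<le> L x} \<le> ennreal (1 / (l / 2)) * (\<integral>\<^sup>+x. L x \<partial>lborel)"
      using l by (intro Markov_lborel) auto
    also have "\<dots> \<le> ennreal (1 / (l / 2)) * (ennreal M * Y)"
      by (intro mult_left_mono L_int) auto
    also have "\<dots> = ennreal (1 / (l / 2) * (M * (Kk * \<epsilon> powr (- gam)))) * vol U"
    proof -
      have "ennreal (1 / (l / 2) * (M * (Kk * \<epsilon> powr (- gam)))) = ennreal (1 / (l / 2)) * ennreal (M * (Kk * \<epsilon> powr (- gam)))"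
        using l M Kk(1) by (intro ennreal_mult) auto
      also have "ennreal (M * (Kk * \<epsilon> powr (- gam))) = ennreal M * ennreal (Kk * \<epsilon> powr (- gam))"
        using M Kk(1) by (intro ennreal_mult) auto
      finally show ?thesis
        unfolding Y_def by (simp only: mult.assoc)
    qed
    also have "\<dots> \<le> ennreal (K * (\<epsilon> powr (- gam) / l)) * vol U"
    proof (intro mult_right_mono ennreal_leI)
      have "1 / (l / 2) * (M * (Kk * \<epsilon> powr (- gam))) = (2 * (M * Kk)) * (\<epsilon> powr (- gam) / l)"
        by simp
      also have "\<dots> \<le> K * (\<epsilon> powr (- gam) / l)"
        using l by (intro mult_right_mono K) auto
      finally show "1 / (l / 2) * (M * (Kk * \<epsilon> powr (- gam))) \<le> K * (\<epsilon> powr (- gam) / l)" .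
    qed simp
    finally have L_level: "vol {x. ennreal (l / 2) \<le> L x} \<le> ennreal (K * (\<epsilon> powr (- gam) / l)) * vol U" .
    define B where "B = {x. ennreal ((l / 2)\<^sup>2) \<le> S x} \<union> {x. ennreal (l / 2) \<le> L x}"
    have [measurable]: "{x. ennreal ((l / 2)\<^sup>2) \<le> S x} \<in> sets borel" "{x. ennreal (l / 2) \<le> L x} \<in> sets borel"
      by measurable
    have "B \<in> sets borel"
      unfolding B_def by measurable
    moreover have "x \<in> B" if t: "t \<in> {1..2}" "ennreal l < low \<delta> U t x" for x t
    proof (rule ccontr)
      assume "x \<notin> B"
      then have nB: "\<not> ennreal ((l / 2)\<^sup>2) \<le> S x" "L x \<le> ennreal (l / 2)"
        by (auto simp: B_def)
      define n where "n = norm (multiplier_avg (high_symbol \<delta> \<epsilon> (\<lambda>z. of_real (indicator U z))) t x)"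
      have "low \<delta> U t x \<le> ennreal n + (\<Sum>i\<in>{1..ord}. of_nat (ord choose i) * low (s i) U t x)"
        unfolding n_def s_def by (rule low_le_high_plus_low[OF Ub U(2) \<delta>(1) \<epsilon>(1)])
      also have "\<dots> \<le> ennreal n + L x"
        unfolding L_def using \<Lambda>(2)[OF _ t(1)] by (intro add_left_mono sum_mono mult_left_mono) auto
      finally have "ennreal l < ennreal n + L x"
        using t(2) by (rule order_less_le_trans[rotated])
      moreover have "ennreal (n\<^sup>2) \<le> S x"
        unfolding n_def by (rule S(1)[OF t(1)])
      moreover have "0 \<le> n"
        by (simp add: n_def)
      ultimately show False
        using split[of l n "L x" "S x"] nB l by blast
    qed
    moreover have "vol B \<le> ennreal (K * (\<epsilon> powr (- gam) / l + \<epsilon> powr (2 * a - 1) / l\<^sup>2)) * vol U"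
    proof -
      have "vol B \<le> vol {x. ennreal ((l / 2)\<^sup>2) \<le> S x} + vol {x. ennreal (l / 2) \<le> L x}"
        unfolding B_def by (rule emeasure_subadditive) auto
      also have "\<dots> \<le> ennreal (K * (\<epsilon> powr (2 * a - 1) / l\<^sup>2)) * vol U + ennreal (K * (\<epsilon> powr (- gam) / l)) * vol U"
        by (intro add_mono S L_level)
      also have "\<dots> = ennreal (K * (\<epsilon> powr (2 * a - 1) / l\<^sup>2) + K * (\<epsilon> powr (- gam) / l)) * vol U"
        using K(1) l by (subst ennreal_plus) (auto simp: distrib_right)
      also have "K * (\<epsilon> powr (2 * a - 1) / l\<^sup>2) + K * (\<epsilon> powr (- gam) / l) = K * (\<epsilon> powr (- gam) / l + \<epsilon> powr (2 * a - 1) / l\<^sup>2)"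
        by (simp only: distrib_left add.commute)
      finally show ?thesis .
    qed
    ultimately show "\<exists>B\<in>sets borel. (\<forall>x. (\<exists>t\<in>{1..2}. ennreal l < low \<delta> U t x) \<longrightarrow> x \<in> B) \<and>
        vol B \<le> ennreal (K * (\<epsilon> powr (- gam) / l + \<epsilon> powr (2 * a - 1) / l\<^sup>2)) * vol U"
      by (intro bexI[of _ B]) auto
  next
    fix U :: "'a set" and \<epsilon> \<delta> l :: real
    assume U: "open U" "vol U < \<infinity>" and \<epsilon>: "0 < \<epsilon>" "\<epsilon> \<le> 1" and \<delta>: "0 < \<delta>" "\<delta> \<le> \<epsilon>\<^sup>2" and l: "0 < l"
      and small: "K * \<epsilon> powr (- (DIM('a) - b)) * measure lborel U \<le> l"
    have Ub [measurable]: "U \<in> sets borel" using U by simp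
    have U_eq: "vol U = ennreal (measure lborel U)"
      using U by (intro emeasure_eq_ennreal_measure) auto
    obtain S where [measurable]: "S \<in> borel_measurable borel" and
      S: "\<And>x t. t \<in> {1..2} \<Longrightarrow> ennreal ((norm (multiplier_avg (high_symbol \<delta> \<epsilon> (\<lambda>z. of_real (indicator U z))) t x))\<^sup>2) \<le> S x"
        "vol {x. ennreal ((l / 2)\<^sup>2) \<le> S x} \<le> ennreal (K * (\<epsilon> powr (2 * a - 1) / l\<^sup>2)) * vol U"
      using S_ex[OF U \<epsilon> \<delta>(1) l] by blast
    define s where "s i = \<delta> + real i * \<epsilon>\<^sup>2" for i
    define Y where "Y = K1 * \<epsilon> powr (- (DIM('a) - b)) * measure lborel U"
    have Y: "0 \<le> Y"
      using K1 by (simp add: Y_def)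
    have low_Y: "low (s i) U t x \<le> ennreal Y" if i: "i \<in> {1..ord}" and t: "t \<in> {1..2}" for i t x
    proof -
      note sb' = sb[OF \<epsilon> \<delta> i, folded s_def]
      have "0 \<le> DIM('a) - b" using b by simp
      then have "K1 * (s i) powr (- ((DIM('a) - b) / 2)) \<le> K1 * \<epsilon> powr (- (DIM('a) - b))"
        by (intro mult_left_mono sb'(3) K1(1))
      then have k: "kernel (s i) t x \<le> ennreal (K1 * \<epsilon> powr (- (DIM('a) - b)))" for x
        using K1(2)[OF sb'(1), of t x] t by (meson atLeastAtMost_iff ennreal_leI order_trans)
      have "low (s i) U t x \<le> ennreal (K1 * \<epsilon> powr (- (DIM('a) - b))) * vol U"
        by (rule low_bounded[OF Ub k])
      also have "\<dots> = ennreal Y"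
        unfolding U_eq Y_def using K1(1) by (intro ennreal_mult[symmetric]) auto
      finally show ?thesis .
    qed
    define B where "B = {x. ennreal ((l / 2)\<^sup>2) \<le> S x}"
    have "B \<in> sets borel"
      unfolding B_def by measurable
    moreover have "x \<in> B" if t: "t \<in> {1..2}" "ennreal l < low \<delta> U t x" for x t
    proof -
      define n where "n = norm (multiplier_avg (high_symbol \<delta> \<epsilon> (\<lambda>z. of_real (indicator U z))) t x)"
      have "low \<delta> U t x \<le> ennreal n + (\<Sum>i\<in>{1..ord}. of_nat (ord choose i) * low (s i) U t x)"
        unfolding n_def s_def by (rule low_le_high_plus_low[OF Ub U(2) \<delta>(1) \<epsilon>(1)])
      also have "\<dots> \<le> ennreal n + (\<Sum>i\<in>{1..ord}. of_nat (ord choose i) * ennreal Y)"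
        using low_Y[OF _ t(1)] by (intro add_left_mono sum_mono mult_left_mono) auto
      also have "(\<Sum>i\<in>{1..ord}. of_nat (ord choose i) * ennreal Y) = ennreal (M * Y)"
        unfolding sum_distrib_right[symmetric] M_eq using M Y by (intro ennreal_mult[symmetric]) auto
      finally have "ennreal l < ennreal n + ennreal (M * Y)"
        using t(2) by (rule order_less_le_trans[rotated])
      \<comment> \<open>The smallness assumption is tailored to this: the low part cannot exceed l/2
        at any point.\<close>
      moreover have "ennreal (M * Y) \<le> ennreal (l / 2)"
      proof (rule ennreal_leI)
        have "2 * (M * Y) = (2 * (M * K1)) * (\<epsilon> powr (- (DIM('a) - b)) * measure lborel U)"
          by (simp add: Y_def)
        also have "\<dots> \<le> K * (\<epsilon> powr (- (DIM('a) - b)) * measure lborel U)"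
          by (intro mult_right_mono K) auto
        also have "\<dots> \<le> l"
          using small by (simp only: mult.assoc)
        finally show "M * Y \<le> l / 2" by simp
      qed
      moreover have "ennreal (n\<^sup>2) \<le> S x"
        unfolding n_def by (rule S(1)[OF t(1)])
      moreover have "0 \<le> n"
        by (simp add: n_def)
      ultimately show ?thesis
        using split[of l n "ennreal (M * Y)" "S x"] l by (simp add: B_def)
    qed
    ultimately show "\<exists>B\<in>sets borel. (\<forall>x. (\<exists>t\<in>{1..2}. ennreal l < low \<delta> U t x) \<longrightarrow> x \<in> B) \<and>
        vol B \<le> ennreal (K * (\<epsilon> powr (2 * a - 1) / l\<^sup>2)) * vol U"
      using S(2) by (intro bexI[of _ B]) (auto simp: B_def)
  qed
qed

text \<open>The indicator of an open set is lower semicontinuous, and by Fatou's lemma so are its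
  averages.\<close>

lemma open_average_level:
  assumes U: "open U"
  shows "open {x. c < (\<integral>\<^sup>+y. indicator U (x - t *\<^sub>R y) \<partial>\<mu>)}"
proof -
  have [measurable]: "U \<in> sets borel" using U by simp
  have "closed {x. (\<integral>\<^sup>+y. indicator U (x - t *\<^sub>R y) \<partial>\<mu>) \<le> c}"
    unfolding closed_sequential_limits
  proof (intro allI impI, elim conjE)
    fix x l assume x: "\<forall>n. x n \<in> {x. (\<integral>\<^sup>+y. indicator U (x - t *\<^sub>R y) \<partial>\<mu>) \<le> c}" and lim: "x \<longlonglongrightarrow> l"
    have "indicator U (l - t *\<^sub>R y) \<le> liminf (\<lambda>n. indicator U (x n - t *\<^sub>R y) :: ennreal)" for y
    proof (cases "l - t *\<^sub>R y \<in> U")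
      case True
      have "(\<lambda>n. x n - t *\<^sub>R y) \<longlonglongrightarrow> l - t *\<^sub>R y"
        by (intro tendsto_intros lim)
      then have "eventually (\<lambda>n. x n - t *\<^sub>R y \<in> U) sequentially"
        using U True by (rule topological_tendstoD)
      then have "eventually (\<lambda>n. 1 \<le> (indicator U (x n - t *\<^sub>R y) :: ennreal)) sequentially"
        by eventually_elim simp
      then show ?thesis
        using True by (auto intro: Liminf_bounded)
    qed simp
    then have "(\<integral>\<^sup>+y. indicator U (l - t *\<^sub>R y) \<partial>\<mu>) \<le> (\<integral>\<^sup>+y. liminf (\<lambda>n. indicator U (x n - t *\<^sub>R y)) \<partial>\<mu>)"
      by (intro nn_integral_mono)
    also have "\<dots> \<le> liminf (\<lambda>n. \<integral>\<^sup>+y. indicator U (x n - t *\<^sub>R y) \<partial>\<mu>)"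
      by (rule nn_integral_liminf) measurable
    also have "\<dots> \<le> c"
      using x by (intro Liminf_le) auto
    finally show "l \<in> {x. (\<integral>\<^sup>+y. indicator U (x - t *\<^sub>R y) \<partial>\<mu>) \<le> c}"
      by simp
  qed
  moreover have "- {x. (\<integral>\<^sup>+y. indicator U (x - t *\<^sub>R y) \<partial>\<mu>) \<le> c} = {x. c < (\<integral>\<^sup>+y. indicator U (x - t *\<^sub>R y) \<partial>\<mu>)}"
    by auto
  ultimately show ?thesis
    by (metis open_Compl)
qed

text \<open>A union of open sets over all \<open>t\<close>, so measurability holds although the
  supremum is uncountable.\<close>

lemma open_level:
  assumes "open U"
  shows "open {x. c < omax U x}"
proof -
  have "{x. c < omax U x} = (\<Union>t\<in>{1..2}. {x. c < (\<integral>\<^sup>+y. indicator U (x - t *\<^sub>R y) \<partial>\<mu>)})"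
    by (auto simp: pos_max_def less_SUP_iff)
  then show ?thesis
    using open_average_level[OF assms] by auto
qed

lemma borel_measurable_pos_max_open:
  assumes "open U"
  shows "omax U \<in> borel_measurable borel"
  using open_level[OF assms] by (intro borel_measurableI_greater) simp

lemma pos_max_indicator_le: "omax U x \<le> ennreal mass"
proof -
  have "(\<integral>\<^sup>+y. indicator U (x - t *\<^sub>R y) \<partial>\<mu>) \<le> (\<integral>\<^sup>+y. 1 \<partial>\<mu>)" for t
    by (intro nn_integral_mono) (auto simp: indicator_def)
  then show ?thesis
    unfolding pos_max_def by (intro SUP_least) (simp add: emeasure_mu_UNIV)
qed

lemma pos_max_empty [simp]: "omax {} x = 0"
  by (simp add: pos_max_def)

text \<open>The limit \<delta> -> 0 of the previous estimates: a point where some average exceeds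
  \<open>l\<close> belongs, for that same \<open>t\<close>, to the exceptional sets of all
  sufficiently small \<delta>.\<close>

lemma level_set_bounds:
  obtains K where "0 < K"
    "\<And>U \<epsilon> l. \<lbrakk>open U; vol U < \<infinity>; 0 < \<epsilon>; \<epsilon> \<le> 1; 0 < l\<rbrakk> \<Longrightarrow>
      vol {x. ennreal l < omax U x} \<le> ennreal (K * (\<epsilon> powr (- gam) / l + \<epsilon> powr (2 * a - 1) / l\<^sup>2)) * vol U"
    "\<And>U \<epsilon> l. \<lbrakk>open U; vol U < \<infinity>; 0 < \<epsilon>; \<epsilon> \<le> 1; 0 < l;
        K * \<epsilon> powr (- (DIM('a) - b)) * measure lborel U \<le> l\<rbrakk> \<Longrightarrow>
      vol {x. ennreal l < omax U x} \<le> ennreal (K * (\<epsilon> powr (2 * a - 1) / l\<^sup>2)) * vol U"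
proof -
  obtain K where K: "0 < K"
    "\<And>U \<epsilon> \<delta> l. \<lbrakk>open U; vol U < \<infinity>; 0 < \<epsilon>; \<epsilon> \<le> 1; 0 < \<delta>; \<delta> \<le> \<epsilon>\<^sup>2; 0 < l\<rbrakk> \<Longrightarrow>
      \<exists>B\<in>sets borel. (\<forall>x. (\<exists>t\<in>{1..2}. ennreal l < low \<delta> U t x) \<longrightarrow> x \<in> B) \<and>
        vol B \<le> ennreal (K * (\<epsilon> powr (- gam) / l + \<epsilon> powr (2 * a - 1) / l\<^sup>2)) * vol U"
    "\<And>U \<epsilon> \<delta> l. \<lbrakk>open U; vol U < \<infinity>; 0 < \<epsilon>; \<epsilon> \<le> 1; 0 < \<delta>; \<delta> \<le> \<epsilon>\<^sup>2; 0 < l;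
        K * \<epsilon> powr (- (DIM('a) - b)) * measure lborel U \<le> l\<rbrakk> \<Longrightarrow>
      \<exists>B\<in>sets borel. (\<forall>x. (\<exists>t\<in>{1..2}. ennreal l < low \<delta> U t x) \<longrightarrow> x \<in> B) \<and>
        vol B \<le> ennreal (K * (\<epsilon> powr (2 * a - 1) / l\<^sup>2)) * vol U"
    by (rule level_set_core) (rule that)
  have lim: "vol {x. ennreal l < omax U x} \<le> D"
    if U: "open U" and \<epsilon>: "0 < \<epsilon>" and ex: "\<And>\<delta>. \<lbrakk>0 < \<delta>; \<delta> \<le> \<epsilon>\<^sup>2\<rbrakk> \<Longrightarrow>
      \<exists>B\<in>sets borel. (\<forall>x. (\<exists>t\<in>{1..2}. ennreal l < low \<delta> U t x) \<longrightarrow> x \<in> B) \<and> vol B \<le> D" for U \<epsilon> l D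
  proof -
    define \<delta> where "\<delta> n = \<epsilon>\<^sup>2 / real (Suc n)" for n
    have \<delta>: "0 < \<delta> n" "\<delta> n \<le> \<epsilon>\<^sup>2" for n
      using \<epsilon> by (auto simp: \<delta>_def field_simps)
    have \<delta>_lim: "\<delta> \<longlonglongrightarrow> 0"
      unfolding \<delta>_def[abs_def] by (rule LIMSEQ_Suc[OF lim_const_over_n])
    have "\<forall>n. \<exists>B. B \<in> sets borel \<and> (\<forall>x. (\<exists>t\<in>{1..2}. ennreal l < low (\<delta> n) U t x) \<longrightarrow> x \<in> B) \<and> vol B \<le> D"
      using ex[OF \<delta>] by blast
    from choice[OF this] obtain B where B: "\<And>n. B n \<in> sets borel"
      "\<And>n x t. t \<in> {1..2} \<Longrightarrow> ennreal l < low (\<delta> n) U t x \<Longrightarrow> x \<in> B n" "\<And>n. vol (B n) \<le> D"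
      by blast
    show ?thesis
    proof (rule emeasure_eventually_le)
      fix x assume "x \<in> {x. ennreal l < omax U x}"
      then obtain t where t: "t \<in> {1..2}" "ennreal l < (\<integral>\<^sup>+y. indicator U (x - t *\<^sub>R y) \<partial>\<mu>)"
        by (auto simp: pos_max_def less_SUP_iff)
      have "ennreal l < liminf (\<lambda>n. low (\<delta> n) U t x)"
        by (rule order_less_le_trans[OF t(2) average_le_liminf_low[OF U \<delta>(1) \<delta>_lim]])
      then have "eventually (\<lambda>n. ennreal l < low (\<delta> n) U t x) sequentially"
        using less_LiminfD by blast
      then show "eventually (\<lambda>n. x \<in> B n) sequentially"
        by eventually_elim (rule B(2)[OF t(1)])
    qed (use B in auto)
  qed
  show ?thesis
  proof
    show "0 < K" by (rule K)
  next
    fix U :: "'a set" and \<epsilon> l :: real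
    assume *: "open U" "vol U < \<infinity>" "0 < \<epsilon>" "\<epsilon> \<le> 1" "0 < l"
    show "vol {x. ennreal l < omax U x} \<le> ennreal (K * (\<epsilon> powr (- gam) / l + \<epsilon> powr (2 * a - 1) / l\<^sup>2)) * vol U"
      by (rule lim[OF *(1,3)]) (rule K(2)[OF *(1-4) _ _ *(5)])
  next
    fix U :: "'a set" and \<epsilon> l :: real
    assume *: "open U" "vol U < \<infinity>" "0 < \<epsilon>" "\<epsilon> \<le> 1" "0 < l"
      "K * \<epsilon> powr (- (DIM('a) - b)) * measure lborel U \<le> l"
    show "vol {x. ennreal l < omax U x} \<le> ennreal (K * (\<epsilon> powr (2 * a - 1) / l\<^sup>2)) * vol U"
      by (rule lim[OF *(1,3)]) (rule K(3)[OF *(1-4) _ _ *(5,6)])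
  qed
qed

section \<open>Restricted weak type at the vertices\<close>

lemma finite_level:
  assumes "open U" "vol U < \<infinity>" "0 < l"
  shows "vol {x. ennreal l < omax U x} < \<infinity>"
proof (rule level_set_bounds)
  fix K assume K: "\<And>U \<epsilon> l. \<lbrakk>open U; vol U < \<infinity>; 0 < \<epsilon>; \<epsilon> \<le> 1; 0 < l\<rbrakk> \<Longrightarrow>
      vol {x. ennreal l < omax U x} \<le> ennreal (K * (\<epsilon> powr (- gam) / l + \<epsilon> powr (2 * a - 1) / l\<^sup>2)) * vol U"
  have "vol {x. ennreal l < omax U x} \<le> ennreal (K * (1 powr (- gam) / l + 1 powr (2 * a - 1) / l\<^sup>2)) * vol U"
    using assms by (intro K) auto
  also have "\<dots> < \<infinity>"
    using assms by (simp add: ennreal_mult_less_top)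
  finally show ?thesis .
qed

text \<open>Real-valued so that real powers can be taken; for open \<open>U\<close> of finite
  measure and l > 0 nothing is lost, by \<open>finite_level\<close>.\<close>

definition level_measure :: "'a set \<Rightarrow> real \<Rightarrow> real"
  where "level_measure U l = measure lborel {x. ennreal l < omax U x}"

lemma level_measure_eq:
  assumes "open U" "vol U < \<infinity>" "0 < l"
  shows "vol {x. ennreal l < omax U x} = ennreal (level_measure U l)"
  unfolding level_measure_def using finite_level[OF assms]
  by (intro emeasure_eq_ennreal_measure) auto

lemma level_measure_nonneg: "0 \<le> level_measure U l"
  by (simp add: level_measure_def)

lemma level_set_nonempty:
  assumes "0 < level_measure U l"
  shows "{x. ennreal l < omax U x} \<noteq> {}"
proof
  assume e: "{x. ennreal l < omax U x} = {}"
  have "level_measure U l = 0"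
    unfolding level_measure_def e by (rule measure_empty)
  then show False
    using assms by linarith
qed

text \<open>A nonempty level set forces \<open>U\<close> to be nonempty, hence, being open, of
  positive measure. The bound l < mass is what later keeps \<epsilon> at most 1.\<close>

lemma level_measure_pos:
  assumes U: "open U" "vol U < \<infinity>" and l: "0 < l" and pos: "0 < level_measure U l"
  shows "0 < measure lborel U" "l < mass"
proof -
  have ne: "{x. ennreal l < omax U x} \<noteq> {}"
    by (rule level_set_nonempty[OF pos])
  then have "U \<noteq> {}"
    by (metis (no_types, lifting) Collect_empty_eq not_less_zero pos_max_empty)
  have "vol U \<noteq> 0"
    proof
      assume "vol U = 0"
      then have "U \<in> null_sets lborel"
        using U(1) by (intro null_setsI) auto
      then have "negligible U"
        unfolding negligible_iff_null_sets by (rule null_sets_completionI)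
      then show False
        using open_not_negligible[OF U(1) \<open>U \<noteq> {}\<close>] by simp
    qed
  then show "0 < measure lborel U"
    using U by (simp add: measure_def enn2real_positive_iff zero_less_iff_neq_zero)
  obtain x where "ennreal l < omax U x"
    using ne by auto
  then have "ennreal l < ennreal mass"
    using pos_max_indicator_le[of U x] by (rule order_less_le_trans)
  then show "l < mass"
    using l by (simp add: ennreal_less_iff)
qed

text \<open>Restricted weak type \<open>(1/u, 1/v)\<close> of the maximal operator. In this form it also makes sense for
  \<open>u = 0\<close> and \<open>v = 0\<close>, and it is preserved under convex combinations of \<open>(u, v)\<close>.\<close>

definition restricted_weak :: "real \<times> real \<Rightarrow> bool"
  where "restricted_weak w \<longleftrightarrow> (\<exists>A>0. \<forall>U l. open U \<longrightarrow> vol U < \<infinity> \<longrightarrow> 0 < l \<longrightarrow> 0 < level_measure U l \<longrightarrow>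
    level_measure U l powr (snd w) \<le> A / l * measure lborel U powr (fst w))"

text \<open>The trivial L^\<infinity> bound: a level set of positive measure has height below the
  mass.\<close>

lemma restricted_weak_zero: "restricted_weak (0, 0)"
  unfolding restricted_weak_def
proof (intro exI[of _ "mass + 1"] conjI allI impI)
  fix U l assume *: "open U" "vol U < \<infinity>" "0 < l" "0 < level_measure U l"
  show "level_measure U l powr snd (0, 0) \<le> (mass + 1) / l * measure lborel U powr fst (0, 0)"
    using level_measure_pos[OF *] * by (simp add: field_simps)
qed (use mass_nonneg in linarith)

text \<open>The weighted geometric mean of the two inequalities; the factors 1/l recombine because
  the weights add up to 1.\<close>

lemma restricted_weak_convex:
  assumes "restricted_weak w0" "restricted_weak w1" and \<theta>: "0 \<le> \<theta>" "\<theta> \<le> 1"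
  shows "restricted_weak ((1 - \<theta>) *\<^sub>R w0 + \<theta> *\<^sub>R w1)"
proof -
  obtain A0 where A0: "0 < A0" "\<And>U l. \<lbrakk>open U; vol U < \<infinity>; 0 < l; 0 < level_measure U l\<rbrakk> \<Longrightarrow>
    level_measure U l powr (snd w0) \<le> A0 / l * measure lborel U powr (fst w0)"
    using assms(1) unfolding restricted_weak_def by blast
  obtain A1 where A1: "0 < A1" "\<And>U l. \<lbrakk>open U; vol U < \<infinity>; 0 < l; 0 < level_measure U l\<rbrakk> \<Longrightarrow>
    level_measure U l powr (snd w1) \<le> A1 / l * measure lborel U powr (fst w1)"
    using assms(2) unfolding restricted_weak_def by blast
  show ?thesis
    unfolding restricted_weak_def
  proof (intro exI[of _ "A0 + A1"] conjI allI impI)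
    show "0 < A0 + A1" using A0 A1 by simp
    fix U l assume *: "open U" "vol U < \<infinity>" "0 < l" "0 < level_measure U l"
    define D where "D = level_measure U l"
    define e where "e = measure lborel U"
    define Q where "Q = (A0 + A1) / l"
    have pos: "0 < D" "0 < e" "0 < Q"
      using level_measure_pos[OF *] * A0 A1 by (auto simp: D_def e_def Q_def)
    have "A0 / l \<le> Q" "A1 / l \<le> Q"
      using * A0 A1 by (auto simp: Q_def intro: divide_right_mono)
    then have le: "D powr (snd w0) \<le> Q * e powr (fst w0)" "D powr (snd w1) \<le> Q * e powr (fst w1)"
      using A0(2)[OF *] A1(2)[OF *] unfolding D_def e_def
      by (meson mult_right_mono order_trans powr_ge_zero)+
    have "D powr ((1 - \<theta>) * snd w0 + \<theta> * snd w1) = (D powr (snd w0)) powr (1 - \<theta>) * (D powr (snd w1)) powr \<theta>"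
      by (simp add: powr_add powr_powr mult.commute)
    also have "\<dots> \<le> (Q * e powr (fst w0)) powr (1 - \<theta>) * (Q * e powr (fst w1)) powr \<theta>"
      using le \<theta> by (intro mult_mono powr_mono2) auto
    also have "\<dots> = ((Q) powr (1 - \<theta>) * (Q) powr \<theta>) * (e powr ((1 - \<theta>) * fst w0 + \<theta> * fst w1))"
      using pos by (simp add: powr_mult powr_add powr_powr mult_ac)
    also have "(Q) powr (1 - \<theta>) * (Q) powr \<theta> = Q"
      using pos by (simp flip: powr_add)
    finally show "level_measure U l powr snd ((1 - \<theta>) *\<^sub>R w0 + \<theta> *\<^sub>R w1) \<le>
        (A0 + A1) / l * measure lborel U powr fst ((1 - \<theta>) *\<^sub>R w0 + \<theta> *\<^sub>R w1)"
      by (simp add: D_def e_def Q_def)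
  qed
qed

text \<open>With \<theta> = 2a - 1 + gam, the choice \<epsilon>^\<theta> = l/m makes the terms
  \<epsilon>^(-gam) / l and \<epsilon>^(2a-1) / l^2 equal up to a constant. The result is a bound by
  l^(-p) |U| with p = 1 + gam/\<theta> = 1/\<alpha>.\<close>

lemma restricted_weak_diagonal:
  defines "\<alpha> \<equiv> (2 * a - 1 + gam) / (2 * a - 1 + 2 * gam)"
  shows "restricted_weak (\<alpha>, \<alpha>)"
proof -
  obtain K where K: "0 < K"
    "\<And>U \<epsilon> l. \<lbrakk>open U; vol U < \<infinity>; 0 < \<epsilon>; \<epsilon> \<le> 1; 0 < l\<rbrakk> \<Longrightarrow>
      vol {x. ennreal l < omax U x} \<le> ennreal (K * (\<epsilon> powr (- gam) / l + \<epsilon> powr (2 * a - 1) / l\<^sup>2)) * vol U"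
    by (rule level_set_bounds) (rule that)
  define \<theta> where "\<theta> = 2 * a - 1 + gam"
  have \<theta>: "0 < \<theta>"
    using a gam_nonneg by (simp add: \<theta>_def)
  define p where "p = 1 + gam / \<theta>"
  have p: "0 < p" "p * \<alpha> = 1"
  proof -
    have d: "2 * a - 1 + 2 * gam = \<theta> + gam"
      by (simp add: \<theta>_def)
    have s: "0 < \<theta> + gam"
      using \<theta> gam_nonneg by linarith
    have p_eq: "p = (\<theta> + gam) / \<theta>"
      using \<theta> by (simp add: p_def add_divide_distrib)
    show "0 < p"
      unfolding p_eq using \<theta> s by simp
    show "p * \<alpha> = 1"
      unfolding p_eq \<alpha>_def d \<theta>_def[symmetric] using \<theta> s by simp
  qed
  have \<alpha>: "0 < \<alpha>"
    using p by (metis mult_eq_0_iff not_less_iff_gr_or_eq zero_less_mult_pos zero_less_one)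
  define m where "m = mass + 1"
  have m: "0 < m" by (simp add: m_def add_nonneg_pos)
  define K' where "K' = K * (1 + 1 / m) * m powr (gam / \<theta>)"
  have K': "0 < K'"
    using K m by (simp add: K'_def add_pos_pos)
  show ?thesis
    unfolding restricted_weak_def
  proof (intro exI[of _ "K' powr \<alpha>"] conjI allI impI)
    show "0 < K' powr \<alpha>" using K' by simp
    fix U l assume *: "open U" "vol U < \<infinity>" "0 < l" "0 < level_measure U l"
    define e where "e = measure lborel U"
    have e: "0 < e" "vol U = ennreal e"
      using level_measure_pos(1)[OF *] *(2) by (auto simp: e_def intro!: emeasure_eq_ennreal_measure)
    \<comment> \<open>Only heights below the mass occur, so after this normalisation \<epsilon> is
      at most 1.\<close>
    define r where "r = l / m"
    have r: "0 < r" "r \<le> 1"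
      using level_measure_pos(2)[OF *] *(3) m by (auto simp: r_def m_def)
    define \<epsilon> where "\<epsilon> = r powr (1 / \<theta>)"
    have \<epsilon>: "0 < \<epsilon>" "\<epsilon> \<le> 1"
      using r \<theta> by (auto simp: \<epsilon>_def intro: powr_le1)
    have "ennreal (level_measure U l) \<le> ennreal (K * (\<epsilon> powr (- gam) / l + \<epsilon> powr (2 * a - 1) / l\<^sup>2)) * ennreal e"
      using K(2)[OF *(1,2) \<epsilon> *(3)] level_measure_eq[OF *(1-3)] e(2) by simp
    also have "\<dots> = ennreal (K * (\<epsilon> powr (- gam) / l + \<epsilon> powr (2 * a - 1) / l\<^sup>2) * e)"
      using K(1) e *(3) by (intro ennreal_mult[symmetric]) auto
    finally have "level_measure U l \<le> K * (\<epsilon> powr (- gam) / l + \<epsilon> powr (2 * a - 1) / l\<^sup>2) * e"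
      using K(1) e *(3) by (subst (asm) ennreal_le_iff) auto
    also have "K * (\<epsilon> powr (- gam) / l + \<epsilon> powr (2 * a - 1) / l\<^sup>2) * e = K' * l powr (- p) * e"
    proof -
      have 1: "\<epsilon> powr (- gam) = r powr (- (gam / \<theta>))"
        by (simp add: \<epsilon>_def powr_powr)
      have "\<epsilon> powr (2 * a - 1) = r powr ((2 * a - 1) / \<theta>)"
        by (simp add: \<epsilon>_def powr_powr)
      also have "(2 * a - 1) / \<theta> = 1 + - (gam / \<theta>)"
        using \<theta> by (simp add: \<theta>_def field_simps)
      also have "r powr (1 + - (gam / \<theta>)) = r powr 1 * r powr (- (gam / \<theta>))"
        by (rule powr_add)
      finally have 2: "\<epsilon> powr (2 * a - 1) = (l / m) * r powr (- (gam / \<theta>))"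
        using *(3) m by (simp add: r_def)
      have 3: "r powr (- (gam / \<theta>)) = m powr (gam / \<theta>) * l powr (- (gam / \<theta>))"
        using *(3) m by (simp add: r_def powr_divide powr_minus_divide)
      have 4: "l powr (- (gam / \<theta>)) / l = l powr (- p)"
      proof -
        have p': "- p = - (gam / \<theta>) - 1"
          by (simp add: p_def)
        show ?thesis
          unfolding p' powr_diff using *(3) by simp
      qed
      have "\<epsilon> powr (- gam) / l + \<epsilon> powr (2 * a - 1) / l\<^sup>2 = (1 + 1 / m) * (r powr (- (gam / \<theta>)) / l)"
        unfolding 1 2 using *(3) m
        by (simp add: field_simps power2_eq_square del: powr_minus)
      also have "r powr (- (gam / \<theta>)) / l = m powr (gam / \<theta>) * (l powr (- (gam / \<theta>)) / l)"
        unfolding 3 by simp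
      finally show ?thesis
        unfolding 4 K'_def by simp
    qed
    finally have "level_measure U l powr \<alpha> \<le> (K' * l powr (- p) * e) powr \<alpha>"
      using \<alpha> level_measure_nonneg by (intro powr_mono2) auto
    also have "\<dots> = K' powr \<alpha> * l powr (- (p * \<alpha>)) * e powr \<alpha>"
      using K' *(3) e by (simp add: powr_mult powr_powr)
    also have "\<dots> = K' powr \<alpha> / l * e powr \<alpha>"
      unfolding p(2) using *(3) by (simp add: powr_minus_divide)
    finally show "level_measure U l powr snd (\<alpha>, \<alpha>) \<le> K' powr \<alpha> / l * measure lborel U powr fst (\<alpha>, \<alpha>)"
      by (simp add: e_def)
  qed
qed

lemma full_dimension:
  assumes "b = DIM('a)"
  obtains K where "0 < K"
    "\<And>U x. \<lbrakk>open U; vol U < \<infinity>\<rbrakk> \<Longrightarrow> omax U x \<le> ennreal K * vol U"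
    "\<And>U. \<lbrakk>open U; vol U < \<infinity>\<rbrakk> \<Longrightarrow> (\<integral>\<^sup>+x. omax U x \<partial>lborel) \<le> ennreal K * vol U"
proof -
  obtain K1 where K1: "0 \<le> K1"
    "\<And>s t x. \<lbrakk>0 < s; 1 \<le> t\<rbrakk> \<Longrightarrow> kernel s t x \<le> ennreal (K1 * s powr (- ((DIM('a) - b) / 2)))"
    using kernel_le by blast
  have g: "gam = 0"
    unfolding gam_def using assms by simp
  obtain K2 where K2: "0 \<le> K2"
    "\<And>s. \<lbrakk>0 < s; s \<le> 1\<rbrakk> \<Longrightarrow> \<exists>\<kappa>\<in>borel_measurable borel. (\<forall>x. \<forall>t\<in>{1..2}. kernel s t x \<le> \<kappa> x) \<and>
      (\<integral>\<^sup>+x. \<kappa> x \<partial>lborel) \<le> ennreal (K2 * s powr (- (gam / 2)))"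
    by (rule kernel_maximal[OF zero_less_one]) (rule that)
  define K where "K = K1 + K2 + 1"
  have K: "0 < K" "K1 \<le> K" "K2 \<le> K"
    using K1 K2 by (auto simp: K_def)
  define \<delta> where "\<delta> n = 1 / real (Suc n)" for n
  have \<delta>: "0 < \<delta> n" "\<delta> n \<le> 1" for n
    by (auto simp: \<delta>_def)
  have \<delta>_lim: "\<delta> \<longlonglongrightarrow> 0"
    unfolding \<delta>_def[abs_def] by (rule LIMSEQ_Suc[OF lim_const_over_n])
  show ?thesis
  proof
    show "0 < K" by (rule K)
    fix U :: "'a set" assume U: "open U" "vol U < \<infinity>"
    have Ub: "U \<in> sets borel" using U by simp
    show "omax U x \<le> ennreal K * vol U" for x
      unfolding pos_max_def
    proof (rule SUP_least)
      fix t :: real assume t: "t \<in> {1..2}"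
      have k: "kernel (\<delta> n) t x \<le> ennreal K" for n x
      proof -
        have "kernel (\<delta> n) t x \<le> ennreal K1"
          using K1(2)[OF \<delta>(1)[of n], of t x] t assms \<delta>(1)[of n] by simp
        then show ?thesis
          using K(2) by (meson ennreal_leI order_trans)
      qed
      have "(\<integral>\<^sup>+y. indicator U (x - t *\<^sub>R y) \<partial>\<mu>) \<le> liminf (\<lambda>n. low (\<delta> n) U t x)"
        by (rule average_le_liminf_low[OF U(1) \<delta>(1) \<delta>_lim])
      also have "\<dots> \<le> ennreal K * vol U"
        using low_bounded[OF Ub k] by (intro Liminf_le) auto
      finally show "(\<integral>\<^sup>+y. indicator U (x - t *\<^sub>R y) \<partial>\<mu>) \<le> ennreal K * vol U" .
    qed
    have "\<forall>n. \<exists>\<Lambda>. \<Lambda> \<in> borel_measurable borel \<and> (\<forall>x. \<forall>t\<in>{1..2}. low (\<delta> n) U t x \<le> \<Lambda> x) \<and> (\<integral>\<^sup>+x. \<Lambda> x \<partial>lborel) \<le> ennreal K * vol U"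
    proof
      fix n
      obtain \<kappa> where \<kappa>: "\<kappa> \<in> borel_measurable borel" "\<And>x t. t \<in> {1..2} \<Longrightarrow> kernel (\<delta> n) t x \<le> \<kappa> x"
          "(\<integral>\<^sup>+x. \<kappa> x \<partial>lborel) \<le> ennreal (K2 * \<delta> n powr (- (gam / 2)))"
        using K2(2)[OF \<delta>] by blast
      have "(\<integral>\<^sup>+x. \<kappa> x \<partial>lborel) \<le> ennreal K2"
        using \<kappa>(3) \<delta>(1)[of n] g by simp
      then have "(\<integral>\<^sup>+x. \<kappa> x \<partial>lborel) \<le> ennreal K"
        using K(3) by (meson ennreal_leI order_trans)
      from low_maximal[OF Ub \<kappa>(1,2) this]
      show "\<exists>\<Lambda>. \<Lambda> \<in> borel_measurable borel \<and> (\<forall>x. \<forall>t\<in>{1..2}. low (\<delta> n) U t x \<le> \<Lambda> x) \<and> (\<integral>\<^sup>+x. \<Lambda> x \<partial>lborel) \<le> ennreal K * vol U"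
        by blast
    qed
    from choice[OF this] obtain \<Lambda> where \<Lambda>: "\<And>n. \<Lambda> n \<in> borel_measurable borel"
      "\<And>n x t. t \<in> {1..2} \<Longrightarrow> low (\<delta> n) U t x \<le> \<Lambda> n x" "\<And>n. (\<integral>\<^sup>+x. \<Lambda> n x \<partial>lborel) \<le> ennreal K * vol U"
      by blast
    have "omax U x \<le> liminf (\<lambda>n. \<Lambda> n x)" for x
      unfolding pos_max_def
    proof (rule SUP_least)
      fix t :: real assume t: "t \<in> {1..2}"
      have "(\<integral>\<^sup>+y. indicator U (x - t *\<^sub>R y) \<partial>\<mu>) \<le> liminf (\<lambda>n. low (\<delta> n) U t x)"
        by (rule average_le_liminf_low[OF U(1) \<delta>(1) \<delta>_lim])
      also have "\<dots> \<le> liminf (\<lambda>n. \<Lambda> n x)"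
        using \<Lambda>(2)[OF t] by (intro Liminf_mono) auto
      finally show "(\<integral>\<^sup>+y. indicator U (x - t *\<^sub>R y) \<partial>\<mu>) \<le> liminf (\<lambda>n. \<Lambda> n x)" .
    qed
    then have "(\<integral>\<^sup>+x. omax U x \<partial>lborel) \<le> (\<integral>\<^sup>+x. liminf (\<lambda>n. \<Lambda> n x) \<partial>lborel)"
      by (intro nn_integral_mono)
    also have "\<dots> \<le> liminf (\<lambda>n. \<integral>\<^sup>+x. \<Lambda> n x \<partial>lborel)"
      using \<Lambda>(1) by (intro nn_integral_liminf) auto
    also have "\<dots> \<le> ennreal K * vol U"
      using \<Lambda>(3) by (intro Liminf_le) auto
    finally show "(\<integral>\<^sup>+x. omax U x \<partial>lborel) \<le> ennreal K * vol U" .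
  qed
qed

text \<open>The choice \<epsilon>^e = K |U| / l is the smallest for which the low part never exceeds
  l/2. The surviving high part is of order |U|^(1+k) l^(-(2+k)) with k = (2a - 1)/e; taking the
  power \<open>v\<close> with (2 + k) v = 1 gives the claim. For e = 0 it is the uniform bound of
  the case b = d.\<close>

lemma restricted_weak_off_diagonal:
  defines "e \<equiv> DIM('a) - b"
  shows "restricted_weak ((e + 2 * a - 1) / (2 * e + 2 * a - 1), e / (2 * e + 2 * a - 1))"
proof (cases "e = 0")
  case True
  then have "b = DIM('a)" by (simp add: e_def)
  then obtain K where K: "0 < K"
    "\<And>U x. \<lbrakk>open U; vol U < \<infinity>\<rbrakk> \<Longrightarrow> omax U x \<le> ennreal K * vol U"
    by (rule full_dimension) (rule that)
  have "restricted_weak (1, 0)"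
    unfolding restricted_weak_def
  proof (intro exI[of _ K] conjI allI impI)
    show "0 < K" by (rule K)
    fix U l assume *: "open U" "vol U < \<infinity>" "0 < l" "0 < level_measure U l"
    have e: "0 < measure lborel U" "vol U = ennreal (measure lborel U)"
      using level_measure_pos(1)[OF *] *(2) by (auto intro!: emeasure_eq_ennreal_measure)
    have "{x. ennreal l < omax U x} \<noteq> {}"
      by (rule level_set_nonempty[OF *(4)])
    then obtain x where "ennreal l < omax U x"
      by auto
    also have "\<dots> \<le> ennreal K * ennreal (measure lborel U)"
      using K(2)[OF *(1,2), of x] e(2) by simp
    also have "\<dots> = ennreal (K * measure lborel U)"
      using K(1) by (intro ennreal_mult[symmetric]) auto
    finally have "l < K * measure lborel U"
      using *(3) by (simp add: ennreal_less_iff)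
    then show "level_measure U l powr snd (1, 0) \<le> K / l * measure lborel U powr fst (1, 0)"
      using * e(1) by (simp add: field_simps)
  qed
  then show ?thesis
    using True a by simp
next
  case False
  then have e: "0 < e" using b by (simp add: e_def)
  obtain K where K: "0 < K"
    "\<And>U \<epsilon> l. \<lbrakk>open U; vol U < \<infinity>; 0 < \<epsilon>; \<epsilon> \<le> 1; 0 < l\<rbrakk> \<Longrightarrow>
      vol {x. ennreal l < omax U x} \<le> ennreal (K * (\<epsilon> powr (- gam) / l + \<epsilon> powr (2 * a - 1) / l\<^sup>2)) * vol U"
    "\<And>U \<epsilon> l. \<lbrakk>open U; vol U < \<infinity>; 0 < \<epsilon>; \<epsilon> \<le> 1; 0 < l;
        K * \<epsilon> powr (- (DIM('a) - b)) * measure lborel U \<le> l\<rbrakk> \<Longrightarrow>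
      vol {x. ennreal l < omax U x} \<le> ennreal (K * (\<epsilon> powr (2 * a - 1) / l\<^sup>2)) * vol U"
    by (rule level_set_bounds) (rule that)
  define k where "k = (2 * a - 1) / e"
  have k: "0 < k" using a e by (simp add: k_def)
  define v where "v = e / (2 * e + 2 * a - 1)"
  define u where "u = (e + 2 * a - 1) / (2 * e + 2 * a - 1)"
  have den: "0 < 2 * e + 2 * a - 1" using a e by linarith
  have v: "0 < v" "(2 + k) * v = 1" "(1 + k) * v = u"
  proof -
    have k2: "2 + k = (2 * e + 2 * a - 1) / e" and k1: "1 + k = (e + 2 * a - 1) / e"
      using e by (auto simp: k_def field_simps)
    show "0 < v" "(2 + k) * v = 1" "(1 + k) * v = u"
      unfolding k2 k1 v_def u_def using den e by auto
  qed
  define m where "m = mass + 2"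
  have m: "1 \<le> m" by (simp add: m_def)
  define K' where "K' = K * m * K powr k"
  have K': "0 < K'"
    using K(1) m by (simp add: K'_def)
  have "restricted_weak (u, v)"
    unfolding restricted_weak_def
  proof (intro exI[of _ "K' powr v"] conjI allI impI)
    show "0 < K' powr v" using K' by simp
    fix U l assume *: "open U" "vol U < \<infinity>" "0 < l" "0 < level_measure U l"
    define w where "w = measure lborel U"
    have w: "0 < w" "vol U = ennreal w"
      using level_measure_pos(1)[OF *] *(2) by (auto simp: w_def intro!: emeasure_eq_ennreal_measure)
    define r where "r = K * w / l"
    have r: "0 < r" using K(1) w *(3) by (simp add: r_def)
    have real_bound: "level_measure U l \<le> X * w"
      if "vol {x. ennreal l < omax U x} \<le> ennreal X * vol U" "0 \<le> X" for X
    proof -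
      have "ennreal (level_measure U l) \<le> ennreal (X * w)"
        using that level_measure_eq[OF *(1-3)] w by (simp add: ennreal_mult)
      then show ?thesis
        using that w by (subst (asm) ennreal_le_iff) auto
    qed
    have main: "level_measure U l \<le> K * m * (r powr k / l\<^sup>2) * w"
    proof (cases "r \<le> 1")
      case True
      define \<epsilon> where "\<epsilon> = r powr (1 / e)"
      have \<epsilon>: "0 < \<epsilon>" "\<epsilon> \<le> 1"
        using r e True by (auto simp: \<epsilon>_def intro: powr_le1)
      have "\<epsilon> powr (- (DIM('a) - b)) = r powr (- 1)"
        using e by (simp add: \<epsilon>_def powr_powr e_def[symmetric])
      then have "K * \<epsilon> powr (- (DIM('a) - b)) * measure lborel U \<le> l"
        using r K(1) w *(3) by (simp add: powr_minus_divide w_def[symmetric] r_def)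
      from K(3)[OF *(1,2) \<epsilon> *(3) this]
      have "level_measure U l \<le> K * (\<epsilon> powr (2 * a - 1) / l\<^sup>2) * w"
        using K(1) by (intro real_bound) auto
      also have "\<epsilon> powr (2 * a - 1) = r powr k"
        by (simp add: \<epsilon>_def powr_powr k_def)
      also have "K * (r powr k / l\<^sup>2) * w \<le> (K * m) * (r powr k / l\<^sup>2) * w"
        using K(1) m w by (intro mult_right_mono) (auto simp: mult_left_mono)
      finally show ?thesis .
    next
      case False
      \<comment> \<open>If r > 1 the optimal \<epsilon> is not admissible. The first estimate with
        \<epsilon> = 1 suffices, because r^k \<ge> 1 and the height is bounded by the mass.\<close>
      have lm: "l < m"
        using level_measure_pos(2)[OF *] by (simp add: m_def)
      have "level_measure U l \<le> K * (1 powr (- gam) / l + 1 powr (2 * a - 1) / l\<^sup>2) * w"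
        using K(1) *(3) by (intro real_bound K(2) *) auto
      also have "1 powr (- gam) / l + 1 powr (2 * a - 1) / l\<^sup>2 = (l + 1) / l\<^sup>2"
        using *(3) by (simp add: power2_eq_square add_divide_distrib)
      also have "K * ((l + 1) / l\<^sup>2) * w \<le> K * (m * r powr k / l\<^sup>2) * w"
      proof -
        have "1 \<le> r powr k"
          using False k by (intro ge_one_powr_ge_zero) auto
        moreover have "l + 1 \<le> m"
          using level_measure_pos(2)[OF *] by (simp add: m_def)
        ultimately have "l + 1 \<le> m * r powr k"
          using m mult_left_mono[of 1 "r powr k" m] by linarith
        then show ?thesis
          using K(1) w *(3) by (intro mult_right_mono mult_left_mono divide_right_mono) auto
      qed
      finally show ?thesis by simp
    qed
    also have "K * m * (r powr k / l\<^sup>2) * w = K' * l powr (- (2 + k)) * w powr (1 + k)"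
    proof -
      have 1: "r powr k = K powr k * w powr k * l powr (- k)"
        using K(1) w *(3) by (simp add: r_def powr_mult powr_divide powr_minus_divide)
      have 2: "l powr (- (2 + k)) = l powr (- k) / l\<^sup>2"
      proof -
        have k': "- (2 + k) = - k - 2" by simp
        show ?thesis
          unfolding k' powr_diff using *(3) by simp
      qed
      have 3: "w powr (1 + k) = w * w powr k"
        using w by (simp add: powr_add)
      show ?thesis
        unfolding 1 2 3 K'_def by simp
    qed
    finally have "level_measure U l powr v \<le> (K' * l powr (- (2 + k)) * w powr (1 + k)) powr v"
      using v level_measure_nonneg by (intro powr_mono2) auto
    also have "\<dots> = K' powr v * l powr (- ((2 + k) * v)) * w powr ((1 + k) * v)"
    proof -
      have "(l powr (- (2 + k))) powr v = l powr (- ((2 + k) * v))"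
        by (simp only: powr_powr mult_minus_left)
      moreover have "(w powr (1 + k)) powr v = w powr ((1 + k) * v)"
        by (rule powr_powr)
      ultimately show ?thesis
        using K' by (simp only: powr_mult)
    qed
    also have "\<dots> = K' powr v / l * w powr u"
      unfolding v(2,3) using *(3) by (simp add: powr_minus_divide)
    finally show "level_measure U l powr snd (u, v) \<le> K' powr v / l * measure lborel U powr fst (u, v)"
      by (simp add: w_def)
  qed
  then show ?thesis
    by (simp add: u_def v_def)
qed

end

section \<open>Sums over dyadic levels\<close>

text \<open>A sum over all integers as an integral for counting measure, so that Tonelli, dominated
  convergence and monotonicity are those of integrals.\<close>

abbreviation zsum :: "(int \<Rightarrow> ennreal) \<Rightarrow> ennreal"
  where "zsum f \<equiv> \<integral>\<^sup>+k. f k \<partial>count_space UNIV"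

abbreviation two :: "real \<Rightarrow> real"
  where "two x \<equiv> 2 powr x"

abbreviation dy :: "int \<Rightarrow> real"
  where "dy k \<equiv> 2 powr real_of_int k"

lemma zsum_point: "f k \<le> zsum f"
  by (rule nn_integral_ge_point) simp

lemma zsum_swap: "zsum (\<lambda>m. zsum (\<lambda>k. f m k)) = zsum (\<lambda>k. zsum (\<lambda>m. f m k))"
  by (rule nn_integral_count_space_nn_integral) auto

lemma zsum_nn_integral:
  "(\<And>k. f k \<in> borel_measurable M) \<Longrightarrow> (\<integral>\<^sup>+x. zsum (\<lambda>k. f k x) \<partial>M) = zsum (\<lambda>k. \<integral>\<^sup>+x. f k x \<partial>M)"
  by (rule nn_integral_count_space_nn_integral) auto

lemma borel_measurable_zsum [measurable (raw)]:
  assumes "\<And>k. f k \<in> borel_measurable M"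
  shows "(\<lambda>x. zsum (\<lambda>k. f k x)) \<in> borel_measurable M"
proof -
  have "zsum (\<lambda>k. f k x) = (\<Sum>n. f (int_decode n) x)" for x
    using nn_integral_bij_count_space[OF bij_int_decode, of "\<lambda>k. f k x"]
    by (simp add: nn_integral_count_space_nat)
  then show ?thesis
    using assms by simp
qed

lemma emeasure_UN_zsum:
  assumes "\<And>k::int. B k \<in> sets M"
  shows "emeasure M (\<Union>k. B k) \<le> zsum (\<lambda>k. emeasure M (B k))"
proof -
  have "emeasure M (\<Union>k. B k) = (\<integral>\<^sup>+x. indicator (\<Union>k. B k) x \<partial>M)"
    using assms by (subst nn_integral_indicator) auto
  also have "\<dots> \<le> (\<integral>\<^sup>+x. zsum (\<lambda>k. indicator (B k) x) \<partial>M)"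
  proof (intro nn_integral_mono)
    fix x
    show "indicator (\<Union>k. B k) x \<le> zsum (\<lambda>k. indicator (B k) x)"
    proof (cases "x \<in> (\<Union>k. B k)")
      case True
      then obtain k where "x \<in> B k" by blast
      then show ?thesis
        using zsum_point[of "\<lambda>k. indicator (B k) x" k] True by simp
    qed simp
  qed
  also have "\<dots> = zsum (\<lambda>k. emeasure M (B k))"
    using assms by (subst zsum_nn_integral) auto
  finally show ?thesis .
qed

text \<open>Uniformity in the real centre \<open>x\<close> is the point: moving the centre to an
  integer costs a factor 2^\<eta>, and integer translations do not change the sum.\<close>

lemma zsum_geometric:
  assumes "0 < \<eta>"
  obtains W where "0 < W" "\<And>x::real. zsum (\<lambda>k. ennreal (two (- \<eta> * \<bar>real_of_int k - x\<bar>))) \<le> ennreal W"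
proof -
  define r where "r = two (- \<eta>)"
  have r: "0 < r" "r < 1"
    using assms by (auto simp: r_def powr_less_one)
  define V where "V = 1 / (1 - r) + 1 / (1 - r)"
  have V: "0 < V"
    using r by (simp add: V_def)
  have pow: "two (- \<eta> * real n) = r ^ n" for n
    by (simp add: r_def powr_realpow[symmetric] powr_powr)
  have geo: "(\<Sum>n. ennreal (r ^ n)) = ennreal (1 / (1 - r))"
    using r by (subst suminf_ennreal2) (auto simp: suminf_geometric intro!: summable_geometric)
  have nat: "zsum (\<lambda>k. ennreal (two (- \<eta> * \<bar>real_of_int k\<bar>))) \<le> ennreal V"
  proof -
    have "zsum (\<lambda>k. ennreal (two (- \<eta> * \<bar>real_of_int k\<bar>))) = (\<integral>\<^sup>+k\<in>range int \<union> range (\<lambda>n. - int n). ennreal (two (- \<eta> * \<bar>real_of_int k\<bar>)) \<partial>count_space UNIV)"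
    proof -
      have "k \<in> range int \<union> range (\<lambda>n. - int n)" for k
        by (cases k rule: int_cases2) auto
      then show ?thesis by (intro nn_integral_cong) simp
    qed
    also have "\<dots> \<le> (\<integral>\<^sup>+k. ennreal (two (- \<eta> * \<bar>real_of_int k\<bar>)) * indicator (range int) k +
        ennreal (two (- \<eta> * \<bar>real_of_int k\<bar>)) * indicator (range (\<lambda>n. - int n)) k \<partial>count_space UNIV)"
      by (intro nn_integral_mono) (auto simp: indicator_def)
    also have "\<dots> = (\<integral>\<^sup>+k\<in>range int. ennreal (two (- \<eta> * \<bar>real_of_int k\<bar>)) \<partial>count_space UNIV) +
        (\<integral>\<^sup>+k\<in>range (\<lambda>n. - int n). ennreal (two (- \<eta> * \<bar>real_of_int k\<bar>)) \<partial>count_space UNIV)"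
      by (rule nn_integral_add) auto
    also have "(\<integral>\<^sup>+k\<in>range int. ennreal (two (- \<eta> * \<bar>real_of_int k\<bar>)) \<partial>count_space UNIV) = (\<Sum>n. ennreal (two (- \<eta> * \<bar>real_of_int (int n)\<bar>)))"
      by (subst nn_integral_count_space_indicator[symmetric], simp)
        (subst nn_integral_bij_count_space[symmetric, where A = UNIV and g = int], auto simp: nn_integral_count_space_nat bij_betw_def)
    also have "(\<integral>\<^sup>+k\<in>range (\<lambda>n. - int n). ennreal (two (- \<eta> * \<bar>real_of_int k\<bar>)) \<partial>count_space UNIV) = (\<Sum>n. ennreal (two (- \<eta> * \<bar>real_of_int (- int n)\<bar>)))"
      by (subst nn_integral_count_space_indicator[symmetric], simp)
        (subst nn_integral_bij_count_space[symmetric, where A = UNIV and g = "\<lambda>n. - int n"], auto simp: nn_integral_count_space_nat bij_betw_def inj_on_def)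
    also have "(\<Sum>n. ennreal (two (- \<eta> * \<bar>real_of_int (int n)\<bar>))) = ennreal (1 / (1 - r))"
      unfolding geo[symmetric] pow[symmetric] by simp
    also have "(\<Sum>n. ennreal (two (- \<eta> * \<bar>real_of_int (- int n)\<bar>))) = ennreal (1 / (1 - r))"
      unfolding geo[symmetric] pow[symmetric] by simp
    also have "ennreal (1 / (1 - r)) + ennreal (1 / (1 - r)) = ennreal V"
      unfolding V_def using r by (intro ennreal_plus[symmetric]) auto
    finally show ?thesis .
  qed
  show ?thesis
  proof
    show "0 < two \<eta> * V"
      using V by simp
    fix x :: real
    define n where "n = \<lfloor>x\<rfloor>"
    have le: "ennreal (two (- \<eta> * \<bar>real_of_int k - x\<bar>)) \<le> ennreal (two \<eta>) * ennreal (two (- \<eta> * \<bar>real_of_int (k - n)\<bar>))" for k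
    proof -
      have "\<bar>real_of_int (k - n)\<bar> \<le> \<bar>real_of_int k - x\<bar> + 1"
        unfolding n_def by simp linarith
      then have "\<eta> * \<bar>real_of_int (k - n)\<bar> \<le> \<eta> * (\<bar>real_of_int k - x\<bar> + 1)"
        using assms by (intro mult_left_mono) auto
      then have "- \<eta> * \<bar>real_of_int k - x\<bar> \<le> \<eta> + - \<eta> * \<bar>real_of_int (k - n)\<bar>"
        by (simp add: distrib_left)
      then have "two (- \<eta> * \<bar>real_of_int k - x\<bar>) \<le> two \<eta> * two (- \<eta> * \<bar>real_of_int (k - n)\<bar>)"
        unfolding powr_add[symmetric] by (intro powr_mono) auto
      then show ?thesis
        by (subst ennreal_mult[symmetric]) (auto intro: ennreal_leI)
    qed
    have "zsum (\<lambda>k. ennreal (two (- \<eta> * \<bar>real_of_int k - x\<bar>))) \<le> zsum (\<lambda>k. ennreal (two \<eta>) * ennreal (two (- \<eta> * \<bar>real_of_int (k - n)\<bar>)))"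
      by (intro nn_integral_mono le)
    also have "\<dots> = ennreal (two \<eta>) * zsum (\<lambda>k. ennreal (two (- \<eta> * \<bar>real_of_int (k - n)\<bar>)))"
      by (rule nn_integral_cmult) simp
    also have "zsum (\<lambda>k. ennreal (two (- \<eta> * \<bar>real_of_int (k - n)\<bar>))) = zsum (\<lambda>k. ennreal (two (- \<eta> * \<bar>real_of_int k\<bar>)))"
      by (rule nn_integral_bij_count_space) (rule bij_betwI[where g = "\<lambda>k. k + n"], auto)
    also have "ennreal (two \<eta>) * \<dots> \<le> ennreal (two \<eta>) * ennreal V"
      by (intro mult_left_mono nat) auto
    also have "\<dots> = ennreal (two \<eta> * V)"
      using V by (intro ennreal_mult[symmetric]) auto
    finally show "zsum (\<lambda>k. ennreal (two (- \<eta> * \<bar>real_of_int k - x\<bar>))) \<le> ennreal (two \<eta> * V)" .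
  qed
qed

lemma ennpowr_ennreal: "0 \<le> x \<Longrightarrow> s \<noteq> 0 \<Longrightarrow> ennpowr (ennreal x) s = ennreal (x powr s)"
  by (simp add: ennpowr_def)

text \<open>A finite positive \<open>x\<close> satisfies 2^m < x \<le> 2^(m+1) for one
  \<open>m\<close>, and that term alone suffices. The strict lower inequality matches the superlevel
  sets used later. For x = \<infinity> every level contributes and the sum diverges.\<close>

lemma ennpowr_le_levels:
  assumes q: "0 < q"
  shows "ennpowr x q \<le> zsum (\<lambda>m. ennreal (two ((real_of_int m + 1) * q)) * (if ennreal (dy m) < x then 1 else 0))"
    (is "_ \<le> zsum ?f")
proof (cases x)
  case (real r)
  show ?thesis
  proof (cases "r = 0")
    case True
    then show ?thesis
      using q real by (simp add: ennpowr_def)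
  next
    case False
    then have r: "0 < r" using real by simp
    define m where "m = \<lceil>log 2 r\<rceil> - 1"
    have "real_of_int m < log 2 r" "log 2 r \<le> real_of_int m + 1"
      unfolding m_def by linarith+
    then have m: "dy m < r" "r \<le> two (real_of_int m + 1)"
      using r by (auto simp: less_log_iff log_le_iff)
    have "r powr q \<le> two (real_of_int m + 1) powr q"
      using m r q by (intro powr_mono2) auto
    then have "ennpowr x q \<le> ennreal (two ((real_of_int m + 1) * q))"
      using real q r by (auto simp: ennpowr_ennreal powr_powr intro: ennreal_leI)
    also have "\<dots> = ?f m"
      using m real r by (simp add: ennreal_less_iff)
    also have "\<dots> \<le> zsum ?f"
      by (rule zsum_point)
    finally show ?thesis .
  qed
next
  case top
  have "zsum ?f = \<infinity>"
  proof (rule ccontr)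
    assume "zsum ?f \<noteq> \<infinity>"
    then obtain s where s: "zsum ?f = ennreal s" "0 \<le> s"
      by (cases "zsum ?f") auto
    obtain n :: nat where n: "s < (2 powr q) ^ n"
      using real_arch_pow[of "2 powr q" s] q by auto
    have "(2 powr q) ^ n = two (real n * q)"
      by (simp add: powr_realpow[symmetric] powr_powr mult.commute)
    also have "\<dots> \<le> two ((real_of_int (int n) + 1) * q)"
      using q by (intro powr_mono) auto
    finally have "ennreal ((2 powr q) ^ n) \<le> ?f (int n)"
      using top by (simp add: ennreal_leI)
    also have "\<dots> \<le> ennreal s"
      unfolding s(1)[symmetric] by (rule zsum_point)
    finally show False
      using n s(2) by (simp add: ennreal_le_iff)
  qed
  then show ?thesis by simp
qed

text \<open>If every term stayed within its share l w_k / W, the total could not exceed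
  \<open>l\<close>.\<close>

lemma pigeonhole_zsum:
  assumes W: "zsum (\<lambda>k. ennreal (w k)) \<le> ennreal W" "0 < W" and w: "\<And>k. 0 \<le> w k" and l: "0 < l"
    and gt: "ennreal l < zsum (\<lambda>k. f k)"
  shows "\<exists>k. ennreal (l / W * w k) < f k"
proof (rule ccontr)
  assume "\<not> ?thesis"
  then have "zsum (\<lambda>k. f k) \<le> zsum (\<lambda>k. ennreal (l / W) * ennreal (w k))"
    using l W w by (intro nn_integral_mono) (auto simp: not_less ennreal_mult[symmetric])
  also have "\<dots> = ennreal (l / W) * zsum (\<lambda>k. ennreal (w k))"
    by (rule nn_integral_cmult) simp
  also have "\<dots> \<le> ennreal (l / W) * ennreal W"
    by (intro mult_left_mono W) auto
  also have "\<dots> = ennreal l"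
    using l W by (simp flip: ennreal_mult)
  finally show False
    using gt by simp
qed

text \<open>Off-diagonal Marcinkiewicz interpolation for sums over dyadic levels. At level \<open>2^m\<close> the weak type
  bound with exponents \<open>(u1, v1)\<close> is used for \<open>k \<le> \<sigma> * m\<close> and the one with \<open>(u0, v0)\<close> for
  \<open>k > \<sigma> * m\<close>; \<open>\<sigma>\<close> makes both contributions balance at \<open>k = \<sigma> * m\<close>.\<close>

lemma dyadic_interpolation:
  fixes u0 v0 u1 v1 \<theta> :: real
  assumes v: "0 < v1" "v1 < v0" and u: "u1 < u0" "v0 \<le> u0" "v1 \<le> u1" and \<theta>: "0 < \<theta>" "\<theta> < 1" and A: "0 < A"
  defines "u \<equiv> (1 - \<theta>) * u0 + \<theta> * u1" and "w \<equiv> (1 - \<theta>) * v0 + \<theta> * v1"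
  obtains C where "0 < C"
    "\<And>(M :: 'b measure) g e. \<lbrakk>\<forall>k. g k \<in> borel_measurable M; \<forall>k. 0 \<le> e k;
      \<forall>k. \<forall>s>0. emeasure M {x\<in>space M. ennreal s < g k x} \<le> ennreal ((A / s * e k powr u0) powr (1 / v0));
      \<forall>k. \<forall>s>0. emeasure M {x\<in>space M. ennreal s < g k x} \<le> ennreal ((A / s * e k powr u1) powr (1 / v1));
      zsum (\<lambda>k. ennreal (two (real_of_int k / u) * e k)) \<le> 1\<rbrakk> \<Longrightarrow>
      (\<integral>\<^sup>+x. ennpowr (zsum (\<lambda>k. ennreal (dy k) * g k x)) (1 / w) \<partial>M) \<le> ennreal C"
proof -
  have uw: "0 < w" "0 < u" "v1 < w" "w < v0" "u1 < u" "u < u0"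
  proof -
    have "0 < \<theta> * (v0 - v1)" "0 < (1 - \<theta>) * (v0 - v1)" "0 < \<theta> * (u0 - u1)" "0 < (1 - \<theta>) * (u0 - u1)"
      using \<theta> u v by auto
    then show "v1 < w" "w < v0" "u1 < u" "u < u0"
      by (auto simp: u_def w_def algebra_simps)
    then show "0 < w" "0 < u" using v u by linarith+
  qed
  define p where "p = 1 / u"
  define q where "q = 1 / w"
  have pq: "0 < p" "0 < q" using uw by (auto simp: p_def q_def)
  \<comment> \<open>The slope for which both identities \<open>bal\<close> hold with the same value;
    this is possible because (u, w) lies on the segment between the two given points.\<close>
  define \<sigma> where "\<sigma> = (v0 - v1) / (u0 - u1) * u / w"
  have \<sigma>: "0 < \<sigma>"
    using uw u v by (simp add: \<sigma>_def)
  have bal: "v1 / w - 1 = \<sigma> * (u1 / u - 1)" "v0 / w - 1 = \<sigma> * (u0 / u - 1)"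
  proof -
    have wv: "v1 - w = - (1 - \<theta>) * (v0 - v1)" "v0 - w = \<theta> * (v0 - v1)" "u1 - u = - (1 - \<theta>) * (u0 - u1)" "u0 - u = \<theta> * (u0 - u1)"
      by (auto simp: u_def w_def algebra_simps)
    have c: "\<sigma> * (X * (u0 - u1) / u) = X * (v0 - v1) / w" for X
      using uw u by (simp add: \<sigma>_def)
    have d: "v1 / w - 1 = (v1 - w) / w" "v0 / w - 1 = (v0 - w) / w" "u1 / u - 1 = (u1 - u) / u" "u0 / u - 1 = (u0 - u) / u"
      using uw by (auto simp: diff_divide_distrib)
    show "v1 / w - 1 = \<sigma> * (u1 / u - 1)" "v0 / w - 1 = \<sigma> * (u0 / u - 1)"
      unfolding d wv c by (rule refl)+
  qed
  \<comment> \<open>The rates at which the two weak type bounds decay away from the line k =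
    \<sigma> m, each on its own side.\<close>
  define \<kappa>0 where "\<kappa>0 = (1 / w - 1 / v0) / \<sigma>"
  define \<kappa>1 where "\<kappa>1 = (1 / v1 - 1 / w) / \<sigma>"
  have \<kappa>01: "0 < \<kappa>0" "0 < \<kappa>1"
    using uw v \<sigma> by (auto simp: \<kappa>0_def \<kappa>1_def intro!: divide_pos_pos frac_less2)
  define \<kappa> where "\<kappa> = min \<kappa>0 \<kappa>1"
  have \<kappa>: "0 < \<kappa>" "\<kappa> \<le> \<kappa>0" "\<kappa> \<le> \<kappa>1" using \<kappa>01 by (auto simp: \<kappa>_def)
  \<comment> \<open>The pigeonhole weights lower the thresholds; \<eta> is so small that this
    consumes at most half of the decay, whichever of the two bounds is used.\<close>
  define \<eta> where "\<eta> = \<kappa> * v1 / 2"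
  have \<eta>: "0 < \<eta>" "\<eta> / v1 = \<kappa> / 2" "\<eta> / v0 \<le> \<kappa> / 2"
  proof -
    show "0 < \<eta>" "\<eta> / v1 = \<kappa> / 2" using \<kappa> v by (auto simp: \<eta>_def)
    have "\<eta> / v0 \<le> \<eta> / v1" using v \<kappa> by (intro divide_left_mono) (auto simp: \<eta>_def)
    then show "\<eta> / v0 \<le> \<kappa> / 2" using \<kappa> v by (simp add: \<eta>_def)
  qed
  obtain W where W: "0 < W" "\<And>x::real. zsum (\<lambda>k. ennreal (two (- \<eta> * \<bar>real_of_int k - x\<bar>))) \<le> ennreal W"
    by (rule zsum_geometric[OF \<eta>(1)]) (rule that)
  have \<kappa>\<sigma>: "0 < \<kappa> / 2 * \<sigma>" using \<kappa> \<sigma> by simp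
  obtain V where V: "0 < V" "\<And>x::real. zsum (\<lambda>k. ennreal (two (- (\<kappa> / 2 * \<sigma>) * \<bar>real_of_int k - x\<bar>))) \<le> ennreal V"
    by (rule zsum_geometric[OF \<kappa>\<sigma>]) (rule that)
  define A' where "A' = (A * W) powr (1 / v0) + (A * W) powr (1 / v1)"
  have A': "0 < A'" "(A * W) powr (1 / v0) \<le> A'" "(A * W) powr (1 / v1) \<le> A'"
    using A W by (auto simp: A'_def add_pos_pos)
  show ?thesis
  proof
    show "0 < two q * (A' * V)" using A' V by simp
    fix M :: "'b measure" and g e
    assume "\<forall>k. g k \<in> borel_measurable M" and "\<forall>k. 0 \<le> e k"
      and D0': "\<forall>k. \<forall>s>0. emeasure M {x\<in>space M. ennreal s < g k x} \<le> ennreal ((A / s * e k powr u0) powr (1 / v0))"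
      and D1': "\<forall>k. \<forall>s>0. emeasure M {x\<in>space M. ennreal s < g k x} \<le> ennreal ((A / s * e k powr u1) powr (1 / v1))"
      and norm: "zsum (\<lambda>k. ennreal (two (real_of_int k / u) * e k)) \<le> 1"
    then have g [measurable]: "\<And>k. g k \<in> borel_measurable M" and e: "\<And>k. 0 \<le> e k"
      by auto
    note D0 = D0'[rule_format] and D1 = D1'[rule_format]
    define H where "H x = zsum (\<lambda>k. ennreal (dy k) * g k x)" for x
    have [measurable]: "H \<in> borel_measurable M"
      unfolding H_def[abs_def] by measurable
    \<comment> \<open>The share of the level 2^m allotted to the \<open>k\<close>-th term, divided
      by the coefficient 2^k.\<close>
    define s where "s m k = dy m / W * two (- \<eta> * \<bar>real_of_int k - \<sigma> * real_of_int m\<bar>) / dy k" for m k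
    have s: "0 < s m k" for m k
      using W by (simp add: s_def)
    define F where "F m k = A' * (two (real_of_int k / u) * e k) * two (- (\<kappa> / 2) * \<bar>real_of_int k - \<sigma> * real_of_int m\<bar>)" for m k
    have F0: "0 \<le> F m k" for m k
      using A' e by (simp add: F_def)
    have e_le: "e k \<le> two (- real_of_int k / u)" for k
    proof -
      have "ennreal (two (real_of_int k / u) * e k) \<le> 1"
        using zsum_point[of "\<lambda>k. ennreal (two (real_of_int k / u) * e k)" k] norm by (rule order_trans)
      then have "two (real_of_int k / u) * e k \<le> 1"
        by (simp add: ennreal_le_1)
      then show ?thesis
        by (simp add: powr_minus field_simps)
    qed
    \<comment> \<open>Both weak type bounds lead to the same \<open>F m k\<close>; the condition
      \<open>yi\<close> expresses being on the side of the line where the bound in use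
      decays.\<close>
    have key: "two (real_of_int m * q) * (A / s m k * e k powr ui) powr (1 / vi) \<le> F m k"
      if ui: "vi \<le> ui" "0 < vi" and A'i: "(A * W) powr (1 / vi) \<le> A'" and bali: "vi / w - 1 = \<sigma> * (ui / u - 1)"
        and yi: "(real_of_int k - \<sigma> * real_of_int m) * ((1 / vi - 1 / w) / \<sigma>) \<le> - \<kappa> * \<bar>real_of_int k - \<sigma> * real_of_int m\<bar>"
        and \<eta>i: "\<eta> / vi \<le> \<kappa> / 2" for m k ui vi
    proof -
      define y where "y = real_of_int k - \<sigma> * real_of_int m"
      define K where "K = real_of_int k"
      have mK: "real_of_int m = (K - y) / \<sigma>"
        using \<sigma> by (simp add: y_def K_def)
      have As: "A / s m k = (A * W) * two (K - real_of_int m + \<eta> * \<bar>y\<bar>)"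
        unfolding s_def by (simp add: y_def K_def powr_add powr_diff powr_minus field_simps)
      \<comment> \<open>Since ui \<ge> vi the power of \<open>e k\<close> is at least 1. One factor
        is kept for the final summation, and the surplus is estimated by
        \<open>e_le\<close>.\<close>
      have ek: "(e k powr ui) powr (1 / vi) \<le> e k * two (- (K / u) * (ui / vi - 1))"
      proof (cases "e k = 0")
        case False
        then have e0: "0 < e k" using e[of k] by simp
        have "(e k powr ui) powr (1 / vi) = e k powr (1 + (ui / vi - 1))"
          by (simp add: powr_powr)
        also have "\<dots> = e k * e k powr (ui / vi - 1)"
          using e0 by (subst powr_add) simp
        also have "\<dots> \<le> e k * (two (- real_of_int k / u)) powr (ui / vi - 1)"
          using e0 e_le ui by (intro mult_left_mono powr_mono2) auto
        also have "(two (- real_of_int k / u)) powr (ui / vi - 1) = two (- (K / u) * (ui / vi - 1))"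
          by (simp add: powr_powr K_def)
        finally show ?thesis .
      qed simp
      have "two (real_of_int m * q) * (A / s m k * e k powr ui) powr (1 / vi) =
        two (real_of_int m * q) * ((A * W) powr (1 / vi) * two ((K - real_of_int m + \<eta> * \<bar>y\<bar>) / vi)) * (e k powr ui) powr (1 / vi)"
        unfolding As using A W by (simp add: powr_mult powr_powr)
      also have "\<dots> \<le> two (real_of_int m * q) * (A' * two ((K - real_of_int m + \<eta> * \<bar>y\<bar>) / vi)) * (e k * two (- (K / u) * (ui / vi - 1)))"
        using A' e by (intro mult_mono ek A'i) auto
      also have "\<dots> = A' * e k * two (real_of_int m * q + (K - real_of_int m + \<eta> * \<bar>y\<bar>) / vi + - (K / u) * (ui / vi - 1))"
        by (simp only: powr_add mult_ac)
      also have "\<dots> \<le> A' * e k * two (K / u + - (\<kappa> / 2) * \<bar>y\<bar>)"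
      proof (intro mult_left_mono powr_mono)
        have "1 / w - 1 / vi = 1 / vi * (vi / w - 1)"
          using ui by (simp add: right_diff_distrib)
        then have "K * ((1 / w - 1 / vi) / \<sigma>) = (K / vi) * ((vi / w - 1) / \<sigma>)"
          by simp
        moreover have "(K - y) / \<sigma> * (1 / w - 1 / vi) = K * ((1 / w - 1 / vi) / \<sigma>) - y * ((1 / w - 1 / vi) / \<sigma>)"
          by (metis left_diff_distrib times_divide_eq_left times_divide_eq_right)
        ultimately have "(K - y) / \<sigma> * (1 / w - 1 / vi) = (K / vi) * ((vi / w - 1) / \<sigma>) - y * ((1 / w - 1 / vi) / \<sigma>)"
          by (simp only:)
        also have "(vi / w - 1) / \<sigma> = ui / u - 1"
          unfolding bali using \<sigma> by simp
        finally have "(K - y) / \<sigma> * (1 / w - 1 / vi) = K / vi * (ui / u - 1) - y * ((1 / w - 1 / vi) / \<sigma>)" .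
        moreover have "K / vi * (ui / u - 1) = K / u * (ui / vi) - K / vi"
          by (simp add: right_diff_distrib)
        moreover have "y * ((1 / vi - 1 / w) / \<sigma>) = - (y * ((1 / w - 1 / vi) / \<sigma>))"
          by (metis minus_diff_eq minus_divide_left mult_minus_right)
        ultimately have "(K - y) / \<sigma> * (1 / w - 1 / vi) + K / vi - K / u * (ui / vi) = y * ((1 / vi - 1 / w) / \<sigma>)"
          by linarith
        moreover have "y * ((1 / vi - 1 / w) / \<sigma>) \<le> - \<kappa> * \<bar>y\<bar>"
          using yi by (simp add: y_def)
        moreover have "\<eta> / vi * \<bar>y\<bar> \<le> \<kappa> / 2 * \<bar>y\<bar>"
          using \<eta>i by (rule mult_right_mono) simp
        ultimately have "(K - y) / \<sigma> * (1 / w - 1 / vi) + K / vi - K / u * (ui / vi) + \<eta> / vi * \<bar>y\<bar> \<le> - (\<kappa> / 2) * \<bar>y\<bar>"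
          by linarith
        then show "real_of_int m * q + (K - real_of_int m + \<eta> * \<bar>y\<bar>) / vi + - (K / u) * (ui / vi - 1) \<le> K / u + - (\<kappa> / 2) * \<bar>y\<bar>"
          unfolding mK q_def by (simp add: algebra_simps add_divide_distrib diff_divide_distrib)
      qed (use A' e in auto)
      also have "\<dots> = F m k"
        unfolding F_def y_def K_def by (simp only: powr_add mult_ac)
      finally show ?thesis .
    qed
    have level: "ennreal (two (real_of_int m * q)) * emeasure M {x\<in>space M. ennreal (s m k) < g k x} \<le> ennreal (F m k)" for m k
    proof -
      define y where "y = real_of_int k - \<sigma> * real_of_int m"
      have "\<exists>X. emeasure M {x\<in>space M. ennreal (s m k) < g k x} \<le> ennreal X \<and> 0 \<le> X \<and> two (real_of_int m * q) * X \<le> F m k"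
      proof (cases "y \<le> 0")
        case True
        have "\<kappa> * \<bar>y\<bar> \<le> \<kappa>1 * \<bar>y\<bar>" using \<kappa> by (intro mult_right_mono) auto
        then have "y * ((1 / v1 - 1 / w) / \<sigma>) \<le> - \<kappa> * \<bar>y\<bar>"
          using True by (simp add: \<kappa>1_def mult.commute)
        then have "two (real_of_int m * q) * (A / s m k * e k powr u1) powr (1 / v1) \<le> F m k"
          using u v A' bal \<eta> by (intro key) (auto simp: y_def)
        then show ?thesis
          using D1[OF s[of m k], of k] by (intro exI conjI) auto
      next
        case False
        have "\<kappa> * \<bar>y\<bar> \<le> \<kappa>0 * \<bar>y\<bar>" using \<kappa> by (intro mult_right_mono) auto
        then have "y * ((1 / v0 - 1 / w) / \<sigma>) \<le> - \<kappa> * \<bar>y\<bar>"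
          using False by (simp add: \<kappa>0_def diff_divide_distrib algebra_simps)
        then have "two (real_of_int m * q) * (A / s m k * e k powr u0) powr (1 / v0) \<le> F m k"
          using u v A' bal \<eta> by (intro key) (auto simp: y_def)
        then show ?thesis
          using D0[OF s[of m k], of k] by (intro exI conjI) auto
      qed
      then obtain X where X: "emeasure M {x\<in>space M. ennreal (s m k) < g k x} \<le> ennreal X" "0 \<le> X" "two (real_of_int m * q) * X \<le> F m k"
        by blast
      have "ennreal (two (real_of_int m * q)) * emeasure M {x\<in>space M. ennreal (s m k) < g k x} \<le> ennreal (two (real_of_int m * q)) * ennreal X"
        by (intro mult_left_mono X) auto
      also have "\<dots> = ennreal (two (real_of_int m * q) * X)"
        using X by (intro ennreal_mult[symmetric]) auto
      also have "\<dots> \<le> ennreal (F m k)"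
        by (intro ennreal_leI X)
      finally show ?thesis .
    qed
    have sub: "emeasure M {x\<in>space M. ennreal (dy m) < H x} \<le> zsum (\<lambda>k. emeasure M {x\<in>space M. ennreal (s m k) < g k x})" for m
    proof -
      have "\<exists>k. ennreal (s m k) < g k x" if "ennreal (dy m) < H x" for x
      proof -
        have "\<exists>k. ennreal (dy m / W * two (- \<eta> * \<bar>real_of_int k - \<sigma> * real_of_int m\<bar>)) < ennreal (dy k) * g k x"
          using that W by (intro pigeonhole_zsum) (auto simp: H_def)
        then obtain k where k: "ennreal (dy m / W * two (- \<eta> * \<bar>real_of_int k - \<sigma> * real_of_int m\<bar>)) < ennreal (dy k) * g k x"
          by blast
        have "ennreal (s m k) < g k x"
        proof (rule ccontr)
          assume "\<not> ennreal (s m k) < g k x"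
          then have "ennreal (dy k) * g k x \<le> ennreal (dy k) * ennreal (s m k)"
            by (intro mult_left_mono) auto
          also have "\<dots> = ennreal (dy k * s m k)"
            using s[of m k] by (intro ennreal_mult[symmetric]) auto
          also have "dy k * s m k = dy m / W * two (- \<eta> * \<bar>real_of_int k - \<sigma> * real_of_int m\<bar>)"
            by (simp add: s_def)
          finally show False using k by simp
        qed
        then show ?thesis by blast
      qed
      then have "{x\<in>space M. ennreal (dy m) < H x} \<subseteq> (\<Union>k. {x\<in>space M. ennreal (s m k) < g k x})"
        by blast
      then have "emeasure M {x\<in>space M. ennreal (dy m) < H x} \<le> emeasure M (\<Union>k. {x\<in>space M. ennreal (s m k) < g k x})"
        by (intro emeasure_mono sets.countable_UN) auto
      also have "\<dots> \<le> zsum (\<lambda>k. emeasure M {x\<in>space M. ennreal (s m k) < g k x})"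
        by (rule emeasure_UN_zsum) measurable
      finally show ?thesis .
    qed
    have "(\<integral>\<^sup>+x. ennpowr (H x) q \<partial>M) \<le> (\<integral>\<^sup>+x. zsum (\<lambda>m. ennreal (two ((real_of_int m + 1) * q)) * indicator {x\<in>space M. ennreal (dy m) < H x} x) \<partial>M)"
      by (intro nn_integral_mono order_trans[OF ennpowr_le_levels[OF pq(2)]]) (auto simp: indicator_def)
    also have "\<dots> = zsum (\<lambda>m. ennreal (two ((real_of_int m + 1) * q)) * emeasure M {x\<in>space M. ennreal (dy m) < H x})"
      by (subst zsum_nn_integral) (auto simp: nn_integral_cmult_indicator)
    also have "\<dots> \<le> zsum (\<lambda>m. ennreal (two q) * zsum (\<lambda>k. ennreal (F m k)))"
    proof (intro nn_integral_mono)
      fix m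
      have "ennreal (two ((real_of_int m + 1) * q)) = ennreal (two q) * ennreal (two (real_of_int m * q))"
      proof -
        have "two ((real_of_int m + 1) * q) = two q * two (real_of_int m * q)"
          unfolding powr_add[symmetric] by (simp add: algebra_simps)
        then show ?thesis
          by (simp add: ennreal_mult)
      qed
      then have "ennreal (two ((real_of_int m + 1) * q)) * emeasure M {x\<in>space M. ennreal (dy m) < H x}
          \<le> ennreal (two q) * (ennreal (two (real_of_int m * q)) * zsum (\<lambda>k. emeasure M {x\<in>space M. ennreal (s m k) < g k x}))"
        using sub[of m] by (simp only: mult.assoc) (intro mult_left_mono, auto)
      also have "ennreal (two (real_of_int m * q)) * zsum (\<lambda>k. emeasure M {x\<in>space M. ennreal (s m k) < g k x})
          = zsum (\<lambda>k. ennreal (two (real_of_int m * q)) * emeasure M {x\<in>space M. ennreal (s m k) < g k x})"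
        by (rule nn_integral_cmult[symmetric]) simp
      also have "ennreal (two q) * \<dots> \<le> ennreal (two q) * zsum (\<lambda>k. ennreal (F m k))"
        by (intro mult_left_mono nn_integral_mono level) auto
      finally show "ennreal (two ((real_of_int m + 1) * q)) * emeasure M {x\<in>space M. ennreal (dy m) < H x}
          \<le> ennreal (two q) * zsum (\<lambda>k. ennreal (F m k))" .
    qed
    also have "\<dots> = ennreal (two q) * zsum (\<lambda>k. zsum (\<lambda>m. ennreal (F m k)))"
      by (subst nn_integral_cmult) (auto simp: zsum_swap[of "\<lambda>m k. ennreal (F m k)"])
    \<comment> \<open>For fixed \<open>k\<close> the terms decay geometrically in \<open>m\<close>
      away from k/\<sigma>, so the inner sum is bounded uniformly; the remaining sum over
      \<open>k\<close> is the normalised one.\<close>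
    also have "\<dots> \<le> ennreal (two q) * zsum (\<lambda>k. ennreal (A' * V) * ennreal (two (real_of_int k / u) * e k))"
    proof (intro mult_left_mono nn_integral_mono)
      fix k
      define B where "B = A' * (two (real_of_int k / u) * e k)"
      have B: "0 \<le> B" using A' e by (simp add: B_def)
      have "ennreal (F m k) = ennreal B * ennreal (two (- (\<kappa> / 2 * \<sigma>) * \<bar>real_of_int m - real_of_int k / \<sigma>\<bar>))" for m
      proof -
        have "\<bar>real_of_int k - \<sigma> * real_of_int m\<bar> = \<sigma> * \<bar>real_of_int m - real_of_int k / \<sigma>\<bar>"
        proof -
          have "\<sigma> * \<bar>real_of_int m - real_of_int k / \<sigma>\<bar> = \<bar>\<sigma> * (real_of_int m - real_of_int k / \<sigma>)\<bar>"
            using \<sigma> by (simp add: abs_mult)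
          also have "\<sigma> * (real_of_int m - real_of_int k / \<sigma>) = \<sigma> * real_of_int m - real_of_int k"
            using \<sigma> by (simp add: right_diff_distrib)
          finally show ?thesis by (simp add: abs_minus_commute)
        qed
        then have "F m k = B * two (- (\<kappa> / 2 * \<sigma>) * \<bar>real_of_int m - real_of_int k / \<sigma>\<bar>)"
          by (simp add: F_def B_def mult.assoc)
        then show ?thesis
          using B by (simp add: ennreal_mult)
      qed
      then have "zsum (\<lambda>m. ennreal (F m k)) = ennreal B * zsum (\<lambda>m. ennreal (two (- (\<kappa> / 2 * \<sigma>) * \<bar>real_of_int m - real_of_int k / \<sigma>\<bar>)))"
        by (simp add: nn_integral_cmult)
      also have "\<dots> \<le> ennreal B * ennreal V"
        by (intro mult_left_mono V) auto
      also have "\<dots> = ennreal ((A' * V) * (two (real_of_int k / u) * e k))"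
        using B V by (subst ennreal_mult[symmetric]) (auto simp: B_def mult_ac)
      also have "\<dots> = ennreal (A' * V) * ennreal (two (real_of_int k / u) * e k)"
        using A' V e[of k] by (intro ennreal_mult) auto
      finally show "zsum (\<lambda>m. ennreal (F m k)) \<le> ennreal (A' * V) * ennreal (two (real_of_int k / u) * e k)" .
    qed auto
    also have "\<dots> = ennreal (two q) * (ennreal (A' * V) * zsum (\<lambda>k. ennreal (two (real_of_int k / u) * e k)))"
      by (subst nn_integral_cmult) auto
    also have "\<dots> \<le> ennreal (two q) * (ennreal (A' * V) * 1)"
      by (intro mult_left_mono norm) auto
    also have "\<dots> = ennreal (two q * (A' * V))"
      using A' V by (simp add: ennreal_mult)
    finally show "(\<integral>\<^sup>+x. ennpowr (zsum (\<lambda>k. ennreal (dy k) * g k x)) (1 / w) \<partial>M) \<le> ennreal (two q * (A' * V))"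
      by (simp only: H_def q_def)
  qed
qed

lemma ennpowr_1 [simp]: "ennpowr x 1 = x"
  by (cases x) (auto simp: ennpowr_def)

text \<open>Kolmogorov's inequality: functions in weak L^(1/v) with 1/v > 1 are integrable over sets
  of finite measure. Each dyadic level set is bounded by |W| at low heights and by the weak type
  estimate at large ones, and both sides sum geometrically.\<close>

lemma weak_type_integral_bound:
  fixes v :: real
  assumes v: "0 < v" "v < 1"
  obtains C where "0 < C"
    "\<And>(g :: 'a::euclidean_space \<Rightarrow> ennreal) c W. \<lbrakk>g \<in> borel_measurable borel; 0 \<le> c; W \<in> sets borel; vol W < \<infinity>;
      \<forall>s>0. vol {x. ennreal s < g x} \<le> ennreal ((c / s) powr (1 / v))\<rbrakk> \<Longrightarrow>
      (\<integral>\<^sup>+x\<in>W. g x \<partial>lborel) \<le> ennreal (C * c * measure lborel W powr (1 - v))"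
proof -
  define q where "q = 1 / v"
  have q: "1 < q" using v by (simp add: q_def)
  define \<eta> where "\<eta> = min 1 (q - 1)"
  have \<eta>: "0 < \<eta>" "\<eta> \<le> 1" "\<eta> \<le> q - 1" using q by (auto simp: \<eta>_def)
  obtain V where V: "0 < V" "\<And>x::real. zsum (\<lambda>k. ennreal (two (- \<eta> * \<bar>real_of_int k - x\<bar>))) \<le> ennreal V"
    by (rule zsum_geometric[OF \<eta>(1)]) (rule that)
  show ?thesis
  proof
    show "0 < 2 * V" using V by simp
    fix g :: "'a \<Rightarrow> ennreal" and c :: real and W :: "'a set"
    assume g [measurable]: "g \<in> borel_measurable borel" and c: "0 \<le> c" and W [measurable]: "W \<in> sets borel" and fin: "vol W < \<infinity>"
      and D: "\<forall>s>0. vol {x. ennreal s < g x} \<le> ennreal ((c / s) powr (1 / v))"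
    define w where "w = measure lborel W"
    have w: "vol W = ennreal w" "0 \<le> w"
      unfolding w_def using fin by (auto intro!: emeasure_eq_ennreal_measure)
    define L where "L m = W \<inter> {x. ennreal (dy m) < g x}" for m
    have L [measurable]: "L m \<in> sets borel" for m
      unfolding L_def by measurable
    have Lw: "vol (L m) \<le> ennreal w" for m
      unfolding w(1)[symmetric] by (intro emeasure_mono) (auto simp: L_def)
    have Lc: "vol (L m) \<le> ennreal ((c / dy m) powr q)" for m
    proof -
      have "vol (L m) \<le> vol {x. ennreal (dy m) < g x}"
        by (intro emeasure_mono) (auto simp: L_def)
      then show ?thesis
        using D[rule_format, of "dy m"] unfolding q_def by (simp add: order_trans)
    qed
    have "(\<integral>\<^sup>+x\<in>W. g x \<partial>lborel) \<le> (\<integral>\<^sup>+x. zsum (\<lambda>m. ennreal (two (real_of_int m + 1)) * indicator (L m) x) \<partial>lborel)"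
    proof (intro nn_integral_mono)
      fix x
      show "g x * indicator W x \<le> zsum (\<lambda>m. ennreal (two (real_of_int m + 1)) * indicator (L m) x)"
      proof (cases "x \<in> W")
        case True
        have "g x = ennpowr (g x) 1" by simp
        also have "\<dots> \<le> zsum (\<lambda>m. ennreal (two ((real_of_int m + 1) * 1)) * (if ennreal (dy m) < g x then 1 else 0))"
          by (rule ennpowr_le_levels) simp
        also have "\<dots> = zsum (\<lambda>m. ennreal (two (real_of_int m + 1)) * indicator (L m) x)"
          using True by (intro nn_integral_cong) (simp add: L_def indicator_def)
        finally show ?thesis using True by simp
      qed simp
    qed
    also have "\<dots> = zsum (\<lambda>m. ennreal (two (real_of_int m + 1)) * vol (L m))"
      by (subst zsum_nn_integral) (auto simp: nn_integral_cmult_indicator)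
    also have "\<dots> \<le> ennreal (2 * V * c * w powr (1 - v))"
    proof (cases "c = 0 \<or> w = 0")
      case True
      then have "vol (L m) = 0" for m
        using Lw[of m] Lc[of m] by auto
      then show ?thesis by simp
    next
      case False
      then have pos: "0 < c" "0 < w" using c w by auto
      \<comment> \<open>The height 2^x at which the two bounds for the measure of a level set
        coincide.\<close>
      define x where "x = log 2 (c * w powr (- v))"
      have x: "two x = c * w powr (- v)"
        using pos by (simp add: x_def)
      have level: "ennreal (two (real_of_int m + 1)) * vol (L m) \<le> ennreal (2 * c * w powr (1 - v)) * ennreal (two (- \<eta> * \<bar>real_of_int m - x\<bar>))" for m
      proof -
        define y where "y = real_of_int m - x"
        have m: "two (real_of_int m + 1) = 2 * (c * w powr (- v)) * two y"
          unfolding x[symmetric] y_def by (simp add: powr_add powr_diff)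
        have ww: "w powr (- v) * w = w powr (1 - v)"
          using pos by (simp add: powr_diff powr_minus field_simps)
        have "\<exists>X. vol (L m) \<le> ennreal X \<and> 0 \<le> X \<and> two y * X \<le> w * two (- \<eta> * \<bar>y\<bar>)"
        proof (cases "y \<le> 0")
          case True
          have "two y \<le> two (- \<eta> * \<bar>y\<bar>)"
            using True \<eta> mult_right_mono[of \<eta> 1 "- y"] by (intro powr_mono) auto
          then show ?thesis
            using Lw[of m] pos by (intro exI[of _ w] conjI) (auto simp: mult.commute)
        next
          case False
          have "(c / dy m) powr q = w * two (- q * y)"
          proof -
            have "dy m = two x * two y"
              by (simp add: y_def flip: powr_add)
            then have "c / dy m = w powr v * two (- y)"
              unfolding x using pos by (simp add: powr_minus field_simps)
            then have "(c / dy m) powr q = (w powr v) powr q * (two (- y)) powr q"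
              by (simp add: powr_mult)
            also have "(w powr v) powr q = w"
              using v pos by (simp add: powr_powr q_def)
            finally show ?thesis
              by (simp add: powr_powr mult.commute)
          qed
          moreover have "two y * (w * two (- q * y)) \<le> w * two (- \<eta> * \<bar>y\<bar>)"
          proof -
            have "two y * (w * two (- q * y)) = w * two (y + - q * y)"
              by (simp only: powr_add mult_ac)
            also have "\<dots> \<le> w * two (- \<eta> * \<bar>y\<bar>)"
              using False \<eta> pos mult_right_mono[of \<eta> "q - 1" y] by (intro mult_left_mono powr_mono) (auto simp: algebra_simps)
            finally show ?thesis .
          qed
          ultimately show ?thesis
            using Lc[of m] pos by (intro exI[of _ "w * two (- q * y)"] conjI) auto
        qed
        then obtain X where X: "vol (L m) \<le> ennreal X" "0 \<le> X" "two y * X \<le> w * two (- \<eta> * \<bar>y\<bar>)" by blast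
        have "ennreal (two (real_of_int m + 1)) * vol (L m) \<le> ennreal (two (real_of_int m + 1)) * ennreal X"
          by (intro mult_left_mono X) auto
        also have "\<dots> = ennreal (two (real_of_int m + 1) * X)"
          using X by (intro ennreal_mult[symmetric]) auto
        also have "\<dots> \<le> ennreal (2 * c * w powr (1 - v) * two (- \<eta> * \<bar>y\<bar>))"
        proof (rule ennreal_leI)
          have "two (real_of_int m + 1) * X = 2 * (c * w powr (- v)) * (two y * X)"
            unfolding m by simp
          also have "\<dots> \<le> 2 * (c * w powr (- v)) * (w * two (- \<eta> * \<bar>y\<bar>))"
            using pos by (intro mult_left_mono X) auto
          also have "\<dots> = 2 * c * (w powr (- v) * w) * two (- \<eta> * \<bar>y\<bar>)"
            by simp
          finally show "two (real_of_int m + 1) * X \<le> 2 * c * w powr (1 - v) * two (- \<eta> * \<bar>y\<bar>)"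
            unfolding ww .
        qed
        also have "\<dots> = ennreal (2 * c * w powr (1 - v)) * ennreal (two (- \<eta> * \<bar>y\<bar>))"
          using pos by (intro ennreal_mult) auto
        finally show ?thesis by (simp add: y_def)
      qed
      have "zsum (\<lambda>m. ennreal (two (real_of_int m + 1)) * vol (L m)) \<le> zsum (\<lambda>m. ennreal (2 * c * w powr (1 - v)) * ennreal (two (- \<eta> * \<bar>real_of_int m - x\<bar>)))"
        by (intro nn_integral_mono level)
      also have "\<dots> = ennreal (2 * c * w powr (1 - v)) * zsum (\<lambda>m. ennreal (two (- \<eta> * \<bar>real_of_int m - x\<bar>)))"
        by (rule nn_integral_cmult) simp
      also have "\<dots> \<le> ennreal (2 * c * w powr (1 - v)) * ennreal V"
        by (intro mult_left_mono V) auto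
      also have "\<dots> = ennreal (2 * V * c * w powr (1 - v))"
        using pos V by (subst ennreal_mult[symmetric]) (auto simp: mult_ac)
      finally show ?thesis .
    qed
    finally show "(\<integral>\<^sup>+x\<in>W. g x \<partial>lborel) \<le> ennreal (2 * V * c * measure lborel W powr (1 - v))"
      by (simp only: w_def)
  qed
qed

text \<open>Weak L^(1/v) is normable for 1/v > 1. Integrating the sum over its own level set,
  Kolmogorov's inequality may be applied term by term, and the measure of the level set is then
  recovered by division.\<close>

lemma weak_type_sum:
  fixes v :: real
  assumes v: "0 < v" "v < 1"
  obtains C where "0 < C"
    "\<And>(g :: int \<Rightarrow> 'a::euclidean_space \<Rightarrow> ennreal) c r s. \<lbrakk>\<forall>k. g k \<in> borel_measurable borel; \<forall>k. 0 \<le> c k;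
      \<forall>k. \<forall>s>0. vol {x. ennreal s < g k x} \<le> ennreal ((c k / s) powr (1 / v));
      zsum (\<lambda>k. ennreal (c k)) \<le> ennreal r; 0 \<le> r; 0 < s\<rbrakk> \<Longrightarrow>
      vol {x. ennreal s < zsum (\<lambda>k. g k x)} \<le> ennreal ((C * r / s) powr (1 / v))"
proof -
  obtain C where C: "0 < C"
    "\<And>(g :: 'a::euclidean_space \<Rightarrow> ennreal) c W. \<lbrakk>g \<in> borel_measurable borel; 0 \<le> c; W \<in> sets borel; vol W < \<infinity>;
      \<forall>s>0. vol {x. ennreal s < g x} \<le> ennreal ((c / s) powr (1 / v))\<rbrakk> \<Longrightarrow>
      (\<integral>\<^sup>+x\<in>W. g x \<partial>lborel) \<le> ennreal (C * c * measure lborel W powr (1 - v))"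
    by (rule weak_type_integral_bound[OF v, where 'a = 'a]) (rule that)
  show ?thesis
  proof
    show "0 < C" by (rule C)
    fix g :: "int \<Rightarrow> 'a \<Rightarrow> ennreal" and c :: "int \<Rightarrow> real" and r s :: real
    assume "\<forall>k. g k \<in> borel_measurable borel" and "\<forall>k. 0 \<le> c k"
      and D: "\<forall>k. \<forall>s>0. vol {x. ennreal s < g k x} \<le> ennreal ((c k / s) powr (1 / v))"
      and r: "zsum (\<lambda>k. ennreal (c k)) \<le> ennreal r" "0 \<le> r" and s: "0 < s"
    then have g [measurable]: "\<And>k. g k \<in> borel_measurable borel" and c: "\<And>k. 0 \<le> c k"
      by auto
    define H where "H x = zsum (\<lambda>k. g k x)" for x
    have [measurable]: "H \<in> borel_measurable borel"
      unfolding H_def[abs_def] by measurable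
    \<comment> \<open>The level set is cut to balls because its measure must be finite for this
      division; the bound does not depend on the ball.\<close>
    define B where "B n = {x. ennreal s < H x} \<inter> ball 0 (real n)" for n
    have B [measurable]: "B n \<in> sets borel" for n
      unfolding B_def by measurable
    have "vol {x. ennreal s < H x} \<le> ennreal ((C * r / s) powr (1 / v))"
    proof (rule emeasure_eventually_le)
      fix x assume "x \<in> {x. ennreal s < H x}"
      then have "x \<in> B n" if "norm x < real n" for n
        using that by (simp add: B_def)
      moreover have "eventually (\<lambda>n. norm x < real n) sequentially"
        using filterlim_real_sequentially by (simp add: filterlim_at_top_dense)
      ultimately show "eventually (\<lambda>n. x \<in> B n) sequentially"
        by (auto elim: eventually_mono)
    next
      fix n
      show "B n \<in> sets lborel" by simp
      have "vol (B n) \<le> vol (ball (0::'a) (real n))"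
        by (intro emeasure_mono) (auto simp: B_def)
      also have "\<dots> < \<infinity>" by (intro emeasure_bounded_finite bounded_ball)
      finally have fin: "vol (B n) < \<infinity>" .
      define w where "w = measure lborel (B n)"
      have w: "vol (B n) = ennreal w" "0 \<le> w"
        unfolding w_def using fin by (auto intro!: emeasure_eq_ennreal_measure)
      have "ennreal s * ennreal w = (\<integral>\<^sup>+x\<in>B n. ennreal s \<partial>lborel)"
        by (simp add: nn_integral_cmult_indicator w)
      also have "\<dots> \<le> (\<integral>\<^sup>+x. zsum (\<lambda>k. g k x * indicator (B n) x) \<partial>lborel)"
        by (intro nn_integral_mono) (auto simp: B_def H_def indicator_def)
      also have "\<dots> = zsum (\<lambda>k. \<integral>\<^sup>+x\<in>B n. g k x \<partial>lborel)"
        by (rule zsum_nn_integral) measurable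
      also have "\<dots> \<le> zsum (\<lambda>k. ennreal (C * w powr (1 - v)) * ennreal (c k))"
      proof (intro nn_integral_mono)
        fix k
        have "(\<integral>\<^sup>+x\<in>B n. g k x \<partial>lborel) \<le> ennreal (C * c k * w powr (1 - v))"
          unfolding w_def by (rule C(2)[OF g c B fin spec[OF D]])
        also have "\<dots> = ennreal (C * w powr (1 - v)) * ennreal (c k)"
          using C(1) c[of k] by (subst ennreal_mult[symmetric]) (auto simp: mult_ac)
        finally show "(\<integral>\<^sup>+x\<in>B n. g k x \<partial>lborel) \<le> ennreal (C * w powr (1 - v)) * ennreal (c k)" .
      qed
      also have "\<dots> = ennreal (C * w powr (1 - v)) * zsum (\<lambda>k. ennreal (c k))"
        by (rule nn_integral_cmult) simp
      also have "\<dots> \<le> ennreal (C * w powr (1 - v)) * ennreal r"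
        by (intro mult_left_mono r) auto
      finally have "ennreal (s * w) \<le> ennreal (C * w powr (1 - v) * r)"
        using s w r(2) C(1) by (simp add: ennreal_mult)
      then have sw: "s * w \<le> C * w powr (1 - v) * r"
        using C(1) r(2) by (subst (asm) ennreal_le_iff) auto
      have "w \<le> (C * r / s) powr (1 / v)"
      proof (cases "w = 0")
        case False
        then have w0: "0 < w" using w by simp
        have "w powr v * w powr (1 - v) = w"
          using w0 by (simp flip: powr_add)
        then have "s * (w powr v) * w powr (1 - v) \<le> (C * r) * w powr (1 - v)"
          using sw by (simp add: mult_ac)
        then have "s * w powr v \<le> C * r"
          using w0 by simp
        then have "w powr v \<le> C * r / s"
          using s by (simp add: field_simps)
        then have "(w powr v) powr (1 / v) \<le> (C * r / s) powr (1 / v)"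
          using v by (intro powr_mono2) auto
        then show ?thesis
          using v w0 by (simp add: powr_powr)
      qed simp
      then show "vol (B n) \<le> ennreal ((C * r / s) powr (1 / v))"
        unfolding w(1) by (rule ennreal_leI)
    qed
    then show "vol {x. ennreal s < zsum (\<lambda>k. g k x)} \<le> ennreal ((C * r / s) powr (1 / v))"
      by (simp add: H_def)
  qed
qed

section \<open>Open sets of small measure and null sets\<close>

context decaying_measure
begin

text \<open>The level set bound with \<epsilon> = 1 is linear in |U n|, so at every positive height
  the infimum has a null level set.\<close>

lemma small_open_sets:
  assumes U: "\<And>n. open (U n)" and lim: "(\<lambda>n. vol (U n)) \<longlonglongrightarrow> 0"
  shows "AE x in lborel. (INF n. omax (U n) x) = 0"
proof -
  obtain K where K: "0 < K"
    "\<And>U \<epsilon> l. \<lbrakk>open U; vol U < \<infinity>; 0 < \<epsilon>; \<epsilon> \<le> 1; 0 < l\<rbrakk> \<Longrightarrow>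
      vol {x. ennreal l < omax U x} \<le> ennreal (K * (\<epsilon> powr (- gam) / l + \<epsilon> powr (2 * a - 1) / l\<^sup>2)) * vol U"
    by (rule level_set_bounds) (rule that)
  have [measurable]: "omax (U n) \<in> borel_measurable borel" for n
    by (rule borel_measurable_pos_max_open[OF U])
  have "AE x in lborel. \<not> ennreal (1 / real (Suc j)) < (INF n. omax (U n) x)" for j
  proof -
    define l where "l = 1 / real (Suc j)"
    have l: "0 < l" by (simp add: l_def)
    define B where "B = {x. ennreal l < (INF n. omax (U n) x)}"
    have B [measurable]: "B \<in> sets borel" unfolding B_def by measurable
    define k where "k = ennreal (K * (1 powr (- gam) / l + 1 powr (2 * a - 1) / l\<^sup>2))"
    have "(\<lambda>n. k * vol (U n)) \<longlonglongrightarrow> k * 0"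
      by (rule ennreal_tendsto_cmult[OF _ lim]) (simp add: k_def)
    moreover have "eventually (\<lambda>n. vol B \<le> k * vol (U n)) sequentially"
    proof -
      have "eventually (\<lambda>n. vol (U n) < \<infinity>) sequentially"
        by (rule order_tendstoD(2)[OF lim]) simp
      then show ?thesis
      proof eventually_elim
        case (elim n)
        have "B \<subseteq> {x. ennreal l < omax (U n) x}"
          unfolding B_def by (auto intro: order_less_le_trans INF_lower)
        then have "vol B \<le> vol {x. ennreal l < omax (U n) x}"
          by (intro emeasure_mono) auto
        also have "\<dots> \<le> k * vol (U n)"
          unfolding k_def by (rule K(2)[OF U elim _ _ l]) auto
        finally show ?case .
      qed
    qed
    ultimately have "vol B \<le> k * 0"
      by (rule tendsto_lowerbound) simp
    then have "B \<in> null_sets lborel"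
      by (intro null_setsI) auto
    then have "AE x in lborel. x \<notin> B"
      by (rule AE_not_in)
    then show ?thesis
      by (simp add: B_def l_def)
  qed
  then have "AE x in lborel. \<forall>j. \<not> ennreal (1 / real (Suc j)) < (INF n. omax (U n) x)"
    by (simp add: AE_all_countable)
  then show ?thesis
  proof eventually_elim
    case (elim x)
    have "(INF n. omax (U n) x) \<le> 0"
    proof (rule ennreal_le_epsilon)
      fix e :: real assume e: "0 < e"
      then obtain j where "1 / real (Suc j) < e"
        using nat_approx_posE by blast
      then show "(INF n. omax (U n) x) \<le> 0 + ennreal e"
        using elim[rule_format, of j] e by (simp add: not_less) (meson ennreal_leI less_imp_le order_trans)
    qed
    then show ?case by simp
  qed
qed

text \<open>Even a Lebesgue null set can be charged by a translated dilate of \<mu>. Enclosing it in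
  open sets of vanishing measure shows that this happens only for a null set of \<open>x\<close>,
  which can be chosen independently of \<open>t\<close>.\<close>

lemma AE_average_avoids_null_set:
  assumes N: "N \<in> null_sets lborel"
  shows "AE x in lborel. \<forall>t\<in>{1..2}. AE y in \<mu>. x - t *\<^sub>R y \<notin> N"
proof -
  have Nb [measurable]: "N \<in> sets borel" and N0: "vol N = 0"
    using N by auto
  have "\<exists>U. open U \<and> N \<subseteq> U \<and> vol U \<le> ennreal (1 / real (Suc n))" for n
  proof -
    have "N \<in> sets lebesgue" "0 < 1 / real (Suc n)"
      using Nb by auto
    then obtain T where T: "open T" "N \<subseteq> T" "(T - N) \<in> lmeasurable" "emeasure lebesgue (T - N) < ennreal (1 / real (Suc n))"
      by (rule sets_lebesgue_outer_open)
    have Tb: "T \<in> sets lborel" "T - N \<in> sets lborel"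
      using T(1) Nb by auto
    have "vol T \<le> vol ((T - N) \<union> N)"
      using Tb Nb by (intro emeasure_mono) auto
    also have "\<dots> \<le> vol (T - N) + vol N"
      using Tb Nb by (intro emeasure_subadditive) auto
    also have "\<dots> = emeasure lebesgue (T - N)"
      using Tb N0 by simp
    also have "\<dots> \<le> ennreal (1 / real (Suc n))"
      using T(4) by (rule order_less_imp_le)
    finally show ?thesis
      using T by blast
  qed
  then have "\<forall>n. \<exists>U. open U \<and> N \<subseteq> U \<and> vol U \<le> ennreal (1 / real (Suc n))"
    by (rule allI)
  from choice[OF this] obtain U where U: "\<And>n. open (U n)" "\<And>n. N \<subseteq> U n" "\<And>n. vol (U n) \<le> ennreal (1 / real (Suc n))"
    by blast
  have "(\<lambda>n. ennreal (1 / real (Suc n))) \<longlonglongrightarrow> ennreal 0"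
    by (intro tendsto_ennrealI LIMSEQ_Suc[OF lim_const_over_n])
  then have lim: "(\<lambda>n. ennreal (1 / real (Suc n))) \<longlonglongrightarrow> 0"
    by simp
  have "(\<lambda>n. vol (U n)) \<longlonglongrightarrow> 0"
    by (rule tendsto_sandwich[OF _ _ tendsto_const lim]) (use U(3) in simp_all)
  from small_open_sets[OF U(1) this] show ?thesis
  proof eventually_elim
    case (elim x)
    show ?case
    proof
      fix t :: real assume t: "t \<in> {1..2}"
      have "(\<integral>\<^sup>+y. indicator N (x - t *\<^sub>R y) \<partial>\<mu>) \<le> omax (U n) x" for n
      proof -
        have "(\<integral>\<^sup>+y. indicator N (x - t *\<^sub>R y) \<partial>\<mu>) \<le> (\<integral>\<^sup>+y. indicator (U n) (x - t *\<^sub>R y) \<partial>\<mu>)"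
          using U(2)[of n] by (intro nn_integral_mono) (auto simp: indicator_def)
        also have "\<dots> \<le> omax (U n) x"
          unfolding pos_max_def using t by (rule SUP_upper)
        finally show ?thesis .
      qed
      then have "(\<integral>\<^sup>+y. indicator N (x - t *\<^sub>R y) \<partial>\<mu>) \<le> (INF n. omax (U n) x)"
        by (intro INF_greatest)
      then have "(\<integral>\<^sup>+y. indicator N (x - t *\<^sub>R y) \<partial>\<mu>) = 0"
        using elim by simp
      then have "AE y in \<mu>. indicator N (x - t *\<^sub>R y) = (0 :: ennreal)"
        by (subst (asm) nn_integral_0_iff_AE) auto
      then show "AE y in \<mu>. x - t *\<^sub>R y \<notin> N"
        by eventually_elim (simp add: indicator_def split: if_splits)
    qed
  qed
qed

end

section \<open>Measurability and domination of the local maximal function\<close>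

lemma continuous_on_uniform_approx:
  fixes f :: "'a::metric_space \<Rightarrow> 'b::metric_space"
  assumes "\<And>e. 0 < e \<Longrightarrow> \<exists>g. continuous_on S g \<and> (\<forall>x\<in>S. dist (f x) (g x) \<le> e)"
  shows "continuous_on S f"
  unfolding continuous_on_iff
proof (intro ballI allI impI)
  fix x and e :: real assume x: "x \<in> S" and e: "0 < e"
  then obtain g where g: "continuous_on S g" "\<And>y. y \<in> S \<Longrightarrow> dist (f y) (g y) \<le> e / 4"
    using assms[of "e / 4"] by auto
  obtain d where d: "0 < d" "\<And>y. y \<in> S \<Longrightarrow> dist y x < d \<Longrightarrow> dist (g y) (g x) < e / 4"
    using g(1) x e unfolding continuous_on_iff by (metis zero_less_divide_iff zero_less_numeral)
  show "\<exists>d>0. \<forall>x'\<in>S. dist x' x < d \<longrightarrow> dist (f x') (f x) < e"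
  proof (intro exI[of _ d] conjI ballI impI)
    fix y assume y: "y \<in> S" "dist y x < d"
    have "dist (f y) (f x) \<le> dist (f y) (g y) + dist (g y) (g x) + dist (g x) (f x)"
      using dist_triangle[of "f y" "f x" "g y"] dist_triangle[of "g y" "f x" "g x"] by linarith
    moreover have "dist (g x) (f x) \<le> e / 4"
      using g(2)[OF x] by (simp add: dist_commute)
    ultimately show "dist (f y) (f x) < e"
      using g(2)[OF y(1)] d(2)[OF y] e by linarith
  qed (rule d)
qed

text \<open>A weak form of Lusin's theorem: Egorov's argument, with closeness in place of equality off \<open>V\<close>.\<close>

lemma Lusin_bounded:
  fixes f :: "'a::euclidean_space \<Rightarrow> 'b::euclidean_space"
  assumes f [measurable]: "f \<in> borel_measurable borel" and B: "\<And>x. norm (f x) \<le> B" and e: "0 < e"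
  obtains g V where "continuous_on UNIV g" "\<And>x. norm (g x) \<le> B" "open V" "vol V \<le> ennreal e"
    "\<And>x. x \<in> ball 0 r \<Longrightarrow> x \<notin> V \<Longrightarrow> dist (f x) (g x) \<le> e"
proof -
  have B0: "0 \<le> B"
    using B[of 0] norm_ge_zero order_trans by blast
  have "f \<in> borel_measurable lebesgue"
    using f by (simp add: measurable_completion)
  then have "f measurable_on UNIV"
    by (rule lebesgue_measurable_imp_measurable_on) simp
  then obtain N G where N: "negligible N" and G: "\<And>n. continuous_on UNIV (G n)"
    "\<And>x. x \<notin> N \<Longrightarrow> (\<lambda>n. G n x) \<longlonglongrightarrow> f x"
    unfolding measurable_on_def by auto
  \<comment> \<open>Projecting to the ball restores the bound \<open>B\<close> for the continuous
    approximants; it preserves continuity, and also the limit since \<open>f\<close> itself lies in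
    the ball.\<close>
  define P where "P = closest_point (cball (0::'b) B)"
  have P: "continuous_on UNIV P"
    unfolding P_def using B0 by (intro continuous_on_closest_point) auto
  have PB: "norm (P x) \<le> B" for x
    using closest_point_in_set[of "cball (0::'b) B" x] B0 by (simp add: P_def)
  have Pf: "P (f x) = f x" for x
    unfolding P_def using B[of x] by (intro closest_point_self) simp
  define h where "h n x = P (G n x)" for n x
  have h: "continuous_on UNIV (h n)" for n
    unfolding h_def[abs_def] by (rule continuous_on_compose2[OF P G(1)]) simp
  have [measurable]: "h n \<in> borel_measurable borel" for n
    using h by (rule borel_measurable_continuous_onI)
  have h_lim: "(\<lambda>n. h n x) \<longlonglongrightarrow> f x" if "x \<notin> N" for x
    using continuous_on_tendsto_compose[OF P G(2)[OF that]] by (simp add: h_def Pf)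
  \<comment> \<open>The points where the approximation is still worse than \<open>e\<close> at some
    index from \<open>n\<close> on. Their intersection over \<open>n\<close> is null, and
    restriction to a ball makes continuity of the measure from above available.\<close>
  define D where "D n = ball 0 r \<inter> {x. \<exists>m\<ge>n. e < dist (f x) (h m x)}" for n
  have D [measurable]: "D n \<in> sets borel" for n
    unfolding D_def by measurable
  have Dfin: "vol (D n) < \<infinity>" for n
  proof -
    have "vol (D n) \<le> vol (ball (0::'a) r)"
      by (intro emeasure_mono) (auto simp: D_def)
    also have "\<dots> < \<infinity>" by (intro emeasure_bounded_finite bounded_ball)
    finally show ?thesis .
  qed
  have "(\<lambda>n. vol (D n)) \<longlonglongrightarrow> vol (\<Inter>n. D n)"
  proof (rule Lim_emeasure_decseq)
    show "decseq D"
      unfolding decseq_def D_def by (auto intro: order_trans)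
    show "vol (D n) \<noteq> \<infinity>" for n
      using Dfin[of n] by simp
  qed auto
  moreover have "(\<Inter>n. D n) \<subseteq> N"
  proof (rule subsetI, rule ccontr)
    fix x assume x: "x \<in> (\<Inter>n. D n)" and xN: "x \<notin> N"
    have "eventually (\<lambda>n. dist (h n x) (f x) < e) sequentially"
      using h_lim[OF xN] e by (rule tendstoD)
    then obtain n where "\<And>m. n \<le> m \<Longrightarrow> dist (h m x) (f x) < e"
      unfolding eventually_sequentially by blast
    moreover obtain m where "n \<le> m" "e < dist (f x) (h m x)"
      using x by (auto simp: D_def)
    ultimately show False
      by (metis dist_commute less_asym)
  qed
  then have "negligible (\<Inter>n. D n)"
    using N negligible_subset by blast
  then have "vol (\<Inter>n. D n) = 0"
    by (simp add: negligible_iff_emeasure0)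
  ultimately have "eventually (\<lambda>n. vol (D n) < ennreal (e / 2)) sequentially"
    using e by (intro order_tendstoD(2)) auto
  then obtain n where n: "vol (D n) < ennreal (e / 2)"
    by (auto simp: eventually_sequentially)
  have "D n \<in> sets lebesgue" "0 < e / 2"
    using D e by auto
  then obtain V where V: "open V" "D n \<subseteq> V" "V - D n \<in> lmeasurable" "emeasure lebesgue (V - D n) < ennreal (e / 2)"
    by (rule sets_lebesgue_outer_open)
  show thesis
  proof
    show "continuous_on UNIV (h n)" by (rule h)
    show "norm (h n x) \<le> B" for x by (simp add: h_def PB)
    show "open V" by (rule V)
    have Vb: "V \<in> sets borel" using V by simp
    have "vol V = vol (D n \<union> (V - D n))"
      using V(2) by (intro arg_cong[where f = "vol"]) auto
    also have "\<dots> \<le> vol (D n) + vol (V - D n)"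
      using Vb by (intro emeasure_subadditive) auto
    also have "\<dots> \<le> ennreal (e / 2) + ennreal (e / 2)"
      using n V(4) Vb by (intro add_mono) auto
    also have "\<dots> = ennreal e"
      using e by (simp flip: ennreal_plus)
    finally show "vol V \<le> ennreal e" .
    show "dist (f x) (h n x) \<le> e" if "x \<in> ball 0 r" "x \<notin> V" for x
    proof (rule ccontr)
      assume "\<not> dist (f x) (h n x) \<le> e"
      then have "x \<in> D n" using that by (auto simp: D_def)
      then show False using that V(2) by auto
    qed
  qed
qed

context decaying_measure
begin

lemma continuous_on_average:
  fixes g :: "'a \<Rightarrow> complex"
  assumes g: "continuous_on UNIV g" and B: "\<And>x. norm (g x) \<le> B"
  shows "continuous_on T (\<lambda>t. \<integral>y. g (x - t *\<^sub>R y) \<partial>\<mu>)"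
  unfolding continuous_on_sequentially
proof (intro allI ballI impI, elim conjE)
  fix s :: "nat \<Rightarrow> real" and t assume s: "s \<longlonglongrightarrow> t"
  have [measurable]: "g \<in> borel_measurable borel"
    using g by (rule borel_measurable_continuous_onI)
  show "((\<lambda>t. \<integral>y. g (x - t *\<^sub>R y) \<partial>\<mu>) \<circ> s) \<longlonglongrightarrow> (\<integral>y. g (x - t *\<^sub>R y) \<partial>\<mu>)"
    unfolding comp_def
  proof (rule integral_dominated_convergence)
    show "integrable \<mu> (\<lambda>y. B)" by simp
    show "AE y in \<mu>. (\<lambda>i. g (x - s i *\<^sub>R y)) \<longlonglongrightarrow> g (x - t *\<^sub>R y)"
    proof (intro AE_I2 continuous_on_tendsto_compose[OF g])
      show "(\<lambda>i. x - s i *\<^sub>R y) \<longlonglongrightarrow> x - t *\<^sub>R y" for y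
        by (intro tendsto_intros s)
    qed auto
  qed (auto intro: B)
qed

lemma integrable_bounded_average:
  fixes g :: "'a \<Rightarrow> complex"
  assumes [measurable]: "g \<in> borel_measurable borel" and B: "\<And>x. norm (g x) \<le> B"
  shows "integrable \<mu> (\<lambda>y. g (x - t *\<^sub>R y))"
  by (rule integrable_const_bound[where B = B]) (auto intro: B)

text \<open>Off small open sets \<open>f\<close> is close to continuous functions, whose averages are continuous in \<open>t\<close>; the averages
  over the small open sets are uniformly small by \<open>small_open_sets\<close>. This continuity reduces the supremum over
  \<open>[1, 2]\<close> to a countable one.\<close>

lemma AE_continuous_on_average_bounded:
  fixes f :: "'a \<Rightarrow> complex"
  assumes f [measurable]: "f \<in> borel_measurable borel" and B: "\<And>x. norm (f x) \<le> B"
  shows "AE x in lborel. continuous_on {1..2} (\<lambda>t. \<integral>y. f (x - t *\<^sub>R y) \<partial>\<mu>)"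
proof -
  have B0: "0 \<le> B"
    using B[of 0] norm_ge_zero order_trans by blast
  have "\<exists>g V. continuous_on UNIV g \<and> (\<forall>x. norm (g x) \<le> B) \<and> open V \<and> vol V \<le> ennreal (1 / real (Suc n)) \<and>
    (\<forall>x. x \<in> ball 0 (real n) \<longrightarrow> x \<notin> V \<longrightarrow> dist (f x) (g x) \<le> 1 / real (Suc n))" for n
  proof -
    have "0 < 1 / real (Suc n)" by simp
    from Lusin_bounded[OF f B this, of "real n"] show ?thesis by metis
  qed
  then obtain g V where g: "\<And>n. continuous_on UNIV (g n)" "\<And>n x. norm (g n x) \<le> B"
    and V: "\<And>n. open (V n)" "\<And>n. vol (V n) \<le> ennreal (1 / real (Suc n))"
    and near: "\<And>n x. x \<in> ball 0 (real n) \<Longrightarrow> x \<notin> V n \<Longrightarrow> dist (f x) (g n x) \<le> 1 / real (Suc n)"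
    by metis
  have "(\<lambda>n. ennreal (1 / real (Suc n))) \<longlonglongrightarrow> ennreal 0"
    by (intro tendsto_ennrealI LIMSEQ_Suc[OF lim_const_over_n])
  then have lim: "(\<lambda>n. ennreal (1 / real (Suc n))) \<longlonglongrightarrow> 0"
    by simp
  have V_lim: "(\<lambda>n. vol (V n)) \<longlonglongrightarrow> 0"
    by (rule tendsto_sandwich[OF _ _ tendsto_const lim]) (use V(2) in simp_all)
  \<comment> \<open>The shift by \<open>m\<close> allows an index that is large and has a small
    average at the same time; a large index is needed for the accuracy and the radius.\<close>
  have "AE x in lborel. (INF n. pos_max (indicator (V (n + m))) x) = 0" for m
    using V(1) LIMSEQ_ignore_initial_segment[OF V_lim] by (rule small_open_sets)
  then have "AE x in lborel. \<forall>m. (INF n. pos_max (indicator (V (n + m))) x) = 0"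
    by (simp add: AE_all_countable)
  then show ?thesis
  proof eventually_elim
    case (elim x)
    show ?case
    proof (rule continuous_on_uniform_approx)
      fix e :: real assume e: "0 < e"
      define k where "k = mass + 2 * B + 1"
      have k: "0 < k" using B0 mass_nonneg unfolding k_def by linarith
      define \<epsilon> where "\<epsilon> = e / k"
      have \<epsilon>: "0 < \<epsilon>" using e k by (simp add: \<epsilon>_def)
      obtain m1 where m1: "1 / real (Suc m1) < \<epsilon>"
        using \<epsilon> nat_approx_posE by blast
      \<comment> \<open>The approximation is known only on balls; this radius accommodates all
        points x - t y with t \<le> 2 and |y| \<le> R.\<close>
      obtain m2 where m2: "norm x + 2 * R < real m2"
        using reals_Archimedean2 by blast
      define m where "m = max m1 m2"
      have "(INF n. pos_max (indicator (V (n + m))) x) < ennreal \<epsilon>"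
        using elim \<epsilon> by simp
      then obtain n' where n': "pos_max (indicator (V (n' + m))) x < ennreal \<epsilon>"
        unfolding INF_less_iff by blast
      define n where "n = n' + m"
      have n: "omax (V n) x < ennreal \<epsilon>"
        using n' by (simp add: n_def)
      have "1 / real (Suc n) \<le> 1 / real (Suc m1)"
        by (intro divide_left_mono) (auto simp: n_def m_def)
      then have n\<epsilon>: "1 / real (Suc n) \<le> \<epsilon>" using m1 by linarith
      have "real m2 \<le> real n" by (simp add: n_def m_def)
      then have nR: "norm x + 2 * R < real n" using m2 by linarith
      have [measurable]: "g n \<in> borel_measurable borel" "V n \<in> sets borel"
        using g V by (auto intro: borel_measurable_continuous_onI)
      have "dist (\<integral>y. f (x - t *\<^sub>R y) \<partial>\<mu>) (\<integral>y. g n (x - t *\<^sub>R y) \<partial>\<mu>) \<le> e" if t: "t \<in> {1..2}" for t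
      proof -
        have int: "integrable \<mu> (\<lambda>y. f (x - t *\<^sub>R y))" "integrable \<mu> (\<lambda>y. g n (x - t *\<^sub>R y))"
          by (intro integrable_bounded_average[of _ B] B g; measurable)+
        have ind: "integrable \<mu> (\<lambda>y. indicator (V n) (x - t *\<^sub>R y) :: real)"
          by (rule integrable_const_bound[where B = 1]) (auto simp: indicator_def)
        have "ennreal (\<integral>y. indicator (V n) (x - t *\<^sub>R y) \<partial>\<mu>) = (\<integral>\<^sup>+y. indicator (V n) (x - t *\<^sub>R y) \<partial>\<mu>)"
          using ind by (subst nn_integral_eq_integral[symmetric]) (auto simp: ennreal_indicator)
        also have "\<dots> \<le> omax (V n) x"
          unfolding pos_max_def using t by (intro SUP_upper)
        also have "\<dots> \<le> ennreal \<epsilon>" using n by simp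
        finally have small: "(\<integral>y. indicator (V n) (x - t *\<^sub>R y) \<partial>\<mu>) \<le> \<epsilon>"
          using \<epsilon> by (simp add: ennreal_le_iff)
        have "norm ((\<integral>y. f (x - t *\<^sub>R y) \<partial>\<mu>) - (\<integral>y. g n (x - t *\<^sub>R y) \<partial>\<mu>)) = norm (\<integral>y. f (x - t *\<^sub>R y) - g n (x - t *\<^sub>R y) \<partial>\<mu>)"
          using int by simp
        also have "\<dots> \<le> (\<integral>y. \<epsilon> + 2 * B * indicator (V n) (x - t *\<^sub>R y) \<partial>\<mu>)"
        proof (rule order_trans[OF integral_norm_bound], rule integral_mono_AE)
          show "integrable \<mu> (\<lambda>y. norm (f (x - t *\<^sub>R y) - g n (x - t *\<^sub>R y)))"
            using int by simp
          show "integrable \<mu> (\<lambda>y. \<epsilon> + 2 * B * indicator (V n) (x - t *\<^sub>R y))"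
            using ind by simp
          show "AE y in \<mu>. norm (f (x - t *\<^sub>R y) - g n (x - t *\<^sub>R y)) \<le> \<epsilon> + 2 * B * indicator (V n) (x - t *\<^sub>R y)"
            using R(2)
          proof eventually_elim
            case (elim y)
            have "norm (x - t *\<^sub>R y) \<le> norm x + norm (t *\<^sub>R y)"
              by (rule norm_triangle_ineq4)
            also have "norm (t *\<^sub>R y) \<le> 2 * R"
              using t elim by (auto intro: mult_mono)
            finally have ball: "x - t *\<^sub>R y \<in> ball 0 (real n)"
              using nR by simp
            show ?case
            proof (cases "x - t *\<^sub>R y \<in> V n")
              case True
              have "norm (f (x - t *\<^sub>R y) - g n (x - t *\<^sub>R y)) \<le> norm (f (x - t *\<^sub>R y)) + norm (g n (x - t *\<^sub>R y))"
                by (rule norm_triangle_ineq4)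
              also have "\<dots> \<le> B + B"
                by (intro add_mono B g)
              finally show ?thesis using True \<epsilon> by simp
            next
              case False
              then show ?thesis
                using near[OF ball False] n\<epsilon> by (simp add: dist_norm)
            qed
          qed
        qed
        also have "\<dots> = mass * \<epsilon> + 2 * B * (\<integral>y. indicator (V n) (x - t *\<^sub>R y) \<partial>\<mu>)"
          using ind by (simp add: mass_def)
        also have "\<dots> \<le> mass * \<epsilon> + 2 * B * \<epsilon>"
          using small B0 by (intro add_left_mono mult_left_mono) auto
        also have "\<dots> \<le> k * \<epsilon>"
          using \<epsilon> by (simp add: k_def algebra_simps)
        also have "\<dots> = e"
          using k by (simp add: \<epsilon>_def)
        finally show ?thesis by (simp add: dist_norm)
      qed
      then show "\<exists>g. continuous_on {1..2} g \<and> (\<forall>t\<in>{1..2}. dist (\<integral>y. f (x - t *\<^sub>R y) \<partial>\<mu>) (g t) \<le> e)"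
        using continuous_on_average[OF g] by blast
    qed
  qed
qed

end

lemma measurable_completion_AE:
  assumes f: "f \<in> measurable (completion M) L" and ae: "AE x in M. f x = g x" and L: "space L = UNIV"
  shows "g \<in> measurable (completion M) L"
proof (rule measurableI)
  fix A assume A: "A \<in> sets L"
  show "g -` A \<inter> space (completion M) \<in> sets (completion M)"
  proof (rule completion.in_sets_AE)
    have "AE x in completion M. f x = g x"
      using ae by (rule AE_completion)
    then show "AE x in completion M. x \<in> f -` A \<inter> space (completion M) \<longleftrightarrow> x \<in> g -` A \<inter> space (completion M)"
      by eventually_elim simp
    show "f -` A \<inter> space (completion M) \<in> sets (completion M)"
      using f A by (rule measurable_sets)
  qed simp
qed (simp add: L)

lemma lebesgue_measurable_borel_representative:
  fixes f :: "'a::euclidean_space \<Rightarrow> complex"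
  assumes f: "f \<in> borel_measurable lebesgue"
  obtains f' N where "f' \<in> borel_measurable borel" "N \<in> null_sets lborel" "\<And>x. x \<notin> N \<Longrightarrow> f x = f' x"
proof -
  have "(\<lambda>x. Re (f x)) \<in> borel_measurable lebesgue" "(\<lambda>x. Im (f x)) \<in> borel_measurable lebesgue"
    using f by measurable
  then obtain r i where [measurable]: "r \<in> borel_measurable lborel" "i \<in> borel_measurable lborel"
    and ae: "AE x in lborel. Re (f x) = r x" "AE x in lborel. Im (f x) = i x"
    using completion_ex_borel_measurable_real by metis
  have "AE x in lborel. f x = Complex (r x) (i x)"
    using ae by eventually_elim (simp add: complex_eq_iff)
  then obtain N where N: "N \<in> null_sets lborel" "{x \<in> space lborel. \<not> f x = Complex (r x) (i x)} \<subseteq> N"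
    by (auto simp: eventually_ae_filter)
  show thesis
  proof
    show "(\<lambda>x. Complex (r x) (i x)) \<in> borel_measurable borel"
      unfolding Complex_eq by measurable
    show "f x = Complex (r x) (i x)" if "x \<notin> N" for x
      using N(2) that by auto
  qed (rule N)
qed

lemma SUP_rational_dense:
  fixes h :: "real \<Rightarrow> real"
  assumes h: "continuous_on {1..2} h"
  shows "(SUP t\<in>{1..2}. ennreal (h t)) = (SUP t\<in>{1..2} \<inter> \<rat>. ennreal (h t))" (is "_ = ?S")
proof (rule antisym)
  have closure: "closure ({1..2} \<inter> \<rat>) = {1..2::real}"
  proof
    show "closure ({1..2} \<inter> \<rat>) \<subseteq> {1..2::real}"
      by (intro closure_minimal) auto
    show "{1..2::real} \<subseteq> closure ({1..2} \<inter> \<rat>)"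
    proof
      fix t :: real assume t: "t \<in> {1..2}"
      show "t \<in> closure ({1..2} \<inter> \<rat>)"
      proof (cases "t = 2")
        case True
        have "(2::real) \<in> {1..2} \<inter> \<rat>" by simp
        then have "2 \<in> closure ({1..2::real} \<inter> \<rat>)" by (rule subsetD[OF closure_subset])
        then show ?thesis by (simp add: True)
      next
        case False
        show ?thesis
          unfolding closure_approachable
        proof (intro allI impI)
          fix e :: real assume "0 < e"
          then have "t < min 2 (t + e)" using t False by auto
          then obtain q where "q \<in> \<rat>" "t < q" "q < min 2 (t + e)"
            using Rats_dense_in_real by blast
          then show "\<exists>y\<in>{1..2} \<inter> \<rat>. dist y t < e"
            using t by (intro bexI[of _ q]) (auto simp: dist_real_def)
        qed
      qed
    qed
  qed
  show "(SUP t\<in>{1..2}. ennreal (h t)) \<le> ?S"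
  proof (rule SUP_least)
    fix t :: real assume t: "t \<in> {1..2}"
    show "ennreal (h t) \<le> ?S"
    proof (cases ?S)
      case (real r)
      have "h t \<le> r"
      proof (rule continuous_le_on_closure[where S = "{1..2} \<inter> \<rat>" and f = h])
        show "continuous_on (closure ({1..2} \<inter> \<rat>)) h" unfolding closure by (rule h)
        show "t \<in> closure ({1..2} \<inter> \<rat>)" unfolding closure by (rule t)
        show "h s \<le> r" if "s \<in> {1..2} \<inter> \<rat>" for s
        proof -
          have "ennreal (h s) \<le> ?S" using that by (rule SUP_upper)
          then show ?thesis using real by (simp add: ennreal_le_iff2) linarith
        qed
      qed
      then show ?thesis using real by (simp add: ennreal_leI)
    next
      case top
      show ?thesis unfolding top by simp
    qed
  qed
  show "?S \<le> (SUP t\<in>{1..2}. ennreal (h t))"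
    by (rule SUP_subset_mono) auto
qed

section \<open>Dyadic levels and domination of the maximal function\<close>

definition level :: "('a::euclidean_space \<Rightarrow> complex) \<Rightarrow> int \<Rightarrow> 'a set"
  where "level f k = {x. dy k \<le> norm (f x) \<and> norm (f x) < two (real_of_int k + 1)}"

lemma sets_level:
  assumes "f \<in> borel_measurable lebesgue"
  shows "level f k \<in> sets lebesgue"
proof -
  have "(\<lambda>x. norm (f x)) \<in> borel_measurable lebesgue"
    using measurable_comp[OF assms borel_measurable_norm] by (simp add: comp_def)
  then have "(\<lambda>x. norm (f x)) -` {dy k..<two (real_of_int k + 1)} \<inter> space lebesgue \<in> sets lebesgue"
    by (rule measurable_sets) simp
  also have "(\<lambda>x. norm (f x)) -` {dy k..<two (real_of_int k + 1)} \<inter> space lebesgue = level f k"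
    by (auto simp: level_def)
  finally show ?thesis .
qed

lemma ex_level:
  assumes "f x \<noteq> 0"
  obtains k where "x \<in> level f k"
proof
  define k where "k = \<lfloor>log 2 (norm (f x))\<rfloor>"
  have "real_of_int k \<le> log 2 (norm (f x))" "log 2 (norm (f x)) < real_of_int k + 1"
    unfolding k_def by linarith+
  then show "x \<in> level f k"
    using assms by (auto simp: level_def le_log_iff log_less_iff)
qed

context decaying_measure
begin

lemma abs_average_eq:
  assumes f' [measurable]: "f' \<in> borel_measurable borel" and eq: "\<And>x. x \<notin> N \<Longrightarrow> f x = f' x"
    and ae: "AE y in \<mu>. x - t *\<^sub>R y \<notin> N"
  shows "abs_average \<mu> t f x =
    (if integrable \<mu> (\<lambda>y. f' (x - t *\<^sub>R y)) then ennreal (norm (\<integral>y. f' (x - t *\<^sub>R y) \<partial>\<mu>)) else \<infinity>)"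
proof -
  have m: "(\<lambda>y. f' (x - t *\<^sub>R y)) \<in> borel_measurable \<mu>"
    by measurable
  have mc: "(\<lambda>y. f' (x - t *\<^sub>R y)) \<in> borel_measurable (completion \<mu>)"
    using m by (rule measurable_completion)
  have ae': "AE y in \<mu>. f' (x - t *\<^sub>R y) = f (x - t *\<^sub>R y)"
    using ae by eventually_elim (simp add: eq)
  then have aec: "AE y in completion \<mu>. f (x - t *\<^sub>R y) = f' (x - t *\<^sub>R y)"
    by (intro AE_completion) (auto elim: eventually_mono)
  have fm: "(\<lambda>y. f (x - t *\<^sub>R y)) \<in> borel_measurable (completion \<mu>)"
    using mc ae' by (rule measurable_completion_AE) simp
  have "integrable (completion \<mu>) (\<lambda>y. f (x - t *\<^sub>R y)) \<longleftrightarrow> integrable \<mu> (\<lambda>y. f' (x - t *\<^sub>R y))"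
    using integrable_cong_AE[OF fm mc aec] integrable_completion[OF m] by simp
  moreover have "(\<integral>y. f (x - t *\<^sub>R y) \<partial>completion \<mu>) = (\<integral>y. f' (x - t *\<^sub>R y) \<partial>\<mu>)"
    using integral_cong_AE[OF fm mc aec] integral_completion[OF m] by simp
  ultimately show ?thesis
    by (simp add: abs_average_def)
qed

text \<open>Almost everywhere the averages are finite and continuous in \<open>t\<close>, so the
  supremum is attained along rational \<open>t\<close>, where it is Borel measurable; completeness
  of Lebesgue measure transfers this to \<open>local_maximal\<close>.\<close>

lemma borel_measurable_local_maximal:
  assumes f' [measurable]: "f' \<in> borel_measurable borel" and N: "N \<in> null_sets lborel" and eq: "\<And>x. x \<notin> N \<Longrightarrow> f x = f' x"
    and ae: "AE x in lborel. (\<forall>t\<in>{1..2}. integrable \<mu> (\<lambda>y. f' (x - t *\<^sub>R y))) \<and>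
      continuous_on {1..2} (\<lambda>t. \<integral>y. f' (x - t *\<^sub>R y) \<partial>\<mu>)"
  shows "local_maximal \<mu> f \<in> borel_measurable lebesgue"
proof (rule measurable_completion_AE)
  have [simp]: "countable ({1..2} \<inter> \<rat> :: real set)"
    using countable_rat by (rule countable_subset[rotated]) auto
  have "(\<lambda>x. SUP t\<in>{1..2} \<inter> \<rat>. ennreal (norm (\<integral>y. f' (x - t *\<^sub>R y) \<partial>\<mu>))) \<in> borel_measurable borel"
    by (rule borel_measurable_SUP) (simp, measurable)
  then show "(\<lambda>x. SUP t\<in>{1..2} \<inter> \<rat>. ennreal (norm (\<integral>y. f' (x - t *\<^sub>R y) \<partial>\<mu>))) \<in> borel_measurable lebesgue"
    by (intro measurable_completion) simp
  show "AE x in lborel. (SUP t\<in>{1..2} \<inter> \<rat>. ennreal (norm (\<integral>y. f' (x - t *\<^sub>R y) \<partial>\<mu>))) = local_maximal \<mu> f x"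
    using ae AE_average_avoids_null_set[OF N]
  proof eventually_elim
    case (elim x)
    have "local_maximal \<mu> f x = (SUP t\<in>{1..2}. ennreal (norm (\<integral>y. f' (x - t *\<^sub>R y) \<partial>\<mu>)))"
      unfolding local_maximal_def
      by (intro SUP_cong refl) (use elim abs_average_eq[OF f' eq] in simp)
    also have "\<dots> = (SUP t\<in>{1..2} \<inter> \<rat>. ennreal (norm (\<integral>y. f' (x - t *\<^sub>R y) \<partial>\<mu>)))"
      using elim by (intro SUP_rational_dense continuous_intros) simp
    finally show ?case by simp
  qed
qed simp

text \<open>Each \<open>U k\<close> is meant to cover the level where |f| is between 2^k and
  2^(k+1); the factor 2 accounts for the upper end.\<close>

definition majorant :: "(int \<Rightarrow> 'a set) \<Rightarrow> 'a \<Rightarrow> ennreal"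
  where "majorant U x = zsum (\<lambda>k. ennreal (dy k) * (2 * omax (U k) x))"

lemma borel_measurable_majorant:
  "(\<And>k. open (U k)) \<Longrightarrow> majorant U \<in> borel_measurable borel"
  unfolding majorant_def[abs_def]
  using borel_measurable_pos_max_open by (intro borel_measurable_zsum borel_measurable_times borel_measurable_const) auto

lemma bounded_maximal:
  assumes f: "f \<in> borel_measurable lebesgue" and B: "AE x in lebesgue. norm (f x) \<le> B" and B0: "0 \<le> B"
  shows "local_maximal \<mu> f \<in> borel_measurable lebesgue" "AE x in lebesgue. local_maximal \<mu> f x \<le> ennreal (mass * B)"
proof -
  obtain g N where g [measurable]: "g \<in> borel_measurable borel" and N: "N \<in> null_sets lborel" "\<And>x. x \<notin> N \<Longrightarrow> f x = g x"
    using lebesgue_measurable_borel_representative[OF f] by metis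
  have "AE x in lborel. norm (f x) \<le> B"
    using B unfolding AE_completion_iff .
  then obtain N' where "N' \<in> null_sets lborel" "{x \<in> space lborel. \<not> norm (f x) \<le> B} \<subseteq> N'"
    by (auto simp: eventually_ae_filter)
  then have N': "N' \<in> null_sets lborel" "\<And>x. x \<notin> N' \<Longrightarrow> norm (f x) \<le> B"
    by auto
  \<comment> \<open>The continuity result requires a bound at every point, not just almost
    everywhere.\<close>
  define f' where "f' x = (if norm (g x) \<le> B then g x else 0)" for x
  have f' [measurable]: "f' \<in> borel_measurable borel"
    unfolding f'_def[abs_def] by measurable
  have f'B: "norm (f' x) \<le> B" for x
    using B0 by (simp add: f'_def)
  have NN: "N \<union> N' \<in> null_sets lborel"
    using N N' by auto
  have eq: "f x = f' x" if "x \<notin> N \<union> N'" for x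
    using that N(2)[of x] N'(2)[of x] by (simp add: f'_def)
  have int: "integrable \<mu> (\<lambda>y. f' (x - t *\<^sub>R y))" for x t
    using f' f'B by (rule integrable_bounded_average)
  show "local_maximal \<mu> f \<in> borel_measurable lebesgue"
    using f' NN eq
  proof (rule borel_measurable_local_maximal)
    show "AE x in lborel. (\<forall>t\<in>{1..2}. integrable \<mu> (\<lambda>y. f' (x - t *\<^sub>R y))) \<and>
        continuous_on {1..2} (\<lambda>t. \<integral>y. f' (x - t *\<^sub>R y) \<partial>\<mu>)"
      using AE_continuous_on_average_bounded[OF f' f'B] int by simp
  qed
  have "AE x in lborel. local_maximal \<mu> f x \<le> ennreal (mass * B)"
    using AE_average_avoids_null_set[OF NN]
  proof eventually_elim
    case (elim x)
    show ?case
      unfolding local_maximal_def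
    proof (rule SUP_least)
      fix t :: real assume t: "t \<in> {1..2}"
      have "norm (\<integral>y. f' (x - t *\<^sub>R y) \<partial>\<mu>) \<le> (\<integral>y. B \<partial>\<mu>)"
        using int f'B by (intro order_trans[OF integral_norm_bound] integral_mono) auto
      also have "\<dots> = mass * B" by (simp add: mass_def)
      finally have "norm (\<integral>y. f' (x - t *\<^sub>R y) \<partial>\<mu>) \<le> mass * B" .
      moreover have "AE y in \<mu>. x - t *\<^sub>R y \<notin> N \<union> N'"
        using elim t by (rule bspec)
      ultimately show "abs_average \<mu> t f x \<le> ennreal (mass * B)"
        using abs_average_eq[where f = f and f' = f' and N = "N \<union> N'" and x = x and t = t] f' eq int by (simp add: ennreal_leI)
    qed
  qed
  then show "AE x in lebesgue. local_maximal \<mu> f x \<le> ennreal (mass * B)"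
    by (rule AE_completion)
qed

end

lemma zsum_tail_tendsto_0:
  assumes "zsum c < \<infinity>"
  shows "(\<lambda>n. zsum (\<lambda>k. if int n \<le> k then c k else 0)) \<longlonglongrightarrow> 0"
proof -
  have "(\<lambda>n. zsum (\<lambda>k. if int n \<le> k then c k else 0)) \<longlonglongrightarrow> zsum (\<lambda>k. 0)"
  proof (rule nn_integral_dominated_convergence[where w = c])
    show "zsum c < \<infinity>" by (rule assms)
    show "AE k in count_space UNIV. (\<lambda>n. if int n \<le> k then c k else 0) \<longlonglongrightarrow> 0"
    proof (rule AE_I2)
      fix k :: int
      have "eventually (\<lambda>n. (if int n \<le> k then c k else 0) = 0) sequentially"
        using eventually_gt_at_top[of "nat k"] by eventually_elim auto
      then show "(\<lambda>n. if int n \<le> k then c k else 0) \<longlonglongrightarrow> 0"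
        by (rule tendsto_eventually)
    qed
  qed auto
  then show ?thesis by simp
qed

text \<open>A null level cannot in general be covered by an open set of measure at most 0. In that
  case the empty set is taken, and the level is discarded as a null set by the caller.\<close>

lemma outer_open_double:
  fixes L :: "'a::euclidean_space set"
  assumes L: "L \<in> sets lebesgue" and fin: "emeasure lebesgue L < \<infinity>"
  obtains U where "open U" "vol U \<le> 2 * emeasure lebesgue L" "L \<subseteq> U \<or> emeasure lebesgue L = 0"
proof (cases "emeasure lebesgue L = 0")
  case True
  then show ?thesis
    by (intro that[of "{}"]) auto
next
  case False
  define e where "e = measure lebesgue L"
  have e: "emeasure lebesgue L = ennreal e"
    unfolding e_def using fin by (intro emeasure_eq_ennreal_measure) auto
  then have "0 < e" using False by (cases "e \<le> 0") (auto simp: ennreal_neg)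
  then obtain T where T: "open T" "L \<subseteq> T" "emeasure lebesgue (T - L) < ennreal e"
    using sets_lebesgue_outer_open[OF L] by metis
  have Tl: "T \<in> sets lebesgue" using T by simp
  have "vol T = emeasure lebesgue (L \<union> (T - L))"
    using T(1,2) by (simp add: Un_absorb1)
  also have "\<dots> \<le> emeasure lebesgue L + emeasure lebesgue (T - L)"
    using L Tl by (intro emeasure_subadditive) auto
  also have "\<dots> \<le> emeasure lebesgue L + emeasure lebesgue L"
    using T(3) e by (intro add_left_mono) simp
  finally have "vol T \<le> 2 * emeasure lebesgue L"
    by (simp add: mult_2)
  then show ?thesis
    using T by (intro that[of T]) auto
qed

context decaying_measure
begin

text \<open>Domination is read off level by level. Measurability is conditional on an almost
  everywhere finite majorant: then the series over the levels has vanishing tails, so the averages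
  of the truncations of \<open>f\<close> converge uniformly in \<open>t\<close>, and continuity
  carries over from the bounded case.\<close>

lemma maximal_control:
  assumes f: "f \<in> borel_measurable lebesgue" and fin: "\<And>k. emeasure lebesgue (level f k) < \<infinity>"
  obtains U where "\<And>k. open (U k)" "\<And>k. vol (U k) \<le> 2 * emeasure lebesgue (level f k)"
    "AE x in lborel. local_maximal \<mu> f x \<le> majorant U x"
    "AE x in lborel. majorant U x < \<infinity> \<Longrightarrow> local_maximal \<mu> f \<in> borel_measurable lebesgue"
proof -
  obtain f' N0 where f' [measurable]: "f' \<in> borel_measurable borel" and N0: "N0 \<in> null_sets lborel" "\<And>x. x \<notin> N0 \<Longrightarrow> f x = f' x"
    using lebesgue_measurable_borel_representative[OF f] by metis
  have "\<forall>k. \<exists>U. open U \<and> vol U \<le> 2 * emeasure lebesgue (level f k) \<and>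
      (level f k \<subseteq> U \<or> emeasure lebesgue (level f k) = 0)"
    using outer_open_double[OF sets_level[OF f] fin] by metis
  then obtain U where U: "\<And>k. open (U k)" "\<And>k. vol (U k) \<le> 2 * emeasure lebesgue (level f k)"
    and LU: "\<And>k. level f k \<subseteq> U k \<or> emeasure lebesgue (level f k) = 0"
    by metis
  \<comment> \<open>The union of the null levels, which the open sets may miss.\<close>
  define Z where "Z = (\<Union>k\<in>{k. emeasure lebesgue (level f k) = 0}. level f k)"
  have "Z \<in> null_sets lebesgue"
    unfolding Z_def using sets_level[OF f] by (intro null_sets_UN') (auto simp: null_sets_def)
  then obtain N1 where N1: "N1 \<in> null_sets lborel" "Z \<subseteq> N1"
    by (auto simp: null_sets_completion_iff2)
  define N where "N = N0 \<union> N1"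
  have N: "N \<in> null_sets lborel" using N0 N1 by (auto simp: N_def)
  have eq: "\<And>x. x \<notin> N \<Longrightarrow> f x = f' x" using N0 by (auto simp: N_def)
  have U_borel [measurable]: "U k \<in> sets borel" for k using U by simp
  define c where "c x k = ennreal (dy k) * (2 * omax (U k) x)" for x k
  have two_succ: "ennreal (two (real_of_int k + 1)) = ennreal (dy k) * 2" for k
    by (simp add: powr_add ennreal_mult)
  \<comment> \<open>Formulated for a part \<open>h\<close> of \<open>f\<close> supported on the
    levels in \<open>S\<close>, to serve both the full function and the tail left by
    truncation.\<close>
  have point: "ennreal (norm (h z)) \<le> zsum (\<lambda>k. if k \<in> S then ennreal (two (real_of_int k + 1)) * indicator (U k) z else 0)"
    if z: "z \<notin> N" and h: "norm (h z) \<le> norm (f z)" "\<And>k. h z \<noteq> 0 \<Longrightarrow> z \<in> level f k \<Longrightarrow> k \<in> S" for h :: "'a \<Rightarrow> complex" and z S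
  proof (cases "h z = 0")
    case False
    then have "f z \<noteq> 0" using h(1) by auto
    then obtain k where k: "z \<in> level f k" by (rule ex_level)
    have "z \<in> U k"
      using LU[of k] k z N1(2) by (auto simp: N_def Z_def)
    have "norm (h z) \<le> two (real_of_int k + 1)"
      using h(1) k by (simp add: level_def)
    then have "ennreal (norm (h z)) \<le> (if k \<in> S then ennreal (two (real_of_int k + 1)) * indicator (U k) z else 0)"
      using h(2)[OF False k] \<open>z \<in> U k\<close> by (simp add: ennreal_leI)
    also have "\<dots> \<le> zsum (\<lambda>k. if k \<in> S then ennreal (two (real_of_int k + 1)) * indicator (U k) z else 0)"
      by (rule zsum_point)
    finally show ?thesis .
  qed simp
  have avg: "(\<integral>\<^sup>+y. ennreal (norm (h (x - t *\<^sub>R y))) \<partial>\<mu>) \<le> zsum (\<lambda>k. if k \<in> S then c x k else 0)"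
    if x: "AE y in \<mu>. x - t *\<^sub>R y \<notin> N" and t: "t \<in> {1..2}"
      and h: "\<And>z. z \<notin> N \<Longrightarrow> norm (h z) \<le> norm (f z)" "\<And>z k. z \<notin> N \<Longrightarrow> h z \<noteq> 0 \<Longrightarrow> z \<in> level f k \<Longrightarrow> k \<in> S"
    for h :: "'a \<Rightarrow> complex" and x t S
  proof -
    have "(\<integral>\<^sup>+y. ennreal (norm (h (x - t *\<^sub>R y))) \<partial>\<mu>) \<le>
        (\<integral>\<^sup>+y. zsum (\<lambda>k. if k \<in> S then ennreal (two (real_of_int k + 1)) * indicator (U k) (x - t *\<^sub>R y) else 0) \<partial>\<mu>)"
    proof (rule nn_integral_mono_AE)
      show "AE y in \<mu>. ennreal (norm (h (x - t *\<^sub>R y))) \<le>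
        zsum (\<lambda>k. if k \<in> S then ennreal (two (real_of_int k + 1)) * indicator (U k) (x - t *\<^sub>R y) else 0)"
        using x
      proof eventually_elim
        case (elim y)
        show ?case
          using elim h by (intro point) auto
      qed
    qed
    also have "\<dots> = zsum (\<lambda>k. \<integral>\<^sup>+y. (if k \<in> S then ennreal (two (real_of_int k + 1)) * indicator (U k) (x - t *\<^sub>R y) else 0) \<partial>\<mu>)"
      by (rule zsum_nn_integral) simp
    also have "\<dots> \<le> zsum (\<lambda>k. if k \<in> S then c x k else 0)"
    proof (intro nn_integral_mono)
      fix k
      have "(\<integral>\<^sup>+y. indicator (U k) (x - t *\<^sub>R y) \<partial>\<mu>) \<le> omax (U k) x"
        unfolding pos_max_def using t by (rule SUP_upper)
      then have "ennreal (two (real_of_int k + 1)) * (\<integral>\<^sup>+y. indicator (U k) (x - t *\<^sub>R y) \<partial>\<mu>) \<le> c x k"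
        unfolding c_def two_succ mult.assoc by (intro mult_left_mono) auto
      then show "(\<integral>\<^sup>+y. (if k \<in> S then ennreal (two (real_of_int k + 1)) * indicator (U k) (x - t *\<^sub>R y) else 0) \<partial>\<mu>) \<le> (if k \<in> S then c x k else 0)"
        by (simp add: nn_integral_cmult)
    qed
    finally show ?thesis .
  qed
  have total: "(\<integral>\<^sup>+y. ennreal (norm (f' (x - t *\<^sub>R y))) \<partial>\<mu>) \<le> majorant U x"
    if "AE y in \<mu>. x - t *\<^sub>R y \<notin> N" "t \<in> {1..2}" for x t
    using avg[where h = f' and S = UNIV, OF that] eq by (simp add: majorant_def c_def)
  show thesis
  proof (rule that[OF U])
    show "AE x in lborel. local_maximal \<mu> f x \<le> majorant U x"
      using AE_average_avoids_null_set[OF N]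
    proof eventually_elim
      case (elim x)
      show ?case
        unfolding local_maximal_def
      proof (rule SUP_least)
        fix t :: real assume t: "t \<in> {1..2}"
        have x: "AE y in \<mu>. x - t *\<^sub>R y \<notin> N" using elim t by (rule bspec)
        show "abs_average \<mu> t f x \<le> majorant U x"
        proof (cases "integrable \<mu> (\<lambda>y. f' (x - t *\<^sub>R y))")
          case True
          then have "abs_average \<mu> t f x = ennreal (norm (\<integral>y. f' (x - t *\<^sub>R y) \<partial>\<mu>))"
            using abs_average_eq[OF f' eq x] by simp
          also have "\<dots> \<le> (\<integral>\<^sup>+y. ennreal (norm (f' (x - t *\<^sub>R y))) \<partial>\<mu>)"
            by (rule integral_norm_bound_ennreal[OF True])
          also note total[OF x t]
          finally show ?thesis .
        next
          \<comment> \<open>A divergent average has value \<infinity> by definition, which is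
            consistent since the majorant is then infinite too.\<close>
          case False
          then have "(\<integral>\<^sup>+y. ennreal (norm (f' (x - t *\<^sub>R y))) \<partial>\<mu>) = \<infinity>"
            by (simp add: integrable_iff_bounded flip: top.not_eq_extremum)
          then have "majorant U x = \<infinity>"
            using total[OF x t] by (simp add: top_unique)
          then show ?thesis by simp
        qed
      qed
    qed
  next
    assume finite: "AE x in lborel. majorant U x < \<infinity>"
    \<comment> \<open>Truncation at height 2^n: the difference lives on the levels k \<ge> n, so its
      averages are bounded by a tail of the majorant that does not involve \<open>t\<close>.\<close>
    define fn where "fn n z = (if norm (f' z) < two (real n) then f' z else 0)" for n z
    have fn [measurable]: "fn n \<in> borel_measurable borel" for n
      unfolding fn_def[abs_def] by measurable
    have fnB: "norm (fn n z) \<le> two (real n)" for n z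
      by (simp add: fn_def)
    have "AE x in lborel. continuous_on {1..2} (\<lambda>t. \<integral>y. fn n (x - t *\<^sub>R y) \<partial>\<mu>)" for n
      using fn fnB by (rule AE_continuous_on_average_bounded)
    then have cont: "AE x in lborel. \<forall>n. continuous_on {1..2} (\<lambda>t. \<integral>y. fn n (x - t *\<^sub>R y) \<partial>\<mu>)"
      by (simp add: AE_all_countable)
    show "local_maximal \<mu> f \<in> borel_measurable lebesgue"
      using f' N eq
    proof (rule borel_measurable_local_maximal)
      show "AE x in lborel. (\<forall>t\<in>{1..2}. integrable \<mu> (\<lambda>y. f' (x - t *\<^sub>R y))) \<and>
          continuous_on {1..2} (\<lambda>t. \<integral>y. f' (x - t *\<^sub>R y) \<partial>\<mu>)"
        using finite cont AE_average_avoids_null_set[OF N]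
      proof eventually_elim
        case (elim x)
        have x: "AE y in \<mu>. x - t *\<^sub>R y \<notin> N" if "t \<in> {1..2}" for t
          using elim(3) that by (rule bspec)
        have int: "integrable \<mu> (\<lambda>y. f' (x - t *\<^sub>R y))" if t: "t \<in> {1..2}" for t
          using total[OF x[OF t] t] elim(1) by (simp add: integrable_iff_bounded order_le_less_trans)
        have intn: "integrable \<mu> (\<lambda>y. fn n (x - t *\<^sub>R y))" for t n
          using fn fnB by (rule integrable_bounded_average)
        have "zsum (c x) < \<infinity>"
          using elim(1) by (simp add: majorant_def c_def)
        then have tail: "(\<lambda>n. zsum (\<lambda>k. if int n \<le> k then c x k else 0)) \<longlonglongrightarrow> 0"
          by (rule zsum_tail_tendsto_0)
        have "continuous_on {1..2} (\<lambda>t. \<integral>y. f' (x - t *\<^sub>R y) \<partial>\<mu>)"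
        proof (rule continuous_on_uniform_approx)
          fix e :: real assume e: "0 < e"
          have "eventually (\<lambda>n. zsum (\<lambda>k. if int n \<le> k then c x k else 0) < ennreal e) sequentially"
            using tail e by (intro order_tendstoD(2)) auto
          then obtain n where n: "zsum (\<lambda>k. if int n \<le> k then c x k else 0) < ennreal e"
            by (auto simp: eventually_sequentially)
          have "dist (\<integral>y. f' (x - t *\<^sub>R y) \<partial>\<mu>) (\<integral>y. fn n (x - t *\<^sub>R y) \<partial>\<mu>) \<le> e" if t: "t \<in> {1..2}" for t
          proof -
            define h where "h z = f' z - fn n z" for z
            have h: "norm (h z) \<le> norm (f z)" if "z \<notin> N" for z
              using eq[OF that] by (simp add: h_def fn_def)
            have hS: "k \<in> {int n..}" if "z \<notin> N" "h z \<noteq> 0" "z \<in> level f k" for z k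
            proof -
              have "two (real n) \<le> norm (f z)"
                using that eq[OF that(1)] by (auto simp: h_def fn_def split: if_splits)
              also have "\<dots> < two (real_of_int k + 1)"
                using that(3) by (simp add: level_def)
              finally have "real n < real_of_int k + 1" by simp
              then show ?thesis by simp
            qed
            have ih: "integrable \<mu> (\<lambda>y. h (x - t *\<^sub>R y))"
              unfolding h_def using int[OF t] intn by (rule Bochner_Integration.integrable_diff)
            have "ennreal (norm (\<integral>y. h (x - t *\<^sub>R y) \<partial>\<mu>)) \<le> (\<integral>\<^sup>+y. ennreal (norm (h (x - t *\<^sub>R y))) \<partial>\<mu>)"
              by (rule integral_norm_bound_ennreal[OF ih])
            also have "\<dots> \<le> zsum (\<lambda>k. if k \<in> {int n..} then c x k else 0)"
              by (rule avg) (use x[OF t] t h hS in auto)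
            also have "\<dots> \<le> ennreal e" using n by simp
            finally have "norm (\<integral>y. h (x - t *\<^sub>R y) \<partial>\<mu>) \<le> e"
              using e by (simp add: ennreal_le_iff)
            also have "(\<integral>y. h (x - t *\<^sub>R y) \<partial>\<mu>) = (\<integral>y. f' (x - t *\<^sub>R y) \<partial>\<mu>) - (\<integral>y. fn n (x - t *\<^sub>R y) \<partial>\<mu>)"
              unfolding h_def using int[OF t] intn by (rule Bochner_Integration.integral_diff)
            finally show ?thesis by (simp add: dist_norm)
          qed
          then show "\<exists>g. continuous_on {1..2} g \<and> (\<forall>t\<in>{1..2}. dist (\<integral>y. f' (x - t *\<^sub>R y) \<partial>\<mu>) (g t) \<le> e)"
            using elim(2) by blast
        qed
        then show ?case using int by blast
      qed
    qed
  qed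
qed

end

section \<open>Lebesgue and Lorentz bounds\<close>

lemma ennpowr_mono: "x \<le> y \<Longrightarrow> 0 \<le> s \<Longrightarrow> ennpowr x s \<le> ennpowr y s"
  by (auto simp: ennpowr_def top_unique less_top intro!: ennreal_leI powr_mono2 enn2real_mono)

lemma ennpowr_cmult: "0 < c \<Longrightarrow> ennpowr (ennreal c * x) s = ennreal (c powr s) * ennpowr x s"
  by (cases x) (auto simp: ennpowr_def ennreal_mult_top powr_mult enn2real_mult ennreal_mult ennreal_mult_eq_top_iff)

lemma borel_measurable_ennpowr [measurable (raw)]:
  assumes [measurable]: "f \<in> borel_measurable M"
  shows "(\<lambda>x. ennpowr (f x) s) \<in> borel_measurable M"
  unfolding ennpowr_def by measurable

lemma recip_simps [simp]: "recip \<infinity> = 0" "recip 1 = 1" "0 < u \<Longrightarrow> recip (ennreal u) = 1 / u"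
  by (auto simp: recip_def ennreal_1[symmetric] divide_ennreal simp del: ennreal_1)

lemma exponent_eq_recip:
  assumes "1 \<le> p"
  shows "p = \<infinity> \<and> recip p = 0 \<or> 0 < recip p \<and> recip p \<le> 1 \<and> p = ennreal (1 / recip p)"
proof (cases p)
  case (real r)
  then have "1 \<le> r" using assms by (simp flip: ennreal_1)
  then show ?thesis using real by simp
qed (simp flip: infinity_ennreal_def)

lemma Lp_norm_finite_exponent:
  "0 < u \<Longrightarrow> Lp_norm (ennreal (1 / u)) g = ennpowr (\<integral>\<^sup>+x. ennpowr (g x) (1 / u) \<partial>lebesgue) u"
  by (simp add: Lp_norm_def)

lemma Lp_norm_cmult_le:
  fixes g :: "'a::euclidean_space \<Rightarrow> ennreal"
  assumes [measurable]: "g \<in> borel_measurable lebesgue" and c: "0 < c" and p: "1 \<le> p"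
  shows "Lp_norm p (\<lambda>x. ennreal c * g x) \<le> ennreal c * Lp_norm p g"
  using exponent_eq_recip[OF p]
proof (elim disjE conjE)
  assume p: "p = \<infinity>"
  have "AE x in lebesgue. ennreal c * g x \<le> ennreal c * esssup lebesgue g"
    using esssup_AE[of g lebesgue] by eventually_elim (intro mult_left_mono, auto)
  then show ?thesis
    unfolding p Lp_norm_def by (simp add: esssup_I)
next
  define u where "u = recip p"
  assume u: "0 < recip p" and p: "p = ennreal (1 / recip p)"
  have u: "0 < u" "p = ennreal (1 / u)" using u p by (simp_all add: u_def)
  have "(\<integral>\<^sup>+x. ennpowr (ennreal c * g x) (1 / u) \<partial>lebesgue) = ennreal (c powr (1 / u)) * (\<integral>\<^sup>+x. ennpowr (g x) (1 / u) \<partial>lebesgue)"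
    unfolding ennpowr_cmult[OF c] by (rule nn_integral_cmult) measurable
  moreover have "(c powr (1 / u)) powr u = c" "0 < c powr (1 / u)"
    using u c by (simp_all add: powr_powr)
  ultimately show ?thesis
    unfolding u(2) Lp_norm_finite_exponent[OF u(1)] by (simp add: ennpowr_cmult)
qed

lemma level_unique:
  assumes "x \<in> level f k" "x \<in> level f m"
  shows "k = m"
proof -
  have "dy k < two (real_of_int m + 1)" "dy m < two (real_of_int k + 1)"
    using assms unfolding level_def mem_Collect_eq by linarith+
  then show ?thesis by simp
qed

lemma zsum_level_le:
  assumes "0 < p"
  shows "zsum (\<lambda>k. ennreal (two (real_of_int k * p)) * indicator (level f k) x) \<le> ennpowr (ennreal (norm (f x))) p"
proof (cases "f x = 0")
  case True
  then have "x \<notin> level f k" for k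
    by (simp add: level_def not_le)
  then show ?thesis by simp
next
  case False
  then obtain m where m: "x \<in> level f m" using ex_level[of f x] by blast
  have "ennreal (two (real_of_int k * p)) * indicator (level f k) x = ennreal (two (real_of_int m * p)) * indicator {m} k" for k
    using level_unique[OF m, of k] m by (cases "k = m") (auto simp: indicator_def)
  then have "zsum (\<lambda>k. ennreal (two (real_of_int k * p)) * indicator (level f k) x) = zsum (\<lambda>k. ennreal (two (real_of_int m * p)) * indicator {m} k)"
    by simp
  also have "\<dots> = ennreal (two (real_of_int m * p))"
    by (subst nn_integral_cmult_indicator) auto
  also have "two (real_of_int m * p) \<le> norm (f x) powr p"
    using m assms powr_mono2[of p "dy m" "norm (f x)"] by (simp add: level_def powr_powr)
  finally show ?thesis
    using assms by (simp add: ennpowr_ennreal ennreal_leI)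
qed

text \<open>The levels are disjoint and |f|^p is at least 2^(kp) on the \<open>k\<close>-th
  one.\<close>

lemma zsum_level_measure_le:
  assumes f: "f \<in> borel_measurable lebesgue" and p: "0 < p"
  shows "zsum (\<lambda>k. ennreal (two (real_of_int k * p)) * emeasure lebesgue (level f k)) \<le> (\<integral>\<^sup>+x. ennpowr (ennreal (norm (f x))) p \<partial>lebesgue)"
proof -
  have "zsum (\<lambda>k. ennreal (two (real_of_int k * p)) * emeasure lebesgue (level f k)) = zsum (\<lambda>k. \<integral>\<^sup>+x. ennreal (two (real_of_int k * p)) * indicator (level f k) x \<partial>lebesgue)"
    using sets_level[OF f] by (simp add: nn_integral_cmult_indicator)
  also have "\<dots> = (\<integral>\<^sup>+x. zsum (\<lambda>k. ennreal (two (real_of_int k * p)) * indicator (level f k) x) \<partial>lebesgue)"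
    using f by (intro zsum_nn_integral[symmetric] borel_measurable_times_ennreal borel_measurable_const borel_measurable_indicator sets_level)
  also have "\<dots> \<le> (\<integral>\<^sup>+x. ennpowr (ennreal (norm (f x))) p \<partial>lebesgue)"
    by (intro nn_integral_mono zsum_level_le p)
  finally show ?thesis .
qed

context decaying_measure
begin

text \<open>Restates restricted weak type in the form consumed by the summation results. In the
  constant 4 A one factor 2 comes from the threshold s/2, the other from |U| \<le> 2 e and 2^u \<le>
  2.\<close>

lemma restricted_weak_emeasure:
  assumes rw: "restricted_weak (u, v)" and v: "0 < v" and u: "0 \<le> u" "u \<le> 1"
  obtains A where "0 < A" "\<And>(U :: 'a set) e s. \<lbrakk>open U; vol U \<le> 2 * ennreal e; 0 \<le> e; 0 < s\<rbrakk> \<Longrightarrow>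
    vol {x. ennreal s < 2 * omax U x} \<le> ennreal ((A / s * e powr u) powr (1 / v))"
proof -
  obtain A where A: "0 < A" "\<And>U l. \<lbrakk>open U; vol U < \<infinity>; 0 < l; 0 < level_measure U l\<rbrakk> \<Longrightarrow>
    level_measure U l powr v \<le> A / l * measure lborel U powr u"
    using rw unfolding restricted_weak_def by auto
  show thesis
  proof (rule that[of "4 * A"])
    show "0 < 4 * A" using A by simp
    fix U :: "'a set" and e s :: real assume U: "open U" "vol U \<le> 2 * ennreal e" and e: "0 \<le> e" and s: "0 < s"
    have e2: "vol U \<le> ennreal (2 * e)"
      using U(2) e by (simp add: ennreal_mult)
    then have fin: "vol U < \<infinity>"
      by (rule order_le_less_trans) simp
    define D where "D = level_measure U (s / 2)"
    have "{x. ennreal s < 2 * omax U x} \<subseteq> {x. ennreal (s / 2) < omax U x}"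
    proof safe
      fix x assume *: "ennreal s < 2 * omax U x"
      show "ennreal (s / 2) < omax U x"
      proof (rule ccontr)
        assume "\<not> ?thesis"
        then have "2 * omax U x \<le> 2 * ennreal (s / 2)"
          by (intro mult_left_mono) auto
        also have "\<dots> = ennreal s"
          using s by (simp add: ennreal_mult[symmetric] flip: ennreal_numeral)
        finally show False using * by simp
      qed
    qed
    then have "vol {x. ennreal s < 2 * omax U x} \<le> vol {x. ennreal (s / 2) < omax U x}"
      using open_level[OF U(1)] by (intro emeasure_mono) auto
    also have "\<dots> = ennreal D"
      unfolding D_def using U fin s by (intro level_measure_eq) auto
    also have "D \<le> (4 * A / s * e powr u) powr (1 / v)"
    proof (cases "0 < D")
      case True
      have m: "0 < measure lborel U"
        using level_measure_pos(1)[OF U(1) fin _ True[unfolded D_def]] s by simp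
      have m2: "measure lborel U \<le> 2 * e"
        unfolding measure_def using e2 e by (intro enn2real_leI) auto
      have "D powr v \<le> A / (s / 2) * measure lborel U powr u"
        unfolding D_def using True s U fin by (intro A(2)) (auto simp: D_def)
      also have "measure lborel U powr u \<le> (2 * e) powr u"
        using m m2 u by (intro powr_mono2) auto
      also have "(2 * e) powr u = two u * e powr u"
        using e by (simp add: powr_mult)
      also have "\<dots> \<le> 2 * e powr u"
        using powr_mono[OF u(2), of 2] by (intro mult_right_mono) auto
      finally have "D powr v \<le> A / (s / 2) * (2 * e powr u)"
        using A s by (meson divide_nonneg_pos half_gt_zero less_imp_le mult_left_mono order_trans)
      also have "\<dots> = 4 * A / s * e powr u" by simp
      finally have "(D powr v) powr (1 / v) \<le> (4 * A / s * e powr u) powr (1 / v)"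
        using v by (intro powr_mono2) auto
      then show ?thesis using True v by (simp add: powr_powr)
    next
      case False
      then show ?thesis using level_measure_nonneg[of U "s / 2"]
        by (simp add: D_def)
    qed
    finally show "vol {x. ennreal s < 2 * omax U x} \<le> ennreal ((4 * A / s * e powr u) powr (1 / v))"
      by (simp add: ennreal_leI)
  qed
qed

definition strong_type :: "ennreal \<Rightarrow> ennreal \<Rightarrow> bool"
  where "strong_type p q \<longleftrightarrow> (\<exists>C::real. \<forall>f\<in>Lp_space p. local_maximal \<mu> f \<in> borel_measurable lebesgue \<and>
    Lp_norm q (local_maximal \<mu> f) \<le> ennreal C * Lp_norm p (\<lambda>x. ennreal (norm (f x))))"

lemma local_maximal_cmult:
  assumes "c \<noteq> 0"
  shows "local_maximal \<mu> (\<lambda>x. c * f x) x = ennreal (norm c) * local_maximal \<mu> f x"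
proof -
  have "abs_average \<mu> t (\<lambda>x. c * f x) x = ennreal (norm c) * abs_average \<mu> t f x" for t
  proof -
    have "integrable (completion \<mu>) (\<lambda>y. c * f (x - t *\<^sub>R y)) \<longleftrightarrow> integrable (completion \<mu>) (\<lambda>y. f (x - t *\<^sub>R y))"
      using assms integrable_mult_right[of c "completion \<mu>" "\<lambda>y. f (x - t *\<^sub>R y)"]
        integrable_mult_right[of "1 / c" "completion \<mu>" "\<lambda>y. c * f (x - t *\<^sub>R y)"] by auto
    then show ?thesis
      using assms by (simp add: abs_average_def norm_mult ennreal_mult ennreal_mult_top)
  qed
  then show ?thesis
    by (simp add: local_maximal_def SUP_mult_left_ennreal)
qed

text \<open>Homogeneity reduces the estimate to functions of norm at most 1. The norm of
  \<open>f\<close> may be 0, so one divides by an arbitrary larger positive number, which finally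
  tends to the norm.\<close>

lemma strong_typeI:
  fixes B :: real
  assumes p: "1 \<le> p" and q: "1 \<le> q" and B: "0 \<le> B"
    and unit: "\<And>f. f \<in> borel_measurable lebesgue \<Longrightarrow> Lp_norm p (\<lambda>x. ennreal (norm (f x))) \<le> 1 \<Longrightarrow>
      local_maximal \<mu> f \<in> borel_measurable lebesgue \<and> Lp_norm q (local_maximal \<mu> f) \<le> ennreal B"
  shows "strong_type p q"
  unfolding strong_type_def
proof (intro exI[of _ B] ballI)
  fix f :: "'a \<Rightarrow> complex" assume "f \<in> Lp_space p"
  define F where "F = enn2real (Lp_norm p (\<lambda>x. ennreal (norm (f x))))"
  have f: "f \<in> borel_measurable lebesgue" and F: "Lp_norm p (\<lambda>x. ennreal (norm (f x))) = ennreal F" "0 \<le> F"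
    using \<open>f \<in> Lp_space p\<close> by (auto simp: Lp_space_def F_def)
  have nf: "(\<lambda>x. ennreal (norm (f x))) \<in> borel_measurable lebesgue"
    using measurable_comp[OF measurable_comp[OF f borel_measurable_norm] measurable_ennreal] by (simp add: comp_def)
  have scaled: "local_maximal \<mu> f \<in> borel_measurable lebesgue \<and> Lp_norm q (local_maximal \<mu> f) \<le> ennreal (c * B)" if c: "0 < c" "F \<le> c" for c
  proof -
    define g where "g x = complex_of_real (1 / c) * f x" for x
    have g: "g \<in> borel_measurable lebesgue"
      unfolding g_def[abs_def] using f by (intro borel_measurable_times borel_measurable_const)
    have "Lp_norm p (\<lambda>x. ennreal (norm (g x))) = Lp_norm p (\<lambda>x. ennreal (1 / c) * ennreal (norm (f x)))"
      using c by (simp add: g_def norm_mult norm_divide flip: ennreal_mult)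
    also have "\<dots> \<le> ennreal (1 / c) * ennreal F"
      unfolding F(1)[symmetric] using c by (intro Lp_norm_cmult_le nf p) simp
    also have "\<dots> = ennreal (F / c)"
      using c F by (simp flip: ennreal_mult)
    also have "\<dots> \<le> 1"
      using c F by (simp add: ennreal_le_1)
    finally have Mg: "local_maximal \<mu> g \<in> borel_measurable lebesgue" "Lp_norm q (local_maximal \<mu> g) \<le> ennreal B"
      using unit[OF g] by auto
    have "f = (\<lambda>x. complex_of_real c * g x)"
      using c by (auto simp: g_def)
    then have Mf: "local_maximal \<mu> f = (\<lambda>x. ennreal c * local_maximal \<mu> g x)"
      using c local_maximal_cmult[of "complex_of_real c" g] by auto
    have "Lp_norm q (local_maximal \<mu> f) \<le> ennreal c * Lp_norm q (local_maximal \<mu> g)"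
      unfolding Mf using Mg c q by (intro Lp_norm_cmult_le)
    also have "\<dots> \<le> ennreal c * ennreal B"
      by (intro mult_left_mono Mg) auto
    also have "\<dots> = ennreal (c * B)"
      using c B by (intro ennreal_mult[symmetric]) auto
    finally have "Lp_norm q (local_maximal \<mu> f) \<le> ennreal (c * B)" .
    moreover have "local_maximal \<mu> f \<in> borel_measurable lebesgue"
      unfolding Mf using borel_measurable_const Mg(1) by (rule borel_measurable_times_ennreal)
    ultimately show ?thesis by (rule conjI[rotated])
  qed
  have "Lp_norm q (local_maximal \<mu> f) \<le> ennreal (B * F)"
  proof (rule ennreal_le_epsilon)
    fix e :: real assume e: "0 < e"
    define d where "d = e / (B + 1)"
    have d: "0 < d" using e B by (simp add: d_def)
    have "d * B \<le> d * (B + 1)" using d by (intro mult_left_mono) auto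
    also have "\<dots> = e" using B by (simp add: d_def)
    finally have dC: "d * B \<le> e" .
    have "Lp_norm q (local_maximal \<mu> f) \<le> ennreal ((F + d) * B)"
      by (rule scaled[THEN conjunct2]) (use F(2) d in auto)
    also have "\<dots> \<le> ennreal (B * F + e)"
      using dC by (intro ennreal_leI) (simp add: algebra_simps)
    also have "\<dots> = ennreal (B * F) + ennreal e"
      using B F e by simp
    finally show "Lp_norm q (local_maximal \<mu> f) \<le> ennreal (B * F) + ennreal e" .
  qed
  moreover have "local_maximal \<mu> f \<in> borel_measurable lebesgue"
    by (rule scaled[of "F + 1", THEN conjunct1]) (use F(2) in auto)
  ultimately show "local_maximal \<mu> f \<in> borel_measurable lebesgue \<and>
      Lp_norm q (local_maximal \<mu> f) \<le> ennreal B * Lp_norm p (\<lambda>x. ennreal (norm (f x)))"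
    unfolding F(1) ennreal_mult[OF B F(2)] by (rule conjI[rotated])
qed

end

lemma Lp_norm_le_1_imp:
  assumes u: "0 < u" and le: "Lp_norm (ennreal (1 / u)) g \<le> 1"
  shows "(\<integral>\<^sup>+x. ennpowr (g x) (1 / u) \<partial>lebesgue) \<le> 1" (is "?I \<le> 1")
proof -
  have "ennpowr ?I u \<le> 1"
    using le u by (simp add: Lp_norm_finite_exponent)
  then have "ennpowr (ennpowr ?I u) (1 / u) \<le> ennpowr 1 (1 / u)"
    using u by (intro ennpowr_mono) auto
  also have "ennpowr (ennpowr ?I u) (1 / u) = ?I"
    using u by (cases "?I") (auto simp: ennpowr_def powr_powr)
  also have "ennpowr 1 (1 / u) = 1" by (simp add: ennpowr_def)
  finally show ?thesis .
qed

context decaying_measure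
begin

text \<open>A finite integral makes the majorant finite almost everywhere, which is exactly the
  condition for measurability of the maximal function.\<close>

lemma local_maximal_strong_bound:
  assumes ae: "AE x in lborel. local_maximal \<mu> f x \<le> majorant U x" and U: "\<And>k. open (U k)"
    and meas: "AE x in lborel. majorant U x < \<infinity> \<Longrightarrow> local_maximal \<mu> f \<in> borel_measurable lebesgue"
    and q: "0 < q" and int: "(\<integral>\<^sup>+x. ennpowr (majorant U x) q \<partial>lborel) \<le> ennreal B"
  shows "local_maximal \<mu> f \<in> borel_measurable lebesgue"
    "(\<integral>\<^sup>+x. ennpowr (local_maximal \<mu> f x) q \<partial>lebesgue) \<le> ennreal B"
proof -
  have "AE x in lborel. ennpowr (majorant U x) q \<noteq> \<infinity>"
  proof (rule nn_integral_noteq_infinite)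
    show "(\<lambda>x. ennpowr (majorant U x) q) \<in> borel_measurable lborel"
      using borel_measurable_ennpowr[OF borel_measurable_majorant[OF U]] by simp
    show "(\<integral>\<^sup>+x. ennpowr (majorant U x) q \<partial>lborel) \<noteq> \<infinity>"
      using int by (auto simp: top_unique)
  qed
  then have "AE x in lborel. majorant U x < \<infinity>"
  proof eventually_elim
    case (elim x)
    then show ?case
      using q by (cases "majorant U x") (auto simp: ennpowr_def)
  qed
  then show "local_maximal \<mu> f \<in> borel_measurable lebesgue"
    by (rule meas)
  have "AE x in lborel. ennpowr (local_maximal \<mu> f x) q \<le> ennpowr (majorant U x) q"
    using ae by eventually_elim (use q in \<open>intro ennpowr_mono, auto\<close>)
  then have "(\<integral>\<^sup>+x. ennpowr (local_maximal \<mu> f x) q \<partial>lborel) \<le> (\<integral>\<^sup>+x. ennpowr (majorant U x) q \<partial>lborel)"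
    by (rule nn_integral_mono_AE)
  then show "(\<integral>\<^sup>+x. ennpowr (local_maximal \<mu> f x) q \<partial>lebesgue) \<le> ennreal B"
    unfolding nn_integral_completion using int by (rule order_trans)
qed

text \<open>The interpolation is applied to the measures e k of the levels of \<open>f\<close>. Its
  normalisation is the sum of 2^(k/u) e k, bounded by the integral of |f|^(1/u).\<close>

lemma strong_type_interpolated:
  fixes u0 v0 u1 v1 \<theta> :: real
  assumes rw: "restricted_weak (u0, v0)" "restricted_weak (u1, v1)"
    and v: "0 < v1" "v1 < v0" and u: "u1 < u0" "v0 \<le> u0" "v1 \<le> u1" "u0 \<le> 1" and \<theta>: "0 < \<theta>" "\<theta> < 1"
  defines "u \<equiv> (1 - \<theta>) * u0 + \<theta> * u1" and "w \<equiv> (1 - \<theta>) * v0 + \<theta> * v1"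
  shows "strong_type (ennreal (1 / u)) (ennreal (1 / w))"
proof -
  have pos: "0 < u0" "0 < u1" "0 < v0" "u1 \<le> 1" using u v by linarith+
  have uw: "0 < u" "u \<le> 1" "0 < w" "w \<le> 1"
  proof -
    show "0 < u" "0 < w" using pos v \<theta> by (auto simp: u_def w_def intro!: add_pos_pos mult_pos_pos)
    have "(1 - \<theta>) * u0 + \<theta> * u1 \<le> (1 - \<theta>) * 1 + \<theta> * 1"
      using u pos \<theta> by (intro add_mono mult_left_mono) auto
    then show "u \<le> 1" by (simp add: u_def)
    have "(1 - \<theta>) * v0 + \<theta> * v1 \<le> (1 - \<theta>) * 1 + \<theta> * 1"
      using u v pos \<theta> by (intro add_mono mult_left_mono) auto
    then show "w \<le> 1" by (simp add: w_def)
  qed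
  obtain A0 where A0: "0 < A0" "\<And>(U :: 'a set) e s. \<lbrakk>open U; vol U \<le> 2 * ennreal e; 0 \<le> e; 0 < s\<rbrakk> \<Longrightarrow>
    vol {x. ennreal s < 2 * omax U x} \<le> ennreal ((A0 / s * e powr u0) powr (1 / v0))"
    using restricted_weak_emeasure[OF rw(1)] pos u by (metis less_imp_le)
  obtain A1 where A1: "0 < A1" "\<And>(U :: 'a set) e s. \<lbrakk>open U; vol U \<le> 2 * ennreal e; 0 \<le> e; 0 < s\<rbrakk> \<Longrightarrow>
    vol {x. ennreal s < 2 * omax U x} \<le> ennreal ((A1 / s * e powr u1) powr (1 / v1))"
    using restricted_weak_emeasure[OF rw(2)] pos u v by (metis less_imp_le)
  define A where "A = A0 + A1"
  have A: "0 < A" "A0 \<le> A" "A1 \<le> A" using A0 A1 by (auto simp: A_def)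
  have mono: "(A' / s * e powr u') powr (1 / v') \<le> (A / s * e powr u') powr (1 / v')"
    if "0 < A'" "A' \<le> A" "0 < v'" "0 < s" "0 \<le> e" for A' u' v' s e :: real
    using that by (intro powr_mono2 mult_right_mono divide_right_mono) auto
  obtain B where B: "0 < B"
    "\<And>(M :: 'a measure) g e. \<lbrakk>\<forall>k. g k \<in> borel_measurable M; \<forall>k. 0 \<le> e k;
      \<forall>k. \<forall>s>0. emeasure M {x\<in>space M. ennreal s < g k x} \<le> ennreal ((A / s * e k powr u0) powr (1 / v0));
      \<forall>k. \<forall>s>0. emeasure M {x\<in>space M. ennreal s < g k x} \<le> ennreal ((A / s * e k powr u1) powr (1 / v1));
      zsum (\<lambda>k. ennreal (two (real_of_int k / u) * e k)) \<le> 1\<rbrakk> \<Longrightarrow>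
      (\<integral>\<^sup>+x. ennpowr (zsum (\<lambda>k. ennreal (dy k) * g k x)) (1 / w) \<partial>M) \<le> ennreal B"
    by (rule dyadic_interpolation[OF v u(1-3) \<theta> A(1), where 'b = 'a, folded u_def w_def]) (rule that)
  show ?thesis
  proof (rule strong_typeI)
    show "1 \<le> ennreal (1 / u)" "1 \<le> ennreal (1 / w)"
      using uw by (auto simp flip: ennreal_1 intro!: ennreal_leI)
    show "0 \<le> B powr w" by simp
    fix f :: "'a \<Rightarrow> complex"
    assume f: "f \<in> borel_measurable lebesgue" and "Lp_norm (ennreal (1 / u)) (\<lambda>x. ennreal (norm (f x))) \<le> 1"
    then have I: "(\<integral>\<^sup>+x. ennpowr (ennreal (norm (f x))) (1 / u) \<partial>lebesgue) \<le> 1"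
      using uw by (intro Lp_norm_le_1_imp)
    define e where "e k = measure lebesgue (level f k)" for k
    have sum: "zsum (\<lambda>k. ennreal (two (real_of_int k * (1 / u))) * emeasure lebesgue (level f k)) \<le> 1"
      using zsum_level_measure_le[OF f, of "1 / u"] uw I by (meson order_trans zero_less_divide_1_iff)
    have fin: "emeasure lebesgue (level f k) < \<infinity>" for k
    proof -
      have "ennreal (two (real_of_int k * (1 / u))) * emeasure lebesgue (level f k) \<le> 1"
        using zsum_point[of "\<lambda>k. ennreal (two (real_of_int k * (1 / u))) * emeasure lebesgue (level f k)" k] sum by (rule order_trans)
      then show ?thesis
        by (cases "emeasure lebesgue (level f k)") (auto simp: ennreal_mult_top top_unique)
    qed
    have e: "emeasure lebesgue (level f k) = ennreal (e k)" "0 \<le> e k" for k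
      unfolding e_def using fin[of k] by (auto intro!: emeasure_eq_ennreal_measure)
    obtain U where U: "\<And>k. open (U k)" "\<And>k. vol (U k) \<le> 2 * emeasure lebesgue (level f k)"
      and ae: "AE x in lborel. local_maximal \<mu> f x \<le> majorant U x"
      and meas: "AE x in lborel. majorant U x < \<infinity> \<Longrightarrow> local_maximal \<mu> f \<in> borel_measurable lebesgue"
      by (rule maximal_control[OF f fin]) (rule that)
    define g where "g k x = 2 * omax (U k) x" for k x
    have "(\<integral>\<^sup>+x. ennpowr (zsum (\<lambda>k. ennreal (dy k) * g k x)) (1 / w) \<partial>lborel) \<le> ennreal B"
    proof (rule B(2)[where M = lborel and g = g and e = e])
      show "\<forall>k. g k \<in> borel_measurable lborel"
        unfolding g_def[abs_def] using borel_measurable_pos_max_open[OF U(1)] by simp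
      show "\<forall>k. 0 \<le> e k" using e by simp
      show "\<forall>k. \<forall>s>0. vol {x\<in>space lborel. ennreal s < g k x} \<le> ennreal ((A / s * e k powr u0) powr (1 / v0))"
      proof (intro allI impI)
        fix k and s :: real assume s: "0 < s"
        show "vol {x\<in>space lborel. ennreal s < g k x} \<le> ennreal ((A / s * e k powr u0) powr (1 / v0))"
          using order_trans[OF A0(2)[OF U(1)[of k] U(2)[of k, unfolded e] e(2) s] ennreal_leI[OF mono[OF A0(1) A(2) pos(3) s e(2)]]]
          unfolding g_def by simp
      qed
      show "\<forall>k. \<forall>s>0. vol {x\<in>space lborel. ennreal s < g k x} \<le> ennreal ((A / s * e k powr u1) powr (1 / v1))"
      proof (intro allI impI)
        fix k and s :: real assume s: "0 < s"
        show "vol {x\<in>space lborel. ennreal s < g k x} \<le> ennreal ((A / s * e k powr u1) powr (1 / v1))"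
          using order_trans[OF A1(2)[OF U(1)[of k] U(2)[of k, unfolded e] e(2) s] ennreal_leI[OF mono[OF A1(1) A(3) v(1) s e(2)]]]
          unfolding g_def by simp
      qed
      show "zsum (\<lambda>k. ennreal (two (real_of_int k / u) * e k)) \<le> 1"
        using sum e(2) by (simp add: e(1) ennreal_mult)
    qed
    then have int: "(\<integral>\<^sup>+x. ennpowr (majorant U x) (1 / w) \<partial>lborel) \<le> ennreal B"
      by (simp add: majorant_def g_def)
    have w1: "0 < 1 / w" using uw by simp
    note M = local_maximal_strong_bound[OF ae U(1) meas w1 int]
    have "Lp_norm (ennreal (1 / w)) (local_maximal \<mu> f) = ennpowr (\<integral>\<^sup>+x. ennpowr (local_maximal \<mu> f x) (1 / w) \<partial>lebesgue) w"
      using uw by (intro Lp_norm_finite_exponent)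
    also have "\<dots> \<le> ennpowr (ennreal B) w"
      using M(2) uw by (intro ennpowr_mono) auto
    also have "\<dots> = ennreal (B powr w)"
      using B(1) uw by (intro ennpowr_ennreal) auto
    finally show "local_maximal \<mu> f \<in> borel_measurable lebesgue \<and>
        Lp_norm (ennreal (1 / w)) (local_maximal \<mu> f) \<le> ennreal (B powr w)"
      using M(1) by (rule conjI[rotated])
  qed
qed

lemma strong_type_infinity: "strong_type \<infinity> \<infinity>"
proof (rule strong_typeI)
  show "0 \<le> mass" by simp
  fix f :: "'a \<Rightarrow> complex"
  assume f: "f \<in> borel_measurable lebesgue" and "Lp_norm \<infinity> (\<lambda>x. ennreal (norm (f x))) \<le> 1"
  then have sup: "esssup lebesgue (\<lambda>x. ennreal (norm (f x))) \<le> 1"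
    by (simp add: Lp_norm_def)
  have "AE x in lebesgue. norm (f x) \<le> 1"
    using esssup_AE[of "\<lambda>x. ennreal (norm (f x))" lebesgue]
  proof eventually_elim
    case (elim x)
    then have "ennreal (norm (f x)) \<le> 1"
      using sup by (rule order_trans)
    then show ?case by (simp add: ennreal_le_1)
  qed
  then have M: "local_maximal \<mu> f \<in> borel_measurable lebesgue" "AE x in lebesgue. local_maximal \<mu> f x \<le> ennreal (mass * 1)"
    by (rule bounded_maximal[OF f], simp)+
  then have "Lp_norm \<infinity> (local_maximal \<mu> f) \<le> ennreal mass"
    by (simp add: Lp_norm_def esssup_I)
  then show "local_maximal \<mu> f \<in> borel_measurable lebesgue \<and> Lp_norm \<infinity> (local_maximal \<mu> f) \<le> ennreal mass"
    using M by blast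
qed auto

lemma local_maximal_sup_bound:
  assumes ae: "AE x in lborel. local_maximal \<mu> f x \<le> majorant U x"
    and meas: "AE x in lborel. majorant U x < \<infinity> \<Longrightarrow> local_maximal \<mu> f \<in> borel_measurable lebesgue"
    and B: "\<And>x. majorant U x \<le> ennreal B"
  shows "local_maximal \<mu> f \<in> borel_measurable lebesgue" "Lp_norm \<infinity> (local_maximal \<mu> f) \<le> ennreal B"
proof -
  have "majorant U x < \<infinity>" for x
    using B[of x] by (rule order_le_less_trans) simp
  then show M: "local_maximal \<mu> f \<in> borel_measurable lebesgue"
    by (intro meas AE_I2)
  have "AE x in lborel. local_maximal \<mu> f x \<le> ennreal B"
    using ae by eventually_elim (rule order_trans[OF _ B])
  then have "AE x in lebesgue. local_maximal \<mu> f x \<le> ennreal B"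
    by (rule AE_completion)
  then show "Lp_norm \<infinity> (local_maximal \<mu> f) \<le> ennreal B"
    using M by (simp add: Lp_norm_def esssup_I)
qed

text \<open>Here v = 0 and the interpolation between weak types does not apply. The terms of the
  majorant are summed directly: the trivial bound by the mass for k \<le> 0, and |U k| of order
  2^(-kp) for k > 0, which sums because p > 1.\<close>

lemma strong_type_full_dimension:
  assumes dim: "b = DIM('a)" and u: "0 < u" "u < 1"
  shows "strong_type (ennreal (1 / u)) \<infinity>"
proof -
  obtain K where K: "0 < K"
    "\<And>U x. \<lbrakk>open U; vol U < \<infinity>\<rbrakk> \<Longrightarrow> omax U x \<le> ennreal K * vol U"
    by (rule full_dimension[OF dim]) (rule that)
  define p where "p = 1 / u"
  have p: "1 < p" using u by (simp add: p_def)
  define \<eta> where "\<eta> = min 1 (p - 1)"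
  have \<eta>: "0 < \<eta>" "\<eta> \<le> 1" "\<eta> \<le> p - 1" using p by (auto simp: \<eta>_def)
  obtain W where W: "0 < W" "\<And>x::real. zsum (\<lambda>k. ennreal (two (- \<eta> * \<bar>real_of_int k - x\<bar>))) \<le> ennreal W"
    by (rule zsum_geometric[OF \<eta>(1)]) (rule that)
  define L where "L = 2 * mass + 4 * K"
  have L: "0 \<le> L" "2 * mass \<le> L" "4 * K \<le> L" using K by (auto simp: L_def)
  show ?thesis
    unfolding p_def[symmetric]
  proof (rule strong_typeI)
    show "1 \<le> ennreal p" using p by (simp flip: ennreal_1)
    show "0 \<le> L * W" using L W by simp
    fix f :: "'a \<Rightarrow> complex"
    assume f: "f \<in> borel_measurable lebesgue" and "Lp_norm (ennreal p) (\<lambda>x. ennreal (norm (f x))) \<le> 1"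
    then have I: "(\<integral>\<^sup>+x. ennpowr (ennreal (norm (f x))) p \<partial>lebesgue) \<le> 1"
      using u unfolding p_def by (intro Lp_norm_le_1_imp)
    have level: "ennreal (two (real_of_int k * p)) * emeasure lebesgue (level f k) \<le> 1" for k
      using zsum_point[of "\<lambda>k. ennreal (two (real_of_int k * p)) * emeasure lebesgue (level f k)" k] zsum_level_measure_le[OF f, of p] p I
      by (meson less_trans order_trans zero_less_one)
    have le: "emeasure lebesgue (level f k) \<le> ennreal (two (- real_of_int k * p))" for k
    proof -
      have "emeasure lebesgue (level f k) = ennreal (two (- real_of_int k * p)) * (ennreal (two (real_of_int k * p)) * emeasure lebesgue (level f k))"
        unfolding mult.assoc[symmetric] by (simp add: powr_minus flip: ennreal_mult)
      also have "\<dots> \<le> ennreal (two (- real_of_int k * p)) * 1"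
        by (intro mult_left_mono level) simp
      finally show ?thesis by simp
    qed
    have fin: "emeasure lebesgue (level f k) < \<infinity>" for k
      using le[of k] by (rule order_le_less_trans) simp
    obtain U where U: "\<And>k. open (U k)" "\<And>k. vol (U k) \<le> 2 * emeasure lebesgue (level f k)"
      and ae: "AE x in lborel. local_maximal \<mu> f x \<le> majorant U x"
      and meas: "AE x in lborel. majorant U x < \<infinity> \<Longrightarrow> local_maximal \<mu> f \<in> borel_measurable lebesgue"
      by (rule maximal_control[OF f fin]) (rule that)
    have "majorant U x \<le> ennreal (L * W)" for x
    proof -
      have piece: "ennreal (dy k) * (2 * omax (U k) x) \<le> ennreal L * ennreal (two (- \<eta> * \<bar>real_of_int k - 0\<bar>))" for k
      proof -
        have "\<exists>X\<ge>0. omax (U k) x \<le> ennreal X \<and> dy k * (2 * X) \<le> L * two (- \<eta> * \<bar>real_of_int k - 0\<bar>)"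
        proof (cases "k \<le> 0")
          case True
          have "dy k \<le> two (- \<eta> * \<bar>real_of_int k - 0\<bar>)"
            using True \<eta> mult_right_mono[of \<eta> 1 "- real_of_int k"] by (intro powr_mono) auto
          then have "(2 * mass) * dy k \<le> L * two (- \<eta> * \<bar>real_of_int k - 0\<bar>)"
            using L by (intro mult_mono) auto
          then show ?thesis
            using pos_max_indicator_le[of "U k" x] by (intro exI[of _ mass]) (auto simp: mult_ac)
        next
          case False
          have "vol (U k) \<le> 2 * ennreal (two (- real_of_int k * p))"
            using U(2)[of k] le[of k] by (meson mult_left_mono order_trans zero_le)
          then have Uk: "vol (U k) \<le> ennreal (2 * two (- real_of_int k * p))"
            by (simp add: ennreal_mult)
          then have "vol (U k) < \<infinity>"
            by (rule order_le_less_trans) simp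
          then have "omax (U k) x \<le> ennreal K * vol (U k)"
            by (rule K(2)[OF U(1)])
          also have "\<dots> \<le> ennreal K * ennreal (2 * two (- real_of_int k * p))"
            by (intro mult_left_mono Uk) simp
          also have "\<dots> = ennreal (K * (2 * two (- real_of_int k * p)))"
            using K by (intro ennreal_mult[symmetric]) auto
          finally have X: "omax (U k) x \<le> ennreal (K * (2 * two (- real_of_int k * p)))" .
          have "dy k * (2 * (K * (2 * two (- real_of_int k * p)))) = (4 * K) * two (real_of_int k + - real_of_int k * p)"
            by (simp only: powr_add) simp
          also have "\<dots> \<le> L * two (- \<eta> * \<bar>real_of_int k - 0\<bar>)"
            using False \<eta> L mult_right_mono[of \<eta> "p - 1" "real_of_int k"] by (intro mult_mono powr_mono) (auto simp: algebra_simps)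
          finally show ?thesis
            using X K by (intro exI[of _ "K * (2 * two (- real_of_int k * p))"]) auto
        qed
        then obtain X where X: "0 \<le> X" "omax (U k) x \<le> ennreal X" "dy k * (2 * X) \<le> L * two (- \<eta> * \<bar>real_of_int k - 0\<bar>)"
          by blast
        have "ennreal (dy k) * (2 * omax (U k) x) \<le> ennreal (dy k) * (2 * ennreal X)"
          by (intro mult_left_mono X) auto
        also have "\<dots> = ennreal (dy k * (2 * X))"
          using X by (simp add: ennreal_mult)
        also have "\<dots> \<le> ennreal (L * two (- \<eta> * \<bar>real_of_int k - 0\<bar>))"
          by (intro ennreal_leI X)
        also have "\<dots> = ennreal L * ennreal (two (- \<eta> * \<bar>real_of_int k - 0\<bar>))"
          using L by (intro ennreal_mult) auto
        finally show ?thesis .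
      qed
      have "majorant U x \<le> zsum (\<lambda>k. ennreal L * ennreal (two (- \<eta> * \<bar>real_of_int k - 0\<bar>)))"
        unfolding majorant_def by (intro nn_integral_mono piece)
      also have "\<dots> = ennreal L * zsum (\<lambda>k. ennreal (two (- \<eta> * \<bar>real_of_int k - 0\<bar>)))"
        by (rule nn_integral_cmult) simp
      also have "\<dots> \<le> ennreal L * ennreal W"
        by (intro mult_left_mono W) auto
      also have "\<dots> = ennreal (L * W)"
        using L W by (intro ennreal_mult[symmetric]) auto
      finally show ?thesis .
    qed
    from local_maximal_sup_bound[OF ae meas this]
    show "local_maximal \<mu> f \<in> borel_measurable lebesgue \<and> Lp_norm \<infinity> (local_maximal \<mu> f) \<le> ennreal (L * W)"
      by blast
  qed simp
qed

end

section \<open>Lorentz norms in terms of dyadic levels\<close>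

lemma powr_integral_ge:
  fixes u r :: real
  assumes u: "0 < u" and r: "0 \<le> r"
  shows "ennreal (r powr u) \<le> ennreal u * (\<integral>\<^sup>+t\<in>{0<..}. ennreal (t powr (u - 1)) * indicator {t. ennreal t < ennreal r} t \<partial>lborel)"
proof -
  have "((\<lambda>t. t powr (u - 1)) has_integral (r powr (u - 1 + 1) / (u - 1 + 1))) {0..r}"
    using u r by (intro has_integral_powr_from_0) auto
  then have I: "(\<integral>\<^sup>+t. ennreal (t powr (u - 1)) * indicator {0..r} t \<partial>lborel) = ennreal (r powr u / u)"
    using nn_integral_has_integral_lebesgue'[of "{0..r}" "\<lambda>t. t powr (u - 1)" "r powr u / u"] by simp
  have "ennreal (r powr u) = ennreal u * ennreal (r powr u / u)"
    using u by (simp flip: ennreal_mult)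
  also have "ennreal (r powr u / u) = (\<integral>\<^sup>+t\<in>{0<..}. ennreal (t powr (u - 1)) * indicator {t. ennreal t < ennreal r} t \<partial>lborel)"
    unfolding I[symmetric]
  proof (rule nn_integral_cong_AE)
    have "AE t in lborel. t \<noteq> 0 \<and> t \<noteq> r"
      using AE_lborel_singleton[of 0] AE_lborel_singleton[of r] by eventually_elim simp
    then show "AE t in lborel. ennreal (t powr (u - 1)) * indicator {0..r} t =
        ennreal (t powr (u - 1)) * indicator {t. ennreal t < ennreal r} t * indicator {0<..} t"
      by eventually_elim (use r in \<open>auto simp: indicator_def ennreal_less_iff\<close>)
  qed
  finally show ?thesis by simp
qed

text \<open>Writes a power of a measure as an integral over t < D, so that the sum over levels can
  be exchanged with the integral in the Lorentz norm.\<close>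

lemma ennpowr_integral_ge:
  assumes u: "0 < u"
  shows "ennpowr D u \<le> ennreal u * (\<integral>\<^sup>+t\<in>{0<..}. ennreal (t powr (u - 1)) * indicator {t. ennreal t < D} t \<partial>lborel)"
    (is "_ \<le> ?J D")
proof (cases D)
  case (real r)
  then show ?thesis
    using powr_integral_ge[OF u, of r] u by (simp add: ennpowr_ennreal)
next
  case top
  have le: "ennreal (real n) \<le> ?J D" for n
  proof -
    have "ennreal (real n) = ennreal ((real n powr (1 / u)) powr u)"
      using u by (simp add: powr_powr)
    also have "\<dots> \<le> ?J (ennreal (real n powr (1 / u)))"
      by (rule powr_integral_ge[OF u]) simp
    also have "\<dots> \<le> ?J D"
      by (intro mult_left_mono nn_integral_mono mult_right_mono) (auto simp: top indicator_def)
    finally show ?thesis .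
  qed
  have "?J D = \<infinity>"
  proof (rule ccontr)
    assume "?J D \<noteq> \<infinity>"
    then obtain x where x: "?J D = ennreal x" "0 \<le> x" by (cases "?J D") auto
    obtain n where "x < real n" using reals_Archimedean2 by blast
    then show False using le[of n] x by (simp add: ennreal_le_iff)
  qed
  then show ?thesis by simp
qed

text \<open>The admissible powers of 2 are bounded by 2 y and form a geometric series, dominated by
  its largest member.\<close>

lemma zsum_two_le:
  obtains B where "0 < B" "\<And>y. zsum (\<lambda>k. ennreal (dy k) * (if ennreal (two (real_of_int k - 1)) \<le> y then 1 else 0)) \<le> ennreal B * y"
proof -
  obtain W where W: "0 < W" "\<And>x::real. zsum (\<lambda>k. ennreal (two (- 1 * \<bar>real_of_int k - x\<bar>))) \<le> ennreal W"
    by (rule zsum_geometric[of 1]) (auto intro: that)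
  show thesis
  proof
    show "0 < 2 * W" using W by simp
    fix y :: ennreal
    show "zsum (\<lambda>k. ennreal (dy k) * (if ennreal (two (real_of_int k - 1)) \<le> y then 1 else 0)) \<le> ennreal (2 * W) * y"
    proof (cases y)
      case (real r)
      show ?thesis
      proof (cases "r = 0")
        case True
        then show ?thesis using real by (simp add: ennreal_eq_0_iff not_le)
      next
        case False
        then have r: "0 < r" using real by simp
        define x where "x = log 2 r + 1"
        have x: "two x = 2 * r" using r by (simp add: x_def powr_add)
        have "ennreal (dy k) * (if ennreal (two (real_of_int k - 1)) \<le> y then 1 else 0) \<le>
            ennreal (2 * r) * ennreal (two (- 1 * \<bar>real_of_int k - x\<bar>))" for k
        proof (cases "ennreal (two (real_of_int k - 1)) \<le> y")
          case True
          then have "two (real_of_int k - 1) \<le> r"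
            using real by (simp add: ennreal_le_iff)
          then have "real_of_int k - 1 \<le> log 2 r"
            using r by (simp add: le_log_iff)
          then have "real_of_int k \<le> x" by (simp add: x_def)
          then have "dy k = two x * two (- 1 * \<bar>real_of_int k - x\<bar>)"
            by (simp flip: powr_add)
          then have "ennreal (dy k) = ennreal (2 * r) * ennreal (two (- 1 * \<bar>real_of_int k - x\<bar>))"
            unfolding x using r by (simp add: ennreal_mult)
          then show ?thesis using True by simp
        qed simp
        then have "zsum (\<lambda>k. ennreal (dy k) * (if ennreal (two (real_of_int k - 1)) \<le> y then 1 else 0)) \<le>
            zsum (\<lambda>k. ennreal (2 * r) * ennreal (two (- 1 * \<bar>real_of_int k - x\<bar>)))"
          by (intro nn_integral_mono)
        also have "\<dots> = ennreal (2 * r) * zsum (\<lambda>k. ennreal (two (- 1 * \<bar>real_of_int k - x\<bar>)))"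
          by (rule nn_integral_cmult) simp
        also have "\<dots> \<le> ennreal (2 * r) * ennreal W"
          by (intro mult_left_mono W) auto
        also have "\<dots> = ennreal (2 * W) * y"
          using r W real by (simp add: mult_ac flip: ennreal_mult)
        finally show ?thesis .
      qed
    next
      case top
      have "ennreal (2 * W) * y = \<infinity>"
        using W unfolding top by (simp add: ennreal_mult_top)
      then show ?thesis by simp
    qed
  qed
qed

lemma decreasing_rearrangement_ge:
  fixes g :: "'a::euclidean_space \<Rightarrow> ennreal"
  assumes g: "g \<in> borel_measurable lebesgue" and t: "ennreal t < distribution_fun g s"
  shows "s \<le> decreasing_rearrangement g t"
  unfolding decreasing_rearrangement_def
proof (rule Inf_greatest, rule ccontr)
  fix s' assume s': "s' \<in> {s. distribution_fun g s \<le> ennreal t}" and "\<not> s \<le> s'"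
  then have "s' < s" by simp
  then have "{x. s < g x} \<subseteq> {x. s' < g x}" by auto
  moreover have "{x. s' < g x} \<in> sets lebesgue"
  proof -
    have "g -` {s'<..} \<inter> space lebesgue \<in> sets lebesgue"
      using g by (rule measurable_sets) simp
    also have "g -` {s'<..} \<inter> space lebesgue = {x. s' < g x}" by auto
    finally show ?thesis .
  qed
  ultimately have "distribution_fun g s \<le> distribution_fun g s'"
    unfolding distribution_fun_def by (rule emeasure_mono)
  then show False
    using s' t by simp
qed

text \<open>Monotonicity makes the superlevel sets intervals.\<close>

lemma borel_measurable_decreasing_rearrangement [measurable]:
  "decreasing_rearrangement g \<in> borel_measurable borel"
proof (rule borel_measurableI_greater)
  fix y
  have anti: "decreasing_rearrangement g t \<le> decreasing_rearrangement g s" if "s \<le> t" for s t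
    unfolding decreasing_rearrangement_def using that
    by (intro Inf_superset_mono) (auto intro: order_trans ennreal_leI)
  have "is_interval {t. y < decreasing_rearrangement g t}"
    unfolding is_interval_1 using anti by (auto intro: order_less_le_trans)
  then show "{t \<in> space borel. y < decreasing_rearrangement g t} \<in> sets borel"
    by (simp add: real_interval_borel_measurable)
qed

text \<open>At a fixed \<open>t\<close> the level \<open>k\<close> contributes only if the
  distribution function at 2^(k-1) exceeds \<open>t\<close>, which forces the rearrangement at
  \<open>t\<close> to be at least 2^(k-1). The sum over such \<open>k\<close> is geometric, leaving
  the integrand of the Lorentz norm with second index 1.\<close>

lemma zsum_level_le_Lorentz_norm:
  assumes u: "0 < u"
  obtains B where "0 < B" "\<And>(f :: 'a::euclidean_space \<Rightarrow> complex) p. f \<in> borel_measurable lebesgue \<Longrightarrow> recip p = u \<Longrightarrow>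
    zsum (\<lambda>k. ennreal (dy k) * ennpowr (emeasure lebesgue (level f k)) u) \<le> ennreal B * Lorentz_norm p 1 (\<lambda>x. ennreal (norm (f x)))"
proof -
  obtain B where B: "0 < B" "\<And>y. zsum (\<lambda>k. ennreal (dy k) * (if ennreal (two (real_of_int k - 1)) \<le> y then 1 else 0)) \<le> ennreal B * y"
    by (rule zsum_two_le) (rule that)
  show thesis
  proof
    show "0 < B * u" using B u by simp
    fix f :: "'a \<Rightarrow> complex" and p assume f: "f \<in> borel_measurable lebesgue" and p: "recip p = u"
    define g where "g x = ennreal (norm (f x))" for x
    have g: "g \<in> borel_measurable lebesgue"
      using measurable_comp[OF measurable_comp[OF f borel_measurable_norm] measurable_ennreal] by (simp add: comp_def g_def[abs_def])
    \<comment> \<open>The threshold 2^(k-1) lies strictly below the values on the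
      \<open>k\<close>-th level, as the strict inequality in the distribution function
      demands.\<close>
    define D where "D k = distribution_fun g (ennreal (two (real_of_int k - 1)))" for k
    have lev: "emeasure lebesgue (level f k) \<le> D k" for k
      unfolding D_def distribution_fun_def
    proof (rule emeasure_mono)
      have "g -` {ennreal (two (real_of_int k - 1))<..} \<inter> space lebesgue \<in> sets lebesgue"
        using g by (rule measurable_sets) simp
      also have "g -` {ennreal (two (real_of_int k - 1))<..} \<inter> space lebesgue = {x. ennreal (two (real_of_int k - 1)) < g x}" by auto
      finally show "{x. ennreal (two (real_of_int k - 1)) < g x} \<in> sets lebesgue" .
      have "two (real_of_int k - 1) < norm (f x)" if "x \<in> level f k" for x
      proof -
        have "two (real_of_int k - 1) < dy k" by simp
        also have "\<dots> \<le> norm (f x)" using that by (simp add: level_def)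
        finally show ?thesis .
      qed
      then show "level f k \<subseteq> {x. ennreal (two (real_of_int k - 1)) < g x}"
        by (auto simp: g_def ennreal_less_iff)
    qed
    define J where "J t = ennreal (t powr (u - 1)) * indicator {0<..} t" for t :: real
    have [measurable]: "J \<in> borel_measurable borel"
      unfolding J_def[abs_def] by measurable
    have m: "(\<lambda>t. indicator {t. ennreal t < D k} t :: ennreal) \<in> borel_measurable borel" for k
      by measurable
    have "ennpowr (emeasure lebesgue (level f k)) u \<le> ennreal u * (\<integral>\<^sup>+t. J t * indicator {t. ennreal t < D k} t \<partial>lborel)" for k
    proof -
      have "ennpowr (emeasure lebesgue (level f k)) u \<le> ennpowr (D k) u"
        using u by (intro ennpowr_mono lev) simp
      also note ennpowr_integral_ge[OF u, of "D k"]
      finally show ?thesis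
        by (simp add: J_def mult_ac)
    qed
    then have "zsum (\<lambda>k. ennreal (dy k) * ennpowr (emeasure lebesgue (level f k)) u) \<le>
        zsum (\<lambda>k. ennreal (dy k) * (ennreal u * (\<integral>\<^sup>+t. J t * indicator {t. ennreal t < D k} t \<partial>lborel)))"
      by (intro nn_integral_mono mult_left_mono) auto
    also have "\<dots> = zsum (\<lambda>k. \<integral>\<^sup>+t. ennreal u * J t * (ennreal (dy k) * indicator {t. ennreal t < D k} t) \<partial>lborel)"
    proof (intro nn_integral_cong)
      fix k
      define c where "c = ennreal (dy k) * ennreal u"
      have "ennreal (dy k) * (ennreal u * (\<integral>\<^sup>+t. J t * indicator {t. ennreal t < D k} t \<partial>lborel)) = c * (\<integral>\<^sup>+t. J t * indicator {t. ennreal t < D k} t \<partial>lborel)"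
        by (simp add: c_def mult.assoc)
      also have "\<dots> = (\<integral>\<^sup>+t. c * (J t * indicator {t. ennreal t < D k} t) \<partial>lborel)"
        by (rule nn_integral_cmult[symmetric]) measurable
      also have "\<dots> = (\<integral>\<^sup>+t. ennreal u * J t * (ennreal (dy k) * indicator {t. ennreal t < D k} t) \<partial>lborel)"
        by (simp add: c_def mult_ac)
      finally show "ennreal (dy k) * (ennreal u * (\<integral>\<^sup>+t. J t * indicator {t. ennreal t < D k} t \<partial>lborel)) = \<dots>" .
    qed
    also have "\<dots> = (\<integral>\<^sup>+t. zsum (\<lambda>k. ennreal u * J t * (ennreal (dy k) * indicator {t. ennreal t < D k} t)) \<partial>lborel)"
      by (rule zsum_nn_integral[symmetric]) measurable
    also have "\<dots> \<le> (\<integral>\<^sup>+t. ennreal (B * u) * (J t * decreasing_rearrangement g t) \<partial>lborel)"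
    proof (rule nn_integral_mono)
      fix t :: real
      have "zsum (\<lambda>k. ennreal u * J t * (ennreal (dy k) * indicator {t. ennreal t < D k} t)) =
          ennreal u * J t * zsum (\<lambda>k. ennreal (dy k) * indicator {t. ennreal t < D k} t)"
        by (rule nn_integral_cmult) simp
      also have "zsum (\<lambda>k. ennreal (dy k) * indicator {t. ennreal t < D k} t) \<le>
          zsum (\<lambda>k. ennreal (dy k) * (if ennreal (two (real_of_int k - 1)) \<le> decreasing_rearrangement g t then 1 else 0))"
        using decreasing_rearrangement_ge[OF g] by (intro nn_integral_mono mult_left_mono) (auto simp: D_def indicator_def)
      also have "\<dots> \<le> ennreal B * decreasing_rearrangement g t"
        by (rule B)
      finally have "zsum (\<lambda>k. ennreal u * J t * (ennreal (dy k) * indicator {t. ennreal t < D k} t)) \<le>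
          ennreal u * J t * (ennreal B * decreasing_rearrangement g t)"
        by (simp add: mult_left_mono)
      then show "zsum (\<lambda>k. ennreal u * J t * (ennreal (dy k) * indicator {t. ennreal t < D k} t)) \<le>
          ennreal (B * u) * (J t * decreasing_rearrangement g t)"
        using B u by (simp add: ennreal_mult mult_ac)
    qed
    also have "\<dots> = ennreal (B * u) * (\<integral>\<^sup>+t. J t * decreasing_rearrangement g t \<partial>lborel)"
      by (rule nn_integral_cmult) measurable
    also have "(\<integral>\<^sup>+t. J t * decreasing_rearrangement g t \<partial>lborel) = Lorentz_norm p 1 g"
    proof -
      have "J t * decreasing_rearrangement g t =
          ennpowr (ennreal (t powr recip p) * decreasing_rearrangement g t) (enn2real 1) * ennreal (1 / t) * indicator {0<..} t" for t
      proof (cases "0 < t")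
        case True
        then have "t powr (u - 1) = t powr u * (1 / t)"
          by (simp add: powr_diff)
        then have "ennreal (t powr (u - 1)) = ennreal (t powr u) * ennreal (1 / t)"
          using True by (simp only:) (intro ennreal_mult, auto)
        then show ?thesis
          using True by (simp add: J_def p mult_ac)
      qed (simp add: J_def)
      then show ?thesis
        by (simp add: Lorentz_norm_def)
    qed
    finally show "zsum (\<lambda>k. ennreal (dy k) * ennpowr (emeasure lebesgue (level f k)) u) \<le> ennreal (B * u) * Lorentz_norm p 1 (\<lambda>x. ennreal (norm (f x)))"
      by (simp add: g_def[abs_def])
  qed
qed

lemma Lorentz_norm_weak_le:
  fixes g :: "'a::euclidean_space \<Rightarrow> ennreal"
  assumes q: "recip q = v" and v: "0 < v" and B: "0 \<le> B"
    and weak: "\<And>s. 0 < s \<Longrightarrow> emeasure lebesgue {x. ennreal s < g x} \<le> ennreal ((B / s) powr (1 / v))"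
  shows "Lorentz_norm q \<infinity> g \<le> ennreal B"
proof -
  have "ennreal (t powr v) * decreasing_rearrangement g t \<le> ennreal B" if t: "0 < t" for t
  proof (rule ennreal_le_epsilon)
    fix e :: real assume e: "0 < e"
    \<comment> \<open>The height at which the weak bound equals \<open>t\<close>; adding
      \<open>e\<close> keeps it positive when B = 0.\<close>
    define s where "s = (B + e) / t powr v"
    have s: "0 < s" using t B e by (simp add: s_def)
    have "B / s \<le> t powr v"
      using t B e by (simp add: s_def divide_simps mult_right_mono)
    then have "(B / s) powr (1 / v) \<le> (t powr v) powr (1 / v)"
      using v B s by (intro powr_mono2) auto
    also have "\<dots> = t" using t v by (simp add: powr_powr)
    finally have "distribution_fun g (ennreal s) \<le> ennreal t"
      unfolding distribution_fun_def using weak[OF s] by (meson ennreal_leI order_trans)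
    then have "decreasing_rearrangement g t \<le> ennreal s"
      unfolding decreasing_rearrangement_def by (intro Inf_lower) simp
    then have "ennreal (t powr v) * decreasing_rearrangement g t \<le> ennreal (t powr v) * ennreal s"
      by (intro mult_left_mono) auto
    also have "\<dots> = ennreal (t powr v * s)"
      using s by (intro ennreal_mult[symmetric]) auto
    also have "t powr v * s = B + e" using t by (simp add: s_def)
    also have "ennreal (B + e) = ennreal B + ennreal e"
      using B e by simp
    finally show "ennreal (t powr v) * decreasing_rearrangement g t \<le> ennreal B + ennreal e" .
  qed
  then show ?thesis
    by (simp add: Lorentz_norm_def q SUP_le_iff)
qed

context decaying_measure
begin

definition restricted_type :: "ennreal \<Rightarrow> ennreal \<Rightarrow> bool"
  where "restricted_type p q \<longleftrightarrow> (\<exists>C::real. \<forall>f\<in>Lorentz_space p 1. local_maximal \<mu> f \<in> borel_measurable lebesgue \<and>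
    Lorentz_norm q \<infinity> (local_maximal \<mu> f) \<le> ennreal C * Lorentz_norm p 1 (\<lambda>x. ennreal (norm (f x))))"

text \<open>Reduces an endpoint estimate to bounding the majorant in terms of the sum of 2^k |level
  k|^u, which the Lorentz norm controls.\<close>

lemma restricted_typeI:
  fixes B :: real
  assumes u: "recip p = u" "0 < u" and B: "0 \<le> B"
    and core: "\<And>f U r. \<lbrakk>f \<in> borel_measurable lebesgue; \<And>k. open (U k);
      \<And>k. vol (U k) \<le> 2 * emeasure lebesgue (level f k);
      AE x in lborel. local_maximal \<mu> f x \<le> majorant U x;
      AE x in lborel. majorant U x < \<infinity> \<Longrightarrow> local_maximal \<mu> f \<in> borel_measurable lebesgue;
      \<And>k. emeasure lebesgue (level f k) = ennreal (measure lebesgue (level f k));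
      zsum (\<lambda>k. ennreal (dy k * measure lebesgue (level f k) powr u)) \<le> ennreal r; 0 \<le> r\<rbrakk> \<Longrightarrow>
      local_maximal \<mu> f \<in> borel_measurable lebesgue \<and> Lorentz_norm q \<infinity> (local_maximal \<mu> f) \<le> ennreal (B * r)"
  shows "restricted_type p q"
proof -
  obtain L where L: "0 < L" "\<And>(f :: 'a \<Rightarrow> complex) p. f \<in> borel_measurable lebesgue \<Longrightarrow> recip p = u \<Longrightarrow>
    zsum (\<lambda>k. ennreal (dy k) * ennpowr (emeasure lebesgue (level f k)) u) \<le> ennreal L * Lorentz_norm p 1 (\<lambda>x. ennreal (norm (f x)))"
    by (rule zsum_level_le_Lorentz_norm[OF u(2), where 'a = 'a]) (rule that)
  show ?thesis
    unfolding restricted_type_def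
  proof (intro exI[of _ "B * L"] ballI)
    fix f :: "'a \<Rightarrow> complex" assume "f \<in> Lorentz_space p 1"
    define F where "F = enn2real (Lorentz_norm p 1 (\<lambda>x. ennreal (norm (f x))))"
    have f: "f \<in> borel_measurable lebesgue" and F: "Lorentz_norm p 1 (\<lambda>x. ennreal (norm (f x))) = ennreal F" "0 \<le> F"
      using \<open>f \<in> Lorentz_space p 1\<close> by (auto simp: Lorentz_space_def F_def)
    have sum: "zsum (\<lambda>k. ennreal (dy k) * ennpowr (emeasure lebesgue (level f k)) u) \<le> ennreal (L * F)"
      using L(2)[OF f u(1)] L(1) F by (simp add: ennreal_mult)
    have fin: "emeasure lebesgue (level f k) < \<infinity>" for k
    proof -
      have "ennreal (dy k) * ennpowr (emeasure lebesgue (level f k)) u \<le> ennreal (L * F)"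
        using zsum_point[of "\<lambda>k. ennreal (dy k) * ennpowr (emeasure lebesgue (level f k)) u" k] sum by (rule order_trans)
      then show ?thesis
        using u by (cases "emeasure lebesgue (level f k)") (auto simp: ennpowr_def ennreal_mult_top top_unique)
    qed
    have e: "emeasure lebesgue (level f k) = ennreal (measure lebesgue (level f k))" for k
      using fin[of k] by (auto intro!: emeasure_eq_ennreal_measure)
    have pe: "ennreal (dy k) * ennpowr (emeasure lebesgue (level f k)) u = ennreal (dy k * measure lebesgue (level f k) powr u)" for k
      using u(2) unfolding e[of k] by (simp add: ennpowr_ennreal ennreal_mult)
    obtain U where U: "\<And>k. open (U k)" "\<And>k. vol (U k) \<le> 2 * emeasure lebesgue (level f k)"
      and ae: "AE x in lborel. local_maximal \<mu> f x \<le> majorant U x"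
      and meas: "AE x in lborel. majorant U x < \<infinity> \<Longrightarrow> local_maximal \<mu> f \<in> borel_measurable lebesgue"
      by (rule maximal_control[OF f fin]) (rule that)
    have LF: "0 \<le> L * F" using L F by simp
    have M: "local_maximal \<mu> f \<in> borel_measurable lebesgue \<and> Lorentz_norm q \<infinity> (local_maximal \<mu> f) \<le> ennreal (B * (L * F))"
      by (rule core[OF f U ae meas e sum[unfolded pe] LF])
    have "ennreal (B * (L * F)) = ennreal (B * L) * ennreal F"
      using B L F by (subst ennreal_mult[symmetric]) (auto simp: mult.assoc)
    then show "local_maximal \<mu> f \<in> borel_measurable lebesgue \<and>
        Lorentz_norm q \<infinity> (local_maximal \<mu> f) \<le> ennreal (B * L) * Lorentz_norm p 1 (\<lambda>x. ennreal (norm (f x)))"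
      using M unfolding F(1) by (simp only:)
  qed
qed

text \<open>The weak bound tends to 0 as the height grows, so the majorant is finite almost
  everywhere and the maximal function is measurable.\<close>

lemma restricted_type_of_weak_bound:
  assumes ae: "AE x in lborel. local_maximal \<mu> f x \<le> majorant U x" and U: "\<And>k. open (U k)"
    and meas: "AE x in lborel. majorant U x < \<infinity> \<Longrightarrow> local_maximal \<mu> f \<in> borel_measurable lebesgue"
    and weak: "\<And>s. 0 < s \<Longrightarrow> vol {x. ennreal s < majorant U x} \<le> ennreal ((B / s) powr (1 / v))"
    and q: "recip q = v" "0 < v" and B: "0 \<le> B"
  shows "local_maximal \<mu> f \<in> borel_measurable lebesgue \<and> Lorentz_norm q \<infinity> (local_maximal \<mu> f) \<le> ennreal B"
proof -
  have H: "majorant U \<in> borel_measurable borel"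
    using U by (rule borel_measurable_majorant)
  have sets: "{x. c < majorant U x} \<in> sets borel" for c
  proof -
    have "majorant U -` {c<..} \<inter> space borel \<in> sets borel"
      using H by (rule measurable_sets) simp
    also have "majorant U -` {c<..} \<inter> space borel = {x. c < majorant U x}" by auto
    finally show ?thesis .
  qed
  have "vol {x. \<not> majorant U x < \<infinity>} = 0"
  proof -
    have lim: "(\<lambda>n. ennreal ((B / real (Suc n)) powr (1 / v))) \<longlonglongrightarrow> 0"
    proof -
      have "(\<lambda>n. B / real (Suc n)) \<longlonglongrightarrow> 0"
        by (rule LIMSEQ_Suc[OF lim_const_over_n])
      then have "(\<lambda>n. (B / real (Suc n)) powr (1 / v)) \<longlonglongrightarrow> 0 powr (1 / v)"
        using q B by (intro tendsto_powr2 tendsto_const) auto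
      then have "(\<lambda>n. ennreal ((B / real (Suc n)) powr (1 / v))) \<longlonglongrightarrow> ennreal 0"
        using q by (intro tendsto_ennrealI) simp
      then show ?thesis by simp
    qed
    have le: "vol {x. \<not> majorant U x < \<infinity>} \<le> ennreal ((B / real (Suc n)) powr (1 / v))" for n
    proof -
      have "vol {x. \<not> majorant U x < \<infinity>} \<le> vol {x. ennreal (real (Suc n)) < majorant U x}"
        using sets by (intro emeasure_mono) (auto simp: not_less top_unique simp del: of_nat_Suc)
      also have "\<dots> \<le> ennreal ((B / real (Suc n)) powr (1 / v))"
        by (rule weak) simp
      finally show ?thesis .
    qed
    have "vol {x. \<not> majorant U x < \<infinity>} \<le> 0"
      by (rule tendsto_lowerbound[OF lim always_eventually[OF allI[OF le]]]) simp
    then show ?thesis by simp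
  qed
  moreover have "{x. \<not> majorant U x < \<infinity>} \<in> sets lborel"
  proof -
    have "majorant U -` {\<infinity>} \<inter> space borel \<in> sets borel"
      using H by (rule measurable_sets) simp
    also have "majorant U -` {\<infinity>} \<inter> space borel = {x. \<not> majorant U x < \<infinity>}"
      by (auto simp: not_less top_unique)
    finally show ?thesis by simp
  qed
  ultimately have "{x. \<not> majorant U x < \<infinity>} \<in> null_sets lborel"
    by (intro null_setsI)
  then have "AE x in lborel. majorant U x < \<infinity>"
    by (rule AE_I') auto
  then have M: "local_maximal \<mu> f \<in> borel_measurable lebesgue"
    by (rule meas)
  moreover have "Lorentz_norm q \<infinity> (local_maximal \<mu> f) \<le> ennreal B"
  proof (rule Lorentz_norm_weak_le[OF q B])
    fix s :: real assume s: "0 < s"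
    have aec: "AE x in lebesgue. local_maximal \<mu> f x \<le> majorant U x"
      using ae by (rule AE_completion)
    have "emeasure lebesgue {x. ennreal s < local_maximal \<mu> f x} \<le> emeasure lebesgue {x. ennreal s < majorant U x}"
    proof (rule emeasure_mono_AE)
      show "AE x in lebesgue. x \<in> {x. ennreal s < local_maximal \<mu> f x} \<longrightarrow> x \<in> {x. ennreal s < majorant U x}"
        using aec by eventually_elim auto
      show "{x. ennreal s < majorant U x} \<in> sets lebesgue"
        using sets[of "ennreal s"] by simp
    qed
    also have "\<dots> = vol {x. ennreal s < majorant U x}"
      using sets[of "ennreal s"] by simp
    also note weak[OF s]
    finally show "emeasure lebesgue {x. ennreal s < local_maximal \<mu> f x} \<le> ennreal ((B / s) powr (1 / v))" .
  qed
  ultimately show ?thesis ..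
qed

text \<open>The second Lorentz index 1 makes the constants of the individual levels summable, and
  normability of weak L^(1/v) for v < 1 adds the levels up.\<close>

lemma restricted_type_of_restricted_weak:
  assumes rw: "restricted_weak (u, v)" and u: "recip p = u" "0 < u" "u \<le> 1" and v: "recip q = v" "0 < v" "v < 1"
  shows "restricted_type p q"
proof -
  obtain A where A: "0 < A" "\<And>(U :: 'a set) e s. \<lbrakk>open U; vol U \<le> 2 * ennreal e; 0 \<le> e; 0 < s\<rbrakk> \<Longrightarrow>
    vol {x. ennreal s < 2 * omax U x} \<le> ennreal ((A / s * e powr u) powr (1 / v))"
    using restricted_weak_emeasure[OF rw v(2)] u by (metis less_imp_le)
  obtain D where D: "0 < D"
    "\<And>(g :: int \<Rightarrow> 'a \<Rightarrow> ennreal) c r s. \<lbrakk>\<forall>k. g k \<in> borel_measurable borel; \<forall>k. 0 \<le> c k;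
      \<forall>k. \<forall>s>0. vol {x. ennreal s < g k x} \<le> ennreal ((c k / s) powr (1 / v));
      zsum (\<lambda>k. ennreal (c k)) \<le> ennreal r; 0 \<le> r; 0 < s\<rbrakk> \<Longrightarrow>
      vol {x. ennreal s < zsum (\<lambda>k. g k x)} \<le> ennreal ((D * r / s) powr (1 / v))"
    by (rule weak_type_sum[OF v(2,3), where 'a = 'a]) (rule that)
  show ?thesis
  proof (rule restricted_typeI[OF u(1,2)])
    show "0 \<le> D * A" using A D by simp
    fix f :: "'a \<Rightarrow> complex" and U r
    assume f: "f \<in> borel_measurable lebesgue" and U: "\<And>k. open (U k)"
      "\<And>k. vol (U k) \<le> 2 * emeasure lebesgue (level f k)"
      and ae: "AE x in lborel. local_maximal \<mu> f x \<le> majorant U x"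
      and meas: "AE x in lborel. majorant U x < \<infinity> \<Longrightarrow> local_maximal \<mu> f \<in> borel_measurable lebesgue"
      and e: "\<And>k. emeasure lebesgue (level f k) = ennreal (measure lebesgue (level f k))"
      and sum: "zsum (\<lambda>k. ennreal (dy k * measure lebesgue (level f k) powr u)) \<le> ennreal r" and r: "0 \<le> r"
    define c where "c k = A * (dy k * measure lebesgue (level f k) powr u)" for k
    have c: "\<forall>k. 0 \<le> c k" using A by (simp add: c_def)
    define g where "g k x = ennreal (dy k) * (2 * omax (U k) x)" for k x
    have "g k \<in> borel_measurable borel" for k
      unfolding g_def[abs_def]
      by (intro borel_measurable_times_ennreal borel_measurable_const borel_measurable_pos_max_open U)
    then have g: "\<forall>k. g k \<in> borel_measurable borel" by blast
    have weak: "vol {x. ennreal s < g k x} \<le> ennreal ((c k / s) powr (1 / v))" if s: "0 < s" for k s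
    proof -
      define \<tau> where "\<tau> = dy k"
      have \<tau>: "0 < \<tau>" by (simp add: \<tau>_def)
      have "{x. ennreal s < g k x} \<subseteq> {x. ennreal (s / \<tau>) < 2 * omax (U k) x}"
      proof safe
        fix x assume *: "ennreal s < g k x"
        show "ennreal (s / \<tau>) < 2 * omax (U k) x"
        proof (rule ccontr)
          assume "\<not> ?thesis"
          then have "ennreal \<tau> * (2 * omax (U k) x) \<le> ennreal \<tau> * ennreal (s / \<tau>)"
            by (intro mult_left_mono) auto
          also have "\<dots> = ennreal (\<tau> * (s / \<tau>))"
            using s \<tau> by (intro ennreal_mult[symmetric]) auto
          also have "\<tau> * (s / \<tau>) = s" using \<tau> by simp
          finally show False using * by (simp add: g_def \<tau>_def)
        qed
      qed
      then have "vol {x. ennreal s < g k x} \<le> vol {x. ennreal (s / \<tau>) < 2 * omax (U k) x}"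
      proof (rule emeasure_mono)
        have [measurable]: "omax (U k) \<in> borel_measurable borel"
          by (rule borel_measurable_pos_max_open[OF U(1)])
        show "{x. ennreal (s / \<tau>) < 2 * omax (U k) x} \<in> sets lborel"
          by measurable
      qed
      also have "\<dots> \<le> ennreal ((A / (s / \<tau>) * measure lebesgue (level f k) powr u) powr (1 / v))"
        using s \<tau> U(2)[of k] e[of k] by (intro A(2) U(1)) auto
      also have "A / (s / \<tau>) * measure lebesgue (level f k) powr u = c k / s"
        by (simp add: c_def \<tau>_def)
      finally show ?thesis .
    qed
    then have weak': "\<forall>k. \<forall>s>0. vol {x. ennreal s < g k x} \<le> ennreal ((c k / s) powr (1 / v))"
      by blast
    have "zsum (\<lambda>k. ennreal (c k)) = zsum (\<lambda>k. ennreal A * ennreal (dy k * measure lebesgue (level f k) powr u))"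
      unfolding c_def using A by (intro nn_integral_cong ennreal_mult) auto
    also have "\<dots> = ennreal A * zsum (\<lambda>k. ennreal (dy k * measure lebesgue (level f k) powr u))"
      by (rule nn_integral_cmult) simp
    also have "\<dots> \<le> ennreal A * ennreal r"
      by (intro mult_left_mono sum) simp
    also have "\<dots> = ennreal (A * r)"
      using A r by (intro ennreal_mult[symmetric]) auto
    finally have csum: "zsum (\<lambda>k. ennreal (c k)) \<le> ennreal (A * r)" .
    have Ar: "0 \<le> A * r" using A r by simp
    have "vol {x. ennreal s < majorant U x} \<le> ennreal ((D * A * r / s) powr (1 / v))" if "0 < s" for s
      using D(2)[OF g c weak' csum Ar that] by (simp add: majorant_def g_def mult.assoc)
    moreover have "0 \<le> D * A * r" using A D r by simp
    ultimately show "local_maximal \<mu> f \<in> borel_measurable lebesgue \<and> Lorentz_norm q \<infinity> (local_maximal \<mu> f) \<le> ennreal (D * A * r)"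
      using restricted_type_of_weak_bound[OF ae U(1) meas _ v(1,2)] by blast
  qed
qed

lemma restricted_type_full_dimension:
  assumes dim: "b = DIM('a)" and p: "recip p = 1"
  shows "recip q = 1 \<Longrightarrow> restricted_type p q" "restricted_type p \<infinity>"
proof -
  obtain K where K: "0 < K"
    "\<And>U x. \<lbrakk>open U; vol U < \<infinity>\<rbrakk> \<Longrightarrow> omax U x \<le> ennreal K * vol U"
    "\<And>U. \<lbrakk>open U; vol U < \<infinity>\<rbrakk> \<Longrightarrow> (\<integral>\<^sup>+x. omax U x \<partial>lborel) \<le> ennreal K * vol U"
    by (rule full_dimension[OF dim]) (rule that)
  have bound: "zsum (\<lambda>k. ennreal (dy k) * (2 * h k)) \<le> ennreal (4 * K * r)"
    if h: "\<And>k. h k \<le> ennreal K * vol (U k)"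
      and U: "\<And>k. vol (U k) \<le> 2 * emeasure lebesgue (level f k)"
      and e: "\<And>k. emeasure lebesgue (level f k) = ennreal (measure lebesgue (level f k))"
      and sum: "zsum (\<lambda>k. ennreal (dy k * measure lebesgue (level f k) powr 1)) \<le> ennreal r" and r: "0 \<le> r"
    for h :: "int \<Rightarrow> ennreal" and U :: "int \<Rightarrow> 'a set" and f :: "'a \<Rightarrow> complex" and r
  proof -
    have "ennreal (dy k) * (2 * h k) \<le> ennreal (4 * K) * ennreal (dy k * measure lebesgue (level f k) powr 1)" for k
    proof -
      define m where "m = measure lebesgue (level f k)"
      have "vol (U k) \<le> 2 * ennreal m"
        unfolding m_def e[symmetric] by (rule U)
      also have "\<dots> = ennreal (2 * m)"
        by (simp add: ennreal_mult m_def)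
      finally have "ennreal K * vol (U k) \<le> ennreal K * ennreal (2 * m)"
        by (intro mult_left_mono) auto
      also have "\<dots> = ennreal (K * (2 * m))"
        using K by (intro ennreal_mult[symmetric]) (auto simp: m_def)
      finally have hk: "h k \<le> ennreal (K * (2 * m))"
        by (rule order_trans[OF h])
      define X where "X = K * (2 * m)"
      have X: "0 \<le> X" using K by (simp add: X_def m_def)
      have "ennreal (dy k) * (2 * h k) \<le> ennreal (dy k) * (2 * ennreal X)"
        using hk unfolding X_def by (intro mult_left_mono) auto
      also have "\<dots> = ennreal (dy k * (2 * X))"
        using X by (simp add: ennreal_mult)
      also have "dy k * (2 * X) = (4 * K) * (dy k * m)"
        by (simp add: X_def)
      also have "ennreal \<dots> = ennreal (4 * K) * ennreal (dy k * m)"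
        using K by (intro ennreal_mult) (auto simp: m_def)
      finally show ?thesis by (simp add: m_def)
    qed
    then have "zsum (\<lambda>k. ennreal (dy k) * (2 * h k)) \<le> zsum (\<lambda>k. ennreal (4 * K) * ennreal (dy k * measure lebesgue (level f k) powr 1))"
      by (intro nn_integral_mono)
    also have "\<dots> = ennreal (4 * K) * zsum (\<lambda>k. ennreal (dy k * measure lebesgue (level f k) powr 1))"
      by (rule nn_integral_cmult) simp
    also have "\<dots> \<le> ennreal (4 * K) * ennreal r"
      by (intro mult_left_mono sum) simp
    also have "\<dots> = ennreal (4 * K * r)"
      using K r by (intro ennreal_mult[symmetric]) auto
    finally show ?thesis .
  qed
  have Ufin: "vol V < \<infinity>" if "vol V \<le> 2 * emeasure lebesgue L" "emeasure lebesgue L = ennreal m" for V L :: "'a set" and m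
    using that by (metis ennreal_less_top ennreal_mult_less_top ennreal_numeral order_le_less_trans infinity_ennreal_def)
  have K4: "0 \<le> 4 * K" using K by simp
  show "restricted_type p q" if q: "recip q = 1"
  proof (rule restricted_typeI[OF p zero_less_one K4])
    fix f :: "'a \<Rightarrow> complex" and U r
    assume f: "f \<in> borel_measurable lebesgue" and U: "\<And>k. open (U k)"
      "\<And>k. vol (U k) \<le> 2 * emeasure lebesgue (level f k)"
      and ae: "AE x in lborel. local_maximal \<mu> f x \<le> majorant U x"
      and meas: "AE x in lborel. majorant U x < \<infinity> \<Longrightarrow> local_maximal \<mu> f \<in> borel_measurable lebesgue"
      and e: "\<And>k. emeasure lebesgue (level f k) = ennreal (measure lebesgue (level f k))"
      and sum: "zsum (\<lambda>k. ennreal (dy k * measure lebesgue (level f k) powr 1)) \<le> ennreal r" and r: "0 \<le> r"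
    have m: "omax (U k) \<in> borel_measurable lborel" for k
      using borel_measurable_pos_max_open[OF U(1)] by simp
    have "(\<integral>\<^sup>+x. majorant U x \<partial>lborel) = zsum (\<lambda>k. \<integral>\<^sup>+x. ennreal (dy k) * (2 * omax (U k) x) \<partial>lborel)"
      unfolding majorant_def by (intro zsum_nn_integral borel_measurable_times_ennreal borel_measurable_const m)
    also have "\<dots> = zsum (\<lambda>k. ennreal (dy k) * (2 * (\<integral>\<^sup>+x. omax (U k) x \<partial>lborel)))"
      using m by (intro nn_integral_cong) (simp add: nn_integral_cmult)
    also have "\<dots> \<le> ennreal (4 * K * r)"
      by (rule bound[OF K(3)[OF U(1) Ufin[OF U(2) e]] U(2) e sum r])
    finally have I: "(\<integral>\<^sup>+x. majorant U x \<partial>lborel) \<le> ennreal (4 * K * r)" .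
    have "vol {x. ennreal s < majorant U x} \<le> ennreal ((4 * K * r / s) powr (1 / 1))" if s: "0 < s" for s
    proof -
      have H [measurable]: "majorant U \<in> borel_measurable borel"
        using U(1) by (rule borel_measurable_majorant)
      have "vol {x. ennreal s < majorant U x} \<le> vol {x. ennreal s \<le> majorant U x}"
      proof (rule emeasure_mono)
        show "{x. ennreal s \<le> majorant U x} \<in> sets lborel" by measurable
      qed auto
      also have "\<dots> \<le> ennreal (1 / s) * (\<integral>\<^sup>+x. majorant U x \<partial>lborel)"
        by (rule Markov_lborel[OF H s])
      also have "\<dots> \<le> ennreal (1 / s) * ennreal (4 * K * r)"
        by (intro mult_left_mono I) simp
      also have "\<dots> = ennreal (1 / s * (4 * K * r))"
        using s K r by (intro ennreal_mult[symmetric]) auto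
      also have "1 / s * (4 * K * r) = (4 * K * r / s) powr (1 / 1)"
        using s K r by simp
      finally show ?thesis .
    qed
    moreover have "0 \<le> 4 * K * r" using K r by simp
    ultimately show "local_maximal \<mu> f \<in> borel_measurable lebesgue \<and> Lorentz_norm q \<infinity> (local_maximal \<mu> f) \<le> ennreal (4 * K * r)"
      using restricted_type_of_weak_bound[OF ae U(1) meas _ q zero_less_one] by blast
  qed
  show "restricted_type p \<infinity>"
  proof (rule restricted_typeI[OF p zero_less_one K4])
    fix f :: "'a \<Rightarrow> complex" and U r
    assume f: "f \<in> borel_measurable lebesgue" and U: "\<And>k. open (U k)"
      "\<And>k. vol (U k) \<le> 2 * emeasure lebesgue (level f k)"
      and ae: "AE x in lborel. local_maximal \<mu> f x \<le> majorant U x"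
      and meas: "AE x in lborel. majorant U x < \<infinity> \<Longrightarrow> local_maximal \<mu> f \<in> borel_measurable lebesgue"
      and e: "\<And>k. emeasure lebesgue (level f k) = ennreal (measure lebesgue (level f k))"
      and sum: "zsum (\<lambda>k. ennreal (dy k * measure lebesgue (level f k) powr 1)) \<le> ennreal r" and r: "0 \<le> r"
    have "majorant U x \<le> ennreal (4 * K * r)" for x
      unfolding majorant_def by (rule bound[OF K(2)[OF U(1) Ufin[OF U(2) e]] U(2) e sum r])
    from local_maximal_sup_bound[OF ae meas this]
    show "local_maximal \<mu> f \<in> borel_measurable lebesgue \<and> Lorentz_norm \<infinity> \<infinity> (local_maximal \<mu> f) \<le> ennreal (4 * K * r)"
      using Lorentz_norm_infinity[of "local_maximal \<mu> f"] by (simp only:) 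
  qed
qed

section \<open>The triangle of exponents\<close>

definition codim :: real
  where "codim = DIM('a) - b"

text \<open>The formula for 1 / p_(a,b) with d - b replaced by \<open>gam\<close>; where gam = 1 it
  equals 2a / (2a + 1), the reciprocal of \<open>p_dec\<close>.\<close>

definition diag :: real
  where "diag = (2 * a - 1 + gam) / (2 * a - 1 + 2 * gam)"

definition offu :: real
  where "offu = (codim + 2 * a - 1) / (2 * codim + 2 * a - 1)"

definition offv :: real
  where "offv = codim / (2 * codim + 2 * a - 1)"

lemma codim_nonneg: "0 \<le> codim"
  using b by (simp add: codim_def)

text \<open>For codimension above 0 the second coordinates of both vertices lie strictly between 0
  and 1, as the endpoint estimates require. The strict inequality for codimension above 1 says that
  the edge is not vertical, which interpolation along it requires.\<close>

lemma vertex_bounds: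
  shows "0 < diag" "diag \<le> 1" "0 < offu" "offu \<le> 1" "0 \<le> offv" "offv < offu" "offv < diag" "offu \<le> diag"
    "0 < codim \<Longrightarrow> 0 < offv" "0 < codim \<Longrightarrow> diag < 1" "1 < codim \<Longrightarrow> offu < diag"
proof -
  define c where "c = 2 * a - 1"
  have c: "0 < c" using a by (simp add: c_def)
  note e = codim_nonneg
  have g: "gam = min 1 codim" by (simp add: gam_def codim_def)
  have g0: "0 \<le> gam" "gam \<le> codim" using e by (auto simp: g)
  have d: "diag = (c + gam) / (c + 2 * gam)" "offu = (codim + c) / (2 * codim + c)" "offv = codim / (2 * codim + c)"
    by (simp_all add: diag_def offu_def offv_def c_def algebra_simps)
  have pos: "0 < c + 2 * gam" "0 < 2 * codim + c" using c g0 e by linarith+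
  show "0 < diag" "diag \<le> 1" "0 < offu" "offu \<le> 1" "0 \<le> offv"
    unfolding d using c g0 e pos by (auto simp: divide_simps)
  show lt: "offv < offu"
    unfolding d using c pos by (intro divide_strict_right_mono) auto
  show le: "offu \<le> diag"
    unfolding d using c g0 pos by (simp add: frac_le_eq divide_simps algebra_simps)
  show "offv < diag" using lt le by linarith
  show "0 < codim \<Longrightarrow> 0 < offv"
    unfolding d using pos by simp
  show "0 < codim \<Longrightarrow> diag < 1"
    unfolding d using pos by (simp add: g)
  show "offu < diag" if "1 < codim"
  proof -
    have "gam = 1" using that by (simp add: g)
    then show ?thesis
      unfolding d using that c pos by (simp add: divide_simps algebra_simps)
  qed
qed

text \<open>With c = 2a - 1, the map x -> (2x + c) / (x + c) is increasing. It yields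
  \<open>p_dim\<close> at the codimension and \<open>p_dec\<close> at 1, so the minimum is its value
  at \<open>gam\<close>.\<close>

lemma vertex_P_eq: "vertex_P DIM('a) a b = (diag, diag)"
proof -
  define c where "c = 2 * a - 1"
  have c: "0 < c" using a by (simp add: c_def)
  note e = codim_nonneg
  have g: "gam = min 1 codim" by (simp add: gam_def codim_def)
  have p: "p_dec a = (c + 2) / (c + 1)" "p_dim DIM('a) a b = (2 * codim + c) / (codim + c)"
    by (simp_all add: p_dec_def p_dim_def c_def codim_def algebra_simps)
  have "1 / p_circ DIM('a) a b = diag"
  proof (cases "codim \<le> 1")
    case True
    have "(2 * codim + c) / (codim + c) \<le> (c + 2) / (c + 1)"
      using True c e by (simp add: divide_simps) (simp add: algebra_simps)
    then have "p_circ DIM('a) a b = (2 * codim + c) / (codim + c)"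
      unfolding p_circ_def p by simp
    moreover have "gam = codim" using True by (simp add: g)
    ultimately show ?thesis
      by (simp add: diag_def c_def algebra_simps)
  next
    case False
    have "(c + 2) / (c + 1) \<le> (2 * codim + c) / (codim + c)"
      using False c by (simp add: divide_simps) (simp add: algebra_simps)
    then have "p_circ DIM('a) a b = (c + 2) / (c + 1)"
      unfolding p_circ_def p by simp
    moreover have "gam = 1" using False by (simp add: g)
    ultimately show ?thesis
      by (simp add: diag_def c_def algebra_simps)
  qed
  then show ?thesis by (simp add: vertex_P_def)
qed

lemma vertex_Q_eq: "vertex_Q DIM('a) a b = (offu, offv)"
proof -
  define p where "p = p_dim DIM('a) a b"
  have p1: "1 / p = offu"
    by (simp add: p_def p_dim_def offu_def codim_def algebra_simps)
  have u: "0 < offu" "offu \<le> 1" by (rule vertex_bounds)+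
  have "0 < 1 / p" using u p1 by simp
  then have p: "0 < p" by simp
  have nz: "2 * codim + 2 * a - 1 \<noteq> 0" using codim_nonneg a by linarith
  have uv: "1 - offu = offv"
    unfolding offu_def offv_def using nz by (simp add: field_simps)
  have "1 / ennreal p = ennreal offu"
    using p by (simp add: divide_ennreal p1 flip: ennreal_1)
  then have "1 - 1 / ennreal p = ennreal offv"
    using u uv by (simp add: ennreal_minus flip: ennreal_1)
  then have conj: "conj_exponent (ennreal p) = 1 / ennreal offv"
    by (simp add: conj_exponent_def)
  have "recip (conj_exponent (ennreal p)) = offv"
  proof (cases "offv = 0")
    \<comment> \<open>For codimension 0 the conjugate exponent is 1 / 0 = \<infinity> in the
      extended reals, with reciprocal 0.\<close>
    case True
    then show ?thesis unfolding conj recip_def by simp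
  next
    case False
    then have v: "0 < offv" using vertex_bounds(5) by linarith
    then have "conj_exponent (ennreal p) = ennreal (1 / offv)"
      unfolding conj by (simp add: divide_ennreal flip: ennreal_1)
    then show ?thesis using v by simp
  qed
  then show ?thesis
    by (simp add: vertex_Q_def p1 flip: p_def)
qed

lemma restricted_weak_P: "restricted_weak (diag, diag)"
  using restricted_weak_diagonal by (simp add: diag_def)

lemma restricted_weak_Q: "restricted_weak (offu, offv)"
  using restricted_weak_off_diagonal by (simp add: offu_def offv_def codim_def)

text \<open>A point \<open>s R\<close> with \<open>R\<close> on \<open>[P, Q]\<close> and \<open>0 < s < 1\<close> lies strictly between \<open>R\<close> and \<open>(s / 2) R\<close>. This
  fails to help only on the axis \<open>v = 0\<close>, which meets the triangle in \<open>O\<close> alone unless \<open>b = d\<close>.\<close>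

lemma strong_type_below_segment:
  assumes \<theta>: "0 \<le> \<theta>" "\<theta> \<le> 1" and s: "0 \<le> s" "s < 1"
    and pq: "1 \<le> p" "1 \<le> q" "recip p = s * ((1 - \<theta>) * diag + \<theta> * offu)" "recip q = s * ((1 - \<theta>) * diag + \<theta> * offv)"
  shows "strong_type p q"
proof -
  define \<rho> where "\<rho> = (1 - \<theta>) * diag + \<theta> * offu"
  define \<nu> where "\<nu> = (1 - \<theta>) * diag + \<theta> * offv"
  note vb = vertex_bounds
  have \<rho>: "0 < \<rho>" "\<rho> \<le> 1"
  proof -
    have "(1 - \<theta>) * offu + \<theta> * offu \<le> \<rho>"
      unfolding \<rho>_def using \<theta> vb by (intro add_mono mult_left_mono) auto
    then show "0 < \<rho>" using vb by (simp add: algebra_simps)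
    have "\<rho> \<le> (1 - \<theta>) * 1 + \<theta> * 1"
      unfolding \<rho>_def using \<theta> vb by (intro add_mono mult_left_mono) auto
    then show "\<rho> \<le> 1" by simp
  qed
  have \<nu>: "0 \<le> \<nu>" "\<nu> \<le> \<rho>"
    unfolding \<nu>_def \<rho>_def using \<theta> vb by (auto intro!: add_nonneg_nonneg mult_nonneg_nonneg mult_left_mono)
  have \<rho>\<nu>: "recip p = s * \<rho>" "recip q = s * \<nu>" using pq by (auto simp: \<rho>_def \<nu>_def)
  note ep = exponent_eq_recip[OF pq(1)] exponent_eq_recip[OF pq(2)]
  show ?thesis
  proof (cases "s = 0")
    case True
    then show ?thesis using ep \<rho>\<nu> strong_type_infinity by auto
  next
    case False
    then have s0: "0 < s" using s by simp
    have p: "p = ennreal (1 / (s * \<rho>))"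
      using ep(1) s0 \<rho> unfolding \<rho>\<nu> by auto
    show ?thesis
    proof (cases "\<nu> = 0")
      case True
      have "codim = 0"
      proof (rule ccontr)
        assume "codim \<noteq> 0"
        then have "0 < offv" using codim_nonneg vb by simp
        then have "(1 - \<theta>) * offv + \<theta> * offv \<le> \<nu>"
          unfolding \<nu>_def using \<theta> vb by (intro add_mono mult_left_mono) auto
        then show False using True \<open>0 < offv\<close> by (simp add: algebra_simps)
      qed
      then have "b = DIM('a)" by (simp add: codim_def)
      moreover have "0 < s * \<rho>" using s0 \<rho> by simp
      moreover have "s * \<rho> < 1"
        using s s0 \<rho> mult_mono[of s s \<rho> 1] by linarith
      moreover have "q = \<infinity>" using ep(2) unfolding \<rho>\<nu> True by simp
      ultimately show ?thesis
        unfolding p using strong_type_full_dimension by simp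
    next
      case False
      then have \<nu>0: "0 < \<nu>" using \<nu> by simp
      have q: "q = ennreal (1 / (s * \<nu>))"
        using ep(2) s0 \<nu>0 unfolding \<rho>\<nu> by auto
      have rw: "restricted_weak (\<rho>, \<nu>)"
        using restricted_weak_convex[OF restricted_weak_P restricted_weak_Q \<theta>] by (simp add: \<rho>_def \<nu>_def)
      have rw': "restricted_weak (s / 2 * \<rho>, s / 2 * \<nu>)"
        using restricted_weak_convex[OF restricted_weak_zero rw, of "s / 2"] s by simp
      \<comment> \<open>Solves (1 - \<tau>) + \<tau> s/2 = s, placing the point s R between R and
        (s/2) R.\<close>
      define \<tau> where "\<tau> = (1 - s) / (1 - s / 2)"
      have \<tau>: "0 < \<tau>" "\<tau> < 1" using s s0 by (auto simp: \<tau>_def divide_simps)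
      have "\<tau> * (1 - s / 2) = 1 - s" using s by (simp add: \<tau>_def)
      then have \<tau>s: "(1 - \<tau>) + \<tau> * (s / 2) = s" by (simp add: algebra_simps)
      have comb: "(1 - \<tau>) * x + \<tau> * (s / 2 * x) = s * x" for x
      proof -
        have "(1 - \<tau>) * x + \<tau> * (s / 2 * x) = ((1 - \<tau>) + \<tau> * (s / 2)) * x" by (simp only: distrib_right mult.assoc)
        then show ?thesis unfolding \<tau>s .
      qed
      have half: "s / 2 * x < x" if "0 < x" for x
        using that s by (simp add: mult_less_cancel_right1)
      have "strong_type (ennreal (1 / ((1 - \<tau>) * \<rho> + \<tau> * (s / 2 * \<rho>)))) (ennreal (1 / ((1 - \<tau>) * \<nu> + \<tau> * (s / 2 * \<nu>))))"
        by (rule strong_type_interpolated[OF rw rw'])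
          (use \<nu>0 \<nu> \<rho> s0 \<tau> half in \<open>auto intro: mult_left_mono\<close>)
      then show ?thesis unfolding comb p q .
    qed
  qed
qed

lemma triangle_cases:
  assumes "w \<in> exponent_triangle DIM('a) a b"
  obtains s \<theta> where "0 \<le> s" "s \<le> 1" "0 \<le> \<theta>" "\<theta> \<le> 1"
    "w = s *\<^sub>R ((1 - \<theta>) *\<^sub>R (diag, diag) + \<theta> *\<^sub>R (offu, offv))"
proof -
  have "w \<in> convex hull (insert 0 {(diag, diag), (offu, offv)})"
    using assms by (simp add: exponent_triangle_def vertex_P_eq vertex_Q_eq zero_prod_def)
  then obtain u s R where "0 \<le> u" "0 \<le> s" "u + s = 1" "R \<in> convex hull {(diag, diag), (offu, offv)}" "w = u *\<^sub>R 0 + s *\<^sub>R R"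
    by (subst (asm) convex_hull_insert) auto
  moreover from this obtain \<theta> where "0 \<le> \<theta>" "\<theta> \<le> 1" "R = (1 - \<theta>) *\<^sub>R (diag, diag) + \<theta> *\<^sub>R (offu, offv)"
    unfolding segment_convex_hull[symmetric] by (auto simp: in_segment)
  ultimately show thesis
    by (intro that[of s \<theta>]) auto
qed

lemma strong_type_off_segment:
  assumes pq: "1 \<le> p" "1 \<le> q"
    and w: "(recip p, recip q) \<in> exponent_triangle DIM('a) a b - closed_segment (vertex_P DIM('a) a b) (vertex_Q DIM('a) a b)"
  shows "strong_type p q"
proof -
  obtain s \<theta> where s: "0 \<le> s" "s \<le> 1" and \<theta>: "0 \<le> \<theta>" "\<theta> \<le> 1"
    and eq: "(recip p, recip q) = s *\<^sub>R ((1 - \<theta>) *\<^sub>R (diag, diag) + \<theta> *\<^sub>R (offu, offv))"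
    using w triangle_cases by blast
  have "s \<noteq> 1"
  proof
    assume "s = 1"
    then have "(recip p, recip q) \<in> closed_segment (diag, diag) (offu, offv)"
      unfolding eq using \<theta> by (auto simp: in_segment)
    then show False using w by (simp add: vertex_P_eq vertex_Q_eq)
  qed
  then have "s < 1" using s by simp
  then show ?thesis
    using strong_type_below_segment[OF \<theta> s(1) _ pq] eq by simp
qed

text \<open>On the open edge the two vertices themselves are the endpoints of the interpolation;
  codimension above 1 separates their first coordinates.\<close>

lemma strong_type_off_vertices:
  assumes e: "1 < codim" and pq: "1 \<le> p" "1 \<le> q"
    and w: "(recip p, recip q) \<in> exponent_triangle DIM('a) a b - {vertex_P DIM('a) a b, vertex_Q DIM('a) a b}"
  shows "strong_type p q"
proof (cases "(recip p, recip q) \<in> closed_segment (vertex_P DIM('a) a b) (vertex_Q DIM('a) a b)")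
  case True
  then obtain \<theta> where \<theta>: "0 \<le> \<theta>" "\<theta> \<le> 1"
    and eq: "(recip p, recip q) = (1 - \<theta>) *\<^sub>R (diag, diag) + \<theta> *\<^sub>R (offu, offv)"
    by (auto simp: in_segment vertex_P_eq vertex_Q_eq)
  have "\<theta> \<noteq> 0" "\<theta> \<noteq> 1"
    using w eq by (auto simp: vertex_P_eq vertex_Q_eq)
  then have \<theta>': "0 < \<theta>" "\<theta> < 1" using \<theta> by auto
  have uv: "recip p = (1 - \<theta>) * diag + \<theta> * offu" "recip q = (1 - \<theta>) * diag + \<theta> * offv"
    using eq by auto
  have v0: "0 < offv" using e vertex_bounds(9) by simp
  have "0 < recip p" "0 < recip q"
    unfolding uv using \<theta>' v0 vertex_bounds by (auto intro!: add_pos_pos)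
  then have "p = ennreal (1 / recip p)" "q = ennreal (1 / recip q)"
    using exponent_eq_recip[OF pq(1)] exponent_eq_recip[OF pq(2)] by auto
  moreover have "strong_type (ennreal (1 / ((1 - \<theta>) * diag + \<theta> * offu))) (ennreal (1 / ((1 - \<theta>) * diag + \<theta> * offv)))"
    by (rule strong_type_interpolated[OF restricted_weak_P restricted_weak_Q])
      (use v0 \<theta>' e vertex_bounds in auto)
  ultimately show ?thesis unfolding uv by simp
next
  case False
  then show ?thesis using w pq by (intro strong_type_off_segment) auto
qed

lemma restricted_type_vertices:
  assumes pq: "1 \<le> p" "1 \<le> q"
    and w: "(recip p, recip q) \<in> {vertex_P DIM('a) a b, vertex_Q DIM('a) a b}"
  shows "restricted_type p q"
proof (cases "codim = 0")
  case True
  then have dim: "b = DIM('a)" by (simp add: codim_def)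
  have "2 * a - 1 \<noteq> 0" using a by simp
  then have vals: "diag = 1" "offu = 1" "offv = 0"
    using True by (auto simp: diag_def offu_def offv_def gam_def codim_def)
  have "recip p = 1 \<and> (recip q = 1 \<or> recip q = 0)"
    using w by (auto simp: vertex_P_eq vertex_Q_eq vals)
  then show ?thesis
    using restricted_type_full_dimension[OF dim] exponent_eq_recip[OF pq(2)] by auto
next
  case False
  then have e: "0 < codim" using codim_nonneg by simp
  consider "recip p = diag" "recip q = diag" | "recip p = offu" "recip q = offv"
    using w by (auto simp: vertex_P_eq vertex_Q_eq)
  then show ?thesis
  proof cases
    case 1
    then show ?thesis
      using restricted_weak_P vertex_bounds e by (intro restricted_type_of_restricted_weak[of diag diag]) auto
  next
    case 2
    then show ?thesis
      using restricted_weak_Q vertex_bounds e by (intro restricted_type_of_restricted_weak[of offu offv]) auto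
  qed
qed

end

theorem theorem4p1:
  fixes \<mu> :: "(real ^ 'n::finite) measure" and a b C0 :: real
  assumes "sets \<mu> = sets borel"
    and "finite_measure \<mu>"
    and "\<exists>K. compact K \<and> emeasure \<mu> (UNIV - K) = 0"
    and "a > 1 / 2"
    and "0 < b" and "b \<le> real CARD('n)"
    and "\<And>\<xi>. \<xi> \<noteq> 0 \<Longrightarrow> norm (fourier_transform \<mu> \<xi>) \<le> C0 * norm \<xi> powr (- a)"
    and "\<And>x r. 0 < r \<Longrightarrow> measure \<mu> (ball x r) \<le> C0 * r powr b"
  shows
    "(b \<ge> real CARD('n) - 1 \<longrightarrow>
       (\<forall>p q. 1 \<le> p \<longrightarrow> 1 \<le> q \<longrightarrow>
          (recip p, recip q) \<in> exponent_triangle CARD('n) a b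
             - closed_segment (vertex_P CARD('n) a b) (vertex_Q CARD('n) a b) \<longrightarrow>
          (\<exists>C::real. \<forall>f\<in>Lp_space p.
             local_maximal \<mu> f \<in> borel_measurable lebesgue \<and>
             Lp_norm q (local_maximal \<mu> f) \<le> ennreal C * Lp_norm p (\<lambda>x. ennreal (norm (f x))))))
     \<and>
     (b < real CARD('n) - 1 \<longrightarrow>
       (\<forall>p q. 1 \<le> p \<longrightarrow> 1 \<le> q \<longrightarrow>
          (recip p, recip q) \<in> exponent_triangle CARD('n) a b
             - {vertex_P CARD('n) a b, vertex_Q CARD('n) a b} \<longrightarrow>
          (\<exists>C::real. \<forall>f\<in>Lp_space p.
             local_maximal \<mu> f \<in> borel_measurable lebesgue \<and>
             Lp_norm q (local_maximal \<mu> f) \<le> ennreal C * Lp_norm p (\<lambda>x. ennreal (norm (f x))))))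
     \<and>
     (\<forall>p q. 1 \<le> p \<longrightarrow> 1 \<le> q \<longrightarrow>
        (recip p, recip q) \<in> {vertex_P CARD('n) a b, vertex_Q CARD('n) a b} \<longrightarrow>
        (\<exists>C::real. \<forall>f\<in>Lorentz_space p 1.
           local_maximal \<mu> f \<in> borel_measurable lebesgue \<and>
           Lorentz_norm q \<infinity> (local_maximal \<mu> f)
             \<le> ennreal C * Lorentz_norm p 1 (\<lambda>x. ennreal (norm (f x)))))"
proof -
  obtain K where K: "compact K" "emeasure \<mu> (UNIV - K) = 0"
    using assms(3) by blast
  obtain R where R: "0 < R" "\<And>x. x \<in> K \<Longrightarrow> norm x \<le> R"
    using compact_imp_bounded[OF K(1)] bounded_pos by blast
  have "UNIV - K \<in> null_sets \<mu>"
    using K compact_imp_closed[OF K(1)] by (intro null_setsI) (auto simp: assms(1))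
  then have "AE y in \<mu>. y \<notin> UNIV - K"
    by (rule AE_not_in)
  then have supp: "AE y in \<mu>. norm y \<le> R"
    by eventually_elim (simp add: R)
  \<comment> \<open>The sign of the given constant is not prescribed, while the estimates work with
    a nonnegative one.\<close>
  have mono: "C0 * x \<le> \<bar>C0\<bar> * x" if "0 \<le> x" for x
    using that by (intro mult_right_mono) auto
  interpret decaying_measure \<mu> a b "\<bar>C0\<bar>" R
  proof (rule decaying_measure.intro)
    show "sets \<mu> = sets borel" "finite_measure \<mu>" by (rule assms)+
    show "0 < R" "AE y in \<mu>. norm y \<le> R" by (rule R supp)+
    show "1 / 2 < a" "0 < b" "b \<le> real DIM(real ^ 'n)" using assms by auto
    show "norm (fourier_transform \<mu> \<xi>) \<le> \<bar>C0\<bar> * norm \<xi> powr (- a)" if "\<xi> \<noteq> 0" for \<xi>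
      using assms(7)[OF that] mono by (rule order_trans) simp
    show "measure \<mu> (ball x r) \<le> \<bar>C0\<bar> * r powr b" if "0 < r" for x r
      using assms(8)[OF that] mono by (rule order_trans) simp
  qed simp
  have dim: "DIM(real ^ 'n) = CARD('n)" by simp
  note strong = strong_type_off_segment[unfolded dim] strong_type_off_vertices[unfolded dim codim_def]
    and weak = restricted_type_vertices[unfolded dim]
  show ?thesis
    unfolding strong_type_def[symmetric] restricted_type_def[symmetric]
    using strong weak by auto
qed

end
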